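(* Assume that the algebraic Riccati equation $AP+PA'-PSP+R=0$ has a positive definite solution $P$ and that $\mu(A-PS)<0$. Let $(\overline X_t,\breve X_t)$ be two Kalman-Bucy diffusions starting from two Gaussian random variables with covariance matrices $(P_0,\check P_0)$; let $(\eta_t,\breve\eta_t)$ be their $\mathcal F_t$-conditional distributions, $(\pi_t,\breve\pi_t)$ their distributions, and $\widehat X_t=\mathbb E(\overline X_t\mid\mathcal F_t)$, $\check X_t=\mathbb E(\breve X_t\mid\mathcal F_t)$. Then there exists some $t_0$ such that the following hold. (i) For any $\epsilon\in\,]0,2]$ there is a finite constant $c(\epsilon)$ such that for any $t\ge t_0$, almost surely, $$\mathrm{Ent}(\eta_t\mid\breve\eta_t)\le c(\epsilon)\left[\exp\big((1-\epsilon)\mu(A-PS)t\big)\,\|P_0-\check P_0\|_F+\|\check X_t-\widehat X_t\|^2\right].$$ (ii) For any $\epsilon\in\,]0,1/2]$ there is a finite constant $c(\epsilon)$ such that for any $t\ge t_0$, $$\mathrm{Ent}(\pi_t\mid\breve\pi_t)\le c(\epsilon)\exp\big((1-\epsilon)\mu(A-PS)t\big)\left(\mathbb W_2^2(\pi_0,\breve\pi_0)+\|P_0-\check P_0\|_F\right).$$ Here $c(\epsilon)$ stands for a finite constant whose value depends on $\epsilon$ and on the initial matrices $(P_0,\check P_0)$.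
   Context: Filtering model: $dX_t=(AX_t+a)dt+R_1^{1/2}dW_t$, $dY_t=(CX_t+c)dt+R_2^{1/2}dV_t$, $Y_0=0$, where $(W_t,V_t)$ is an $(r_1+r_2)$-dimensional Brownian motion, $X_0$ is an $\mathbb R^{r_1}$-valued Gaussian vector independent of $(W,V)$; $A$ is $r_1\times r_1$, $C$ is $r_2\times r_1$, $a\in\mathbb R^{r_1}$, $c\in\mathbb R^{r_2}$, and $R_1^{1/2},R_2^{1/2}$ are symmetric invertible. Prime denotes transposition. $R=R_1$, $S=C'R_2^{-1}C$, $\mathcal F_t=\sigma(Y_s,s\le t)$. Standing assumption: $(A,R_1^{1/2})$ is a controllable pair and $(A,C)$ is observable. Kalman-Bucy diffusion: the conditional McKean-Vlasov diffusion $$d\overline X_t=(A\overline X_t+a)dt+R_1^{1/2}d\overline W_t+\mathcal P_{\eta_t}C'R_2^{-1}\left[dY_t-\left((C\overline X_t+c)dt+R_2^{1/2}d\overline V_t\right)\right],$$ where $(\overline W,\overline V)$ is an independent copy of $(W,V)$, $\overline X_0$ is a random state, $(\overline W,\overline V,\overline X_0)$ is independent of the signal and the observation, $\eta_t=\mathrm{Law}(\overline X_t\mid\mathcal F_t)$ and $\mathcal P_{\eta}$ is the covariance matrix of the distribution $\eta$. (Equivalently, $\mathcal P_{\eta_t}=P_t$ where $\partial_tP_t=AP_t+P_tA'-P_tSP_t+R$ starts at the covariance matrix $P_0$ of $\overline X_0$.) Both diffusions are driven by the same observation process $Y$. $\mu(B)=\lambda_{\max}((B+B')/2)$ is the logarithmic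 norm; $\|\cdot\|_F$ is the Frobenius norm; $\mathbb W_2$ is the 2-Wasserstein distance for the Euclidean norm; $\mathrm{Ent}(\nu_1\mid\nu_2)=\int\log\frac{d\nu_1}{d\nu_2}\,d\nu_1$ if $\nu_1\ll\nu_2$, and $+\infty$ otherwise. *)

theory Defs
  imports "HOL-Probability.Probability"
begin

section \<open>Matrices\<close>

text \<open>The type class operations \<open>*\<close>, \<open>1\<close> and \<open>^\<close> on \<^typ>\<open>real^'n^'n\<close> are componentwise, so matrix powers
  are defined through \<open>**\<close> and \<^term>\<open>mat 1\<close>.\<close>

definition mat_pow :: "real^'n^'n \<Rightarrow> nat \<Rightarrow> real^'n^'n" where
  "mat_pow A k = (((**) A) ^^ k) (mat 1)"

definition symmetric_mat :: "real^'n^'n \<Rightarrow> bool" where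
  "symmetric_mat B \<longleftrightarrow> transpose B = B"

definition positive_definite :: "real^'n^'n \<Rightarrow> bool" where
  "positive_definite B \<longleftrightarrow> symmetric_mat B \<and> (\<forall>x. x \<noteq> 0 \<longrightarrow> 0 < x \<bullet> (B *v x))"

text \<open>Kalman rank conditions: the block matrix \<open>[B, AB, \<dots>, A\<^sup>r\<^sup>-\<^sup>1B]\<close>, respectively the stacked matrix
  of \<open>C, CA, \<dots>, CA\<^sup>r\<^sup>-\<^sup>1\<close>, has rank \<open>r\<close>.\<close>

definition controllable_pair :: "real^'n^'n \<Rightarrow> real^'k^'n \<Rightarrow> bool" where
  "controllable_pair A B \<longleftrightarrow> dim (\<Union>k<CARD('n). columns (mat_pow A k ** B)) = CARD('n)"

definition observable_pair :: "real^'n^'n \<Rightarrow> real^'n^'m \<Rightarrow> bool" where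
  "observable_pair A C \<longleftrightarrow> dim (\<Union>k<CARD('n). rows (C ** mat_pow A k)) = CARD('n)"

definition lambda_max :: "real^'n^'n \<Rightarrow> real" where
  "lambda_max B = Max {l. \<exists>v. v \<noteq> 0 \<and> B *v v = l *\<^sub>R v}"

definition log_norm :: "real^'n^'n \<Rightarrow> real" where
  "log_norm B = lambda_max ((1/2) *\<^sub>R (B + transpose B))"

text \<open>The library norm on \<^typ>\<open>real^'n^'n\<close> is the Euclidean norm of the vector of Euclidean norms of
  the rows, i.e. the Frobenius norm (not the operator norm).\<close>

abbreviation frobenius_norm :: "real^'n^'n \<Rightarrow> real" where
  "frobenius_norm B \<equiv> norm B"

section \<open>Laws on Euclidean spaces\<close>

definition normal_law :: "real \<Rightarrow> real \<Rightarrow> real measure" where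
  "normal_law m v =
     (if v = 0 then return borel m else density lborel (\<lambda>x. ennreal (normal_density m (sqrt v) x)))"

text \<open>Degenerate Gaussian vectors (singular covariance) are included.\<close>

definition gaussian_vector :: "'w measure \<Rightarrow> ('w \<Rightarrow> 'e::euclidean_space) \<Rightarrow> bool" where
  "gaussian_vector M X \<longleftrightarrow> X \<in> borel_measurable M \<and>
     (\<forall>u. \<exists>m v. 0 \<le> v \<and> distr M borel (\<lambda>\<omega>. u \<bullet> X \<omega>) = normal_law m v)"

definition mean_vec :: "(real^'n) measure \<Rightarrow> real^'n" where
  "mean_vec \<nu> = (\<chi> i. \<integral>x. x $ i \<partial>\<nu>)"

definition cov_matrix :: "(real^'n) measure \<Rightarrow> real^'n^'n" where
  "cov_matrix \<nu> = (\<chi> i j. \<integral>x. (x $ i - mean_vec \<nu> $ i) * (x $ j - mean_vec \<nu> $ j) \<partial>\<nu>)"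

text \<open>The negative part of \<open>log (d\<nu>\<^sub>1/d\<nu>\<^sub>2)\<close> is always \<open>\<nu>\<^sub>1\<close>-integrable for probability measures, so
  non-integrability of the logarithmic density means that its integral is \<open>\<infinity>\<close>
  (whereas \<^const>\<open>KL_divergence\<close> would return 0).\<close>

definition Ent :: "'e measure \<Rightarrow> 'e measure \<Rightarrow> ereal" where
  "Ent \<nu>1 \<nu>2 =
     (if absolutely_continuous \<nu>2 \<nu>1 \<and> integrable \<nu>1 (entropy_density (exp 1) \<nu>2 \<nu>1)
      then ereal (KL_divergence (exp 1) \<nu>2 \<nu>1) else \<infinity>)"

definition couplings ::
  "'e::euclidean_space measure \<Rightarrow> 'e measure \<Rightarrow> ('e \<times> 'e) measure set" where
  "couplings \<nu>1 \<nu>2 = {\<gamma>. prob_space \<gamma> \<and> sets \<gamma> = sets (borel \<Otimes>\<^sub>M borel) \<and>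
     distr \<gamma> borel fst = \<nu>1 \<and> distr \<gamma> borel snd = \<nu>2}"

text \<open>Real-valued, hence meaningful for laws with finite second moments, where the infimum is finite.\<close>

definition W2 :: "'e::euclidean_space measure \<Rightarrow> 'e measure \<Rightarrow> real" where
  "W2 \<nu>1 \<nu>2 =
     sqrt (enn2real (INF \<gamma>\<in>couplings \<nu>1 \<nu>2. \<integral>\<^sup>+z. ennreal ((norm (fst z - snd z))\<^sup>2) \<partial>\<gamma>))"

section \<open>Processes, conditioning, Brownian motion\<close>

text \<open>Processes are indexed by \<^typ>\<open>real\<close>; only their values at times \<open>t \<ge> 0\<close> matter.\<close>

definition process_algebra ::
  "'w measure \<Rightarrow> real set \<Rightarrow> (real \<Rightarrow> 'w \<Rightarrow> 'e::topological_space) \<Rightarrow> 'w measure" where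
  "process_algebra M T Z = sigma (space M) {Z s -` B \<inter> space M | s B. s \<in> T \<and> B \<in> sets borel}"

abbreviation history ::
  "'w measure \<Rightarrow> (real \<Rightarrow> 'w \<Rightarrow> 'e::topological_space) \<Rightarrow> real \<Rightarrow> 'w measure" where
  "history M Z t \<equiv> process_algebra M {0..t} Z"

definition indep_algebras :: "'w measure \<Rightarrow> 'w measure \<Rightarrow> 'w measure \<Rightarrow> bool" where
  "indep_algebras M F G \<longleftrightarrow> prob_space.indep_set M (sets F) (sets G)"

definition continuous_process ::
  "'w measure \<Rightarrow> (real \<Rightarrow> 'w \<Rightarrow> 'e::topological_space) \<Rightarrow> bool" where
  "continuous_process M Z \<longleftrightarrow> (\<forall>t\<ge>0. Z t \<in> borel_measurable M) \<and>
     (\<forall>\<omega>\<in>space M. continuous_on {0..} (\<lambda>t. Z t \<omega>))"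

definition cond_mean :: "'w measure \<Rightarrow> 'w measure \<Rightarrow> ('w \<Rightarrow> real^'n) \<Rightarrow> 'w \<Rightarrow> real^'n" where
  "cond_mean M F X = (\<lambda>\<omega>. \<chi> i. real_cond_exp M F (\<lambda>\<omega>'. X \<omega>' $ i) \<omega>)"

text \<open>\<open>\<eta>\<close> is a (regular) version of the conditional law of \<open>X\<close> given \<open>F\<close>.\<close>

definition is_cond_law ::
  "'w measure \<Rightarrow> 'w measure \<Rightarrow> ('w \<Rightarrow> 'e::topological_space) \<Rightarrow> ('w \<Rightarrow> 'e measure) \<Rightarrow> bool" where
  "is_cond_law M F X \<eta> \<longleftrightarrow> \<eta> \<in> measurable F (prob_algebra borel) \<and>
     (\<forall>B\<in>sets borel. AE \<omega> in M.
        measure (\<eta> \<omega>) B = real_cond_exp M F (indicator (X -` B \<inter> space M)) \<omega>)"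

definition brownian_motion ::
  "'w measure \<Rightarrow> (real \<Rightarrow> 'w \<Rightarrow> 'e::euclidean_space) \<Rightarrow> bool" where
  "brownian_motion M W \<longleftrightarrow> continuous_process M W \<and> (AE \<omega> in M. W 0 \<omega> = 0) \<and>
     (\<forall>s t. 0 \<le> s \<and> s \<le> t \<longrightarrow>
        indep_algebras M (history M W s) (process_algebra M {t} (\<lambda>r \<omega>. W r \<omega> - W s \<omega>)) \<and>
        (\<forall>u. distr M borel (\<lambda>\<omega>. u \<bullet> (W t \<omega> - W s \<omega>)) = normal_law 0 ((t - s) * (norm u)\<^sup>2)))"

text \<open>Stochastic integral \<open>I = \<integral>\<^sub>0\<^sup>t H dZ\<close> of a continuous adapted matrix process against a continuous
  semimartingale: the limit in probability of the left-point Riemann sums as the mesh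
  of the partition tends to 0. For such integrands this is the Ito integral. The sums only involve
  \<open>H\<close> at finitely many deterministic times, so \<open>H\<close> may be replaced by any modification.\<close>

definition has_stochastic_integral ::
  "'w measure \<Rightarrow> (real \<Rightarrow> 'w \<Rightarrow> real^'m^'n) \<Rightarrow> (real \<Rightarrow> 'w \<Rightarrow> real^'m) \<Rightarrow> real \<Rightarrow> ('w \<Rightarrow> real^'n) \<Rightarrow> bool"
  where
  "has_stochastic_integral M H Z t I \<longleftrightarrow>
     (\<forall>s\<in>{0..t}. H s \<in> borel_measurable M \<and> Z s \<in> borel_measurable M) \<and> I \<in> borel_measurable M \<and>
     (\<forall>e>0. \<forall>d>0. \<exists>\<delta>>0. \<forall>(N::nat) (p::nat \<Rightarrow> real).
        p 0 = 0 \<and> p N = t \<and> (\<forall>k<N. p k \<le> p (Suc k) \<and> p (Suc k) - p k < \<delta>) \<longrightarrow>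
        measure M {\<omega>\<in>space M.
          e \<le> norm ((\<Sum>k<N. H (p k) \<omega> *v (Z (p (Suc k)) \<omega> - Z (p k) \<omega>)) - I \<omega>)} < d)"

section \<open>The filtering model and the Kalman-Bucy diffusion\<close>

text \<open>\<open>R1h\<close> and \<open>R2h\<close> stand for \<open>R\<^sub>1\<^sup>1\<^sup>/\<^sup>2\<close> and \<open>R\<^sub>2\<^sup>1\<^sup>/\<^sup>2\<close>. The noise being additive, the signal and
  observation equations are stated pathwise in integrated form; the latter contains \<open>Y\<^sub>0 = 0\<close>.\<close>

definition signal_observation ::
  "'w measure \<Rightarrow> real^'n^'n \<Rightarrow> real^'n \<Rightarrow> real^'n^'m \<Rightarrow> real^'m \<Rightarrow> real^'n^'n \<Rightarrow> real^'m^'m \<Rightarrow>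
   (real \<Rightarrow> 'w \<Rightarrow> real^'n) \<Rightarrow> (real \<Rightarrow> 'w \<Rightarrow> real^'m) \<Rightarrow>
   (real \<Rightarrow> 'w \<Rightarrow> real^'n) \<Rightarrow> (real \<Rightarrow> 'w \<Rightarrow> real^'m) \<Rightarrow> bool" where
  "signal_observation M A a C c R1h R2h W V X Y \<longleftrightarrow>
     brownian_motion M (\<lambda>t \<omega>. (W t \<omega>, V t \<omega>)) \<and>
     gaussian_vector M (X 0) \<and>
     indep_algebras M (process_algebra M {0} X) (process_algebra M {0..} (\<lambda>t \<omega>. (W t \<omega>, V t \<omega>))) \<and>
     continuous_process M X \<and> continuous_process M Y \<and>
     (AE \<omega> in M. \<forall>t\<ge>0.
        X t \<omega> = X 0 \<omega> + integral {0..t} (\<lambda>s. A *v X s \<omega> + a) + R1h *v W t \<omega> \<and>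
        Y t \<omega> = integral {0..t} (\<lambda>s. C *v X s \<omega> + c) + R2h *v V t \<omega>)"

text \<open>The conditional McKean-Vlasov equation. The integrator of the gain is
  \<open>dZ = dY - ((C Xb + c) dt + R\<^sub>2\<^sup>1\<^sup>/\<^sup>2 dVb)\<close>, and the equation says that what remains of \<open>Xb\<close> after removing
  the initial state, the drift and the noise \<open>R\<^sub>1\<^sup>1\<^sup>/\<^sup>2 Wb\<close> is the stochastic integral of
  \<open>P\<^bsub>\<eta>\<^esub> C' R\<^sub>2\<^sup>-\<^sup>1\<close> against \<open>Z\<close>. Square integrability is what makes the conditional means and
  covariances meaningful. The conditional laws \<open>\<eta> t\<close> are
  arbitrary versions, and the covariance process is only required to have a continuous modification.\<close>

definition kalman_bucy_diffusion ::
  "'w measure \<Rightarrow> real^'n^'n \<Rightarrow> real^'n \<Rightarrow> real^'n^'m \<Rightarrow> real^'m \<Rightarrow> real^'n^'n \<Rightarrow> real^'m^'m \<Rightarrow>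
   (real \<Rightarrow> 'w \<Rightarrow> real^'n) \<Rightarrow> (real \<Rightarrow> 'w \<Rightarrow> real^'m) \<Rightarrow>
   (real \<Rightarrow> 'w \<Rightarrow> real^'n) \<Rightarrow> (real \<Rightarrow> 'w \<Rightarrow> real^'m) \<Rightarrow>
   (real \<Rightarrow> 'w \<Rightarrow> real^'n) \<Rightarrow> (real \<Rightarrow> 'w \<Rightarrow> (real^'n) measure) \<Rightarrow> bool" where
  "kalman_bucy_diffusion M A a C c R1h R2h X Y Wb Vb Xb \<eta> \<longleftrightarrow>
     brownian_motion M (\<lambda>t \<omega>. (Wb t \<omega>, Vb t \<omega>)) \<and>
     indep_algebras M (process_algebra M {0} Xb) (process_algebra M {0..} (\<lambda>t \<omega>. (Wb t \<omega>, Vb t \<omega>))) \<and>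
     indep_algebras M (process_algebra M {0..} (\<lambda>t \<omega>. (Wb t \<omega>, Vb t \<omega>, Xb 0 \<omega>)))
                      (process_algebra M {0..} (\<lambda>t \<omega>. (X t \<omega>, Y t \<omega>))) \<and>
     continuous_process M Xb \<and>
     (\<forall>t\<ge>0. integrable M (\<lambda>\<omega>. (norm (Xb t \<omega>))\<^sup>2)) \<and>
     (\<forall>t\<ge>0. is_cond_law M (history M Y t) (Xb t) (\<eta> t)) \<and>
     (\<exists>Q. continuous_process M Q \<and> (\<forall>t\<ge>0. AE \<omega> in M. Q t \<omega> = cov_matrix (\<eta> t \<omega>))) \<and>
     (\<forall>t\<ge>0. has_stochastic_integral M
        (\<lambda>s \<omega>. cov_matrix (\<eta> s \<omega>) ** transpose C ** matrix_inv (R2h ** R2h))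
        (\<lambda>s \<omega>. Y s \<omega> - (integral {0..s} (\<lambda>r. C *v Xb r \<omega> + c) + R2h *v Vb s \<omega>))
        t
        (\<lambda>\<omega>. Xb t \<omega> - Xb 0 \<omega> - integral {0..t} (\<lambda>s. A *v Xb s \<omega> + a) - R1h *v Wb t \<omega>))"

end

theory Submission
  imports Defs "HOL-Probability.Probability"
begin

text \<open>The conditional law of the Kalman-Bucy diffusion given the observations is a Gaussian law
  whose covariance solves the Riccati equation and is therefore deterministic. To see this without any stochastic
  calculus, \<open>u \<bullet> X\<^sub>T\<close> is written as a limit of finite sums by running the adjoint closed-loop flow
  \<open>y' = - (A - QS)' y\<close>, \<open>y\<^sub>T = u\<close>, backwards on a grid: one sum is a function of the observations, the other one is
  a linear form in the initial state and in the increments of an independent Brownian motion. The same representation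
  applies to the signal, so the difference of two conditional means is controlled by the difference of the two
  flows, which decays like \<open>exp (\<mu> t)\<close>. Entropies are compared by splitting off a common isotropic Gaussian
  component and using joint convexity.\<close>

section \<open>Matrices and adjoint flows\<close>

text \<open>Three obstacles shape the argument. The weights y depend on the gain at later times, so
  they are not Ito integrands as long as the gain may be random. Hence only finite sums are used,
  pathwise, and the weights are frozen by conditioning on the observations up to T, of which the
  driving noise is independent. The observation sums are not known to converge, so the conditional
  mean cannot be read off as a limit; Gaussianity comes instead from an identity that is
  multiplicative in u and survives the limit. Finally, the covariance enters its own equation: along
  each path a linear Lyapunov equation with the covariance as coefficient is solved, its solution is
  identified with the covariance, and only then does Riccati uniqueness make it deterministic. The
  constants of the theorem precede the probability space, so every Riccati estimate is uniform over
  all solutions with a given initial matrix; only t0 may depend on the signal. Conditional means are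
  reached through bounded exponentials only, so second moments of their differences are recovered
  from 1 - cos.\<close>

lemma norm_matrix_vector_mult_le:
 fixes A :: "real^'n^'m"
 shows "norm (A *v x) <= norm A * norm x"
proof -
 have "norm (A *v x) = L2_set (%i. \<bar>A $ i \<bullet> x\<bar>) UNIV"
  by (simp add: norm_vec_def matrix_vector_mul_component)
 also have "\<dots> <= L2_set (%i. norm (A $ i) * norm x) UNIV"
  by (intro L2_set_mono) (auto simp: Cauchy_Schwarz_ineq2)
 also have "\<dots> = norm A * norm x"
  by (simp add: norm_vec_def L2_set_left_distrib)
 finally show ?thesis .
qed

lemma norm_transpose: "norm (transpose A) = norm (A :: real^'n^'m)"
proof -
 have "(norm (transpose A))\<^sup>2 = (norm A)\<^sup>2"
  unfolding power2_norm_eq_inner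
  by (simp add: inner_vec_def transpose_def) (rule sum.swap)
 then show ?thesis by simp
qed

lemma norm_matrix_matrix_mult_le:
 fixes A :: "real^'k^'m" and B :: "real^'n^'k"
 shows "norm (A ** B) <= norm A * norm B"
proof -
 have row: "(A ** B) $ i = transpose B *v (A $ i)" for i
  by (vector matrix_matrix_mult_def matrix_vector_mult_def transpose_def mult.commute)
 have "norm (A ** B) = L2_set (%i. norm ((A ** B) $ i)) UNIV"
  by (simp add: norm_vec_def)
 also have "\<dots> <= L2_set (%i. norm (A $ i) * norm B) UNIV"
  unfolding row
 proof (intro L2_set_mono)
  fix i
  show "norm (transpose B *v (A $ i)) <= norm (A $ i) * norm B"
   using norm_matrix_vector_mult_le[of "transpose B" "A $ i"]
   unfolding norm_transpose by (simp only: mult.commute)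
 qed auto
 also have "\<dots> = norm A * norm B"
  by (simp add: norm_vec_def L2_set_left_distrib)
 finally show ?thesis .
qed

lemma bounded_bilinear_matrix_vector_mult:
 "bounded_bilinear ((*v) :: real^'n^'m => real^'n => real^'m)"
proof
 show "\<exists>K. \<forall>A x. norm (A *v x :: real^'m) <= norm (A :: real^'n^'m) * norm x * K"
  by (rule exI[of _ 1]) (simp add: norm_matrix_vector_mult_le)
qed (simp_all add: algebra_simps scaleR_matrix_vector_assoc matrix_vector_mult_scaleR)

lemma bounded_bilinear_matrix_matrix_mult:
 "bounded_bilinear ((**) :: real^'k^'m => real^'n^'k => real^'n^'m)"
proof
 fix A A' :: "real^'k^'m" and B B' :: "real^'n^'k" and r :: real
 show "(A + A') ** B = A ** B + A' ** B"
  by (vector matrix_matrix_mult_def) (simp add: sum.distrib distrib_right)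
 show "A ** (B + B') = A ** B + A ** B'"
  by (vector matrix_matrix_mult_def) (simp add: sum.distrib distrib_left)
 show "(r *\<^sub>R A) ** B = r *\<^sub>R (A ** B)"
  by (vector matrix_matrix_mult_def) (simp add: sum_distrib_left mult.assoc)
 show "A ** (r *\<^sub>R B) = r *\<^sub>R (A ** B)"
  by (vector matrix_matrix_mult_def) (simp add: sum_distrib_left mult.left_commute)
next
 show "\<exists>K. \<forall>A B. norm (A ** B :: real^'n^'m) <= norm (A :: real^'k^'m) * norm (B :: real^'n^'k) * K"
  by (rule exI[of _ 1]) (simp add: norm_matrix_matrix_mult_le)
qed

lemmas matrix_mult_linear =
 bounded_bilinear.add_left[OF bounded_bilinear_matrix_matrix_mult]
 bounded_bilinear.add_right[OF bounded_bilinear_matrix_matrix_mult]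
 bounded_bilinear.diff_left[OF bounded_bilinear_matrix_matrix_mult]
 bounded_bilinear.diff_right[OF bounded_bilinear_matrix_matrix_mult]
 bounded_bilinear.scaleR_left[OF bounded_bilinear_matrix_matrix_mult]
 bounded_bilinear.scaleR_right[OF bounded_bilinear_matrix_matrix_mult]
 bounded_bilinear.minus_left[OF bounded_bilinear_matrix_matrix_mult]
 bounded_bilinear.minus_right[OF bounded_bilinear_matrix_matrix_mult]
 bounded_bilinear.zero_left[OF bounded_bilinear_matrix_matrix_mult]
 bounded_bilinear.zero_right[OF bounded_bilinear_matrix_matrix_mult]

lemmas matrix_vector_linear =
 bounded_bilinear.add_left[OF bounded_bilinear_matrix_vector_mult]
 bounded_bilinear.add_right[OF bounded_bilinear_matrix_vector_mult]
 bounded_bilinear.diff_left[OF bounded_bilinear_matrix_vector_mult]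
 bounded_bilinear.diff_right[OF bounded_bilinear_matrix_vector_mult]
 bounded_bilinear.scaleR_left[OF bounded_bilinear_matrix_vector_mult]
 bounded_bilinear.scaleR_right[OF bounded_bilinear_matrix_vector_mult]
 bounded_bilinear.minus_left[OF bounded_bilinear_matrix_vector_mult]
 bounded_bilinear.minus_right[OF bounded_bilinear_matrix_vector_mult]
 bounded_bilinear.zero_left[OF bounded_bilinear_matrix_vector_mult]
 bounded_bilinear.zero_right[OF bounded_bilinear_matrix_vector_mult]

lemma transpose_linear:
 "transpose (A + B) = transpose A + transpose (B :: real^'n^'m)"
 "transpose (A - B) = transpose A - transpose (B :: real^'n^'m)"
 by (simp_all add: transpose_def vec_eq_iff)

lemma inner_matrix_vector_transpose:
 fixes A :: "real^'n^'m"
 shows "x \<bullet> (A *v y) = (transpose A *v x) \<bullet> y"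
 by (simp add: dot_lmul_matrix)

lemma inner_matrix_vector_le:
 fixes A :: "real^'n^'m"
 shows "\<bar>x \<bullet> (A *v y)\<bar> <= norm A * norm x * norm y"
proof -
 have "\<bar>x \<bullet> (A *v y)\<bar> <= norm x * norm (A *v y)" by (rule Cauchy_Schwarz_ineq2)
 also have "\<dots> <= norm x * (norm A * norm y)"
  by (intro mult_left_mono norm_matrix_vector_mult_le) auto
 finally show ?thesis by (simp add: ac_simps)
qed

text \<open>The flows give bounds on bilinear forms, while the theorem asks for the Frobenius norm.
  Testing on basis vectors bounds each entry by \<open>b\<close>; summing the entries costs the
  dimension factors that reappear in the constants.\<close>

lemma norm_matrix_le_inner_bound:
 fixes D :: "real^'n^'m" and b :: real
 assumes "\<And>x y. \<bar>x \<bullet> (D *v y)\<bar> <= b * norm x * norm y"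
 shows "norm D <= real CARD('m) * (real CARD('n) * b)"
proof -
 have e: "\<bar>D $ i $ j\<bar> <= b" for i j
  using assms[of "axis i 1" "axis j 1"]
  by (simp add: inner_axis' matrix_vector_mult_basis column_def)
 have "norm D <= (\<Sum>i\<in>UNIV. norm (D $ i))" unfolding norm_vec_def by (rule L2_set_le_sum) auto
 also have "\<dots> <= (\<Sum>i\<in>(UNIV::'m set). real CARD('n) * b)"
 proof (intro sum_mono)
  fix i
  have "norm (D $ i) <= (\<Sum>j\<in>UNIV. \<bar>D $ i $ j\<bar>)" by (rule norm_le_l1_cart)
  also have "\<dots> <= (\<Sum>j\<in>(UNIV::'n set). b)" by (intro sum_mono e)
  finally show "norm (D $ i) <= real CARD('n) * b" by simp
 qed
 finally show ?thesis by simp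
qed

section \<open>Nonnegative matrices, the logarithmic norm and rank-one decompositions\<close>

definition psd :: "real^'n^'n => bool" where
 "psd B \<longleftrightarrow> symmetric_mat B \<and> (\<forall>x. 0 <= x \<bullet> (B *v x))"

lemma symmetric_mat_inner:
 assumes "symmetric_mat B"
 shows "x \<bullet> (B *v y) = y \<bullet> (B *v x)"
 using assms by (metis inner_matrix_vector_transpose inner_commute symmetric_mat_def)

lemma psd_Cauchy_Schwarz:
 assumes "psd B"
 shows "(x \<bullet> (B *v y))\<^sup>2 <= (x \<bullet> (B *v x)) * (y \<bullet> (B *v y))"
proof -
 have sym: "symmetric_mat B" and nn: "\<And>x. 0 <= x \<bullet> (B *v x)"
  using assms by (auto simp: psd_def)
 define a b c where "a = x \<bullet> (B *v x)" and "b = x \<bullet> (B *v y)" and "c = y \<bullet> (B *v y)"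
 have q: "0 <= a * s\<^sup>2 + 2 * b * s * r + c * r\<^sup>2" for s r
  using nn[of "s *\<^sub>R x + r *\<^sub>R y"] symmetric_mat_inner[OF sym, of x y]
  by (simp add: a_def b_def c_def matrix_vector_linear algebra_simps power2_eq_square
    inner_add_left inner_add_right)
 have "a >= 0" "c >= 0" using nn a_def c_def by auto
 show ?thesis
 proof (cases "a = 0")
  case True
  have "b = 0"
  proof (rule ccontr)
   assume "b ~= 0"
   \<comment> \<open>With \<open>a = 0\<close> the form is affine in \<open>s\<close>; this
     \<open>s\<close> gives it the value -1.\<close>
   have "0 <= 2 * b * (-(c + 1) / (2 * b)) * 1 + c * 1\<^sup>2"
    using q[of "-(c + 1) / (2 * b)" 1] True by simp
   then show False using \<open>b ~= 0\<close> by (simp add: field_simps)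
  qed
  then show ?thesis using \<open>a >= 0\<close> \<open>c >= 0\<close> by (simp add: a_def[symmetric] b_def[symmetric] c_def[symmetric])
 next
  case False
  have "0 <= a * (-b)\<^sup>2 + 2 * b * (-b) * a + c * a\<^sup>2" by (rule q)
  then have "0 <= a * (a * c - b\<^sup>2)" by (simp add: power2_eq_square algebra_simps)
  then show ?thesis using False \<open>a >= 0\<close>
   by (simp add: a_def[symmetric] b_def[symmetric] c_def[symmetric] zero_le_mult_iff)
 qed
qed

text \<open>\<open>lambda_max\<close> is a \<open>Max\<close> over a set of eigenvalues, which has a
  meaning only if the set is finite: eigenvectors of distinct eigenvalues of the symmetric part are
  orthogonal, hence independent. A maximiser of the Rayleigh quotient on the unit sphere is then
  shown to be an eigenvector, which avoids a diagonalisation.\<close>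

lemma log_norm_bound:
 fixes B :: "real^'n^'n"
 shows "x \<bullet> (B *v x) <= log_norm B * (norm x)\<^sup>2"
proof -
 define G where "G = (1/2) *\<^sub>R (B + transpose B)"
 have symG: "symmetric_mat G"
  by (simp add: symmetric_mat_def G_def transpose_def vec_eq_iff)
 have BG: "x \<bullet> (B *v x) = x \<bullet> (G *v x)" for x
  using inner_matrix_vector_transpose[of x B x]
  by (simp add: G_def matrix_vector_linear inner_add_right inner_commute)
 let ?E = "{l. \<exists>v. v ~= 0 \<and> G *v v = l *\<^sub>R v}"
 have fin: "finite ?E"
 proof -
  define ev where "ev l = (SOME v. v ~= 0 \<and> G *v v = l *\<^sub>R v)" for l
  have ev: "ev l ~= 0 \<and> G *v ev l = l *\<^sub>R ev l" if "l \<in> ?E" for l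
   unfolding ev_def by (rule someI_ex) (use that in simp)
  have orth: "ev l \<bullet> ev k = 0" if "l \<in> ?E" "k \<in> ?E" "l ~= k" for l k
  proof -
   have "k * (ev l \<bullet> ev k) = ev l \<bullet> (G *v ev k)" using ev[OF that(2)] by simp
   also have "\<dots> = ev k \<bullet> (G *v ev l)" by (rule symmetric_mat_inner[OF symG])
   also have "\<dots> = l * (ev l \<bullet> ev k)" using ev[OF that(1)] by (simp add: inner_commute)
   finally show ?thesis using that(3) by simp
  qed
  have inj: "inj_on ev ?E"
  proof (rule inj_onI)
   fix l k assume h: "l \<in> ?E" "k \<in> ?E" "ev l = ev k"
   show "l = k"
   proof (rule ccontr)
    assume "l ~= k"
    from orth[OF h(1,2) this] h(3) ev[OF h(2)] show False by simp
   qed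
  qed
  have "pairwise orthogonal (ev ` ?E)"
   unfolding pairwise_def orthogonal_def using orth by (metis (no_types, lifting) imageE)
  moreover have "0 \<notin> ev ` ?E" using ev by force
  ultimately have "independent (ev ` ?E)" by (rule pairwise_orthogonal_independent)
  then have "finite (ev ` ?E)" by (rule independent_imp_finite)
  then show ?thesis using inj by (rule finite_imageD)
 qed
 have "compact (sphere (0::real^'n) 1)" by simp
 moreover have "sphere (0::real^'n) 1 ~= {}" by simp
 moreover have "continuous_on (sphere 0 1) (%x. x \<bullet> (G *v x))"
  by (intro continuous_intros)
 ultimately obtain v where v: "v \<in> sphere 0 1" "\<And>w. w \<in> sphere 0 1 ==> w \<bullet> (G *v w) <= v \<bullet> (G *v v)"
  using continuous_attains_sup[of "sphere 0 1" "%x. x \<bullet> (G *v x)"] by metis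
 define l where "l = v \<bullet> (G *v v)"
 have nv: "norm v = 1" using v(1) by simp
 have le: "w \<bullet> (G *v w) <= l * (norm w)\<^sup>2" for w
 proof (cases "w = 0")
  case False
  have "((1/norm w) *\<^sub>R w) \<bullet> (G *v ((1/norm w) *\<^sub>R w)) <= l"
   unfolding l_def using False by (intro v(2)) simp
  then have "(w \<bullet> (G *v w)) / (norm w)\<^sup>2 <= l"
   by (simp add: matrix_vector_linear power2_eq_square)
  then show ?thesis using False by (simp add: field_simps)
 qed simp
 define D where "D = l *\<^sub>R mat 1 - G"
 have D: "D *v w = l *\<^sub>R w - G *v w" for w
  by (simp add: D_def matrix_vector_linear)
 have psdD: "psd D"
 proof -
  have "symmetric_mat D" using symG
   by (auto simp: symmetric_mat_def D_def transpose_def vec_eq_iff mat_def)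
  moreover have "0 <= w \<bullet> (D *v w)" for w
   using le[of w] by (simp add: D inner_diff_right power2_norm_eq_inner)
  ultimately show ?thesis by (simp add: psd_def)
 qed
 have "v \<bullet> (D *v v) = 0" using nv by (simp add: D inner_diff_right l_def flip: power2_norm_eq_inner)
 \<comment> \<open>\<open>v\<close> is a null vector for the form of the nonnegative matrix
   \<open>D\<close>; Cauchy-Schwarz turns this into \<open>D *v v = 0\<close>, so the maximum
   \<open>l\<close> is an eigenvalue.\<close>
 then have "(w \<bullet> (D *v v))\<^sup>2 <= 0" for w using psd_Cauchy_Schwarz[OF psdD, of w v] by simp
 then have "D *v v = 0" by (metis inner_eq_zero_iff power2_less_eq_zero_iff)
 then have "l \<in> ?E" using nv by (auto simp: D intro!: exI[of _ v])
 then have "l <= log_norm B"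
  unfolding log_norm_def lambda_max_def G_def[symmetric] using fin by (rule Max_ge[rotated])
 have "x \<bullet> (B *v x) <= l * (norm x)\<^sup>2" using BG le by simp
 also have "\<dots> <= log_norm B * (norm x)\<^sup>2" using \<open>l <= log_norm B\<close> by (intro mult_right_mono) auto
 finally show ?thesis .
qed

text \<open>Symmetric Gaussian elimination: subtracting w w' with \<open>w\<close> the normalised
  pivot row clears row \<open>i\<close>, creates no new nonzero row, and keeps the matrix
  nonnegative by Cauchy-Schwarz. The induction runs over the number of nonzero rows. It takes the
  place of a matrix square root when Gaussian vectors are built.\<close>

lemma psd_rank_one_decomposition:
 fixes B :: "real^'n^'n"
 assumes "psd B"
 shows "\<exists>v :: nat => real^'n. \<exists>k. \<forall>x. x \<bullet> (B *v x) = (\<Sum>i<k. (v i \<bullet> x)\<^sup>2)"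
 using assms
proof (induction "card {i. B $ i ~= 0}" arbitrary: B rule: less_induct)
 case less
 have sym: "symmetric_mat B" and nn: "\<And>x. 0 <= x \<bullet> (B *v x)"
  using less.prems by (auto simp: psd_def)
 show ?case
 proof (cases "B = 0")
  case True
  then show ?thesis by (intro exI[of _ "%_. 0"] exI[of _ 0]) (simp add: matrix_vector_linear)
 next
  case False
  then obtain i where i: "B $ i ~= 0" by (metis vec_eq_iff zero_index)
  have ij: "axis j 1 \<bullet> (B *v axis i 1) = B $ j $ i" for i j
   by (simp add: inner_axis' matrix_vector_mult_basis column_def)
  have symc: "B $ j $ i = B $ i $ j" for i j
   using symmetric_mat_inner[OF sym, of "axis i 1" "axis j 1"] by (simp add: ij)
  have cs: "(B $ j $ i)\<^sup>2 <= B $ j $ j * B $ i $ i" for i j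
   using psd_Cauchy_Schwarz[OF less.prems, of "axis j 1" "axis i 1"] by (simp add: ij)
  have "B $ i $ i ~= 0"
  proof
   assume "B $ i $ i = 0"
   then have "B $ i $ j = 0" for j using cs[of i j] by simp
   then show False using i by (simp add: vec_eq_iff)
  qed
  moreover have "0 <= B $ i $ i" using nn[of "axis i 1"] by (simp add: ij)
  ultimately have pos: "0 < B $ i $ i" by simp
  define b where "b = B $ i $ i"
  define w where "w = (1 / sqrt b) *\<^sub>R (B $ i)"
  define D where "D = (\<chi> j k. B $ j $ k - w $ j * w $ k)"
  have bi: "axis i 1 \<bullet> (B *v x) = B $ i \<bullet> x" for x
   by (simp add: inner_axis' matrix_vector_mul_component)
  have Dx: "x \<bullet> (D *v x) = x \<bullet> (B *v x) - (w \<bullet> x)\<^sup>2" for x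
   by (simp add: D_def inner_vec_def matrix_vector_mult_def left_diff_distrib sum_subtractf
     right_diff_distrib power2_eq_square sum_distrib_left sum_distrib_right ac_simps)
  have wx: "(w \<bullet> x)\<^sup>2 = (B $ i \<bullet> x)\<^sup>2 / b" for x
   using pos by (simp add: w_def b_def power_divide)
  have "psd D"
  proof -
   have "symmetric_mat D"
    using symc by (simp add: symmetric_mat_def D_def transpose_def vec_eq_iff mult.commute)
   moreover have "0 <= x \<bullet> (D *v x)" for x
    using psd_Cauchy_Schwarz[OF less.prems, of "axis i 1" x] pos
    by (simp add: Dx wx bi ij b_def field_simps)
   ultimately show ?thesis by (simp add: psd_def)
  qed
  moreover have "card {j. D $ j ~= 0} < card {j. B $ j ~= 0}"
  proof (rule psubset_card_mono)
   have Di: "D $ i = 0"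
    using pos by (simp add: D_def vec_eq_iff w_def b_def field_simps)
   have "D $ j = 0" if "B $ j = 0" for j
   proof -
    have "B $ i $ j = 0" using that symc[of j i] by simp
    then show ?thesis using that by (simp add: D_def vec_eq_iff w_def)
   qed
   then show "{j. D $ j ~= 0} \<subset> {j. B $ j ~= 0}" using Di i by auto
  qed simp
  ultimately have "\<exists>v :: nat => real^'n. \<exists>k. \<forall>x. x \<bullet> (D *v x) = (\<Sum>i<k. (v i \<bullet> x)\<^sup>2)"
   by (rule less.hyps[rotated])
  then obtain v :: "nat => real^'n" and k where vk: "\<forall>x. x \<bullet> (D *v x) = (\<Sum>i<k. (v i \<bullet> x)\<^sup>2)"
   by (elim exE)
  have "x \<bullet> (B *v x) = (\<Sum>i<Suc k. ((v(k := w)) i \<bullet> x)\<^sup>2)" for x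
   using Dx[of x] vk by simp
  then show ?thesis by (intro exI[of _ "v(k := w)"] exI[of _ "Suc k"]) simp
 qed
qed

declare transpose_matrix_vector [simp del]

text \<open>Banach's fixed point theorem in the weighted norm sup exp (-2 L s) |x s| (Bielecki): the
  weight makes the Picard map a contraction with factor 1/2 on the whole interval, so no local
  solutions have to be glued.\<close>

lemma picard_global:
 fixes G :: "real => 'a::banach => 'a"
 assumes cont: "\<And>x. continuous_on {0..T} x ==> continuous_on {0..T} (%s. G s (x s))"
  and lip: "\<And>s x y. s \<in> {0..T} ==> norm (G s x - G s y) <= L * norm (x - y)"
  and L: "0 < L" and T: "0 <= T"
 shows "\<exists>x. x 0 = x0 \<and>
  (\<forall>s\<in>{0..T}. (x has_vector_derivative G s (x s)) (at s within {0..T}))"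
proof -
 \<comment> \<open>Clamping to {0..T} extends functions to the whole line, so that the complete
   space of bounded continuous functions on \<open>real\<close> can be used.\<close>
 define cl :: "real => real" where "cl s = max 0 (min T s)" for s
 have cl: "cl s \<in> {0..T}" for s using T by (auto simp: cl_def)
 have clid: "cl s = s" if "s \<in> {0..T}" for s using that by (auto simp: cl_def)
 have cl_cont: "continuous_on UNIV cl" unfolding cl_def by (intro continuous_intros)
 define I where "I f s = integral {0..s} (%r. G r (exp (2*L*r) *\<^sub>R f r))" for f :: "real => 'a" and s
 \<comment> \<open>\<open>F\<close> acts on the rescaled unknown
   \<open>f s = exp (- 2*L*s) *\<^sub>R x s\<close>; the solution itself is recovered below as
   \<open>x\<close>.\<close>
 define F where "F f s = exp (- 2*L*cl s) *\<^sub>R (x0 + I f (cl s))" for f :: "real => 'a" and s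
 have gc: "continuous_on {0..T} (%r. G r (exp (2*L*r) *\<^sub>R f r))" if "continuous_on {0..T} f" for f
  by (rule cont) (intro continuous_intros that)
 have Ider: "(I f has_vector_derivative G s (exp (2 * L * s) *\<^sub>R f s)) (at s within {0..T})"
  if "continuous_on {0..T} f" "s \<in> {0..T}" for f s
  using integral_has_vector_derivative[OF gc[OF that(1)] that(2)] unfolding I_def .
 have Icont: "continuous_on {0..T} (I f)" if "continuous_on {0..T} f" for f
  using Ider[OF that] by (meson continuous_on_eq_continuous_within has_vector_derivative_continuous)
 have Fc: "continuous_on UNIV (F f)" if "continuous_on {0..T} f" for f
  unfolding F_def
  by (intro continuous_intros continuous_on_compose2[OF Icont[OF that] cl_cont] cl_cont)
   (use cl in auto)
 have Fb: "bounded (range (F f))" if "continuous_on {0..T} f" for f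
 proof -
  have "range (F f) \<subseteq> F f ` {0..T}"
  proof clarify
   fix s show "F f s \<in> F f ` {0..T}"
    by (rule image_eqI[of _ _ "cl s"]) (use cl clid in \<open>auto simp: F_def\<close>)
  qed
  moreover have "compact (F f ` {0..T})"
   by (intro compact_continuous_image continuous_on_subset[OF Fc[OF that]]) auto
  ultimately show ?thesis using bounded_subset compact_imp_bounded by blast
 qed
 define \<Phi> where "\<Phi> f = Bcontfun (F (apply_bcontfun f))" for f :: "real \<Rightarrow>\<^sub>C 'a"
 have \<Phi>: "apply_bcontfun (\<Phi> f) = F (apply_bcontfun f)" for f
  unfolding \<Phi>_def using Fc[of f] Fb[of f] by (subst Bcontfun_inverse) (auto simp: bcontfun_def)
 have contr: "dist (\<Phi> f) (\<Phi> g) <= (1/2) * dist f g" for f g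
 proof (rule dist_bound)
  fix s
  let ?s = "cl s"
  let ?d = "dist f g"
  have s: "0 <= ?s" "?s <= T" using cl[of s] by auto
  have sub: "{0..?s} \<subseteq> {0..T}" using s by auto
  have int: "(%r. G r (exp (2*L*r) *\<^sub>R apply_bcontfun h r)) integrable_on {0..?s}" for h
   by (intro integrable_continuous_real continuous_on_subset[OF gc sub]) auto
  \<comment> \<open>The integral of L exp (2 L r) is exp (2 L s) / 2 - 1/2; this is the source of
    the contraction factor 1/2.\<close>
  have exint: "((%r. L * exp (2*L*r) * ?d) has_integral (exp (2*L*?s)/2 * ?d - exp (2*L*0)/2 * ?d)) {0..?s}"
   by (intro fundamental_theorem_of_calculus s)
    (auto intro!: derivative_eq_intros simp flip: has_real_derivative_iff_has_vector_derivative)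
  have "norm (I f ?s - I g ?s) = norm (integral {0..?s}
    (%r. G r (exp (2*L*r) *\<^sub>R f r) - G r (exp (2*L*r) *\<^sub>R g r)))"
   unfolding I_def by (subst Henstock_Kurzweil_Integration.integral_diff[OF int int]) simp
  also have "\<dots> <= integral {0..?s} (%r. L * exp (2*L*r) * ?d)"
  proof (intro integral_norm_bound_integral integrable_diff int)
   show "(%r. L * exp (2*L*r) * ?d) integrable_on {0..?s}" using exint by blast
   fix r assume "r \<in> {0..?s}"
   then have "norm (G r (exp (2*L*r) *\<^sub>R f r) - G r (exp (2*L*r) *\<^sub>R g r))
     <= L * norm (exp (2*L*r) *\<^sub>R f r - exp (2*L*r) *\<^sub>R g r)"
    using sub by (intro lip) auto
   also have "\<dots> = L * exp (2*L*r) * dist (apply_bcontfun f r) (g r)"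
    by (simp add: dist_norm flip: scaleR_diff_right)
   also have "\<dots> <= L * exp (2*L*r) * ?d"
    using L by (intro mult_left_mono dist_bounded) auto
   finally show "norm (G r (exp (2*L*r) *\<^sub>R f r) - G r (exp (2*L*r) *\<^sub>R g r)) <= L * exp (2*L*r) * ?d" .
  qed
  also have "\<dots> = exp (2*L*?s)/2 * ?d - 1/2 * ?d"
   using integral_unique[OF exint] by (simp only: mult_zero_right exp_zero)
  also have "\<dots> <= exp (2*L*?s) * ((1/2) * ?d)" by simp
  finally have le: "norm (I f ?s - I g ?s) <= exp (2*L*?s) * ((1/2) * ?d)" .
  have "dist (\<Phi> f s) (\<Phi> g s) = exp (- 2*L*?s) * norm (I f ?s - I g ?s)"
   by (simp add: \<Phi> F_def dist_norm flip: scaleR_diff_right)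
  also have "\<dots> <= exp (- 2*L*?s) * (exp (2*L*?s) * ((1/2) * ?d))"
   by (intro mult_left_mono le) auto
  also have "\<dots> = (1/2) * ?d" by (simp add: mult.assoc[symmetric] flip: exp_add)
  finally show "dist (\<Phi> f s) (\<Phi> g s) <= (1/2) * ?d" .
 qed
 have "\<exists>!f. \<Phi> f = f" by (rule banach_fix_type[of "1/2"]) (use contr in auto)
 then obtain f where f: "\<Phi> f = f" by auto
 define x where "x s = x0 + I f s" for s
 have x: "x s = exp (2 * L * s) *\<^sub>R f s" if "s \<in> {0..T}" for s
 proof -
  have "f s = F f s" using \<Phi>[of f] f by simp
  then show ?thesis using clid[OF that]
   by (simp add: F_def x_def mult.assoc[symmetric] flip: exp_add)
 qed
 have "(x has_vector_derivative G s (x s)) (at s within {0..T})" if "s \<in> {0..T}" for s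
  unfolding x[OF that] unfolding x_def
  using Ider[OF _ that, of f] by (auto intro!: derivative_eq_intros)
 moreover have "x 0 = x0" by (simp add: x_def I_def)
 ultimately show ?thesis by blast
qed

section \<open>Adjoint flows and their energy estimates\<close>

lemma has_vector_derivative_time_reversal:
 fixes x :: "real => 'a::real_normed_vector"
 assumes "(x has_vector_derivative d) (at (T - s) within {0..T})"
 shows "((%s. x (T - s)) has_vector_derivative - d) (at s within {0..T})"
proof -
 have "((%s. T - s) has_vector_derivative -1) (at s within {0..T})"
  by (auto intro!: derivative_eq_intros)
 moreover have "(%s. T - s) ` {0..T} = {0..T}"
  by (auto intro!: image_eqI[of _ _ "T - _"])
 ultimately have "((x \<circ> (%s. T - s)) has_vector_derivative (-1) *\<^sub>R d) (at s within {0..T})"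
  using assms by (intro vector_diff_chain_within) auto
 then show ?thesis by (simp add: o_def)
qed

lemma nondecreasing_from_derivative:
 fixes f :: "real => real"
 assumes "a <= b"
  and "\<And>s. s \<in> {a..b} ==> (f has_real_derivative g s) (at s within {a..b})"
  and "\<And>s. s \<in> {a..b} ==> 0 <= g s"
 shows "f a <= f b"
proof (rule DERIV_nonneg_imp_increasing_open[OF \<open>a <= b\<close>])
 show "continuous_on {a..b} f"
  using assms(2) by (meson DERIV_continuous continuous_on_eq_continuous_within)
 fix x assume x: "a < x" "x < b"
 then have "at x within {a..b} = at x" by (intro at_within_interior) auto
 then show "\<exists>y. (f has_real_derivative y) (at x) \<and> 0 <= y"
  using assms(2,3)[of x] x by auto
qed

lemma fundamental_theorem_of_calculus_on:
 fixes f :: "real => 'a::banach"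
 assumes "a <= b" "\<And>s. s \<in> {a..b} ==> (f has_vector_derivative g s) (at s within S)" "{a..b} \<subseteq> S"
 shows "(g has_integral f b - f a) {a..b}"
 by (rule fundamental_theorem_of_calculus[OF assms(1)])
  (rule has_vector_derivative_within_subset[OF assms(2,3)])

text \<open>Solved backwards from \<open>u\<close> because then, for x' = B x + f, the pairing y . x
  has derivative y . f: the drift matrix disappears, and u . x T becomes an initial term plus an
  integral of y . f.\<close>

definition adjoint_flow :: "(real => real^'n^'n) => real => real^'n => (real => real^'n) => bool" where
 "adjoint_flow B T u y \<longleftrightarrow> y T = u \<and>
  (\<forall>s\<in>{0..T}. (y has_vector_derivative - (transpose (B s) *v y s)) (at s within {0..T}))"

lemma continuous_on_matrix_vector_mult [continuous_intros]:
 fixes f :: "'a::topological_space => real^'n^'m"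
 assumes "continuous_on S f" "continuous_on S g"
 shows "continuous_on S (%s. f s *v g s)"
 by (rule bounded_bilinear.continuous_on[OF bounded_bilinear_matrix_vector_mult assms])

lemma continuous_on_matrix_matrix_mult [continuous_intros]:
 fixes f :: "'a::topological_space => real^'k^'m" and g :: "'a => real^'n^'k"
 assumes "continuous_on S f" "continuous_on S g"
 shows "continuous_on S (%s. f s ** g s)"
 by (rule bounded_bilinear.continuous_on[OF bounded_bilinear_matrix_matrix_mult assms])

lemma bounded_linear_transpose: "bounded_linear (transpose :: real^'n^'m => real^'m^'n)"
proof (rule bounded_linear_intro[where K=1])
 fix x :: "real^'n^'m"
 show "norm (transpose x) <= norm x * 1" by (simp add: norm_transpose)
qed (auto simp: transpose_def vec_eq_iff)

lemma continuous_on_transpose [continuous_intros]: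
 fixes f :: "'a::topological_space => real^'n^'m"
 assumes "continuous_on S f"
 shows "continuous_on S (%s. transpose (f s))"
 by (rule bounded_linear.continuous_on[OF bounded_linear_transpose assms])

lemma continuous_norm_bounded:
 fixes B :: "real => 'a::real_normed_vector"
 assumes "continuous_on {0..T} B"
 obtains b where "0 < b" "\<And>s. s \<in> {0..T} ==> norm (B s) <= b"
proof -
 have "bounded (B ` {0..T})"
  by (intro compact_imp_bounded compact_continuous_image assms) auto
 then show ?thesis using that unfolding bounded_pos by auto
qed

lemma adjoint_flow_exists:
 fixes B :: "real => real^'n^'n" and u :: "real^'n"
 assumes "continuous_on {0..T} B" "0 <= T"
 shows "\<exists>y. adjoint_flow B T u y"
proof -
 obtain b where b: "0 < b" "\<And>s. s \<in> {0..T} ==> norm (B s) <= b"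
  using continuous_norm_bounded[OF assms(1)] by blast
 have c: "continuous_on {0..T} (%s. B (T - s))"
  by (rule continuous_on_compose2[OF assms(1)]) (auto intro!: continuous_intros)
 have "\<exists>x. x 0 = u \<and> (\<forall>s\<in>{0..T}. (x has_vector_derivative transpose (B (T - s)) *v x s) (at s within {0..T}))"
 proof (rule picard_global[where L = b])
  fix s and x y :: "real^'n" assume "s \<in> {0..T}"
  then have "norm (B (T - s)) <= b" by (intro b) auto
  then show "norm (transpose (B (T - s)) *v x - transpose (B (T - s)) *v y) <= b * norm (x - y)"
   using norm_matrix_vector_mult_le[of "transpose (B (T - s))" "x - y"]
   by (simp add: matrix_vector_linear norm_transpose)
    (meson mult_right_mono norm_ge_zero order_trans)
 qed (auto intro!: continuous_intros c assms b)
 then obtain x where x: "x 0 = u"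
  "\<And>s. s \<in> {0..T} ==> (x has_vector_derivative transpose (B (T - s)) *v x s) (at s within {0..T})"
  by blast
 have "adjoint_flow B T u (%s. x (T - s))"
  unfolding adjoint_flow_def
 proof (intro conjI ballI)
  fix s assume "s \<in> {0..T}"
  then show "((%s. x (T - s)) has_vector_derivative - (transpose (B s) *v x (T - s))) (at s within {0..T})"
   using x(2)[of "T - s"] by (intro has_vector_derivative_time_reversal) auto
 qed (simp add: x)
 then show ?thesis by blast
qed

text \<open>Two different matrices \<open>B\<close> and \<open>B'\<close> are allowed, since the
  difference of two Riccati solutions solves D' = B D + D B'^T with their closed loops as
  \<open>B\<close> and \<open>B'\<close>; the form is then constant.\<close>

lemma bilinear_form_derivative:
 fixes D :: "real => real^'n^'n"
 assumes y: "(y has_vector_derivative - (transpose B *v y s)) (at s within U)"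
  and z: "(z has_vector_derivative - (transpose B' *v z s)) (at s within U)"
  and D: "(D has_vector_derivative D') (at s within U)"
 shows "((%s. y s \<bullet> (D s *v z s)) has_real_derivative
  y s \<bullet> ((D' - B ** D s - D s ** transpose B') *v z s)) (at s within U)"
proof -
 have "((%s. D s *v z s) has_vector_derivative
   D s *v (- (transpose B' *v z s)) + D' *v z s) (at s within U)"
  by (rule bounded_bilinear.has_vector_derivative[OF bounded_bilinear_matrix_vector_mult D z])
 then have "((%s. y s \<bullet> (D s *v z s)) has_vector_derivative
   y s \<bullet> (D s *v (- (transpose B' *v z s)) + D' *v z s)
   + (- (transpose B *v y s)) \<bullet> (D s *v z s)) (at s within U)"
  by (rule bounded_bilinear.has_vector_derivative[OF bounded_bilinear_inner y])
 moreover have "(transpose B *v y s) \<bullet> (D s *v z s) = y s \<bullet> (B *v (D s *v z s))"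
  by (simp add: inner_matrix_vector_transpose[of "y s" B])
 then have "y s \<bullet> (D s *v (- (transpose B' *v z s)) + D' *v z s) + (- (transpose B *v y s)) \<bullet> (D s *v z s)
   = y s \<bullet> ((D' - B ** D s - D s ** transpose B') *v z s)"
  by (simp add: matrix_vector_linear inner_add_right inner_diff_right inner_minus_left
    matrix_vector_mul_assoc[symmetric])
 ultimately show ?thesis
  by (simp only: has_real_derivative_iff_has_vector_derivative)
qed

lemma norm_sq_derivative:
 fixes y :: "real => 'a::real_inner"
 assumes "(y has_vector_derivative d) (at s within U)"
 shows "((%s. (norm (y s))\<^sup>2) has_real_derivative 2 * (y s \<bullet> d)) (at s within U)"
 using bounded_bilinear.has_vector_derivative[OF bounded_bilinear_inner assms assms]
 by (simp add: has_real_derivative_iff_has_vector_derivative power2_norm_eq_inner inner_commute)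

lemma adjoint_flow_subset:
 assumes "adjoint_flow B T u y" "{a..b} \<subseteq> {0..T}" "s \<in> {a..b}"
 shows "(y has_vector_derivative - (transpose (B s) *v y s)) (at s within {a..b})"
 using assms has_vector_derivative_within_subset unfolding adjoint_flow_def by blast

text \<open>Gronwall with a variable rate: \<open>g\<close> bounds the quadratic form of the matrix,
  so \<open>(norm (y s))\<^sup>2 * exp (2 * G s)\<close> is nondecreasing. The rate has to vary
  because the closed loop of a Riccati solution approaches the stable matrix only as time
  grows.\<close>

lemma adjoint_flow_energy:
 assumes y: "adjoint_flow B T u y" and ab: "0 <= a" "a <= b" "b <= T"
  and B: "\<And>s x. s \<in> {a..b} ==> x \<bullet> (B s *v x) <= g s * (norm x)\<^sup>2"
  and G: "\<And>s. s \<in> {a..b} ==> (G has_real_derivative g s) (at s within {a..b})"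
 shows "(norm (y a))\<^sup>2 * exp (2 * G a) <= (norm (y b))\<^sup>2 * exp (2 * G b)"
proof -
 have sub: "{a..b} \<subseteq> {0..T}" using ab by auto
 let ?f = "%s. (norm (y s))\<^sup>2 * exp (2 * G s)"
 let ?g = "%s. (2 * (g s * (norm (y s))\<^sup>2 - y s \<bullet> (B s *v y s))) * exp (2 * G s)"
 show ?thesis
 proof (rule nondecreasing_from_derivative[of a b ?f ?g])
  fix s assume s: "s \<in> {a..b}"
  have "y s \<bullet> (transpose (B s) *v y s) = y s \<bullet> (B s *v y s)"
   using inner_matrix_vector_transpose[of "y s" "B s" "y s"] by (simp add: inner_commute)
  then have "((%s. (norm (y s))\<^sup>2) has_real_derivative - 2 * (y s \<bullet> (B s *v y s))) (at s within {a..b})"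
   using norm_sq_derivative[OF adjoint_flow_subset[OF y sub s]] by simp
  then show "(?f has_real_derivative ?g s) (at s within {a..b})"
   by (rule DERIV_cong[OF DERIV_mult[OF _ DERIV_chain2[OF DERIV_exp DERIV_cmult[OF G[OF s]]]]])
    (simp add: algebra_simps)
  show "0 <= ?g s" using B[OF s, of "y s"] by simp
 qed (rule ab)
qed

lemma adjoint_flow_energy_lower:
 assumes y: "adjoint_flow B T u y" and ab: "0 <= a" "a <= b" "b <= T"
  and B: "\<And>s. s \<in> {a..b} ==> norm (B s) <= bet"
 shows "norm (y b) <= exp (bet * (b - a)) * norm (y a)"
proof -
 have sub: "{a..b} \<subseteq> {0..T}" using ab by auto
 let ?f = "%s. - ((norm (y s))\<^sup>2 * exp (- 2 * bet * s))"
 let ?g = "%s. (2 * (bet * (norm (y s))\<^sup>2 + y s \<bullet> (B s *v y s))) * exp (- 2 * bet * s)"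
 have "?f a <= ?f b"
 proof (rule nondecreasing_from_derivative[of a b ?f ?g])
  fix s assume s: "s \<in> {a..b}"
  have "y s \<bullet> (transpose (B s) *v y s) = y s \<bullet> (B s *v y s)"
   using inner_matrix_vector_transpose[of "y s" "B s" "y s"] by (simp add: inner_commute)
  then have "((%s. (norm (y s))\<^sup>2) has_real_derivative - 2 * (y s \<bullet> (B s *v y s))) (at s within {a..b})"
   using norm_sq_derivative[OF adjoint_flow_subset[OF y sub s]] by simp
  then show "(?f has_real_derivative ?g s) (at s within {a..b})"
   by (rule DERIV_cong[OF DERIV_minus[OF DERIV_mult[OF _ DERIV_chain2[OF DERIV_exp DERIV_cmult[OF DERIV_ident]]]]])
    (simp add: algebra_simps)
  have "\<bar>y s \<bullet> (B s *v y s)\<bar> <= norm (B s) * norm (y s) * norm (y s)" by (rule inner_matrix_vector_le)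
  also have "\<dots> <= bet * norm (y s) * norm (y s)" by (intro mult_right_mono B s) auto
  finally show "0 <= ?g s" by (simp add: power2_eq_square)
 qed (rule ab)
 then have "(norm (y b))\<^sup>2 * exp (- 2 * bet * b) * exp (2 * bet * b) <= (norm (y a))\<^sup>2 * exp (- 2 * bet * a) * exp (2 * bet * b)"
  by (intro mult_right_mono) auto
 then have "(norm (y b))\<^sup>2 <= (exp (bet * (b - a)) * norm (y a))\<^sup>2"
  by (simp add: mult.assoc power_mult_distrib algebra_simps flip: exp_add exp_double)
 then show ?thesis by (rule power2_le_imp_le) simp
qed

lemma adjoint_flow_energy_upper:
 assumes y: "adjoint_flow B T u y" and ab: "0 <= a" "a <= b" "b <= T"
  and B: "\<And>s x. s \<in> {a..b} ==> x \<bullet> (B s *v x) <= bet * (norm x)\<^sup>2"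
 shows "norm (y a) <= exp (bet * (b - a)) * norm (y b)"
proof -
 have "(norm (y a))\<^sup>2 * exp (2 * (bet * a)) <= (norm (y b))\<^sup>2 * exp (2 * (bet * b))"
  by (rule adjoint_flow_energy[OF y ab B]) (auto intro!: derivative_eq_intros)
 then have "(norm (y a))\<^sup>2 * exp (2 * (bet * a)) * exp (- 2 * bet * a) <= (norm (y b))\<^sup>2 * exp (2 * (bet * b)) * exp (- 2 * bet * a)"
  by (intro mult_right_mono) auto
 then have "(norm (y a))\<^sup>2 <= (exp (bet * (b - a)) * norm (y b))\<^sup>2"
  by (simp add: mult.assoc power_mult_distrib algebra_simps flip: exp_add exp_double)
 then show ?thesis by (rule power2_le_imp_le) simp
qed

section \<open>The Riccati equation\<close>

definition riccati_field :: "real^'n^'n => real^'n^'n => real^'n^'n => real^'n^'n => real^'n^'n" where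
 "riccati_field A S R Q = A ** Q + Q ** transpose A - Q ** S ** Q + R"

text \<open>\<open>\<mu>\<close> is any negative bound for the quadratic form of the stationary
  closed loop, in the application its logarithmic norm; \<open>r\<close> is the ellipticity constant
  of \<open>R\<close>, positive there because \<open>R1h\<close> is invertible.\<close>

locale riccati_stable =
 fixes A S R P :: "real^'n^'n" and \<mu> r :: real
 assumes psdS: "psd S" and symP: "symmetric_mat P"
  and ARE: "riccati_field A S R P = 0"
  and R_ge: "\<And>x. r * (norm x)\<^sup>2 <= x \<bullet> (R *v x)" and r_pos: "0 < r"
  and mu_neg: "\<mu> < 0"
  and stable: "\<And>x. x \<bullet> ((A - P ** S) *v x) <= \<mu> * (norm x)\<^sup>2"
begin

text \<open>Nonnegativity belongs to the notion: the solutions that occur are covariance matrices,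
  so it is available at once and invariance of the cone does not have to be proved. The derivative
  at 0 is one-sided.\<close>

definition sol :: "real^'n^'n => (real => real^'n^'n) => bool" where
 "sol P0 Q \<longleftrightarrow> Q 0 = P0 \<and> (\<forall>t\<ge>0. psd (Q t)) \<and>
  (\<forall>t\<ge>0. (Q has_vector_derivative riccati_field A S R (Q t)) (at t within {0..}))"

abbreviation "clm Q \<equiv> (%s. A - Q s ** S)"

lemma transpose_closed_loop:
 assumes "symmetric_mat X"
 shows "transpose (A - X ** S) = transpose A - S ** X"
 using assms psdS by (simp add: transpose_linear matrix_transpose_mul psd_def symmetric_mat_def)

lemma sol_deriv:
 assumes "sol P0 Q" "s \<in> U" "U \<subseteq> {0..}"
 shows "(Q has_vector_derivative riccati_field A S R (Q s)) (at s within U)"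
 using assms has_vector_derivative_within_subset[of Q _ s "{0..}" U] unfolding sol_def by auto

lemma sol_psd: "sol P0 Q ==> 0 <= t ==> psd (Q t)"
 and sol_sym: "sol P0 Q ==> 0 <= t ==> symmetric_mat (Q t)"
 and sol_0: "sol P0 Q ==> Q 0 = P0"
 by (auto simp: sol_def psd_def)

lemma sol_continuous:
 assumes "sol P0 Q" "U \<subseteq> {0..}"
 shows "continuous_on U Q"
 using sol_deriv[OF assms(1) _ assms(2)]
 by (meson continuous_on_eq_continuous_within has_vector_derivative_continuous)

lemma closed_loop_continuous:
 assumes "sol P0 Q" "U \<subseteq> {0..}"
 shows "continuous_on U (clm Q)"
 by (intro continuous_intros sol_continuous[OF assms])

lemma stationary_flow_bound:
 assumes y: "adjoint_flow (%_. A - P ** S) T u y" and s: "0 <= s" "s <= T"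
 shows "norm (y s) <= exp (\<mu> * (T - s)) * norm u"
proof -
 have "norm (y s) <= exp (\<mu> * (T - s)) * norm (y T)"
  by (rule adjoint_flow_energy_upper[OF y]) (use s stable in auto)
 then show ?thesis using y by (simp add: adjoint_flow_def)
qed

text \<open>The form of Q - P is followed along the flow of the stationary closed loop, the only one
  whose decay is known so far. There its derivative is minus the form of (Q - P) S (Q - P), so it is
  nonincreasing, and the flow run from t back to 0 does not increase the norm.\<close>

lemma quadratic_upper:
 assumes Q: "sol P0 Q" and t: "0 <= t"
 shows "x \<bullet> (Q t *v x) <= (norm P + norm (P0 - P)) * (norm x)\<^sup>2"
proof -
 obtain y where y: "adjoint_flow (%_. A - P ** S) t x y"
  using adjoint_flow_exists[of t "%_. A - P ** S" x] t by auto
 let ?f = "%s. - (y s \<bullet> ((Q s - P) *v y s))"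
 let ?g = "%s. ((Q s - P) *v y s) \<bullet> (S *v ((Q s - P) *v y s))"
 have "?f 0 <= ?f t"
 proof (rule nondecreasing_from_derivative[of 0 t ?f ?g])
  fix s assume s: "s \<in> {0..t}"
  have D: "((%s. Q s - P) has_vector_derivative riccati_field A S R (Q s)) (at s within {0..t})"
   by (rule derivative_eq_intros sol_deriv[OF Q s])+ auto
  have yd: "(y has_vector_derivative - (transpose (A - P ** S) *v y s)) (at s within {0..t})"
   using y s by (auto simp: adjoint_flow_def)
  \<comment> \<open>The stationary equation is subtracted first; the linear terms then cancel
    against those produced by the flow.\<close>
  have id: "riccati_field A S R (Q s) - (A - P ** S) ** (Q s - P) - (Q s - P) ** transpose (A - P ** S)
    = - ((Q s - P) ** S ** (Q s - P))"
  proof -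
   have "riccati_field A S R (Q s) = riccati_field A S R (Q s) - riccati_field A S R P"
    by (simp add: ARE)
   then show ?thesis
    unfolding transpose_closed_loop[OF symP] riccati_field_def
    by (simp add: matrix_mult_linear matrix_mul_assoc algebra_simps)
  qed
  have "symmetric_mat (Q s - P)"
   using sol_sym[OF Q, of s] s symP by (simp add: symmetric_mat_def transpose_linear)
  then have "y s \<bullet> (((Q s - P) ** S ** (Q s - P)) *v y s) = ?g s"
   by (simp add: matrix_vector_mul_assoc[symmetric] inner_matrix_vector_transpose[of "y s" "Q s - P"]
     symmetric_mat_def)
  then show "(?f has_real_derivative ?g s) (at s within {0..t})"
   using DERIV_minus[OF bilinear_form_derivative[OF yd yd D]] unfolding id
   by (simp add: matrix_vector_linear)
  show "0 <= ?g s" using psdS by (simp add: psd_def)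
 qed (rule t)
 then have "x \<bullet> ((Q t - P) *v x) <= y 0 \<bullet> ((P0 - P) *v y 0)"
  using y sol_0[OF Q] by (simp add: adjoint_flow_def)
 also have "\<dots> <= norm (P0 - P) * norm (y 0) * norm (y 0)"
  using inner_matrix_vector_le[of "y 0" "P0 - P" "y 0"] by linarith
 also have "\<dots> <= norm (P0 - P) * (norm x)\<^sup>2"
 proof -
  have "norm (y 0) <= exp (\<mu> * (t - 0)) * norm x" by (rule stationary_flow_bound[OF y]) (use t in auto)
  also have "\<dots> <= 1 * norm x" using mu_neg t by (intro mult_right_mono) (auto simp: mult_le_0_iff)
  finally have "(norm (y 0))\<^sup>2 <= (norm x)\<^sup>2" by (intro power_mono) auto
  then show ?thesis by (simp add: mult.assoc power2_eq_square mult_left_mono)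
 qed
 finally have "x \<bullet> (Q t *v x) <= x \<bullet> (P *v x) + norm (P0 - P) * (norm x)\<^sup>2"
  by (simp add: matrix_vector_linear inner_diff_right)
 moreover have "x \<bullet> (P *v x) <= norm P * (norm x)\<^sup>2"
  using inner_matrix_vector_le[of x P x] by (simp add: power2_eq_square mult.assoc)
 ultimately show ?thesis by (simp add: distrib_right)
qed

text \<open>The constant is chosen before \<open>Q\<close>, so it depends on \<open>P0\<close> but
  not on the solution; this order of quantifiers recurs below. Cauchy-Schwarz for the nonnegative
  \<open>Q t\<close> passes from the quadratic to the bilinear form.\<close>

lemma sol_bounded:
 "\<exists>Lam>0. \<forall>Q t. sol P0 Q --> 0 <= t --> norm (Q t) <= Lam"
proof -
 define l where "l = norm P + norm (P0 - P)"
 have l: "0 <= l" by (simp add: l_def)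
 have "norm (Q t) <= real CARD('n) * (real CARD('n) * l) + 1" if Q: "sol P0 Q" "0 <= t" for Q t
 proof -
  have "norm (Q t) <= real CARD('n) * (real CARD('n) * l)"
  proof (rule norm_matrix_le_inner_bound)
   fix x y :: "real^'n"
   have "(x \<bullet> (Q t *v y))\<^sup>2 <= (x \<bullet> (Q t *v x)) * (y \<bullet> (Q t *v y))"
    by (rule psd_Cauchy_Schwarz[OF sol_psd[OF Q]])
   also have "\<dots> <= (l * (norm x)\<^sup>2) * (l * (norm y)\<^sup>2)"
    using sol_psd[OF Q] quadratic_upper[OF Q] l by (intro mult_mono) (auto simp: l_def psd_def)
   also have "\<dots> = (l * norm x * norm y)\<^sup>2" by (simp add: power2_eq_square algebra_simps)
   finally have "\<bar>x \<bullet> (Q t *v y)\<bar> <= \<bar>l * norm x * norm y\<bar>"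
    by (simp only: abs_le_square_iff)
   then show "\<bar>x \<bullet> (Q t *v y)\<bar> <= l * norm x * norm y"
    using l by (simp only: abs_of_nonneg mult_nonneg_nonneg norm_ge_zero)
  qed
  then show ?thesis by simp
 qed
 moreover have "0 < real CARD('n) * (real CARD('n) * l) + 1" using l by (simp add: add_nonneg_pos)
 ultimately show ?thesis by blast
qed

lemma closed_loop_bounded:
 "\<exists>bet>0. \<forall>Q t. sol P0 Q --> 0 <= t --> norm (A - Q t ** S) <= bet"
proof -
 obtain Lam where L: "0 < Lam" "\<And>Q t. sol P0 Q ==> 0 <= t ==> norm (Q t) <= Lam"
  using sol_bounded by blast
 have "norm (A - Q t ** S) <= norm A + Lam * norm S + 1" if "sol P0 Q" "0 <= t" for Q t
 proof -
  have "norm (A - Q t ** S) <= norm A + norm (Q t ** S)" by (rule norm_triangle_ineq4)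
  also have "norm (Q t ** S) <= norm (Q t) * norm S" by (rule norm_matrix_matrix_mult_le)
  also have "\<dots> <= Lam * norm S" by (intro mult_right_mono L that) auto
  finally show ?thesis by simp
 qed
 moreover have "0 < norm A + Lam * norm S + 1" using L(1) by (simp add: add_nonneg_pos)
 ultimately show ?thesis by blast
qed

text \<open>With B = A - Q S the Riccati equation reads Q' = B Q + Q B^T + R + Q S Q. Along the flow
  of its own closed loop the form of \<open>Q\<close> is therefore a Lyapunov function, growing at
  least at the rate given by the form of \<open>R\<close>.\<close>

lemma flow_form_derivative:
 assumes Q: "sol P0 Q" and y: "adjoint_flow (clm Q) T u y" and s: "s \<in> {a..b}" "0 <= a" "b <= T"
 shows "((%s. y s \<bullet> (Q s *v y s)) has_real_derivative
  y s \<bullet> (R *v y s) + (Q s *v y s) \<bullet> (S *v (Q s *v y s))) (at s within {a..b})"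
proof -
 have D: "(Q has_vector_derivative riccati_field A S R (Q s)) (at s within {a..b})"
  by (rule sol_deriv[OF Q]) (use s in auto)
 have yd: "(y has_vector_derivative - (transpose (A - Q s ** S) *v y s)) (at s within {a..b})"
  using adjoint_flow_subset[OF y] s by auto
 have sym: "symmetric_mat (Q s)" using sol_sym[OF Q, of s] s by auto
 have id: "riccati_field A S R (Q s) - (A - Q s ** S) ** Q s - Q s ** transpose (A - Q s ** S)
   = R + Q s ** S ** Q s"
  unfolding transpose_closed_loop[OF sym] riccati_field_def
  by (simp add: matrix_mult_linear matrix_mul_assoc algebra_simps)
 have "y s \<bullet> ((Q s ** S ** Q s) *v y s) = (Q s *v y s) \<bullet> (S *v (Q s *v y s))"
  using sym by (simp add: matrix_vector_mul_assoc[symmetric]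
    inner_matrix_vector_transpose[of "y s" "Q s"] symmetric_mat_def)
 then show ?thesis
  using bilinear_form_derivative[OF yd yd D] unfolding id
  by (simp add: matrix_vector_linear inner_add_right)
qed

lemma flow_form_mono:
 assumes Q: "sol P0 Q" and y: "adjoint_flow (clm Q) T u y" and ab: "0 <= a" "a <= b" "b <= T"
  and m: "\<And>s. s \<in> {a..b} ==> m <= (norm (y s))\<^sup>2"
 shows "y a \<bullet> (Q a *v y a) + r * m * (b - a) <= y b \<bullet> (Q b *v y b)"
proof -
 let ?f = "%s. y s \<bullet> (Q s *v y s) - r * m * s"
 let ?g = "%s. y s \<bullet> (R *v y s) + (Q s *v y s) \<bullet> (S *v (Q s *v y s)) - r * m"
 have "?f a <= ?f b"
 proof (rule nondecreasing_from_derivative[of a b ?f ?g])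
  fix s assume s: "s \<in> {a..b}"
  show "(?f has_real_derivative ?g s) (at s within {a..b})"
   by (rule derivative_eq_intros flow_form_derivative[OF Q y s])+ (use ab in auto)
  have "r * m <= r * (norm (y s))\<^sup>2" using m[OF s] r_pos by simp
  moreover have "0 <= (Q s *v y s) \<bullet> (S *v (Q s *v y s))" using psdS by (simp add: psd_def)
  ultimately show "0 <= ?g s" using R_ge[of "y s"] by linarith
 qed (rule ab)
 then show ?thesis by (simp add: algebra_simps)
qed

text \<open>\<open>P0\<close> may be singular, so the bound starts at time 1: over the unit interval
  before \<open>t\<close> the matrix \<open>R\<close> contributes at the rate r |y|^2 at least, and
  there \<open>y\<close> cannot be smaller than exp (- bet) |x|.\<close>

lemma sol_lower:
 "\<exists>l>0. \<forall>Q t x. sol P0 Q --> 1 <= t --> l * (norm x)\<^sup>2 <= x \<bullet> (Q t *v x)"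
proof -
 obtain bet where B: "0 < bet" "\<And>Q t. sol P0 Q ==> 0 <= t ==> norm (A - Q t ** S) <= bet"
  using closed_loop_bounded by blast
 have "r * exp (- 2 * bet) * (norm x)\<^sup>2 <= x \<bullet> (Q t *v x)" if Q: "sol P0 Q" and t: "1 <= t" for Q t x
 proof -
  obtain y where y: "adjoint_flow (clm Q) t x y"
   using adjoint_flow_exists[of t "clm Q" x, OF closed_loop_continuous[OF Q]] t by auto
  have yt: "y t = x" using y by (simp add: adjoint_flow_def)
  have m: "exp (- 2 * bet) * (norm x)\<^sup>2 <= (norm (y s))\<^sup>2" if s: "s \<in> {t - 1..t}" for s
  proof -
   have "norm x <= exp (bet * (t - s)) * norm (y s)"
    unfolding yt[symmetric]
    by (rule adjoint_flow_energy_lower[OF y]) (use s t B(2)[OF Q] in auto)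
   also have "\<dots> <= exp bet * norm (y s)"
    using s B(1) by (intro mult_right_mono) auto
   finally have "(norm x)\<^sup>2 <= (exp bet * norm (y s))\<^sup>2" by (intro power_mono) auto
   then have "exp (- 2 * bet) * (norm x)\<^sup>2 <= exp (- 2 * bet) * (exp bet * norm (y s))\<^sup>2"
    by (intro mult_left_mono) auto
   also have "\<dots> = (norm (y s))\<^sup>2"
    by (simp add: power_mult_distrib mult.assoc[symmetric] flip: exp_double exp_add)
   finally show ?thesis .
  qed
  have "0 <= y (t - 1) \<bullet> (Q (t - 1) *v y (t - 1))"
   using sol_psd[OF Q, of "t - 1"] t by (simp add: psd_def)
  then show ?thesis
   using flow_form_mono[OF Q y, of "t - 1" t, OF _ _ _ m] t yt by simp
 qed
 moreover have "0 < r * exp (- 2 * bet)" using r_pos by simp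
 ultimately show ?thesis by blast
qed

text \<open>From time 1 on, the form of \<open>Q\<close> is monotone along the flow and lies between
  \<open>l\<close> and \<open>Lam\<close> times the squared norm, hence the factor
  \<open>sqrt (Lam / l)\<close>. At most one unit of time remains, for which the crude growth
  \<open>exp bet\<close> is enough.\<close>

lemma flow_bounded:
 "\<exists>K>0. \<forall>Q T u y s. sol P0 Q --> adjoint_flow (clm Q) T u y --> 0 <= s --> s <= T -->
  norm (y s) <= K * norm u"
proof -
 obtain bet where B: "0 < bet" "\<And>Q t. sol P0 Q ==> 0 <= t ==> norm (A - Q t ** S) <= bet"
  using closed_loop_bounded by blast
 obtain Lam where L: "0 < Lam" "\<And>Q t. sol P0 Q ==> 0 <= t ==> norm (Q t) <= Lam"
  using sol_bounded by blast
 obtain l where l: "0 < l" "\<And>Q t x. sol P0 Q ==> 1 <= t ==> l * (norm x)\<^sup>2 <= x \<bullet> (Q t *v x)"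
  using sol_lower by blast
 define k where "k = sqrt (Lam / l) + 1"
 have k1: "1 <= k" using L(1) l(1) by (simp add: k_def)
 have "norm (y s) <= exp bet * k * norm u"
  if Q: "sol P0 Q" and y: "adjoint_flow (clm Q) T u y" and s: "0 <= s" "s <= T" for Q T u y s
 proof -
  have yT: "y T = u" using y by (simp add: adjoint_flow_def)
  have late: "norm (y s') <= k * norm u" if s': "1 <= s'" "s' <= T" for s'
  proof -
   have "l * (norm (y s'))\<^sup>2 <= y s' \<bullet> (Q s' *v y s')" by (rule l(2)[OF Q]) (use s' in auto)
   also have "\<dots> <= y T \<bullet> (Q T *v y T)"
    using flow_form_mono[OF Q y, of s' T 0] s' by simp
   also have "\<dots> <= norm (Q T) * norm u * norm u"
    using inner_matrix_vector_le[of u "Q T" u] yT by simp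
   also have "\<dots> <= Lam * norm u * norm u" using L(2)[OF Q, of T] s' by (intro mult_right_mono) auto
   finally have "(norm (y s'))\<^sup>2 <= (Lam / l) * (norm u)\<^sup>2"
    using l(1) by (simp add: field_simps power2_eq_square)
   also have "\<dots> = (sqrt (Lam / l) * norm u)\<^sup>2" using L(1) l(1) by (simp add: power_mult_distrib)
   finally have "norm (y s') <= sqrt (Lam / l) * norm u"
    by (rule power2_le_imp_le) (use L(1) l(1) in auto)
   also have "\<dots> <= k * norm u" by (intro mult_right_mono) (auto simp: k_def)
   finally show ?thesis .
  qed
  have early: "norm (y s) <= exp bet * norm (y b)" if b: "s <= b" "b <= s + 1" "b <= T" for b
  proof -
   have "norm (y s) <= exp (bet * (b - s)) * norm (y b)"
   proof (rule adjoint_flow_energy_upper[OF y])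
    fix r and x :: "real^'n" assume "r \<in> {s..b}"
    then have "norm (A - Q r ** S) * norm x * norm x <= bet * norm x * norm x"
     using B(2)[OF Q, of r] s by (intro mult_right_mono) auto
    then show "x \<bullet> ((A - Q r ** S) *v x) <= bet * (norm x)\<^sup>2"
     using inner_matrix_vector_le[of x "A - Q r ** S" x]
     unfolding power2_eq_square mult.assoc by linarith
   qed (use s b in auto)
   also have "\<dots> <= exp bet * norm (y b)" using b B(1) by (intro mult_right_mono) auto
   finally show ?thesis .
  qed
  show ?thesis
  proof (cases "1 <= T")
   case True
   define b where "b = max s 1"
   have "norm (y s) <= exp bet * norm (y b)" by (rule early) (use s True in \<open>auto simp: b_def\<close>)
   also have "\<dots> <= exp bet * (k * norm u)"
    by (intro mult_left_mono late) (use s True in \<open>auto simp: b_def\<close>)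
   finally show ?thesis by (simp add: mult.assoc)
  next
   case False
   have "norm (y s) <= exp bet * norm (y T)" by (rule early) (use s False in auto)
   also have "\<dots> <= exp bet * (k * norm u)" using k1 yT mult_right_mono[OF k1, of "norm u"] by simp
   finally show ?thesis by (simp add: mult.assoc)
  qed
 qed
 moreover have "0 < exp bet * k" using k1 by simp
 ultimately show ?thesis by blast
qed

lemma bilinear_form_invariant:
 assumes y: "adjoint_flow (%s. A - Q s ** S) T u y" and z: "adjoint_flow (%s. A - Q' s ** S) T v z"
  and Q: "\<And>s. s \<in> {0..T} ==> (Q has_vector_derivative riccati_field A S R (Q s)) (at s within {0..T})"
  and Q': "\<And>s. s \<in> {0..T} ==> (Q' has_vector_derivative riccati_field A S R (Q' s)) (at s within {0..T})"
  and sym: "\<And>s. s \<in> {0..T} ==> symmetric_mat (Q' s)" and T: "0 <= T"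
 shows "u \<bullet> ((Q T - Q' T) *v v) = y 0 \<bullet> ((Q 0 - Q' 0) *v z 0)"
proof -
 let ?f = "%s. y s \<bullet> ((Q s - Q' s) *v z s)"
 have d: "(?f has_real_derivative 0) (at s within {0..T})" if s: "s \<in> {0..T}" for s
 proof -
  have D: "((%s. Q s - Q' s) has_vector_derivative riccati_field A S R (Q s) - riccati_field A S R (Q' s))
    (at s within {0..T})"
   by (rule derivative_eq_intros Q[OF s] Q'[OF s])+ auto
  have yd: "(y has_vector_derivative - (transpose (A - Q s ** S) *v y s)) (at s within {0..T})"
   and zd: "(z has_vector_derivative - (transpose (A - Q' s ** S) *v z s)) (at s within {0..T})"
   using y z s by (auto simp: adjoint_flow_def)
  have "riccati_field A S R (Q s) - riccati_field A S R (Q' s) - (A - Q s ** S) ** (Q s - Q' s)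
    - (Q s - Q' s) ** transpose (A - Q' s ** S) = 0"
   unfolding transpose_closed_loop[OF sym[OF s]] riccati_field_def
   by (simp add: matrix_mult_linear matrix_mul_assoc algebra_simps)
  then show ?thesis
   using bilinear_form_derivative[OF yd zd D] by (simp add: matrix_vector_linear)
 qed
 have "?f 0 <= ?f T" by (rule nondecreasing_from_derivative[OF T d]) auto
 moreover have "- ?f 0 <= - ?f T"
  by (rule nondecreasing_from_derivative[OF T DERIV_minus[OF d]]) auto
 ultimately show ?thesis using y z by (simp add: adjoint_flow_def)
qed

text \<open>First round of a bootstrap: one flow is only known to be bounded, the stationary one
  decays, so a single factor exp (\<mu> t) appears. This makes the perturbation of the closed loop
  integrable in time; \<open>flow_decay\<close> follows, and with two decaying flows
  \<open>sol_difference\<close> reaches the rate 2 \<mu>.\<close>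

lemma sol_converges:
 "\<exists>K>0. \<forall>Q t. sol P0 Q --> 0 <= t --> norm (Q t - P) <= K * exp (\<mu> * t)"
proof -
 obtain K where K: "0 < K" "\<And>Q T u y s. sol P0 Q ==> adjoint_flow (clm Q) T u y ==> 0 <= s ==> s <= T ==>
  norm (y s) <= K * norm u"
  using flow_bounded by blast
 define n where "n = real CARD('n)"
 have n: "0 <= n" by (simp add: n_def)
 have "norm (Q t - P) <= (n * (n * (K * norm (P0 - P))) + 1) * exp (\<mu> * t)"
  if Q: "sol P0 Q" and t: "0 <= t" for Q t
 proof -
  have "norm (Q t - P) <= n * (n * (K * norm (P0 - P) * exp (\<mu> * t)))"
   unfolding n_def
  proof (rule norm_matrix_le_inner_bound)
   fix u v :: "real^'n"
   obtain y where y: "adjoint_flow (clm Q) t u y"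
    using adjoint_flow_exists[of t "clm Q" u, OF closed_loop_continuous[OF Q]] t by auto
   obtain z where z: "adjoint_flow (%_. A - P ** S) t v z"
    using adjoint_flow_exists[of t "%_. A - P ** S" v] t by auto
   have "u \<bullet> ((Q t - P) *v v) = y 0 \<bullet> ((Q 0 - P) *v z 0)"
    by (rule bilinear_form_invariant[where Q' = "%_. P", OF y z])
     (use sol_deriv[OF Q] t symP in \<open>auto simp: ARE\<close>)
   also have "\<bar>\<dots>\<bar> <= norm (P0 - P) * norm (y 0) * norm (z 0)"
    using inner_matrix_vector_le sol_0[OF Q] by simp
   also have "\<dots> <= norm (P0 - P) * (K * norm u) * (exp (\<mu> * (t - 0)) * norm v)"
    using K(1) by (intro mult_mono mult_nonneg_nonneg K(2)[OF Q y] stationary_flow_bound[OF z] t) auto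
   finally show "\<bar>u \<bullet> ((Q t - P) *v v)\<bar> <= K * norm (P0 - P) * exp (\<mu> * t) * norm u * norm v"
    by (simp add: ac_simps)
  qed
  also have "\<dots> <= (n * (n * (K * norm (P0 - P))) + 1) * exp (\<mu> * t)"
   by (simp add: algebra_simps)
  finally show ?thesis .
 qed
 moreover have "0 < n * (n * (K * norm (P0 - P))) + 1" using n K(1) by (simp add: add_nonneg_pos)
 ultimately show ?thesis by blast
qed

text \<open>Exponent for \<open>adjoint_flow_energy\<close>: an antiderivative of the rate \<mu> + k
  exp (\<mu> s) supplied by \<open>closed_loop_form_bound\<close>. On the positive half-line it
  differs from \<mu> s by a bounded amount.\<close>

definition gain_rate :: "real => real => real" where
 "gain_rate k = (%s. \<mu> * s + k / \<mu> * exp (\<mu> * s))"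

lemma gain_rate_deriv:
 "(gain_rate k has_real_derivative \<mu> + k * exp (\<mu> * s)) (at s within U)"
 unfolding gain_rate_def
 by (rule derivative_eq_intros refl)+ (use mu_neg in auto)

lemma closed_loop_form_bound:
 fixes x :: "real^'n"
 assumes "norm (X - P) <= K * exp (\<mu> * s)"
 shows "x \<bullet> ((A - X ** S) *v x) <= (\<mu> + K * norm S * exp (\<mu> * s)) * (norm x)\<^sup>2"
proof -
 have "norm ((X - P) ** S) * norm x * norm x <= (norm (X - P) * norm S) * norm x * norm x"
  by (intro mult_right_mono norm_matrix_matrix_mult_le) auto
 also have "\<dots> <= (K * exp (\<mu> * s) * norm S) * norm x * norm x"
  by (intro mult_right_mono assms) auto
 finally have "norm ((X - P) ** S) * norm x * norm x <= K * norm S * exp (\<mu> * s) * (norm x)\<^sup>2"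
  by (simp add: power2_eq_square ac_simps)
 then have "- (x \<bullet> (((X - P) ** S) *v x)) <= K * norm S * exp (\<mu> * s) * (norm x)\<^sup>2"
  using inner_matrix_vector_le[of x "(X - P) ** S" x] by linarith
 moreover have "x \<bullet> ((A - X ** S) *v x) = x \<bullet> ((A - P ** S) *v x) - x \<bullet> (((X - P) ** S) *v x)"
  by (simp add: matrix_mult_linear matrix_vector_linear inner_diff_right)
 ultimately show ?thesis
  using stable[of x] unfolding distrib_right by linarith
qed

lemma flow_decay:
 "\<exists>K>0. \<forall>Q T u y s. sol P0 Q --> adjoint_flow (clm Q) T u y --> 0 <= s --> s <= T -->
  norm (y s) <= K * exp (\<mu> * (T - s)) * norm u"
proof -
 obtain K where K: "0 < K" "\<And>Q t. sol P0 Q ==> 0 <= t ==> norm (Q t - P) <= K * exp (\<mu> * t)"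
  using sol_converges by blast
 define k where "k = K * norm S"
 have k: "0 <= k" using K(1) by (simp add: k_def)
 have "norm (y s) <= exp (- k / \<mu>) * exp (\<mu> * (T - s)) * norm u"
  if Q: "sol P0 Q" and y: "adjoint_flow (clm Q) T u y" and s: "0 <= s" "s <= T" for Q T u y s
 proof -
  have "(norm (y s))\<^sup>2 * exp (2 * gain_rate k s) <= (norm (y T))\<^sup>2 * exp (2 * gain_rate k T)"
  proof (rule adjoint_flow_energy[OF y _ _ _ _ gain_rate_deriv])
   fix s' x assume "s' \<in> {s..T}"
   then show "x \<bullet> ((A - Q s' ** S) *v x) <= (\<mu> + k * exp (\<mu> * s')) * (norm x)\<^sup>2"
    using s unfolding k_def by (intro closed_loop_form_bound K(2)[OF Q]) auto
  qed (use s in auto)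
  then have "(norm (y s))\<^sup>2 * exp (2 * gain_rate k s) * exp (- 2 * gain_rate k s)
    <= (norm u)\<^sup>2 * exp (2 * gain_rate k T) * exp (- 2 * gain_rate k s)"
   using y by (intro mult_right_mono) (auto simp: adjoint_flow_def)
  then have "(norm (y s))\<^sup>2 <= (exp (gain_rate k T - gain_rate k s) * norm u)\<^sup>2"
   by (simp add: mult.assoc power_mult_distrib algebra_simps flip: exp_add exp_double)
  then have "norm (y s) <= exp (gain_rate k T - gain_rate k s) * norm u"
   by (rule power2_le_imp_le) simp
  \<comment> \<open>- k / \<mu> is the integral of k exp (\<mu> s) over the whole half-line, the
    total price of the perturbation.\<close>
  also have "\<dots> <= exp (- k / \<mu> + \<mu> * (T - s)) * norm u"
  proof -
   have "k / \<mu> * exp (\<mu> * T) <= 0"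
    using k mu_neg by (intro mult_nonpos_nonneg) (auto simp: divide_nonneg_neg)
   moreover have "- (k / \<mu>) * exp (\<mu> * s) <= - (k / \<mu>) * 1"
    using k mu_neg s by (intro mult_left_mono) (auto simp: divide_nonneg_neg mult_nonpos_nonneg)
   ultimately have "gain_rate k T - gain_rate k s <= - k / \<mu> + \<mu> * (T - s)"
    by (simp add: gain_rate_def algebra_simps)
   then show ?thesis by (intro mult_right_mono) auto
  qed
  finally show ?thesis by (simp only: exp_add)
 qed
 moreover have "0 < exp (- k / \<mu>)" by simp
 ultimately show ?thesis by blast
qed

lemma sol_difference:
 "\<exists>K>0. \<forall>Q Q' t. sol P0 Q --> sol P0' Q' --> 0 <= t -->
  norm (Q t - Q' t) <= K * exp (2 * \<mu> * t) * norm (P0 - P0')"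
proof -
 obtain K where K: "0 < K" "\<And>Q T u y s. sol P0 Q ==> adjoint_flow (clm Q) T u y ==> 0 <= s ==> s <= T ==>
  norm (y s) <= K * exp (\<mu> * (T - s)) * norm u"
  using flow_decay by blast
 obtain K' where K': "0 < K'" "\<And>Q T u y s. sol P0' Q ==> adjoint_flow (clm Q) T u y ==> 0 <= s ==> s <= T ==>
  norm (y s) <= K' * exp (\<mu> * (T - s)) * norm u"
  using flow_decay by blast
 define n where "n = real CARD('n)"
 have n: "0 < n" by (simp add: n_def)
 have "norm (Q t - Q' t) <= (n * (n * (K * K'))) * exp (2 * \<mu> * t) * norm (P0 - P0')"
  if Q: "sol P0 Q" and Q': "sol P0' Q'" and t: "0 <= t" for Q Q' t
 proof -
  have "norm (Q t - Q' t) <= n * (n * (K * K' * exp (2 * \<mu> * t) * norm (P0 - P0')))"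
   unfolding n_def
  proof (rule norm_matrix_le_inner_bound)
   fix u v :: "real^'n"
   obtain y where y: "adjoint_flow (clm Q) t u y"
    using adjoint_flow_exists[of t "clm Q" u, OF closed_loop_continuous[OF Q]] t by auto
   obtain z where z: "adjoint_flow (clm Q') t v z"
    using adjoint_flow_exists[of t "clm Q'" v, OF closed_loop_continuous[OF Q']] t by auto
   have "u \<bullet> ((Q t - Q' t) *v v) = y 0 \<bullet> ((Q 0 - Q' 0) *v z 0)"
    by (rule bilinear_form_invariant[OF y z])
     (use sol_deriv[OF Q] sol_deriv[OF Q'] sol_sym[OF Q'] t in auto)
   also have "\<bar>\<dots>\<bar> <= norm (P0 - P0') * norm (y 0) * norm (z 0)"
    using inner_matrix_vector_le sol_0[OF Q] sol_0[OF Q'] by simp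
   also have "\<dots> <= norm (P0 - P0') * (K * exp (\<mu> * (t - 0)) * norm u) * (K' * exp (\<mu> * (t - 0)) * norm v)"
    using K(1) K'(1) by (intro mult_mono mult_nonneg_nonneg K(2)[OF Q y] K'(2)[OF Q' z] t) auto
   also have "\<dots> = K * K' * exp (2 * \<mu> * t) * norm (P0 - P0') * norm u * norm v"
    by (simp add: mult_exp_exp ac_simps flip: exp_double)
   finally show "\<bar>u \<bullet> ((Q t - Q' t) *v v)\<bar> <= K * K' * exp (2 * \<mu> * t) * norm (P0 - P0') * norm u * norm v" .
  qed
  then show ?thesis by (simp add: ac_simps)
 qed
 moreover have "0 < n * (n * (K * K'))" using n K(1) K'(1) by simp
 ultimately show ?thesis by blast
qed

end

context riccati_stable
begin

text \<open>The difference \<open>z\<close> of the flows vanishes at \<open>T\<close> and satisfies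
  the equation of the first flow with source w = S (Q - Q') y'. The covariance difference decays
  like exp (2 \<mu> s) and y' is of order exp (\<mu> (T - s)), so \<open>w\<close> is of order exp
  (\<mu> T) exp (\<mu> s). This is integrable in s, which is why no factor \<open>T\<close> is
  lost.\<close>

lemma flow_difference:
 "\<exists>K>0. \<forall>Q Q' T u y y' s. sol P0 Q --> sol P0' Q' --> adjoint_flow (clm Q) T u y -->
  adjoint_flow (clm Q') T u y' --> 0 <= s --> s <= T -->
  norm (y s - y' s) <= K * exp (\<mu> * T) * norm (P0 - P0') * norm u"
proof -
 obtain K where K: "0 < K" "\<And>Q t. sol P0 Q ==> 0 <= t ==> norm (Q t - P) <= K * exp (\<mu> * t)"
  using sol_converges by blast
 obtain L where L: "0 < L" "\<And>Q Q' t. sol P0 Q ==> sol P0' Q' ==> 0 <= t ==>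
  norm (Q t - Q' t) <= L * exp (2 * \<mu> * t) * norm (P0 - P0')"
  using sol_difference by blast
 obtain M where M: "0 < M" "\<And>Q T u y s. sol P0' Q ==> adjoint_flow (clm Q) T u y ==> 0 <= s ==> s <= T ==>
  norm (y s) <= M * exp (\<mu> * (T - s)) * norm u"
  using flow_decay by blast
 define k where "k = K * norm S"
 have k: "0 <= k" using K(1) by (simp add: k_def)
 define c where "c = norm S * L * M * exp (- k / \<mu>) / (- \<mu>)"
 have c: "0 <= c" unfolding c_def using L M mu_neg by (intro divide_nonneg_pos mult_nonneg_nonneg) auto
 have "norm (y s - y' s) <= (c + 1) * exp (\<mu> * T) * norm (P0 - P0') * norm u"
  if Q: "sol P0 Q" and Q': "sol P0' Q'" and y: "adjoint_flow (clm Q) T u y"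
   and y': "adjoint_flow (clm Q') T u y'" and s: "0 <= s" "s <= T" for Q Q' T u y y' s
 proof -
  define z where "z s = y s - y' s" for s
  define w where "w s = S *v ((Q s - Q' s) *v y' s)" for s
  define G where "G = norm S * L * M * norm (P0 - P0') * norm u"
  \<comment> \<open>The weight spends only half of the decay: the full rate would be 2 \<mu> + 2 k
    exp (\<mu> s), here it is \<mu> + 2 k exp (\<mu> s). The spare term - \<mu> |z|^2 absorbs the
    cross term with \<open>w\<close>.\<close>
  define e where "e s = exp (gain_rate (2 * k) s)" for s
  define b where "b = G\<^sup>2 * exp (2 * \<mu> * T) / (- \<mu>)"
  have G: "0 <= G" using L M by (simp add: G_def)
  have b: "0 <= b" using mu_neg by (simp add: b_def divide_nonneg_neg)
  have wb: "norm (w s) <= G * exp (\<mu> * T) * exp (\<mu> * s)" if s: "0 <= s" "s <= T" for s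
  proof -
   have "norm (w s) <= norm S * (norm (Q s - Q' s) * norm (y' s))"
    unfolding w_def by (intro norm_matrix_vector_mult_le[THEN order_trans] mult_left_mono norm_matrix_vector_mult_le) auto
   also have "\<dots> <= norm S * ((L * exp (2 * \<mu> * s) * norm (P0 - P0')) * (M * exp (\<mu> * (T - s)) * norm u))"
    using L(1) by (intro mult_left_mono mult_mono L(2)[OF Q Q'] M(2)[OF Q' y'] s) auto
   also have "\<dots> = G * (exp (2 * \<mu> * s) * exp (\<mu> * (T - s)))" by (simp add: G_def)
   also have "exp (2 * \<mu> * s) * exp (\<mu> * (T - s)) = exp (\<mu> * T) * exp (\<mu> * s)"
    by (simp add: algebra_simps flip: exp_add)
   finally show ?thesis by simp
  qed
  \<comment> \<open>The second summand is an antiderivative of b exp (3 \<mu> s), which dominates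
    |w|^2 / (- \<mu>) times the weight; adding it makes \<open>?f\<close> nondecreasing.\<close>
  let ?f = "%s. (norm (z s))\<^sup>2 * e s + b * (exp (3 * \<mu> * s) / (3 * \<mu>))"
  let ?h = "%s. 2 * (z s \<bullet> (w s - transpose (A - Q s ** S) *v z s)) * e s
    + (norm (z s))\<^sup>2 * ((\<mu> + 2 * k * exp (\<mu> * s)) * e s) + b * exp (3 * \<mu> * s)"
  have "?f s <= ?f T"
  proof (rule nondecreasing_from_derivative[of s T ?f ?h])
   fix x assume x: "x \<in> {s..T}"
   then have x0: "0 <= x" "x <= T" using s by auto
   have yd: "(y has_vector_derivative - (transpose (A - Q x ** S) *v y x)) (at x within {s..T})"
    and yd': "(y' has_vector_derivative - (transpose (A - Q' x ** S) *v y' x)) (at x within {s..T})"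
    using adjoint_flow_subset[OF y _ x] adjoint_flow_subset[OF y' _ x] s by auto
   have eq: "- (transpose (A - Q x ** S) *v y x) - - (transpose (A - Q' x ** S) *v y' x)
     = w x - transpose (A - Q x ** S) *v z x"
    unfolding transpose_closed_loop[OF sol_sym[OF Q x0(1)]] transpose_closed_loop[OF sol_sym[OF Q' x0(1)]]
    by (simp add: w_def z_def matrix_vector_linear matrix_mult_linear matrix_vector_mul_assoc algebra_simps)
   have zd: "(z has_vector_derivative w x - transpose (A - Q x ** S) *v z x) (at x within {s..T})"
    using has_vector_derivative_diff[OF yd yd'] unfolding eq z_def .
   have ed: "(e has_real_derivative e x * (\<mu> + 2 * k * exp (\<mu> * x))) (at x within {s..T})"
    unfolding e_def by (rule DERIV_chain2[OF DERIV_exp gain_rate_deriv])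
   show "(?f has_real_derivative ?h x) (at x within {s..T})"
    by (rule DERIV_cong[OF DERIV_add[OF DERIV_mult[OF norm_sq_derivative[OF zd] ed]
       DERIV_cmult[OF DERIV_cdivide[OF DERIV_chain2[OF DERIV_exp DERIV_cmult[OF DERIV_ident]]]]]])
     (use mu_neg in \<open>simp add: algebra_simps\<close>)
   have "z x \<bullet> (transpose (A - Q x ** S) *v z x) = z x \<bullet> ((A - Q x ** S) *v z x)"
    using inner_matrix_vector_transpose[of "z x" "A - Q x ** S" "z x"] by (simp add: inner_commute)
   also have "\<dots> <= (\<mu> + k * exp (\<mu> * x)) * (norm (z x))\<^sup>2"
    unfolding k_def by (rule closed_loop_form_bound[OF K(2)[OF Q x0(1)]])
   finally have 1: "z x \<bullet> (transpose (A - Q x ** S) *v z x) <= (\<mu> + k * exp (\<mu> * x)) * (norm (z x))\<^sup>2" .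
   have 2: "2 * \<bar>z x \<bullet> w x\<bar> <= - \<mu> * (norm (z x))\<^sup>2 + (norm (w x))\<^sup>2 / (- \<mu>)"
   proof -
    have "0 <= (- \<mu> * norm (z x) - norm (w x))\<^sup>2" by simp
    then have "2 * (norm (z x) * norm (w x)) * (- \<mu>) <= (- \<mu> * (norm (z x))\<^sup>2 + (norm (w x))\<^sup>2 / (- \<mu>)) * (- \<mu>)"
     using mu_neg by (simp add: power2_eq_square algebra_simps)
    then have "2 * (norm (z x) * norm (w x)) <= - \<mu> * (norm (z x))\<^sup>2 + (norm (w x))\<^sup>2 / (- \<mu>)"
     using mu_neg by (simp only: mult_le_cancel_right)
    then show ?thesis using Cauchy_Schwarz_ineq2[of "z x" "w x"] by linarith
   qed
   have 3: "(norm (w x))\<^sup>2 / (- \<mu>) * e x <= b * exp (3 * \<mu> * x)"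
   proof -
    have "(norm (w x))\<^sup>2 <= (G * exp (\<mu> * T) * exp (\<mu> * x))\<^sup>2" by (intro power_mono wb x0) auto
    also have "\<dots> = G\<^sup>2 * exp (2 * \<mu> * T) * exp (2 * \<mu> * x)"
     by (simp add: power_mult_distrib mult.assoc flip: exp_double)
    finally have "(norm (w x))\<^sup>2 / (- \<mu>) <= b * exp (2 * \<mu> * x)"
     using mu_neg by (simp add: b_def field_simps)
    moreover have "e x <= exp (\<mu> * x)"
     using k mu_neg by (simp add: e_def gain_rate_def mult_nonpos_nonneg divide_nonneg_neg)
    ultimately have "(norm (w x))\<^sup>2 / (- \<mu>) * e x <= (b * exp (2 * \<mu> * x)) * exp (\<mu> * x)"
     using b by (intro mult_mono) (auto simp: e_def)
    also have "\<dots> = b * exp (3 * \<mu> * x)" by (simp add: mult.assoc flip: exp_add)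
    finally show ?thesis .
   qed
   have "0 <= (2 * (z x \<bullet> w x) - 2 * (z x \<bullet> (transpose (A - Q x ** S) *v z x))
     + (norm (z x))\<^sup>2 * (\<mu> + 2 * k * exp (\<mu> * x)) + (norm (w x))\<^sup>2 / (- \<mu>)) * e x"
   proof (intro mult_nonneg_nonneg)
    show "0 <= 2 * (z x \<bullet> w x) - 2 * (z x \<bullet> (transpose (A - Q x ** S) *v z x))
     + (norm (z x))\<^sup>2 * (\<mu> + 2 * k * exp (\<mu> * x)) + (norm (w x))\<^sup>2 / (- \<mu>)"
     using 1 2 by (simp add: algebra_simps abs_if split: if_splits)
   qed (simp add: e_def)
   then show "0 <= ?h x" using 3 by (simp add: algebra_simps inner_diff_right)
  qed (rule s)
  moreover have "z T = 0" using y y' by (simp add: z_def adjoint_flow_def)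
  moreover have "b * (exp (3 * \<mu> * T) / (3 * \<mu>)) <= 0"
   using b mu_neg by (intro mult_nonneg_nonpos) (auto simp: divide_nonneg_neg)
  ultimately have "(norm (z s))\<^sup>2 * e s <= b * (exp (3 * \<mu> * s) / (- 3 * \<mu>))" by simp
  also have "\<dots> <= b * (exp (\<mu> * s) / (- \<mu>))"
  proof (intro mult_left_mono b)
   have "3 * \<mu> * s <= \<mu> * s" using mu_neg s by (simp add: mult_nonpos_nonneg)
   then have "exp (3 * \<mu> * s) <= exp (\<mu> * s)" by simp
   then show "exp (3 * \<mu> * s) / (- 3 * \<mu>) <= exp (\<mu> * s) / (- \<mu>)"
    using mu_neg by (intro frac_le) auto
  qed
  finally have 4: "(norm (z s))\<^sup>2 * e s <= b * (exp (\<mu> * s) / (- \<mu>))" .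
  have "exp (\<mu> * s) * exp (2 * k / \<mu>) <= e s"
  proof -
   have "2 * k / \<mu> * 1 <= 2 * k / \<mu> * exp (\<mu> * s)"
    using k mu_neg s by (intro mult_left_mono_neg) (auto simp: divide_nonneg_neg mult_nonpos_nonneg)
   then show ?thesis by (simp add: e_def gain_rate_def flip: exp_add)
  qed
  then have "(norm (z s))\<^sup>2 * (exp (\<mu> * s) * exp (2 * k / \<mu>)) <= (norm (z s))\<^sup>2 * e s"
   by (intro mult_left_mono) auto
  also note 4
  finally have "exp (\<mu> * s) * ((norm (z s))\<^sup>2 * exp (2 * k / \<mu>)) <= exp (\<mu> * s) * (b / (- \<mu>))"
   by (simp add: ac_simps)
  then have "(norm (z s))\<^sup>2 * exp (2 * k / \<mu>) <= b / (- \<mu>)" by (simp only: mult_le_cancel_left_pos exp_gt_zero)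
  then have "(norm (z s))\<^sup>2 * exp (2 * k / \<mu>) * exp (- 2 * k / \<mu>) <= b / (- \<mu>) * exp (- 2 * k / \<mu>)"
   by (intro mult_right_mono) auto
  then have "(norm (z s))\<^sup>2 <= b / (- \<mu>) * exp (- 2 * k / \<mu>)"
   by (simp add: mult.assoc flip: exp_add)
  also have "\<dots> = (G * exp (\<mu> * T) * exp (- k / \<mu>) / (- \<mu>))\<^sup>2"
  proof -
   have "exp (- 2 * k / \<mu>) = (exp (- k / \<mu>))\<^sup>2" "exp (2 * \<mu> * T) = (exp (\<mu> * T))\<^sup>2"
    by (simp_all flip: exp_double)
   then show ?thesis using mu_neg
    by (simp only: b_def) (simp add: power2_eq_square)
  qed
  finally have "norm (z s) <= G * exp (\<mu> * T) * exp (- k / \<mu>) / (- \<mu>)"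
   by (rule power2_le_imp_le) (use G mu_neg in \<open>auto intro!: divide_nonneg_pos simp: divide_nonneg_neg mult_nonneg_nonneg\<close>)
  also have "\<dots> = c * exp (\<mu> * T) * norm (P0 - P0') * norm u"
   by (simp add: G_def c_def)
  also have "\<dots> <= (c + 1) * exp (\<mu> * T) * norm (P0 - P0') * norm u"
   by (intro mult_right_mono) auto
  finally show ?thesis unfolding z_def .
 qed
 moreover have "0 < c + 1" using c by simp
 ultimately show ?thesis by blast
qed

lemma sol_unique:
 assumes "sol P0 Q" "sol P0 Q'" "0 <= t"
 shows "Q t = Q' t"
 using sol_difference[of P0 P0] assms by fastforce

end

lemma matrix_inv_mult:
 fixes N :: "real^'n^'n"
 assumes "invertible N"
 shows "matrix_inv N ** N = mat 1" "N ** matrix_inv N = mat 1"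
 using someI_ex[OF assms[unfolded invertible_def]] by (simp_all add: matrix_inv_def)

lemma invertible_lower_bound:
 fixes N :: "real^'n^'n"
 assumes "invertible N"
 shows "\<exists>r>0. \<forall>x. r * (norm x)\<^sup>2 <= (norm (N *v x))\<^sup>2"
proof -
 define J where "J = matrix_inv N"
 have J: "J ** N = mat 1" using matrix_inv_mult(1)[OF assms] by (simp add: J_def)
 define k where "k = norm J + 1"
 have k: "0 < k" by (simp add: k_def add_nonneg_pos)
 have "(1 / k\<^sup>2) * (norm x)\<^sup>2 <= (norm (N *v x))\<^sup>2" for x
 proof -
  have "norm x = norm (J *v (N *v x))" by (simp add: matrix_vector_mul_assoc J)
  also have "\<dots> <= norm J * norm (N *v x)" by (rule norm_matrix_vector_mult_le)
  also have "\<dots> <= k * norm (N *v x)" by (intro mult_right_mono) (auto simp: k_def)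
  finally have "(norm x)\<^sup>2 <= (k * norm (N *v x))\<^sup>2" by (intro power_mono) auto
  then show ?thesis using k by (simp add: power_mult_distrib field_simps)
 qed
 moreover have "0 < 1 / k\<^sup>2" using k by simp
 ultimately show ?thesis by blast
qed

lemma symmetric_matrix_inv:
 fixes N :: "real^'n^'n"
 assumes "symmetric_mat N" "invertible N"
 shows "symmetric_mat (matrix_inv N)" "matrix_inv (N ** N) = matrix_inv N ** matrix_inv N"
proof -
 define J where "J = matrix_inv N"
 have J: "J ** N = mat 1" "N ** J = mat 1"
  using matrix_inv_mult[OF assms(2)] by (simp_all add: J_def)
 have "transpose J ** N = mat 1"
  using assms(1) J(2) by (metis matrix_transpose_mul symmetric_mat_def transpose_mat)
 then have "transpose J = J" using J(2) by (metis matrix_mul_assoc matrix_mul_lid matrix_mul_rid)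
 then show "symmetric_mat (matrix_inv N)" by (simp add: J_def symmetric_mat_def)
 have l: "(J ** J) ** (N ** N) = mat 1" using J by (metis matrix_mul_assoc matrix_mul_rid)
 have r: "(N ** N) ** (J ** J) = mat 1" using J by (metis matrix_mul_assoc matrix_mul_rid)
 have "invertible (N ** N)" using l r unfolding invertible_def by blast
 then have "matrix_inv (N ** N) ** (N ** N) = mat 1" by (rule matrix_inv_mult)
 then have "matrix_inv (N ** N) = J ** J" using r by (metis matrix_mul_assoc matrix_mul_lid matrix_mul_rid)
 then show "matrix_inv (N ** N) = matrix_inv N ** matrix_inv N" by (simp add: J_def)
qed

lemma riccati_stable_filter:
 fixes A R1h S P :: "real^'n^'n" and C :: "real^'n^'m" and R2h :: "real^'m^'m"
 assumes R1: "symmetric_mat R1h" "invertible R1h" and R2: "symmetric_mat R2h" "invertible R2h"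
  and S: "S = transpose C ** matrix_inv (R2h ** R2h) ** C"
  and P: "positive_definite P"
  and ARE: "A ** P + P ** transpose A - P ** S ** P + R1h ** R1h = 0"
  and mu: "log_norm (A - P ** S) < 0"
 shows "\<exists>r. riccati_stable A S (R1h ** R1h) P (log_norm (A - P ** S)) r"
proof -
 obtain r where r: "0 < r" "\<And>x. r * (norm x)\<^sup>2 <= (norm (R1h *v x))\<^sup>2"
  using invertible_lower_bound[OF R1(2)] by blast
 define J where "J = matrix_inv R2h"
 have J: "transpose J = J" "matrix_inv (R2h ** R2h) = J ** J"
  using symmetric_matrix_inv[OF R2] by (simp_all add: J_def symmetric_mat_def)
 have SJ: "S = transpose (J ** C) ** (J ** C)"
  by (simp add: S J matrix_transpose_mul matrix_mul_assoc)
 have "riccati_stable A S (R1h ** R1h) P (log_norm (A - P ** S)) r"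
 proof
  have "symmetric_mat S" unfolding SJ by (simp add: symmetric_mat_def matrix_transpose_mul)
  moreover have "x \<bullet> (S *v x) = (norm ((J ** C) *v x))\<^sup>2" for x
   unfolding SJ by (simp add: matrix_vector_mul_assoc[symmetric] inner_matrix_vector_transpose power2_norm_eq_inner)
  ultimately show "psd S" by (simp add: psd_def)
  show "r * (norm x)\<^sup>2 <= x \<bullet> ((R1h ** R1h) *v x)" for x
   using r(2)[of x] R1(1)
   by (simp add: matrix_vector_mul_assoc[symmetric] inner_matrix_vector_transpose[of x R1h]
     symmetric_mat_def power2_norm_eq_inner)
 qed (use P ARE mu r log_norm_bound in \<open>auto simp: positive_definite_def riccati_field_def\<close>)
 then show ?thesis by blast
qed

section \<open>Gaussian laws and relative entropy\<close>

lemma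
 fixes f :: "'e::euclidean_space => 'b::{banach, second_countable_topology}"
 assumes c: "c ~= 0" and f: "integrable lborel f"
 shows lborel_integrable_affine_vec: "integrable lborel (%x. f (t + c *\<^sub>R x))"
  and lborel_integral_affine_vec: "(\<integral>x. f x \<partial>lborel) = \<bar>c\<bar>^DIM('e) *\<^sub>R (\<integral>x. f (t + c *\<^sub>R x) \<partial>lborel)"
proof -
 have eq: "lborel = density (distr lborel borel (%x. t + c *\<^sub>R x)) (%_. ennreal (\<bar>c\<bar>^DIM('e)))"
  using lborel_affine[OF c, of t] by (simp add: ennreal_power)
 have fm [measurable]: "f \<in> borel_measurable borel" using borel_measurable_integrable[OF f] by simp
 have "integrable (density (distr lborel borel (%x. t + c *\<^sub>R x)) (%_. ennreal (\<bar>c\<bar>^DIM('e)))) f"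
  using f eq by simp
 then have "integrable (distr lborel borel (%x. t + c *\<^sub>R x)) (%x. \<bar>c\<bar>^DIM('e) *\<^sub>R f x)"
  using integrable_density[of f "distr lborel borel (%x. t + c *\<^sub>R x)" "%_. \<bar>c\<bar>^DIM('e)"] by simp
 then have "integrable lborel (%x. \<bar>c\<bar>^DIM('e) *\<^sub>R f (t + c *\<^sub>R x))"
  using integrable_distr_eq[of "%x. t + c *\<^sub>R x" lborel borel "%x. \<bar>c\<bar>^DIM('e) *\<^sub>R f x"] by simp
 then have "integrable lborel (%x. inverse (\<bar>c\<bar>^DIM('e)) *\<^sub>R (\<bar>c\<bar>^DIM('e) *\<^sub>R f (t + c *\<^sub>R x)))"
  by (rule integrable_scaleR_right)
 then show "integrable lborel (%x. f (t + c *\<^sub>R x))"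
  using c by simp
 show "(\<integral>x. f x \<partial>lborel) = \<bar>c\<bar>^DIM('e) *\<^sub>R (\<integral>x. f (t + c *\<^sub>R x) \<partial>lborel)"
  by (subst eq) (simp add: integral_density integral_distr)
qed

lemma
 fixes f :: "'e::euclidean_space => 'b::{banach, second_countable_topology}"
 assumes "integrable lborel f"
 shows lborel_integrable_translate: "integrable lborel (%x. f (x - z))"
  and lborel_integral_translate: "(\<integral>x. f (x - z) \<partial>lborel) = (\<integral>x. f x \<partial>lborel)"
 using lborel_integrable_affine_vec[OF _ assms, of 1 "- z"]
  lborel_integral_affine_vec[OF _ assms, of 1 "- z"] by simp_all

lemma
 fixes f :: "'e::euclidean_space => real => 'b::{real_normed_field, banach, second_countable_topology}"
 assumes f: "\<And>b. b \<in> Basis ==> integrable lborel (f b)"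
 shows lborel_integrable_prod: "integrable lborel (%x. \<Prod>b\<in>Basis. f b (x \<bullet> b))"
  and lborel_integral_prod: "(\<integral>x. (\<Prod>b\<in>Basis. f b (x \<bullet> b)) \<partial>lborel) = (\<Prod>b\<in>Basis. \<integral>x. f b x \<partial>lborel)"
proof -
 interpret product_sigma_finite "%_. lborel :: real measure" by standard
 let ?T = "%f. \<Sum>b\<in>Basis. f b *\<^sub>R (b :: 'e)"
 let ?P = "\<Pi>\<^sub>M b\<in>(Basis :: 'e set). (lborel :: real measure)"
 have eq: "(lborel :: 'e measure) = distr ?P borel ?T"
  unfolding lborel_eq_real by (rule lborel_def)
 have m [measurable]: "?T \<in> measurable ?P borel" by measurable
 have fm [measurable]: "f b \<in> borel_measurable borel" if "b \<in> Basis" for b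
  using borel_measurable_integrable[OF f[OF that]] by simp
 have gm: "(%x. \<Prod>b\<in>Basis. f b (x \<bullet> b)) \<in> borel_measurable borel"
  by (intro borel_measurable_prod measurable_compose[OF _ fm]) auto
 have T: "(\<Prod>b\<in>Basis. f b (?T g \<bullet> b)) = (\<Prod>b\<in>Basis. f b (g b))" for g
  by (intro prod.cong refl) simp
 show "integrable lborel (%x. \<Prod>b\<in>Basis. f b (x \<bullet> b))"
  unfolding eq by (subst integrable_distr_eq[OF m gm]) (simp only: T product_integrable_prod f finite_Basis)
 show "(\<integral>x. (\<Prod>b\<in>Basis. f b (x \<bullet> b)) \<partial>lborel) = (\<Prod>b\<in>Basis. \<integral>x. f b x \<partial>lborel)"
  unfolding eq by (subst integral_distr[OF m gm]) (simp only: T product_integral_prod f finite_Basis)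
qed

lemma char_normal_density:
 assumes "0 < sig"
 shows "(CLINT x|lborel. normal_density m sig x *\<^sub>R iexp (s * x)) = iexp (s * m) * exp (- sig\<^sup>2 * s\<^sup>2 / 2)"
proof -
 have "(CLINT x|lborel. normal_density m sig x *\<^sub>R iexp (s * x))
   = \<bar>sig\<bar> *\<^sub>R (CLINT x|lborel. normal_density m sig (m + sig * x) *\<^sub>R iexp (s * (m + sig * x)))"
  using assms by (intro lborel_integral_real_affine) auto
 also have "\<dots> = (CLINT x|lborel. iexp (s * m) * (std_normal_density x *\<^sub>R iexp ((s * sig) * x)))"
 proof -
  have "sig * normal_density m sig (m + sig * x) = std_normal_density x" for x
   using assms by (simp add: normal_density_def real_sqrt_mult power_mult_distrib)
  note e = this
  have "iexp (s * (m + sig * x)) = iexp (s * m) * iexp ((s * sig) * x)" for x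
   by (simp add: algebra_simps flip: exp_add)
  then have "\<bar>sig\<bar> *\<^sub>R (normal_density m sig (m + sig * x) *\<^sub>R iexp (s * (m + sig * x)))
    = iexp (s * m) * (std_normal_density x *\<^sub>R iexp ((s * sig) * x))" for x
   unfolding e[symmetric] using assms by simp
  then show ?thesis by (simp only: integral_scaleR_right[symmetric])
 qed
 also have "\<dots> = iexp (s * m) * (CLINT x|lborel. std_normal_density x *\<^sub>R iexp ((s * sig) * x))"
  by (rule integral_mult_right_zero)
 also have "(CLINT x|lborel. std_normal_density x *\<^sub>R iexp ((s * sig) * x)) = char std_normal_distribution (s * sig)"
  unfolding char_def by (subst integral_density) auto
 also have "\<dots> = exp (- sig\<^sup>2 * s\<^sup>2 / 2)"
  by (simp add: char_std_normal_distribution power_mult_distrib mult.commute)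
 finally show ?thesis .
qed

definition gauss_density :: "real => 'e::euclidean_space => real" where
 "gauss_density sig x = (\<Prod>b\<in>Basis. normal_density 0 sig (x \<bullet> b))"

lemma norm_sq_Basis: "(norm x)\<^sup>2 = (\<Sum>b\<in>Basis. (x \<bullet> b)\<^sup>2)"
 unfolding power2_norm_eq_inner by (subst euclidean_inner) (simp add: power2_eq_square)

lemma gauss_density_eq:
 fixes x :: "'e::euclidean_space"
 assumes "0 < sig"
 shows "gauss_density sig x = (1 / sqrt (2 * pi * sig\<^sup>2)) ^ DIM('e) * exp (- (norm x)\<^sup>2 / (2 * sig\<^sup>2))"
proof -
 have "(\<Sum>b\<in>Basis. - (x \<bullet> b)\<^sup>2 / (2 * sig\<^sup>2)) = - (norm x)\<^sup>2 / (2 * sig\<^sup>2)"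
  by (simp add: norm_sq_Basis[of x] sum_negf flip: sum_divide_distrib)
 moreover have "gauss_density sig x = (1 / sqrt (2 * pi * sig\<^sup>2)) ^ DIM('e) * (\<Prod>b\<in>Basis. exp (- (x \<bullet> b)\<^sup>2 / (2 * sig\<^sup>2)))"
  by (simp only: gauss_density_def normal_density_def prod.distrib prod_constant diff_0_right)
 ultimately show ?thesis by (simp only: exp_sum[OF finite_Basis, symmetric])
qed

lemma gauss_density_pos: "0 < sig ==> 0 < gauss_density sig x"
 by (simp add: gauss_density_def prod_pos normal_density_pos)

lemma gauss_density_measurable [measurable]: "gauss_density sig \<in> borel_measurable borel"
 unfolding gauss_density_def by measurable

lemma
 assumes "0 < sig"
 shows gauss_density_integrable: "integrable lborel (gauss_density sig :: 'e::euclidean_space => real)"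
  and gauss_density_integral: "(\<integral>x. gauss_density sig (x :: 'e) \<partial>lborel) = 1"
 unfolding gauss_density_def
 using assms lborel_integral_prod[of "%_::'e. normal_density 0 sig"] by (auto intro!: lborel_integrable_prod)

lemma integrable_gauss_iexp:
 fixes u :: "'e::euclidean_space"
 assumes "0 < sig"
 shows "integrable lborel (%x. gauss_density sig x *\<^sub>R iexp (u \<bullet> x))"
 by (rule Bochner_Integration.integrable_bound[OF gauss_density_integrable[OF assms]])
  (auto simp: gauss_density_pos[OF assms, THEN less_imp_le])

lemma char_gauss_density:
 fixes u :: "'e::euclidean_space"
 assumes "0 < sig"
 shows "(CLINT x|lborel. gauss_density sig x *\<^sub>R iexp (u \<bullet> x)) = exp (- sig\<^sup>2 * (norm u)\<^sup>2 / 2)"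
proof -
 have i: "integrable lborel (%x. normal_density 0 sig x *\<^sub>R iexp ((u \<bullet> b) * x))" for b
  by (rule Bochner_Integration.integrable_bound[of _ "normal_density 0 sig"])
   (use assms in auto)
 have "gauss_density sig x *\<^sub>R iexp (u \<bullet> x) = (\<Prod>b\<in>Basis. normal_density 0 sig (x \<bullet> b) *\<^sub>R iexp ((u \<bullet> b) * (x \<bullet> b)))" for x
 proof -
  have "iexp (u \<bullet> x) = (\<Prod>b\<in>Basis. iexp ((u \<bullet> b) * (x \<bullet> b)))"
   by (subst euclidean_inner) (simp add: exp_sum sum_distrib_left)
  then show ?thesis by (simp add: gauss_density_def scaleR_conv_of_real prod.distrib)
 qed
 then have "(CLINT x|lborel. gauss_density sig x *\<^sub>R iexp (u \<bullet> x))
   = (\<Prod>b\<in>Basis. CLINT x|lborel. normal_density 0 sig x *\<^sub>R iexp ((u \<bullet> b) * x))"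
  using lborel_integral_prod[OF i] by simp
 also have "\<dots> = (\<Prod>b\<in>(Basis :: 'e set). of_real (exp (- sig\<^sup>2 * (u \<bullet> b)\<^sup>2 / 2)))"
 proof (intro prod.cong refl)
  fix b :: 'e
  show "(CLINT x|lborel. normal_density 0 sig x *\<^sub>R iexp ((u \<bullet> b) * x)) = of_real (exp (- sig\<^sup>2 * (u \<bullet> b)\<^sup>2 / 2))"
   using char_normal_density[OF assms, of 0 "u \<bullet> b"] by simp
 qed
 also have "\<dots> = of_real (exp (\<Sum>b\<in>(Basis :: 'e set). - sig\<^sup>2 * (u \<bullet> b)\<^sup>2 / 2))"
  by (simp add: exp_sum)
 also have "(\<Sum>b\<in>(Basis :: 'e set). - sig\<^sup>2 * (u \<bullet> b)\<^sup>2 / 2) = - sig\<^sup>2 * (norm u)\<^sup>2 / 2"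
  by (simp add: norm_sq_Basis[of u] sum_negf flip: sum_divide_distrib sum_distrib_left)
 finally show ?thesis .
qed

lemma
 assumes s: "0 < sig" and b: "b \<in> Basis"
 shows integrable_gauss_coord: "integrable lborel (%x :: 'e::euclidean_space. gauss_density sig x * (x \<bullet> b))"
  and integral_gauss_coord: "(\<integral>x. gauss_density sig (x :: 'e) * (x \<bullet> b) \<partial>lborel) = 0"
  and integrable_gauss_coord_sq: "integrable lborel (%x :: 'e. gauss_density sig x * (x \<bullet> b)\<^sup>2)"
proof -
 have gen: "integrable lborel (%x :: 'e. gauss_density sig x * (x \<bullet> b) ^ k)"
  "(\<integral>x. gauss_density sig (x :: 'e) * (x \<bullet> b) ^ k \<partial>lborel) = (\<integral>x. normal_density 0 sig x * x ^ k \<partial>lborel)" for k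
 proof -
  let ?f = "%b' x. normal_density 0 sig x * (if b' = b then x ^ k else 1)"
  have i: "integrable lborel (?f b')" for b'
   using integrable_normal_moment[OF s, of 0 k] s by (cases "b' = b") auto
  have eq: "gauss_density sig x * (x \<bullet> b) ^ k = (\<Prod>b'\<in>Basis. ?f b' (x \<bullet> b'))" for x
   using b by (simp add: gauss_density_def prod.distrib prod.delta)
  have "(\<Prod>b'\<in>(Basis :: 'e set). \<integral>x. ?f b' x \<partial>lborel)
    = (\<Prod>b'\<in>(Basis :: 'e set). if b' = b then (\<integral>x. normal_density 0 sig x * x ^ k \<partial>lborel) else 1)"
   using s by (intro prod.cong refl) auto
  also have "\<dots> = (\<integral>x. normal_density 0 sig x * x ^ k \<partial>lborel)" using b by (simp add: prod.delta)
  finally show "integrable lborel (%x :: 'e. gauss_density sig x * (x \<bullet> b) ^ k)"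
   "(\<integral>x. gauss_density sig (x :: 'e) * (x \<bullet> b) ^ k \<partial>lborel) = (\<integral>x. normal_density 0 sig x * x ^ k \<partial>lborel)"
   unfolding eq using lborel_integrable_prod[of ?f] lborel_integral_prod[of ?f] i by simp_all
 qed
 show "integrable lborel (%x :: 'e. gauss_density sig x * (x \<bullet> b))" using gen(1)[of 1] by simp
 show "(\<integral>x. gauss_density sig (x :: 'e) * (x \<bullet> b) \<partial>lborel) = 0"
  using gen(2)[of 1] normal_moment_odd[OF s, of 0 0] by (simp add: has_bochner_integral_iff)
 show "integrable lborel (%x :: 'e. gauss_density sig x * (x \<bullet> b)\<^sup>2)" using gen(1)[of 2] .
qed

lemma
 assumes s: "0 < sig"
 shows integrable_gauss_norm_sq: "integrable lborel (%x :: 'e::euclidean_space. gauss_density sig x * (norm x)\<^sup>2)"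
  and integrable_gauss_inner: "integrable lborel (%x :: 'e. gauss_density sig x * (x \<bullet> v))"
  and integral_gauss_inner: "(\<integral>x. gauss_density sig (x :: 'e) * (x \<bullet> v) \<partial>lborel) = 0"
proof -
 have n: "gauss_density sig x * (norm x)\<^sup>2 = (\<Sum>b\<in>Basis. gauss_density sig x * (x \<bullet> b)\<^sup>2)" for x :: 'e
  by (simp add: norm_sq_Basis[of x] sum_distrib_left)
 show "integrable lborel (%x :: 'e. gauss_density sig x * (norm x)\<^sup>2)"
  unfolding n by (intro Bochner_Integration.integrable_sum integrable_gauss_coord_sq s)
 have i: "gauss_density sig x * (x \<bullet> v) = (\<Sum>b\<in>Basis. (v \<bullet> b) * (gauss_density sig x * (x \<bullet> b)))" for x :: 'e
  using euclidean_inner[of x v] by (simp add: sum_distrib_left ac_simps)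
 show "integrable lborel (%x :: 'e. gauss_density sig x * (x \<bullet> v))"
  unfolding i by (intro Bochner_Integration.integrable_sum integrable_mult_right integrable_gauss_coord s)
 show "(\<integral>x. gauss_density sig (x :: 'e) * (x \<bullet> v) \<partial>lborel) = 0"
  unfolding i by (subst Bochner_Integration.integral_sum)
   (auto intro!: integrable_mult_right integrable_gauss_coord s simp: integral_gauss_coord[OF s])
qed

section \<open>Uniqueness of a measure with given characteristic function\<close>

definition char_fun :: "'e::euclidean_space measure => 'e => complex" where
 "char_fun \<mu> u = (CLINT x|\<mu>. iexp (u \<bullet> x))"

text \<open>The Gaussian kernel of width \<open>sig\<close> is the Fourier transform of the Gaussian
  density of width \<open>1 / sig\<close>. Fubini then shows that the smoothed measure depends on
  \<open>\<mu>\<close> only through \<open>char_fun\<close>.\<close>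

lemma char_fun_gauss_kernel:
 fixes \<mu> :: "'e::euclidean_space measure"
 assumes "prob_space \<mu>" and [measurable_cong]: "sets \<mu> = sets borel" and s: "0 < sig"
 shows "(\<integral>x. exp (- (norm (y - x))\<^sup>2 / (2 * sig\<^sup>2)) \<partial>\<mu>)
  = (CLINT u|lborel. gauss_density (1 / sig) u *\<^sub>R (iexp (u \<bullet> y) * char_fun \<mu> (- u)))"
proof -
 interpret prob_space \<mu> by fact
 interpret P: pair_sigma_finite \<mu> "lborel :: 'e measure" by standard
 let ?g = "gauss_density (1 / sig) :: 'e => real"
 have s': "0 < 1 / sig" using s by simp
 have int: "integrable (\<mu> \<Otimes>\<^sub>M lborel) (%(x, u). ?g u *\<^sub>R iexp (u \<bullet> (y - x)))"
 proof (rule P.Fubini_integrable)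
  show "(%(x, u). ?g u *\<^sub>R iexp (u \<bullet> (y - x))) \<in> borel_measurable (\<mu> \<Otimes>\<^sub>M lborel)"
   by measurable
  have "(\<integral>u. norm (case (x, u) of (x, u) => ?g u *\<^sub>R iexp (u \<bullet> (y - x))) \<partial>lborel) = 1" for x
   using gauss_density_integral[OF s', where 'e='e] by (simp add: gauss_density_pos[OF s', THEN less_imp_le])
  then show "integrable \<mu> (%x. \<integral>u. norm (case (x, u) of (x, u) => ?g u *\<^sub>R iexp (u \<bullet> (y - x))) \<partial>lborel)"
   by simp
  have "integrable lborel (%u. ?g u *\<^sub>R iexp (u \<bullet> (y - x)))" for x
   using integrable_gauss_iexp[OF s', of "y - x"] by (simp only: inner_commute[of "y - x"])
  then show "AE x in \<mu>. integrable lborel (%u. case (x, u) of (x, u) => ?g u *\<^sub>R iexp (u \<bullet> (y - x)))"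
   by simp
 qed
 have "complex_of_real (\<integral>x. exp (- (norm (y - x))\<^sup>2 / (2 * sig\<^sup>2)) \<partial>\<mu>)
   = (CLINT x|\<mu>. of_real (exp (- (norm (y - x))\<^sup>2 / (2 * sig\<^sup>2))))" by simp
 also have "\<dots> = (CLINT x|\<mu>. CLINT u|lborel. ?g u *\<^sub>R iexp (u \<bullet> (y - x)))"
 proof (intro Bochner_Integration.integral_cong refl)
  fix x
  show "of_real (exp (- (norm (y - x))\<^sup>2 / (2 * sig\<^sup>2))) = (CLINT u|lborel. ?g u *\<^sub>R iexp (u \<bullet> (y - x)))"
   using char_gauss_density[OF s', of "y - x"] s
   unfolding inner_commute[of "y - x"] by (simp add: power_divide)
 qed
 also have "\<dots> = (CLINT u|lborel. CLINT x|\<mu>. ?g u *\<^sub>R iexp (u \<bullet> (y - x)))"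
  by (rule P.Fubini_integral[OF int, symmetric])
 also have "\<dots> = (CLINT u|lborel. ?g u *\<^sub>R (iexp (u \<bullet> y) * char_fun \<mu> (- u)))"
 proof (intro Bochner_Integration.integral_cong refl)
  fix u
  have "(CLINT x|\<mu>. ?g u *\<^sub>R iexp (u \<bullet> (y - x))) = (CLINT x|\<mu>. (?g u *\<^sub>R iexp (u \<bullet> y)) * iexp (- u \<bullet> x))"
   by (intro Bochner_Integration.integral_cong refl)
    (simp add: inner_diff_right right_diff_distrib exp_diff exp_minus field_simps)
  then show "(CLINT x|\<mu>. ?g u *\<^sub>R iexp (u \<bullet> (y - x))) = ?g u *\<^sub>R (iexp (u \<bullet> y) * char_fun \<mu> (- u))"
   by (simp add: char_fun_def)
 qed
 finally show ?thesis .
qed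

lemma integral_gauss_smoothing:
 fixes \<mu> :: "'e::euclidean_space measure" and g :: "'e => real"
 assumes "prob_space \<mu>" and [measurable_cong]: "sets \<mu> = sets borel" and s: "0 < sig"
  and [measurable]: "g \<in> borel_measurable borel" and B: "\<And>x. \<bar>g x\<bar> <= B"
 shows "(\<integral>x. (\<integral>z. gauss_density 1 z * g (x + sig *\<^sub>R z) \<partial>lborel) \<partial>\<mu>)
  = (\<integral>y. (\<integral>x. exp (- (norm (y - x))\<^sup>2 / (2 * sig\<^sup>2)) \<partial>\<mu>) * ((1 / sqrt (2 * pi * sig\<^sup>2)) ^ DIM('e) * g y) \<partial>lborel)"
proof -
 interpret prob_space \<mu> by fact
 interpret P: pair_sigma_finite \<mu> "lborel :: 'e measure" by standard
 let ?g = "gauss_density sig :: 'e => real"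
 have i: "integrable lborel (%y. ?g (y - x) * g y)" for x
 proof (rule Bochner_Integration.integrable_bound)
  show "integrable lborel (%y. ?g (y - x) * B)"
   by (intro integrable_mult_left lborel_integrable_translate gauss_density_integrable s)
  have "0 <= B" using B[of 0] by linarith
  then show "AE y in lborel. norm (?g (y - x) * g y) <= norm (?g (y - x) * B)"
   using B by (auto simp: abs_mult intro!: mult_left_mono)
 qed simp
 have inner: "(\<integral>z. gauss_density 1 z * g (x + sig *\<^sub>R z) \<partial>lborel) = (\<integral>y. ?g (y - x) * g y \<partial>lborel)" for x
 proof -
  have "(\<integral>y. ?g (y - x) * g y \<partial>lborel) = \<bar>sig\<bar> ^ DIM('e) *\<^sub>R (\<integral>z. ?g (x + sig *\<^sub>R z - x) * g (x + sig *\<^sub>R z) \<partial>lborel)"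
   by (rule lborel_integral_affine_vec[OF _ i]) (use s in auto)
  also have "\<dots> = (\<integral>z. sig ^ DIM('e) * (?g (sig *\<^sub>R z) * g (x + sig *\<^sub>R z)) \<partial>lborel)"
   using s by simp
  also have "\<dots> = (\<integral>z. gauss_density 1 z * g (x + sig *\<^sub>R z) \<partial>lborel)"
   using s by (intro Bochner_Integration.integral_cong refl)
    (simp add: gauss_density_eq power_mult_distrib real_sqrt_mult power_divide)
  finally show ?thesis by simp
 qed
 have int: "integrable (\<mu> \<Otimes>\<^sub>M lborel) (%(x, y). ?g (y - x) * g y)"
 proof (rule P.Fubini_integrable)
  show "(%(x, y). ?g (y - x) * g y) \<in> borel_measurable (\<mu> \<Otimes>\<^sub>M lborel)" by measurable
  show "AE x in \<mu>. integrable lborel (%y. case (x, y) of (x, y) => ?g (y - x) * g y)"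
   using i by simp
  have le: "(\<integral>y. norm (?g (y - x) * g y) \<partial>lborel) <= B" for x
  proof -
   have "(\<integral>y. norm (?g (y - x) * g y) \<partial>lborel) <= (\<integral>y. ?g (y - x) * B \<partial>lborel)"
    by (intro integral_mono integrable_norm i integrable_mult_left lborel_integrable_translate gauss_density_integrable s)
     (use B in \<open>auto simp: abs_mult gauss_density_pos[OF s, THEN less_imp_le] intro!: mult_left_mono\<close>)
   also have "\<dots> = B"
    using lborel_integral_translate[OF gauss_density_integrable[OF s], of x] gauss_density_integral[OF s, where 'e='e] by simp
   finally show ?thesis .
  qed
  show "integrable \<mu> (%x. \<integral>y. norm (case (x, y) of (x, y) => ?g (y - x) * g y) \<partial>lborel)"
   by (rule integrable_const_bound[where B = B]) (use le in auto)
 qed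
 have "(\<integral>x. (\<integral>z. gauss_density 1 z * g (x + sig *\<^sub>R z) \<partial>lborel) \<partial>\<mu>) = (\<integral>x. (\<integral>y. ?g (y - x) * g y \<partial>lborel) \<partial>\<mu>)"
  by (simp add: inner)
 also have "\<dots> = (\<integral>y. (\<integral>x. ?g (y - x) * g y \<partial>\<mu>) \<partial>lborel)"
  by (rule P.Fubini_integral[OF int, symmetric])
 also have "\<dots> = (\<integral>y. (\<integral>x. exp (- (norm (y - x))\<^sup>2 / (2 * sig\<^sup>2)) * ((1 / sqrt (2 * pi * sig\<^sup>2)) ^ DIM('e) * g y) \<partial>\<mu>) \<partial>lborel)"
  by (intro Bochner_Integration.integral_cong refl) (simp add: gauss_density_eq[OF s])
 finally show ?thesis by simp
qed

text \<open>\<open>T n\<close> averages \<open>g\<close> over a Gaussian of width 1 / (n + 1). Its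
  integral is fixed by the characteristic function, and dominated convergence lets the width go to
  0.\<close>

lemma char_fun_integral_eq:
 fixes \<mu> \<nu> :: "'e::euclidean_space measure" and g :: "'e => real"
 assumes \<mu>: "prob_space \<mu>" "sets \<mu> = sets borel" and \<nu>: "prob_space \<nu>" "sets \<nu> = sets borel"
  and eq: "char_fun \<mu> = char_fun \<nu>"
  and g: "continuous_on UNIV g" and B: "\<And>x. \<bar>g x\<bar> <= B"
 shows "(\<integral>x. g x \<partial>\<mu>) = (\<integral>x. g x \<partial>\<nu>)"
proof -
 have [measurable]: "g \<in> borel_measurable borel" using g by (rule borel_measurable_continuous_onI)
 define T where "T n x = (\<integral>z. gauss_density 1 z * g (x + (1 / real (Suc n)) *\<^sub>R z) \<partial>lborel)" for n and x :: 'e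
 have Tm [measurable]: "T n \<in> borel_measurable borel" for n
  unfolding T_def by measurable
 have gi: "integrable lborel (%z. B * gauss_density 1 (z :: 'e))"
  using gauss_density_integrable[of 1, where 'e='e] by simp
 have bd: "\<bar>gauss_density 1 z * g y\<bar> <= B * gauss_density 1 z" for y z :: 'e
  using mult_right_mono[OF B[of y], of "gauss_density 1 z"]
  by (simp add: abs_mult gauss_density_pos less_imp_le mult.commute)
 have Tlim: "(%n. T n x) \<longlonglongrightarrow> g x" for x
 proof -
  have "(%n. T n x) \<longlonglongrightarrow> (\<integral>z. gauss_density 1 (z :: 'e) * g x \<partial>lborel)"
   unfolding T_def
  proof (rule integral_dominated_convergence[OF _ _ gi])
   show "AE z in lborel. (%n. gauss_density 1 z * g (x + (1 / real (Suc n)) *\<^sub>R z)) \<longlonglongrightarrow> gauss_density 1 z * g x"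
   proof (rule AE_I2)
    fix z :: 'e
    have "(%n. x + (1 / real (Suc n)) *\<^sub>R z) \<longlonglongrightarrow> x + 0 *\<^sub>R z"
     by (intro tendsto_intros LIMSEQ_Suc[OF lim_1_over_n])
    then have "(%n. g (x + (1 / real (Suc n)) *\<^sub>R z)) \<longlonglongrightarrow> g x"
     using continuous_on_tendsto_compose[OF g] by auto
    then show "(%n. gauss_density 1 z * g (x + (1 / real (Suc n)) *\<^sub>R z)) \<longlonglongrightarrow> gauss_density 1 z * g x"
     by (intro tendsto_intros)
   qed
  qed (use bd in auto)
  then show ?thesis using gauss_density_integral[of 1, where 'e='e] by simp
 qed
 have Tb: "\<bar>T n x\<bar> <= B" for n x
 proof -
  have "\<bar>T n x\<bar> <= (\<integral>z. B * gauss_density 1 (z :: 'e) \<partial>lborel)"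
   unfolding T_def
   by (rule order_trans[OF integral_abs_bound integral_mono'[OF gi]])
    (use bd B[of 0] in \<open>auto simp: gauss_density_pos less_imp_le intro!: mult_nonneg_nonneg\<close>)
  then show ?thesis using gauss_density_integral[of 1, where 'e='e] by simp
 qed
 have lim: "(%n. \<integral>x. T n x \<partial>kap) \<longlonglongrightarrow> (\<integral>x. g x \<partial>kap)" if "prob_space kap" "sets kap = sets borel" for kap
 proof -
  interpret prob_space kap by fact
  note [measurable_cong] = that(2)
  show ?thesis
   by (rule integral_dominated_convergence[where w = "%_. B"]) (use Tlim Tb in auto)
 qed
 have "(\<integral>x. T n x \<partial>\<mu>) = (\<integral>x. T n x \<partial>\<nu>)" for n
 proof -
  let ?s = "1 / real (Suc n)"
  have "complex_of_real (\<integral>x. exp (- (norm (y - x))\<^sup>2 / (2 * ?s\<^sup>2)) \<partial>\<mu>)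
    = complex_of_real (\<integral>x. exp (- (norm (y - x))\<^sup>2 / (2 * ?s\<^sup>2)) \<partial>\<nu>)" for y
   using char_fun_gauss_kernel[OF \<mu>, of ?s y] char_fun_gauss_kernel[OF \<nu>, of ?s y] eq by simp
  then show ?thesis
   unfolding T_def
   using integral_gauss_smoothing[OF \<mu>, of ?s g B] integral_gauss_smoothing[OF \<nu>, of ?s g B] B
   by (simp add: of_real_eq_iff)
 qed
 then show ?thesis using LIMSEQ_unique[OF lim[OF \<mu>]] lim[OF \<nu>] by simp
qed

theorem char_fun_unique:
 fixes \<mu> \<nu> :: "'e::euclidean_space measure"
 assumes \<mu>: "prob_space \<mu>" "sets \<mu> = sets borel" and \<nu>: "prob_space \<nu>" "sets \<nu> = sets borel"
  and eq: "char_fun \<mu> = char_fun \<nu>"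
 shows "\<mu> = \<nu>"
proof -
 interpret M: prob_space \<mu> by fact
 interpret N: prob_space \<nu> by fact
 note [measurable_cong] = \<mu>(2) \<nu>(2)
 have open_eq: "emeasure \<mu> U = emeasure \<nu> U" if U: "open U" for U
 \<comment> \<open>\<open>infdist\<close> to the empty set is 0 by convention, so the approximating
   functions below would vanish for \<open>U = UNIV\<close>.\<close>
 proof (cases "U = UNIV")
  case True
  then show ?thesis
   using M.emeasure_space_1 N.emeasure_space_1 sets_eq_imp_space_eq[OF \<mu>(2)] sets_eq_imp_space_eq[OF \<nu>(2)] by simp
 next
  case False
  define f where "f n x = min 1 (real n * infdist x (- U))" for n x
  have fc: "continuous_on UNIV (f n)" for n
   unfolding f_def by (intro continuous_intros)
  have Um [measurable]: "U \<in> sets borel" using U by simp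
  have fb: "\<bar>f n x\<bar> <= 1" for n x by (auto simp: f_def infdist_nonneg abs_le_iff min_def intro: order_trans[of _ 0])
  have fm [measurable]: "f n \<in> borel_measurable borel" for n using fc by (rule borel_measurable_continuous_onI)
  have flim: "(%n. f n x) \<longlonglongrightarrow> indicator U x" for x
  proof (cases "x \<in> U")
   case True
   then have pos: "0 < infdist x (- U)"
    using U False in_closed_iff_infdist_zero[of "- U" x] infdist_nonneg[of x "- U"]
    by (auto simp: closed_Compl less_le)
   obtain k :: nat where k: "1 / infdist x (- U) < k" using reals_Archimedean2 by blast
   have "f n x = 1" if "n >= k" for n
   proof -
    have "1 <= real k * infdist x (- U)" using k pos by (simp add: field_simps)
    also have "\<dots> <= real n * infdist x (- U)" using that pos by (intro mult_right_mono) auto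
    finally show ?thesis by (simp add: f_def)
   qed
   then have "eventually (%n. f n x = 1) sequentially" by (auto simp: eventually_sequentially)
   then show ?thesis using True by (auto intro: tendsto_eventually)
  next
   case False
   then have "f n x = 0" for n by (simp add: f_def)
   then show ?thesis using False by simp
  qed
  have "(%n. \<integral>x. f n x \<partial>\<mu>) \<longlonglongrightarrow> (\<integral>x. indicator U x \<partial>\<mu>)"
   by (rule integral_dominated_convergence[where w = "%_. 1"]) (use flim fb U in auto)
  moreover have "(%n. \<integral>x. f n x \<partial>\<nu>) \<longlonglongrightarrow> (\<integral>x. indicator U x \<partial>\<nu>)"
   by (rule integral_dominated_convergence[where w = "%_. 1"]) (use flim fb U in auto)
  moreover have "(\<integral>x. f n x \<partial>\<mu>) = (\<integral>x. f n x \<partial>\<nu>)" for n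
   by (rule char_fun_integral_eq[OF \<mu> \<nu> eq fc fb])
  ultimately have "(\<integral>x. indicator U x \<partial>\<mu>) = (\<integral>x. indicator U x \<partial>\<nu> :: real)"
   using LIMSEQ_unique by simp
  then show ?thesis
   using U \<mu>(2) \<nu>(2) by (simp add: M.emeasure_eq_measure N.emeasure_eq_measure sets_eq_imp_space_eq)
 qed
 show ?thesis
 proof (rule measure_eqI_generator_eq[where E = "{U. open U}" and \<Omega> = UNIV and A = "%_. UNIV"])
  show "Int_stable {U :: 'e set. open U}" by (auto simp: Int_stable_def)
  show "sets \<mu> = sigma_sets UNIV {U. open U}" "sets \<nu> = sigma_sets UNIV {U. open U}"
   by (simp_all add: \<mu> \<nu> borel_def)
  show "emeasure \<mu> UNIV ~= \<infinity>" for i :: nat by (simp add: M.emeasure_eq_measure)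
 qed (use open_eq in auto)
qed

text \<open>Jensen's inequality for \<open>(a, b) \<mapsto> a * ln (a / b)\<close>, in the
 pointwise form \<open>a * ln (p / q) <= a * ln (a / b) - a + b * (p / q)\<close> integrated over the mixing space.\<close>

lemma Ent_density_le:
 fixes p q g :: "'e::euclidean_space => real"
 assumes [measurable]: "p \<in> borel_measurable borel" "q \<in> borel_measurable borel"
  and p: "\<And>x. 0 < p x" "integrable lborel p" and q: "\<And>x. 0 < q x" "integrable lborel q"
  and g: "integrable lborel g" and le: "AE x in lborel. p x * ln (p x / q x) <= g x"
 shows "Ent (density lborel p) (density lborel q) <= ereal (\<integral>x. g x \<partial>lborel)"
proof -
 let ?P = "density lborel p" and ?Q = "density lborel q"
 interpret Q: sigma_finite_measure ?Q
  by (subst sigma_finite_measure.sigma_finite_iff_density_finite[OF lborel.sigma_finite_measure_axioms]) auto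
 \<comment> \<open>From above the integrand is dominated by \<open>g\<close>; from below, ln t <= t
   - 1 gives p ln (p / q) >= p - q. Integrability matters because \<open>Ent\<close> is infinite
   without it.\<close>
 have h: "integrable lborel (%x. p x * ln (p x / q x))"
 proof (rule Bochner_Integration.integrable_bound)
  show "integrable lborel (%x. \<bar>g x\<bar> + (p x + q x))" using p q g by auto
  show "AE x in lborel. norm (p x * ln (p x / q x)) <= norm (\<bar>g x\<bar> + (p x + q x))"
   using le
  proof eventually_elim
   case (elim x)
   have "ln (q x / p x) <= q x / p x - 1" using p q by (intro ln_le_minus_one) simp
   then have "p x * - ln (p x / q x) <= p x * (q x / p x - 1)"
    using p(1)[of x] q(1)[of x] by (intro mult_left_mono) (auto simp: ln_div)
   also have "\<dots> = q x - p x" using p(1)[of x] by (simp add: field_simps)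
   finally show ?case using elim p(1)[of x] q(1)[of x] by simp
  qed
 qed simp
 have dens: "density ?Q (%x. p x / q x) = ?P"
  using p q by (subst density_density_eq)
   (auto intro!: density_cong AE_I2 simp: ennreal_mult'[symmetric] less_imp_le less_imp_neq[symmetric])
 have "AE x in ?Q. RN_deriv ?Q ?P x = ennreal (p x / q x)"
 proof -
  have "AE x in ?Q. ennreal (p x / q x) = RN_deriv ?Q (density ?Q (%x. p x / q x)) x"
   by (rule Q.RN_deriv_unique) (auto simp: )
  then show ?thesis unfolding dens by auto
 qed
 then have "AE x in lborel. 0 < ennreal (q x) --> RN_deriv ?Q ?P x = ennreal (p x / q x)"
  by (subst (asm) AE_density) auto
 then have ed: "AE x in lborel. entropy_density (exp 1) ?Q ?P x = ln (p x / q x)"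
 proof eventually_elim
  case (elim x)
  then show ?case using q(1)[of x] p(1)[of x] by (simp add: entropy_density_def log_def)
 qed
 have ac: "absolutely_continuous ?Q ?P"
  unfolding dens[symmetric] by (rule absolutely_continuousI_density) simp
 have [measurable]: "entropy_density (exp 1) ?Q ?P \<in> borel_measurable borel"
  using measurable_entropy_density[of "exp 1" ?Q ?P] by simp
 have int: "integrable ?P (entropy_density (exp 1) ?Q ?P)"
 proof (subst integrable_density)
  show "integrable lborel (%x. p x *\<^sub>R entropy_density (exp 1) ?Q ?P x)"
   by (rule integrable_cong_AE[THEN iffD1, OF _ _ _ h]) (use ed in auto)
 qed (use p in \<open>auto simp: less_imp_le\<close>)
 have "KL_divergence (exp 1) ?Q ?P = (\<integral>x. p x * ln (p x / q x) \<partial>lborel)"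
  using p q by (subst lborel.KL_density_density) (auto simp: log_def less_imp_le less_imp_neq[symmetric])
 also have "\<dots> <= (\<integral>x. g x \<partial>lborel)"
  by (intro integral_mono_AE h g le)
 finally show ?thesis using ac int by (simp add: Ent_def)
qed

section \<open>Relative entropy of isotropic Gaussian mixtures\<close>

context prob_space
begin

text \<open>Lebesgue density of the law of \<open>Z\<close> plus an independent centred Gaussian
  vector whose covariance is sig^2 times the identity. It is positive everywhere, whatever the law
  of \<open>Z\<close>.\<close>

definition gauss_mixture :: "real => ('a => 'e::euclidean_space) => 'e => real" where
 "gauss_mixture sig Z x = expectation (%om. gauss_density sig (x - Z om))"

lemma gauss_density_le:
 assumes "0 < sig"
 shows "\<bar>gauss_density sig (x :: 'e::euclidean_space)\<bar> <= (1 / sqrt (2 * pi * sig\<^sup>2)) ^ DIM('e)"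
 using assms by (simp add: gauss_density_eq abs_mult power_abs mult_left_le)

lemma
 fixes Z :: "'a => 'e::euclidean_space"
 assumes s: "0 < sig" and Z [measurable]: "Z \<in> borel_measurable M"
 shows integrable_gauss_mixture_kernel: "integrable M (%om. gauss_density sig (x - Z om))"
  and gauss_mixture_measurable: "gauss_mixture sig Z \<in> borel_measurable borel"
  and gauss_mixture_pos: "0 < gauss_mixture sig Z x"
  and gauss_mixture_pair_integrable: "integrable (M \<Otimes>\<^sub>M lborel) (%(om, x). gauss_density sig (x - Z om))"
  and gauss_mixture_integrable: "integrable lborel (gauss_mixture sig Z)"
  and gauss_mixture_integral: "(\<integral>x. gauss_mixture sig Z x \<partial>lborel) = 1"
proof -
 interpret P: pair_sigma_finite M "lborel :: 'e measure" by standard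
 show i: "integrable M (%om. gauss_density sig (x - Z om))" for x
  by (rule integrable_const_bound[OF AE_I2]) (use gauss_density_le[OF s] in auto)
 show "gauss_mixture sig Z \<in> borel_measurable borel"
  unfolding gauss_mixture_def by measurable
 have "gauss_mixture sig Z x ~= 0"
 proof
  assume "gauss_mixture sig Z x = 0"
  then have "AE om in M. gauss_density sig (x - Z om) = 0"
  proof -
   have "AE om in M. 0 <= gauss_density sig (x - Z om)"
    by (rule AE_I2) (rule less_imp_le[OF gauss_density_pos[OF s]])
   from integral_nonneg_eq_0_iff_AE[OF i[of x] this] \<open>gauss_mixture sig Z x = 0\<close> show ?thesis
    by (simp add: gauss_mixture_def)
  qed
  then have "AE om in M. False"
   by eventually_elim (metis gauss_density_pos less_irrefl s)
  then show False by simp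
 qed
 moreover have "0 <= gauss_mixture sig Z x"
  unfolding gauss_mixture_def by (intro Bochner_Integration.integral_nonneg less_imp_le gauss_density_pos s)
 ultimately show "0 < gauss_mixture sig Z x" by simp
 show int: "integrable (M \<Otimes>\<^sub>M lborel) (%(om, x). gauss_density sig (x - Z om))"
 proof (rule P.Fubini_integrable)
  have "(\<integral>x. norm (gauss_density sig (x - z)) \<partial>lborel) = 1" for z :: 'e
   using lborel_integral_translate[OF gauss_density_integrable[OF s], of z]
    gauss_density_integral[OF s, where 'e='e] by (simp add: abs_of_pos[OF gauss_density_pos[OF s]])
  then show "integrable M (%om. \<integral>x. norm (case (om, x) of (om, x) => gauss_density sig (x - Z om)) \<partial>lborel)"
   by simp
 qed (auto intro!: AE_I2 lborel_integrable_translate gauss_density_integrable[OF s])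
 show "integrable lborel (gauss_mixture sig Z)"
  using P.integrable_snd[OF int] by (simp add: gauss_mixture_def[abs_def])
 have "(\<integral>x. gauss_mixture sig Z x \<partial>lborel) = (\<integral>om. (\<integral>x. gauss_density sig (x - Z om) \<partial>lborel) \<partial>M)"
  unfolding gauss_mixture_def by (rule P.Fubini_integral[OF int])
 then show "(\<integral>x. gauss_mixture sig Z x \<partial>lborel) = 1"
  using lborel_integral_translate[OF gauss_density_integrable[OF s, where 'e='e]] gauss_density_integral[OF s, where 'e='e]
  by (simp add: prob_space)
qed

lemma
 fixes Z :: "'a => 'e::euclidean_space"
 assumes s: "0 < sig" and Z [measurable]: "Z \<in> borel_measurable M"
 shows gauss_mixture_prob: "prob_space (density lborel (gauss_mixture sig Z))"
  and char_fun_gauss_mixture: "char_fun (density lborel (gauss_mixture sig Z)) u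
   = (CLINT om|M. iexp (u \<bullet> Z om)) * exp (- sig\<^sup>2 * (norm u)\<^sup>2 / 2)"
proof -
 interpret P: pair_sigma_finite M "lborel :: 'e measure" by standard
 note [measurable] = gauss_mixture_measurable[OF s Z]
 have pos: "0 <= gauss_mixture sig Z x" for x using gauss_mixture_pos[OF s Z, of x] by simp
 have "emeasure (density lborel (gauss_mixture sig Z)) UNIV = 1"
  using nn_integral_eq_integral[OF gauss_mixture_integrable[OF s Z]] pos
  by (simp add: emeasure_density gauss_mixture_integral[OF s Z])
 then show "prob_space (density lborel (gauss_mixture sig Z))" by (intro prob_spaceI) simp
 have int: "integrable (M \<Otimes>\<^sub>M lborel) (%(om, x). gauss_density sig (x - Z om) *\<^sub>R iexp (u \<bullet> x))"
  by (rule Bochner_Integration.integrable_bound[OF gauss_mixture_pair_integrable[OF s Z]])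
   auto
 have "char_fun (density lborel (gauss_mixture sig Z)) u
   = (CLINT x|lborel. gauss_mixture sig Z x *\<^sub>R iexp (u \<bullet> x))"
  unfolding char_fun_def using pos by (subst integral_density) auto
 also have "\<dots> = (CLINT x|lborel. CLINT om|M. gauss_density sig (x - Z om) *\<^sub>R iexp (u \<bullet> x))"
  unfolding gauss_mixture_def by (subst integral_scaleR_left[OF integrable_gauss_mixture_kernel[OF s Z]]) simp
 also have "\<dots> = (CLINT om|M. CLINT x|lborel. gauss_density sig (x - Z om) *\<^sub>R iexp (u \<bullet> x))"
  by (rule P.Fubini_integral[OF int])
 also have "\<dots> = (CLINT om|M. iexp (u \<bullet> Z om) * exp (- sig\<^sup>2 * (norm u)\<^sup>2 / 2))"
 proof (intro Bochner_Integration.integral_cong refl)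
  fix om
  have "(CLINT x|lborel. gauss_density sig (x - Z om) *\<^sub>R iexp (u \<bullet> x))
    = (CLINT x|lborel. iexp (u \<bullet> Z om) * (gauss_density sig (x - Z om) *\<^sub>R iexp (u \<bullet> (x - Z om))))"
  proof (intro Bochner_Integration.integral_cong refl)
   fix x
   have "iexp (u \<bullet> x) = iexp (u \<bullet> Z om) * iexp (u \<bullet> (x - Z om))"
    by (simp add: inner_diff_right algebra_simps flip: exp_add)
   then show "gauss_density sig (x - Z om) *\<^sub>R iexp (u \<bullet> x) = iexp (u \<bullet> Z om) * (gauss_density sig (x - Z om) *\<^sub>R iexp (u \<bullet> (x - Z om)))"
    by simp
  qed
  also have "\<dots> = iexp (u \<bullet> Z om) * (CLINT x|lborel. gauss_density sig (x - Z om) *\<^sub>R iexp (u \<bullet> (x - Z om)))"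
   by (rule integral_mult_right_zero)
  also have "(CLINT x|lborel. gauss_density sig (x - Z om) *\<^sub>R iexp (u \<bullet> (x - Z om))) = exp (- sig\<^sup>2 * (norm u)\<^sup>2 / 2)"
   using lborel_integral_translate[OF integrable_gauss_iexp[OF s, of u], of "Z om"] char_gauss_density[OF s, of u] by simp
  finally show "(CLINT x|lborel. gauss_density sig (x - Z om) *\<^sub>R iexp (u \<bullet> x))
    = iexp (u \<bullet> Z om) * exp (- sig\<^sup>2 * (norm u)\<^sup>2 / 2)" .
 qed
 also have "\<dots> = (CLINT om|M. iexp (u \<bullet> Z om)) * exp (- sig\<^sup>2 * (norm u)\<^sup>2 / 2)"
  by (rule integral_mult_left_zero)
 finally show "char_fun (density lborel (gauss_mixture sig Z)) u
   = (CLINT om|M. iexp (u \<bullet> Z om)) * exp (- sig\<^sup>2 * (norm u)\<^sup>2 / 2)" .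
qed

text \<open>For fixed \<open>om\<close>, two Gaussians with the same isotropic covariance and
  centres \<open>Z om\<close>, \<open>Z' om\<close> have relative entropy |Z - Z'|^2 / (2 sig^2);
  joint convexity averages this over \<open>om\<close>. The joint law of the centres is free, so the
  entropy is bounded by a transport cost.\<close>

theorem Ent_gauss_mixture_le:
 fixes Z Z' :: "'a => 'e::euclidean_space"
 assumes s: "0 < sig" and Z [measurable]: "Z \<in> borel_measurable M" and Z' [measurable]: "Z' \<in> borel_measurable M"
  and sq: "integrable M (%om. (norm (Z om - Z' om))\<^sup>2)"
 shows "Ent (density lborel (gauss_mixture sig Z)) (density lborel (gauss_mixture sig Z'))
  <= ereal (expectation (%om. (norm (Z om - Z' om))\<^sup>2) / (2 * sig\<^sup>2))"
proof -
 interpret P: pair_sigma_finite M "lborel :: 'e measure" by standard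
 let ?p = "gauss_mixture sig Z" and ?q = "gauss_mixture sig Z'"
 \<comment> \<open>\<open>l om (x - Z om)\<close> is the logarithm of the ratio of the two component
   densities at \<open>x\<close>.\<close>
 define l where "l om y = (2 * (y \<bullet> (Z om - Z' om)) + (norm (Z om - Z' om))\<^sup>2) / (2 * sig\<^sup>2)" for om and y :: 'e
 define F where "F om x = gauss_density sig (x - Z om) * l om (x - Z om)" for om x
 have Fm [measurable]: "(%(om, x). F om x) \<in> borel_measurable (M \<Otimes>\<^sub>M lborel)"
  unfolding F_def l_def by measurable
 have eq: "gauss_density sig y * l om y = (1 / sig\<^sup>2) * (gauss_density sig y * (y \<bullet> (Z om - Z' om)))
   + ((norm (Z om - Z' om))\<^sup>2 / (2 * sig\<^sup>2)) * gauss_density sig y" for om and y :: 'e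
  using s by (simp add: l_def field_simps)
 have li: "integrable lborel (%y. gauss_density sig y * l om y)" for om
  unfolding eq
  by (intro Bochner_Integration.integrable_add integrable_mult_right integrable_gauss_inner gauss_density_integrable s)
 have lv: "(\<integral>y. gauss_density sig y * l om y \<partial>lborel) = (norm (Z om - Z' om))\<^sup>2 / (2 * sig\<^sup>2)" for om
  unfolding eq
  by (subst Bochner_Integration.integral_add[OF integrable_mult_right integrable_mult_right],
    (intro integrable_gauss_inner gauss_density_integrable s)+)
   (simp only: integral_mult_right_zero integral_gauss_inner[OF s] gauss_density_integral[OF s] mult_zero_right mult_1_right add_0)
 have Fi: "integrable lborel (F om)" for om
  unfolding F_def by (rule lborel_integrable_translate[OF li])
 have Fv: "(\<integral>x. F om x \<partial>lborel) = (norm (Z om - Z' om))\<^sup>2 / (2 * sig\<^sup>2)" for om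
  unfolding F_def using lborel_integral_translate[OF li[of om], of "Z om"] lv by simp
 define m2 where "m2 = (\<integral>y. gauss_density sig (y :: 'e) * (norm y)\<^sup>2 \<partial>lborel)"
 have Fa: "(\<integral>x. norm (F om x) \<partial>lborel) <= (m2 + 2 * (norm (Z om - Z' om))\<^sup>2) / (2 * sig\<^sup>2)" for om
 proof -
  let ?d = "norm (Z om - Z' om)"
  have "(\<integral>x. norm (F om x) \<partial>lborel) = (\<integral>y. norm (gauss_density sig y * l om y) \<partial>lborel)"
   unfolding F_def by (rule lborel_integral_translate[OF integrable_norm[OF li]])
  also have "\<dots> <= (\<integral>y. (gauss_density sig (y :: 'e) * (norm y)\<^sup>2 + 2 * ?d\<^sup>2 * gauss_density sig y) / (2 * sig\<^sup>2) \<partial>lborel)"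
  proof (rule Bochner_Integration.integral_mono)
   fix y :: 'e
   have "\<bar>2 * (y \<bullet> (Z om - Z' om)) + ?d\<^sup>2\<bar> <= 2 * (norm y * ?d) + ?d\<^sup>2"
    using Cauchy_Schwarz_ineq2[of y "Z om - Z' om"]
     abs_triangle_ineq[of "2 * (y \<bullet> (Z om - Z' om))" "?d\<^sup>2"]
    unfolding abs_mult by simp
   also have "2 * (norm y * ?d) <= (norm y)\<^sup>2 + ?d\<^sup>2"
    using sum_squares_bound[of "norm y" ?d] by simp
   finally have "\<bar>l om y\<bar> <= ((norm y)\<^sup>2 + 2 * ?d\<^sup>2) / (2 * sig\<^sup>2)"
    using s by (simp add: l_def abs_divide divide_right_mono)
   then have "gauss_density sig y * \<bar>l om y\<bar> <= gauss_density sig y * (((norm y)\<^sup>2 + 2 * ?d\<^sup>2) / (2 * sig\<^sup>2))"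
    using gauss_density_pos[OF s, of y] by (intro mult_left_mono) auto
   then show "norm (gauss_density sig y * l om y) <= (gauss_density sig y * (norm y)\<^sup>2 + 2 * ?d\<^sup>2 * gauss_density sig y) / (2 * sig\<^sup>2)"
    using gauss_density_pos[OF s, of y] by (simp add: abs_mult algebra_simps)
  qed (use li integrable_gauss_norm_sq[OF s, where 'e='e] gauss_density_integrable[OF s, where 'e='e] in auto)
  also have "\<dots> = (m2 + 2 * ?d\<^sup>2) / (2 * sig\<^sup>2)"
   using integrable_gauss_norm_sq[OF s, where 'e='e] gauss_density_integrable[OF s, where 'e='e] gauss_density_integral[OF s, where 'e='e]
   by (simp add: m2_def)
  finally show ?thesis .
 qed
 have int: "integrable (M \<Otimes>\<^sub>M lborel) (%(om, x). F om x)"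
 proof (rule P.Fubini_integrable[OF Fm])
  show "integrable M (%om. \<integral>x. norm (case (om, x) of (om, x) => F om x) \<partial>lborel)"
  proof (rule Bochner_Integration.integrable_bound)
   show "integrable M (%om. (m2 + 2 * (norm (Z om - Z' om))\<^sup>2) / (2 * sig\<^sup>2))" using sq by auto
   show "AE om in M. norm (\<integral>x. norm (case (om, x) of (om, x) => F om x) \<partial>lborel)
     <= norm ((m2 + 2 * (norm (Z om - Z' om))\<^sup>2) / (2 * sig\<^sup>2))"
   proof -
    have "0 <= m2"
     unfolding m2_def by (intro Bochner_Integration.integral_nonneg mult_nonneg_nonneg less_imp_le[OF gauss_density_pos[OF s]]) simp
    then show ?thesis using Fa by (auto intro!: AE_I2)
   qed
  qed measurable
 qed (use Fi in auto)
 have "AE x in lborel. ?p x * ln (?p x / ?q x) <= expectation (%om. F om x)"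
  using P.AE_integrable_snd[OF int]
 proof eventually_elim
  case (elim x)
  let ?a = "%om. gauss_density sig (x - Z om)" and ?b = "%om. gauss_density sig (x - Z' om)"
  have pq: "0 < ?p x" "0 < ?q x" by (rule gauss_mixture_pos[OF s Z] gauss_mixture_pos[OF s Z'])+
  \<comment> \<open>This is ln t <= t - 1 at t = (p / q) / (a / b), multiplied by a. In the mean
    over \<open>om\<close> the two correction terms become - p and q (p / q), which cancel.\<close>
  have pt: "?a om * ln (?p x / ?q x) <= F om x - ?a om + ?b om * (?p x / ?q x)" for om
  proof -
   have a: "0 < ?a om" and b: "0 < ?b om" using gauss_density_pos[OF s] by auto
   have "ln (?a om / ?b om) = l om (x - Z om)"
   proof -
    have "x - Z' om = (x - Z om) + (Z om - Z' om)" by simp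
    then have "(norm (x - Z' om))\<^sup>2 = (norm (x - Z om))\<^sup>2 + 2 * ((x - Z om) \<bullet> (Z om - Z' om)) + (norm (Z om - Z' om))\<^sup>2"
     by (simp only: power2_norm_eq_inner inner_add_left inner_add_right) (simp add: inner_commute)
    moreover have "?a om / ?b om = exp ((norm (x - Z' om))\<^sup>2 / (2 * sig\<^sup>2) - (norm (x - Z om))\<^sup>2 / (2 * sig\<^sup>2))"
     using s by (simp add: gauss_density_eq flip: exp_diff)
    ultimately show ?thesis by (simp add: l_def add_divide_distrib)
   qed
   moreover have "ln (?p x / ?q x) - ln (?a om / ?b om) <= (?p x / ?q x) / (?a om / ?b om) - 1"
    using ln_le_minus_one[of "(?p x / ?q x) / (?a om / ?b om)"] a b pq by (simp add: ln_div ln_mult)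
   ultimately have "?a om * (ln (?p x / ?q x) - l om (x - Z om)) <= ?a om * ((?p x / ?q x) / (?a om / ?b om) - 1)"
    using a by (intro mult_left_mono) auto
   also have "\<dots> = ?b om * (?p x / ?q x) - ?a om" using a b by (simp add: field_simps)
   finally show ?thesis by (simp add: F_def algebra_simps)
  qed
  have "?p x * ln (?p x / ?q x) = expectation (%om. ?a om * ln (?p x / ?q x))"
   by (simp add: gauss_mixture_def)
  also have "\<dots> <= expectation (%om. F om x - ?a om + ?b om * (?p x / ?q x))"
   by (intro integral_mono pt Bochner_Integration.integrable_add Bochner_Integration.integrable_diff integrable_mult_left elim
     integrable_gauss_mixture_kernel s Z Z')
  also have "\<dots> = expectation (%om. F om x) - ?p x + ?q x * (?p x / ?q x)"
   using elim integrable_gauss_mixture_kernel[OF s Z, of x] integrable_gauss_mixture_kernel[OF s Z', of x]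
   by (simp add: gauss_mixture_def)
  also have "\<dots> = expectation (%om. F om x)" using pq by simp
  finally show ?case .
 qed
 then have "Ent (density lborel ?p) (density lborel ?q) <= ereal (\<integral>x. expectation (%om. F om x) \<partial>lborel)"
  by (intro Ent_density_le gauss_mixture_measurable gauss_mixture_pos gauss_mixture_integrable
    P.integrable_snd[OF int] s Z Z')
 also have "(\<integral>x. expectation (%om. F om x) \<partial>lborel) = expectation (%om. (norm (Z om - Z' om))\<^sup>2 / (2 * sig\<^sup>2))"
  using P.Fubini_integral[OF int] by (simp add: Fv)
 finally show ?thesis by simp
qed

end

section \<open>Gaussian laws on the line and Gaussian vectors with given covariance\<close>

lemma real_distribution_normal_law: "0 <= v ==> real_distribution (normal_law m v)"
 unfolding real_distribution_def real_distribution_axioms_def normal_law_def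
 by (auto simp: prob_space_return prob_space_normal_density)

lemma char_normal_law:
 assumes "0 <= v"
 shows "char (normal_law m v) s = iexp (s * m) * exp (- v * s\<^sup>2 / 2)"
proof (cases "v = 0")
 case True
 then show ?thesis by (simp add: normal_law_def char_def integral_return)
next
 case False
 then have "char (normal_law m v) s = (CLINT x|lborel. normal_density m (sqrt v) x *\<^sub>R iexp (s * x))"
  unfolding normal_law_def char_def by (simp add: integral_density)
 then show ?thesis using False assms char_normal_density[of "sqrt v" m s] by simp
qed

lemma (in prob_space) normal_law_from_char:
 fixes X :: "'a => real"
 assumes X [measurable]: "X \<in> borel_measurable M" and v: "0 <= v"
  and ch: "\<And>s. (CLINT om|M. iexp (s * X om)) = iexp (s * m) * exp (- v * s\<^sup>2 / 2)"
 shows "distr M borel X = normal_law m v"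
proof (rule Levy_uniqueness)
 show "real_distribution (distr M borel X)" by simp
 show "real_distribution (normal_law m v)" by (rule real_distribution_normal_law[OF v])
 show "char (distr M borel X) = char (normal_law m v)"
 proof
  fix s
  have "char (distr M borel X) s = (CLINT om|M. iexp (s * X om))"
   unfolding char_def by (subst integral_distr) auto
  then show "char (distr M borel X) s = char (normal_law m v) s"
   using ch char_normal_law[OF v] by simp
 qed
qed

lemma (in prob_space)
 fixes X :: "'a => real"
 assumes X [measurable]: "X \<in> borel_measurable M" and v: "0 <= v" and law: "distr M borel X = normal_law m v"
 shows normal_law_integrable: "integrable M X"
  and normal_law_mean: "expectation X = m"
  and normal_law_integrable_sq: "integrable M (%om. (X om - m)\<^sup>2)"
  and normal_law_variance: "expectation (%om. (X om - m)\<^sup>2) = v"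
proof -
 have "integrable (normal_law m v) (%x. x) \<and> (\<integral>x. x \<partial>normal_law m v) = m \<and>
   integrable (normal_law m v) (%x. (x - m)\<^sup>2) \<and> (\<integral>x. (x - m)\<^sup>2 \<partial>normal_law m v) = v"
 proof (cases "v = 0")
  case True
  interpret R: prob_space "return borel m" by (rule prob_space_return) simp
  have *: "integrable (return borel m) f" if "f \<in> borel_measurable borel" for f :: "real => real"
  proof (subst integrable_cong_AE)
   show "AE x in return borel m. f x = f m"
    using that by (subst AE_return) auto
  qed (use that in auto)
  show ?thesis using True by (auto simp: normal_law_def integral_return intro!: *)
 next
  case False
  then have s: "0 < sqrt v" using v by simp
  have e: "has_bochner_integral lborel (%x. normal_density m (sqrt v) x * (x - m)\<^sup>2) v"
   using normal_moment_even[OF s, of m 1] v by (simp add: fact_numeral)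
  show ?thesis
   using False normal_moment_nz_1[OF s, of m] e
   by (auto simp: normal_law_def has_bochner_integral_iff integrable_density integral_density)
 qed
 then show "integrable M X" "expectation X = m" "integrable M (%om. (X om - m)\<^sup>2)" "expectation (%om. (X om - m)\<^sup>2) = v"
  unfolding law[symmetric] by (simp_all add: integrable_distr_eq integral_distr)
qed

text \<open>The centred Gaussian vector \<open>\<Sum>i<k. \<xi>\<^sub>i v\<^sub>i\<close> with independent standard normal \<open>\<xi>\<^sub>i\<close>.\<close>

lemma psd_gaussian_vector_exists:
 fixes C :: "real^'n^'n"
 assumes "psd C"
 shows "\<exists>(N :: (nat => real) measure) G. prob_space N \<and> G \<in> borel_measurable N \<and>
  (\<forall>u. (CLINT om|N. iexp (u \<bullet> G om)) = exp (- (u \<bullet> (C *v u)) / 2))"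
proof -
 obtain v :: "nat => real^'n" and k where v: "\<And>x. x \<bullet> (C *v x) = (\<Sum>i<k. (v i \<bullet> x)\<^sup>2)"
  using psd_rank_one_decomposition[OF assms] by blast
 interpret S: prob_space std_normal_distribution
  using real_dist_normal_dist by (simp add: real_distribution_def)
 interpret product_prob_space "%_ :: nat. std_normal_distribution" "{..<k}"
  by standard
 let ?N = "\<Pi>\<^sub>M i\<in>{..<k}. std_normal_distribution"
 define G where "G om = (\<Sum>i<k. om i *\<^sub>R v i)" for om :: "nat => real"
 have "(%om. om i) \<in> borel_measurable ?N" if "i < k" for i
  using measurable_component_singleton[of i "{..<k}" "%_. std_normal_distribution"] that by simp
 then have Gm: "G \<in> borel_measurable ?N"
  unfolding G_def by (intro borel_measurable_sum borel_measurable_scaleR measurable_const) auto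
 have "(CLINT om|?N. iexp (u \<bullet> G om)) = exp (- (u \<bullet> (C *v u)) / 2)" for u
 proof -
  have "(CLINT om|?N. iexp (u \<bullet> G om)) = (CLINT om|?N. (\<Prod>i<k. iexp ((v i \<bullet> u) * om i)))"
   by (intro Bochner_Integration.integral_cong refl)
    (simp add: G_def inner_sum_right exp_sum sum_distrib_left inner_commute mult.commute)
  also have "\<dots> = (\<Prod>i<k. CLINT x|std_normal_distribution. iexp ((v i \<bullet> u) * x))"
   by (rule product_integral_prod) (auto intro!: S.integrable_const_bound[where B = 1])
  also have "\<dots> = (\<Prod>i<k. of_real (exp (- ((v i \<bullet> u)\<^sup>2) / 2)))"
   using char_std_normal_distribution unfolding char_def fun_eq_iff by (simp only:)
  also have "\<dots> = of_real (exp (\<Sum>i<k. - ((v i \<bullet> u)\<^sup>2) / 2))"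
   by (simp add: exp_sum)
  also have "(\<Sum>i<k. - ((v i \<bullet> u)\<^sup>2) / 2) = - (u \<bullet> (C *v u)) / 2"
   by (simp add: v sum_negf flip: sum_divide_distrib)
  finally show ?thesis .
 qed
 then show ?thesis using Gm prob_space_axioms by blast
qed

lemma (in prob_space) gaussian_norm_sq:
 fixes G :: "'a => real^'n" and C :: "real^'n^'n"
 assumes G [measurable]: "G \<in> borel_measurable M" and C: "psd C"
  and ch: "\<And>u. (CLINT om|M. iexp (u \<bullet> G om)) = exp (- (u \<bullet> (C *v u)) / 2)"
  and le: "\<And>x. x \<bullet> (C *v x) <= k * (norm x)\<^sup>2"
 shows "integrable M (%om. (norm (G om))\<^sup>2)" "expectation (%om. (norm (G om))\<^sup>2) <= real CARD('n) * k"
proof -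
 have law: "distr M borel (%om. b \<bullet> G om) = normal_law 0 (b \<bullet> (C *v b))" for b
 proof (rule normal_law_from_char)
  fix s
  show "(CLINT om|M. iexp (s * (b \<bullet> G om))) = iexp (s * 0) * exp (- (b \<bullet> (C *v b)) * s\<^sup>2 / 2)"
   using ch[of "s *\<^sub>R b"] by (simp add: matrix_vector_linear power2_eq_square ac_simps)
 qed (use C in \<open>auto simp: psd_def\<close>)
 have nn: "0 <= b \<bullet> (C *v b)" for b using C by (simp add: psd_def)
 have i: "integrable M (%om. (b \<bullet> G om)\<^sup>2)" "expectation (%om. (b \<bullet> G om)\<^sup>2) = b \<bullet> (C *v b)" for b
  using normal_law_integrable_sq[OF _ nn law, of b] normal_law_variance[OF _ nn law, of b] by auto
 have eq: "(norm (G om))\<^sup>2 = (\<Sum>b\<in>Basis. (b \<bullet> G om)\<^sup>2)" for om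
  by (subst norm_sq_Basis) (simp add: inner_commute)
 show "integrable M (%om. (norm (G om))\<^sup>2)" unfolding eq using i by auto
 have "expectation (%om. (norm (G om))\<^sup>2) = (\<Sum>b\<in>(Basis :: (real^'n) set). b \<bullet> (C *v b))"
  unfolding eq using i by (simp add: Bochner_Integration.integral_sum)
 also have "\<dots> <= (\<Sum>b\<in>(Basis :: (real^'n) set). k)"
  using le by (intro sum_mono) (metis mult_1_right norm_Basis one_power2)
 finally show "expectation (%om. (norm (G om))\<^sup>2) <= real CARD('n) * k" by simp
qed

lemma integral_pair_mult:
 fixes f :: "'a => complex" and g :: "'b => complex"
 assumes "prob_space M" "prob_space N"
  and [measurable]: "f \<in> borel_measurable M" "g \<in> borel_measurable N"
  and "\<And>x. norm (f x) <= 1" "\<And>x. norm (g x) <= 1"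
 shows "(CLINT z|M \<Otimes>\<^sub>M N. f (fst z) * g (snd z)) = (CLINT x|M. f x) * (CLINT y|N. g y)"
proof -
 interpret M: prob_space M by fact
 interpret N: prob_space N by fact
 interpret P: pair_prob_space M N by standard
 have "integrable (M \<Otimes>\<^sub>M N) (%z. f (fst z) * g (snd z))"
  by (rule P.integrable_const_bound[where B = 1]) (use assms(5,6) in \<open>auto simp: norm_mult intro!: AE_I2 mult_le_one\<close>)
 from P.integral_fst'[OF this] show ?thesis by simp
qed

lemma (in prob_space)
 fixes f :: "'b => real"
 assumes "prob_space N" "f \<in> borel_measurable N" "integrable N f"
 shows integrable_pair_snd: "integrable (M \<Otimes>\<^sub>M N) (%z. f (snd z))"
  and integral_pair_snd: "(\<integral>z. f (snd z) \<partial>(M \<Otimes>\<^sub>M N)) = (\<integral>y. f y \<partial>N)"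
proof -
 interpret N: prob_space N by fact
 interpret P: pair_prob_space M N by standard
 show i: "integrable (M \<Otimes>\<^sub>M N) (%z. f (snd z))"
  by (rule P.Fubini_integrable) (use assms in auto)
 from P.integral_fst'[OF this] show "(\<integral>z. f (snd z) \<partial>(M \<Otimes>\<^sub>M N)) = (\<integral>y. f y \<partial>N)"
  by (simp add: prob_space)
qed

lemma (in prob_space)
 fixes f :: "'a => real"
 assumes "prob_space N" "f \<in> borel_measurable M" "integrable M f"
 shows integrable_pair_fst: "integrable (M \<Otimes>\<^sub>M N) (%z. f (fst z))"
  and integral_pair_fst: "(\<integral>z. f (fst z) \<partial>(M \<Otimes>\<^sub>M N)) = (\<integral>y. f y \<partial>M)"
proof -
 interpret N: prob_space N by fact
 interpret P: pair_prob_space M N by standard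
 show i: "integrable (M \<Otimes>\<^sub>M N) (%z. f (fst z))"
  by (rule P.Fubini_integrable) (use assms in \<open>auto simp: N.prob_space\<close>)
 from P.integral_fst'[OF this] show "(\<integral>z. f (fst z) \<partial>(M \<Otimes>\<^sub>M N)) = (\<integral>y. f y \<partial>M)"
  by (simp add: N.prob_space)
qed

text \<open>Common part trick: \<open>P\<close> and \<open>P'\<close> are both \<open>(l / 2) I + C\<close> plus a small positive matrix, so the two
 Gaussian noises can be coupled at a cost linear in \<open>P - P'\<close>.\<close>

theorem (in prob_space) Ent_gaussian_le:
 fixes m m' :: "'a => real^'n" and P P' :: "real^'n^'n"
 assumes \<nu>: "prob_space \<nu>" "sets \<nu> = sets borel" and \<nu>': "prob_space \<nu>'" "sets \<nu>' = sets borel"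
  and m [measurable]: "m \<in> borel_measurable M" "m' \<in> borel_measurable M"
  and sq: "integrable M (%om. (norm (m om - m' om))\<^sup>2)"
  and sym: "symmetric_mat P" "symmetric_mat P'"
  and l: "0 < l" and P'l: "\<And>x. l * (norm x)\<^sup>2 <= x \<bullet> (P' *v x)"
  and close: "norm (P - P') <= l / 2"
  and ch: "\<And>u. char_fun \<nu> u = (CLINT om|M. iexp (u \<bullet> m om)) * exp (- (u \<bullet> (P *v u)) / 2)"
  and ch': "\<And>u. char_fun \<nu>' u = (CLINT om|M. iexp (u \<bullet> m' om)) * exp (- (u \<bullet> (P' *v u)) / 2)"
 shows "Ent \<nu> \<nu>' <= ereal ((2 * expectation (%om. (norm (m om - m' om))\<^sup>2) + 12 * real CARD('n) * norm (P - P')) / l)"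
proof -
 define d where "d = norm (P - P')"
 have d: "0 <= d" by (simp add: d_def)
 \<comment> \<open>P = (l / 2) I + C + D and P' = (l / 2) I + C + D'. The multiple d I of the
   identity is borrowed from P' because P - P' alone need not be nonnegative; there is room for it
   since d <= l / 2.\<close>
 define C where "C = P' - (l / 2 + d) *\<^sub>R mat 1"
 define D where "D = d *\<^sub>R mat 1 + (P - P')"
 define D' where "D' = d *\<^sub>R (mat 1 :: real^'n^'n)"
 have symI: "symmetric_mat (mat 1 :: real^'n^'n)" by (simp add: symmetric_mat_def transpose_mat)
 have symlin: "symmetric_mat X ==> symmetric_mat Y ==> symmetric_mat (X + Y)"
  "symmetric_mat X ==> symmetric_mat Y ==> symmetric_mat (X - Y)"
  "symmetric_mat X ==> symmetric_mat (r *\<^sub>R X)" for X Y :: "real^'n^'n" and r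
  by (simp_all add: symmetric_mat_def transpose_def vec_eq_iff)
 have form: "x \<bullet> (C *v x) = x \<bullet> (P' *v x) - (l / 2 + d) * (norm x)\<^sup>2"
  "x \<bullet> (D *v x) = d * (norm x)\<^sup>2 + x \<bullet> ((P - P') *v x)"
  "x \<bullet> (D' *v x) = d * (norm x)\<^sup>2" for x
  by (simp_all add: C_def D_def D'_def matrix_vector_linear inner_add_right inner_diff_right
    power2_norm_eq_inner)
 have pb: "\<bar>x \<bullet> ((P - P') *v x)\<bar> <= d * (norm x)\<^sup>2" for x
  using inner_matrix_vector_le[of x "P - P'" x] by (simp add: d_def power2_eq_square mult.assoc)
 have psdC: "psd C"
  unfolding psd_def
 proof (intro conjI allI)
  show "symmetric_mat C" unfolding C_def by (intro symlin sym symI)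
  show "0 <= x \<bullet> (C *v x)" for x
  proof -
   have "(l / 2 + d) * (norm x)\<^sup>2 <= l * (norm x)\<^sup>2"
    using close by (intro mult_right_mono) (auto simp: d_def)
   then show ?thesis using P'l[of x] by (simp add: form)
  qed
 qed
 have psdD: "psd D"
  unfolding psd_def
 proof (intro conjI allI)
  show "symmetric_mat D" unfolding D_def by (intro symlin sym symI)
  show "0 <= x \<bullet> (D *v x)" for x
   using pb[of x] unfolding form by linarith
 qed
 have psdD': "psd D'" unfolding psd_def D'_def using d
  by (auto intro!: symlin symI simp: form[unfolded D'_def])
 obtain N1 :: "(nat => real) measure" and G1 where N1: "prob_space N1" and G1 [measurable]: "G1 \<in> borel_measurable N1"
  and c1: "\<And>u. (CLINT om|N1. iexp (u \<bullet> G1 om)) = exp (- (u \<bullet> (C *v u)) / 2)"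
  using psd_gaussian_vector_exists[OF psdC] by blast
 obtain N2 :: "(nat => real) measure" and G2 where N2: "prob_space N2" and G2 [measurable]: "G2 \<in> borel_measurable N2"
  and c2: "\<And>u. (CLINT om|N2. iexp (u \<bullet> G2 om)) = exp (- (u \<bullet> (D *v u)) / 2)"
  using psd_gaussian_vector_exists[OF psdD] by blast
 obtain N3 :: "(nat => real) measure" and G3 where N3: "prob_space N3" and G3 [measurable]: "G3 \<in> borel_measurable N3"
  and c3: "\<And>u. (CLINT om|N3. iexp (u \<bullet> G3 om)) = exp (- (u \<bullet> (D' *v u)) / 2)"
  using psd_gaussian_vector_exists[OF psdD'] by blast
 interpret N1: prob_space N1 by fact
 interpret N2: prob_space N2 by fact
 interpret N3: prob_space N3 by fact
 interpret N23: pair_prob_space N2 N3 by standard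
 interpret N123: pair_prob_space N1 "N2 \<Otimes>\<^sub>M N3" by standard
 interpret NN: pair_prob_space M "N1 \<Otimes>\<^sub>M (N2 \<Otimes>\<^sub>M N3)" by standard
 let ?N = "M \<Otimes>\<^sub>M (N1 \<Otimes>\<^sub>M (N2 \<Otimes>\<^sub>M N3))"
 \<comment> \<open>Both sides share \<open>G1\<close> and the randomness of the means; the noises
   differ only by \<open>G2\<close> and \<open>G3\<close>, whose covariances are of order
   \<open>d\<close>.\<close>
 define Z where "Z z = m (fst z) + (G1 (fst (snd z)) + G2 (fst (snd (snd z))))" for z :: "'a \<times> (nat => real) \<times> (nat => real) \<times> (nat => real)"
 define Z' where "Z' z = m' (fst z) + (G1 (fst (snd z)) + G3 (snd (snd (snd z))))" for z :: "'a \<times> (nat => real) \<times> (nat => real) \<times> (nat => real)"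
 have Zm [measurable]: "Z \<in> borel_measurable ?N" "Z' \<in> borel_measurable ?N"
  unfolding Z_def Z'_def by measurable
 have e2: "integrable N2 (%om. (norm (G2 om))\<^sup>2)" "N2.expectation (%om. (norm (G2 om))\<^sup>2) <= real CARD('n) * (2 * d)"
 proof -
  have "x \<bullet> (D *v x) <= 2 * d * (norm x)\<^sup>2" for x
   using pb[of x] unfolding form by linarith
  from N2.gaussian_norm_sq[OF G2 psdD c2 this]
  show "integrable N2 (%om. (norm (G2 om))\<^sup>2)" "N2.expectation (%om. (norm (G2 om))\<^sup>2) <= real CARD('n) * (2 * d)"
   by auto
 qed
 have e3: "integrable N3 (%om. (norm (G3 om))\<^sup>2)" "N3.expectation (%om. (norm (G3 om))\<^sup>2) <= real CARD('n) * d"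
  using N3.gaussian_norm_sq[OF G3 psdD' c3, of d] by (auto simp: form)
 let ?f = "%z. 2 * (norm (m (fst z) - m' (fst z)))\<^sup>2 + (4 * (norm (G2 (fst (snd (snd z)))))\<^sup>2 + 4 * (norm (G3 (snd (snd (snd z)))))\<^sup>2)"
 have i2: "integrable ?N (%z. (norm (G2 (fst (snd (snd z)))))\<^sup>2)"
  "(\<integral>z. (norm (G2 (fst (snd (snd z)))))\<^sup>2 \<partial>?N) = N2.expectation (%om. (norm (G2 om))\<^sup>2)"
  using integrable_pair_snd[OF N123.prob_space_axioms _ N1.integrable_pair_snd[OF N23.prob_space_axioms _ N2.integrable_pair_fst[OF N3 _ e2(1)]]]
   integral_pair_snd[OF N123.prob_space_axioms _ N1.integrable_pair_snd[OF N23.prob_space_axioms _ N2.integrable_pair_fst[OF N3 _ e2(1)]]]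
   N1.integral_pair_snd[OF N23.prob_space_axioms _ N2.integrable_pair_fst[OF N3 _ e2(1)]]
   N2.integral_pair_fst[OF N3 _ e2(1)] by auto
 have i3: "integrable ?N (%z. (norm (G3 (snd (snd (snd z)))))\<^sup>2)"
  "(\<integral>z. (norm (G3 (snd (snd (snd z)))))\<^sup>2 \<partial>?N) = N3.expectation (%om. (norm (G3 om))\<^sup>2)"
  using integrable_pair_snd[OF N123.prob_space_axioms _ N1.integrable_pair_snd[OF N23.prob_space_axioms _ N2.integrable_pair_snd[OF N3 _ e3(1)]]]
   integral_pair_snd[OF N123.prob_space_axioms _ N1.integrable_pair_snd[OF N23.prob_space_axioms _ N2.integrable_pair_snd[OF N3 _ e3(1)]]]
   N1.integral_pair_snd[OF N23.prob_space_axioms _ N2.integrable_pair_snd[OF N3 _ e3(1)]]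
   N2.integral_pair_snd[OF N3 _ e3(1)] by auto
 have i1: "integrable ?N (%z. (norm (m (fst z) - m' (fst z)))\<^sup>2)"
  "(\<integral>z. (norm (m (fst z) - m' (fst z)))\<^sup>2 \<partial>?N) = expectation (%om. (norm (m om - m' om))\<^sup>2)"
  using integrable_pair_fst[OF N123.prob_space_axioms _ sq] integral_pair_fst[OF N123.prob_space_axioms _ sq] by auto
 have fi: "integrable ?N ?f" using i1 i2 i3 by auto
 have le: "(norm (Z z - Z' z))\<^sup>2 <= ?f z" for z
 proof -
  have gen: "(norm (x + y))\<^sup>2 <= 2 * (norm x)\<^sup>2 + 2 * (norm y)\<^sup>2" for x y :: "real^'n"
  proof -
   have "(norm (x + y))\<^sup>2 + (norm (x - y))\<^sup>2 = 2 * (norm x)\<^sup>2 + 2 * (norm y)\<^sup>2"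
    by (simp add: power2_norm_eq_inner inner_add_left inner_add_right inner_diff_left inner_diff_right)
   then show ?thesis using zero_le_power2[of "norm (x - y)"] by linarith
  qed
  let ?x = "m (fst z) - m' (fst z)" and ?g = "G2 (fst (snd (snd z)))" and ?h = "G3 (snd (snd (snd z)))"
  have "Z z - Z' z = ?x + (?g + - ?h)" by (simp add: Z_def Z'_def)
  then show ?thesis using gen[of ?x "?g + - ?h"] gen[of ?g "- ?h"] by simp
 qed
 have sqZ: "integrable ?N (%z. (norm (Z z - Z' z))\<^sup>2)"
  by (rule Bochner_Integration.integrable_bound[OF fi]) (use le in \<open>auto intro!: AE_I2 intro: order_trans abs_ge_self\<close>)
 \<comment> \<open>12 = 4 * 2 + 4 * 1, as the forms of \<open>D\<close> and \<open>D'\<close> are at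
   most 2 d and d times the squared norm.\<close>
 have Ele: "NN.expectation (%z. (norm (Z z - Z' z))\<^sup>2) <= 2 * expectation (%om. (norm (m om - m' om))\<^sup>2) + 12 * real CARD('n) * d"
 proof -
  have "NN.expectation (%z. (norm (Z z - Z' z))\<^sup>2) <= NN.expectation ?f"
   by (intro Bochner_Integration.integral_mono sqZ fi le)
  also have "\<dots> = 2 * expectation (%om. (norm (m om - m' om))\<^sup>2) + (4 * N2.expectation (%om. (norm (G2 om))\<^sup>2) + 4 * N3.expectation (%om. (norm (G3 om))\<^sup>2))"
   using i1 i2 i3 by simp
  finally show ?thesis using e2 e3 by (simp add: algebra_simps)
 qed
 define sig where "sig = sqrt (l / 2)"
 have s: "0 < sig" "sig\<^sup>2 = l / 2" using l by (simp_all add: sig_def)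
 have chZ: "(CLINT z|?N. iexp (u \<bullet> Z z)) = (CLINT om|M. iexp (u \<bullet> m om)) * (exp (- (u \<bullet> (C *v u)) / 2) * exp (- (u \<bullet> (D *v u)) / 2))" for u
 proof -
  have e: "iexp (u \<bullet> Z z) = iexp (u \<bullet> m (fst z)) * (%w. iexp (u \<bullet> G1 (fst w)) * (%w. iexp (u \<bullet> G2 (fst w)) * 1) (snd w)) (snd z)" for z
   by (simp add: Z_def inner_add_right distrib_left exp_add)
  have "(CLINT z|?N. iexp (u \<bullet> Z z)) = (CLINT om|M. iexp (u \<bullet> m om)) *
   (CLINT w|N1 \<Otimes>\<^sub>M (N2 \<Otimes>\<^sub>M N3). iexp (u \<bullet> G1 (fst w)) * (%w. iexp (u \<bullet> G2 (fst w)) * 1) (snd w))"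
   unfolding e by (rule integral_pair_mult) (auto simp: norm_mult prob_space_axioms N123.prob_space_axioms)
  also have "(CLINT w|N1 \<Otimes>\<^sub>M (N2 \<Otimes>\<^sub>M N3). iexp (u \<bullet> G1 (fst w)) * (%w. iexp (u \<bullet> G2 (fst w)) * 1) (snd w))
   = (CLINT w|N1. iexp (u \<bullet> G1 w)) * (CLINT w|N2 \<Otimes>\<^sub>M N3. iexp (u \<bullet> G2 (fst w)) * 1)"
   by (rule integral_pair_mult) (auto simp: norm_mult N1 N23.prob_space_axioms)
  also have "(CLINT w|N2 \<Otimes>\<^sub>M N3. iexp (u \<bullet> G2 (fst w)) * 1) = (CLINT w|N2. iexp (u \<bullet> G2 w)) * (CLINT w|N3. 1)"
   by (rule integral_pair_mult[of N2 N3 _ "%_. 1"]) (auto simp: N2 N3)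
  finally show ?thesis by (simp only: c1 c2) (simp add: N3.prob_space)
 qed
 have chZ': "(CLINT z|?N. iexp (u \<bullet> Z' z)) = (CLINT om|M. iexp (u \<bullet> m' om)) * (exp (- (u \<bullet> (C *v u)) / 2) * exp (- (u \<bullet> (D' *v u)) / 2))" for u
 proof -
  have e: "iexp (u \<bullet> Z' z) = iexp (u \<bullet> m' (fst z)) * (%w. iexp (u \<bullet> G1 (fst w)) * (%w. 1 * iexp (u \<bullet> G3 (snd w))) (snd w)) (snd z)" for z
   by (simp add: Z'_def inner_add_right distrib_left exp_add)
  have "(CLINT z|?N. iexp (u \<bullet> Z' z)) = (CLINT om|M. iexp (u \<bullet> m' om)) *
   (CLINT w|N1 \<Otimes>\<^sub>M (N2 \<Otimes>\<^sub>M N3). iexp (u \<bullet> G1 (fst w)) * (%w. 1 * iexp (u \<bullet> G3 (snd w))) (snd w))"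
   unfolding e by (rule integral_pair_mult) (auto simp: norm_mult prob_space_axioms N123.prob_space_axioms)
  also have "(CLINT w|N1 \<Otimes>\<^sub>M (N2 \<Otimes>\<^sub>M N3). iexp (u \<bullet> G1 (fst w)) * (%w. 1 * iexp (u \<bullet> G3 (snd w))) (snd w))
   = (CLINT w|N1. iexp (u \<bullet> G1 w)) * (CLINT w|N2 \<Otimes>\<^sub>M N3. 1 * iexp (u \<bullet> G3 (snd w)))"
   by (rule integral_pair_mult) (auto simp: norm_mult N1 N23.prob_space_axioms)
  also have "(CLINT w|N2 \<Otimes>\<^sub>M N3. 1 * iexp (u \<bullet> G3 (snd w))) = (CLINT w|N2. 1) * (CLINT w|N3. iexp (u \<bullet> G3 w))"
   by (rule integral_pair_mult[of N2 N3 "%_. 1"]) (auto simp: N2 N3)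
  finally show ?thesis by (simp only: c1 c3) (simp add: N2.prob_space)
 qed
 have "\<nu> = density lborel (NN.gauss_mixture sig Z)"
 proof (rule char_fun_unique[OF \<nu> NN.gauss_mixture_prob[OF s(1) Zm(1)]])
  show "char_fun \<nu> = char_fun (density lborel (NN.gauss_mixture sig Z))"
  proof
   fix u
   have "- (u \<bullet> (P *v u)) / 2 = - (u \<bullet> (C *v u)) / 2 + - (u \<bullet> (D *v u)) / 2 + - sig\<^sup>2 * (norm u)\<^sup>2 / 2"
    unfolding form s by (simp add: matrix_vector_linear inner_diff_right field_simps)
   then show "char_fun \<nu> u = char_fun (density lborel (NN.gauss_mixture sig Z)) u"
    unfolding NN.char_fun_gauss_mixture[OF s(1) Zm(1)] chZ ch by (simp only: exp_add) simp
  qed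
 qed simp
 moreover have "\<nu>' = density lborel (NN.gauss_mixture sig Z')"
 proof (rule char_fun_unique[OF \<nu>' NN.gauss_mixture_prob[OF s(1) Zm(2)]])
  show "char_fun \<nu>' = char_fun (density lborel (NN.gauss_mixture sig Z'))"
  proof
   fix u
   have "- (u \<bullet> (P' *v u)) / 2 = - (u \<bullet> (C *v u)) / 2 + - (u \<bullet> (D' *v u)) / 2 + - sig\<^sup>2 * (norm u)\<^sup>2 / 2"
    unfolding form s by (simp add: field_simps)
   then show "char_fun \<nu>' u = char_fun (density lborel (NN.gauss_mixture sig Z')) u"
    unfolding NN.char_fun_gauss_mixture[OF s(1) Zm(2)] chZ' ch' by (simp only: exp_add) simp
  qed
 qed simp
 ultimately have "Ent \<nu> \<nu>' <= ereal (NN.expectation (%z. (norm (Z z - Z' z))\<^sup>2) / (2 * sig\<^sup>2))"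
  using NN.Ent_gauss_mixture_le[OF s(1) Zm sqZ] by simp
 also have "\<dots> <= ereal ((2 * expectation (%om. (norm (m om - m' om))\<^sup>2) + 12 * real CARD('n) * norm (P - P')) / l)"
  using Ele l by (simp add: s d_def divide_right_mono)
 finally show ?thesis .
qed

section \<open>Conditional laws and Brownian increments\<close>

locale conditional_law = prob_space M for M :: "'a measure" +
 fixes F :: "'a measure" and X :: "'a => 'e::euclidean_space" and \<eta> :: "'a => 'e measure"
 assumes sub: "subalgebra M F" and X_meas [measurable]: "X \<in> borel_measurable M"
  and law: "is_cond_law M F X \<eta>"
begin

lemma finite_subalg: "finite_measure_subalgebra M F"
 using sub by (simp add: finite_measure_subalgebra_def finite_measure_subalgebra_axioms_def finite_measure_axioms)

lemma kernel_F: "\<eta> \<in> measurable F (subprob_algebra borel)"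
 using law unfolding is_cond_law_def by (blast dest: measurable_prob_algebraD)

lemma kernel_M [measurable]: "\<eta> \<in> measurable M (subprob_algebra borel)"
 by (rule measurable_from_subalg[OF sub kernel_F])

lemma kernel_prob:
 assumes "om \<in> space M"
 shows "prob_space (\<eta> om)" "sets (\<eta> om) = sets borel"
proof -
 have "\<eta> \<in> measurable F (prob_algebra borel)" using law by (simp add: is_cond_law_def)
 moreover have "om \<in> space F" using assms sub by (simp add: subalgebra_def)
 ultimately have "\<eta> om \<in> space (prob_algebra borel)" by (rule measurable_space)
 then show "prob_space (\<eta> om)" "sets (\<eta> om) = sets borel"
  by (auto simp: space_prob_algebra)
qed

lemma F_sets: "A \<in> sets F ==> A \<in> sets M"
 using sub by (auto simp: subalgebra_def)

text \<open>\<open>is_cond_law\<close> speaks of one Borel set at a time; a monotone class argument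
  extends it to nonnegative functions. The localisation on a set of \<open>F\<close> is what
  characterises conditional expectations.\<close>

lemma nn_disintegration:
 assumes A: "A \<in> sets F" and f: "f \<in> borel_measurable borel"
 shows "(\<integral>\<^sup>+om. indicator A om * f (X om) \<partial>M) = (\<integral>\<^sup>+om. indicator A om * (\<integral>\<^sup>+x. f x \<partial>\<eta> om) \<partial>M)"
proof -
 note AM [measurable] = F_sets[OF A]
 interpret FS: finite_measure_subalgebra M F by (rule finite_subalg)
 have int_meas: "(%om. \<integral>\<^sup>+x. g x \<partial>\<eta> om) \<in> borel_measurable M" if "g \<in> borel_measurable borel" for g :: "'e => ennreal"
  using measurable_compose[OF kernel_M nn_integral_measurable_subprob_algebra[OF that]] .
 have eta_cong: "borel_measurable (\<eta> om) = borel_measurable borel" if "om \<in> space M" for om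
  using measurable_cong_sets[OF kernel_prob(2)[OF that] refl] .
 show ?thesis using f
 proof (induction f rule: borel_measurable_induct)
  case (cong f g)
  then show ?case by simp
 next
  case (set B)
  let ?I = "indicator (X -` B \<inter> space M) :: 'a => real"
  have Bm: "X -` B \<inter> space M \<in> sets M" using set by measurable
  have Ii: "integrable M ?I" using Bm by (simp add: emeasure_eq_measure)
  have mm: "(%om. measure (\<eta> om) B) \<in> borel_measurable M"
   using measurable_compose[OF kernel_M measurable_measure_subprob_algebra[OF set]] by simp
  have "(\<integral>om. indicator A om * ?I om \<partial>M) = (\<integral>om. indicator A om * real_cond_exp M F ?I om \<partial>M)"
   using FS.real_cond_exp_intA[OF Ii A] by (simp add: set_lebesgue_integral_def)
  also have "\<dots> = (\<integral>om. indicator A om * measure (\<eta> om) B \<partial>M)"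
  proof (rule integral_cong_AE)
   have "AE om in M. measure (\<eta> om) B = real_cond_exp M F ?I om"
    using law set by (simp add: is_cond_law_def)
   then show "AE om in M. indicator A om * real_cond_exp M F ?I om = indicator A om * measure (\<eta> om) B"
    by eventually_elim simp
  qed (use mm in measurable)
  finally have eq: "(\<integral>om. indicator A om * ?I om \<partial>M) = (\<integral>om. indicator A om * measure (\<eta> om) B \<partial>M)" .
  have i1: "integrable M (%om. indicator A om * ?I om)"
   using integrable_mult_indicator[OF AM Ii] by simp
  have i2: "integrable M (%om. indicator A om * measure (\<eta> om) B)"
  proof (rule integrable_const_bound[where B = 1])
   show "AE om in M. norm (indicator A om * measure (\<eta> om) B) <= 1"
    using kernel_prob(1) by (intro AE_I2) (auto simp: indicator_def prob_space.prob_le_1)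
  qed (use mm in measurable)
  have "(\<integral>\<^sup>+om. indicator A om * indicator B (X om) \<partial>M) = (\<integral>\<^sup>+om. ennreal (indicator A om * ?I om) \<partial>M)"
   by (intro nn_integral_cong) (auto simp: indicator_def)
  also have "\<dots> = ennreal (\<integral>om. indicator A om * ?I om \<partial>M)"
   by (rule nn_integral_eq_integral[OF i1]) auto
  also have "\<dots> = (\<integral>\<^sup>+om. ennreal (indicator A om * measure (\<eta> om) B) \<partial>M)"
   unfolding eq by (rule nn_integral_eq_integral[OF i2, symmetric]) auto
  also have "\<dots> = (\<integral>\<^sup>+om. indicator A om * (\<integral>\<^sup>+x. indicator B x \<partial>\<eta> om) \<partial>M)"
  proof (intro nn_integral_cong)
   fix om assume w: "om \<in> space M"
   interpret E: prob_space "\<eta> om" by (rule kernel_prob[OF w])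
   show "ennreal (indicator A om * measure (\<eta> om) B) = indicator A om * (\<integral>\<^sup>+x. indicator B x \<partial>\<eta> om)"
   proof -
    have "(\<integral>\<^sup>+x. indicator B x \<partial>\<eta> om) = ennreal (measure (\<eta> om) B)"
     using set kernel_prob(2)[OF w] by (simp add: E.emeasure_eq_measure)
    then show ?thesis by (cases "om \<in> A") simp_all
   qed
  qed
  finally show ?case .
 next
  case (mult u c)
  have "(\<integral>\<^sup>+om. indicator A om * (c * u (X om)) \<partial>M) = c * (\<integral>\<^sup>+om. indicator A om * u (X om) \<partial>M)"
   using mult(2) by (subst nn_integral_cmult[symmetric]) (auto simp: ac_simps)
  also have "\<dots> = (\<integral>\<^sup>+om. c * (indicator A om * (\<integral>\<^sup>+x. u x \<partial>\<eta> om)) \<partial>M)"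
   using int_meas[OF mult(2)] mult.IH by (simp add: nn_integral_cmult)
  also have "\<dots> = (\<integral>\<^sup>+om. indicator A om * (\<integral>\<^sup>+x. c * u x \<partial>\<eta> om) \<partial>M)"
   using mult(2) by (intro nn_integral_cong) (simp add: nn_integral_cmult eta_cong ac_simps)
  finally show ?case .
 next
  case (add u v)
  have "(\<integral>\<^sup>+om. indicator A om * (v (X om) + u (X om)) \<partial>M)
    = (\<integral>\<^sup>+om. indicator A om * v (X om) \<partial>M) + (\<integral>\<^sup>+om. indicator A om * u (X om) \<partial>M)"
   using add(1,3) by (subst nn_integral_add[symmetric]) (auto simp: distrib_left)
  also have "\<dots> = (\<integral>\<^sup>+om. indicator A om * (\<integral>\<^sup>+x. v x \<partial>\<eta> om) + indicator A om * (\<integral>\<^sup>+x. u x \<partial>\<eta> om) \<partial>M)"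
   using int_meas[OF add(1)] int_meas[OF add(3)] add.IH by (simp add: nn_integral_add)
  also have "\<dots> = (\<integral>\<^sup>+om. indicator A om * (\<integral>\<^sup>+x. v x + u x \<partial>\<eta> om) \<partial>M)"
   using add(1,3) by (intro nn_integral_cong) (simp add: nn_integral_add eta_cong distrib_left)
  finally show ?case .
 next
  case (seq U)
  have Um: "U i \<in> borel_measurable borel" for i by (rule seq(1))
  have inc: "incseq (%i. U i x)" for x using seq(3) by (auto simp: incseq_def le_fun_def)
  have "(\<integral>\<^sup>+om. indicator A om * (SUP i. U i) (X om) \<partial>M) = (\<integral>\<^sup>+om. (SUP i. indicator A om * U i (X om)) \<partial>M)"
   by (simp add: SUP_apply SUP_mult_left_ennreal image_comp)
  also have "\<dots> = (SUP i. \<integral>\<^sup>+om. indicator A om * U i (X om) \<partial>M)"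
   by (rule nn_integral_monotone_convergence_SUP)
    (use inc Um in \<open>auto simp: incseq_def le_fun_def intro!: mult_left_mono\<close>)
  also have "\<dots> = (SUP i. \<integral>\<^sup>+om. indicator A om * (\<integral>\<^sup>+x. U i x \<partial>\<eta> om) \<partial>M)" using seq.IH by simp
  also have "\<dots> = (\<integral>\<^sup>+om. (SUP i. indicator A om * (\<integral>\<^sup>+x. U i x \<partial>\<eta> om)) \<partial>M)"
   by (rule nn_integral_monotone_convergence_SUP[symmetric])
    (use inc int_meas[OF Um] in \<open>auto simp: incseq_def le_fun_def intro!: mult_left_mono nn_integral_mono\<close>)
  also have "\<dots> = (\<integral>\<^sup>+om. indicator A om * (\<integral>\<^sup>+x. (SUP i. U i) x \<partial>\<eta> om) \<partial>M)"
  proof (intro nn_integral_cong)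
   fix om assume w: "om \<in> space M"
   have "(\<integral>\<^sup>+x. (SUP i. U i) x \<partial>\<eta> om) = (SUP i. \<integral>\<^sup>+x. U i x \<partial>\<eta> om)"
    unfolding SUP_apply image_comp
    by (rule nn_integral_monotone_convergence_SUP) (use seq(3) Um eta_cong[OF w] in auto)
   then show "(SUP i. indicator A om * (\<integral>\<^sup>+x. U i x \<partial>\<eta> om)) = indicator A om * (\<integral>\<^sup>+x. (SUP i. U i) x \<partial>\<eta> om)"
    by (simp add: SUP_mult_left_ennreal)
  qed
  finally show ?case .
 qed
qed

lemma integral_measurable_F:
 fixes f :: "'e => 'b::{banach, second_countable_topology}"
 assumes "f \<in> borel_measurable borel"
 shows "(%om. \<integral>x. f x \<partial>\<eta> om) \<in> borel_measurable F"
 using measurable_compose[OF kernel_F integral_measurable_subprob_algebra[OF assms]] .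

lemma integral_measurable_M:
 fixes f :: "'e => 'b::{banach, second_countable_topology}"
 assumes "f \<in> borel_measurable borel"
 shows "(%om. \<integral>x. f x \<partial>\<eta> om) \<in> borel_measurable M"
 by (rule measurable_from_subalg[OF sub integral_measurable_F[OF assms]])

lemma AE_integrable:
 fixes f :: "'e => real"
 assumes f [measurable]: "f \<in> borel_measurable borel" and i: "integrable M (%om. f (X om))"
 shows "AE om in M. integrable (\<eta> om) f"
proof -
 have "(\<integral>\<^sup>+om. (\<integral>\<^sup>+x. ennreal (norm (f x)) \<partial>\<eta> om) \<partial>M) = (\<integral>\<^sup>+om. ennreal (norm (f (X om))) \<partial>M)"
  using nn_disintegration[of "space M" "%x. ennreal (norm (f x))"] sub
  by (simp add: subalgebra_def sets.top cong: nn_integral_cong) (metis (no_types, lifting) mult_1 nn_integral_cong indicator_simps(1) sets.top)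
 also have "\<dots> < \<infinity>" using i by (simp add: integrable_iff_bounded)
 finally have "(\<integral>\<^sup>+om. (\<integral>\<^sup>+x. ennreal (norm (f x)) \<partial>\<eta> om) \<partial>M) ~= \<infinity>" by simp
 then have "AE om in M. (\<integral>\<^sup>+x. ennreal (norm (f x)) \<partial>\<eta> om) ~= \<infinity>"
  by (intro nn_integral_PInf_AE)
   (use measurable_compose[OF kernel_M nn_integral_measurable_subprob_algebra] in \<open>auto simp: \<close>)
 then show ?thesis
  using AE_space
 proof eventually_elim
  case (elim om)
  then show ?case
   using measurable_cong_sets[OF kernel_prob(2)[OF elim(2)] refl]
   by (auto simp: integrable_iff_bounded top.not_eq_extremum)
 qed
qed

lemma disintegration_nonneg:
 fixes f :: "'e => real"
 assumes A: "A \<in> sets F" and f [measurable]: "f \<in> borel_measurable borel"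
  and i: "integrable M (%om. f (X om))" and nn: "\<And>x. 0 <= f x"
 shows "integrable M (%om. \<integral>x. f x \<partial>\<eta> om)"
  and "(\<integral>om. indicator A om * f (X om) \<partial>M) = (\<integral>om. indicator A om * (\<integral>x. f x \<partial>\<eta> om) \<partial>M)"
proof -
 have gen: "(\<integral>\<^sup>+om. ennreal (indicator A om * f (X om)) \<partial>M) = (\<integral>\<^sup>+om. ennreal (indicator A om * (\<integral>x. f x \<partial>\<eta> om)) \<partial>M)"
  if A: "A \<in> sets F" for A
 proof -
  have "(\<integral>\<^sup>+om. ennreal (indicator A om * f (X om)) \<partial>M) = (\<integral>\<^sup>+om. indicator A om * ennreal (f (X om)) \<partial>M)"
   by (intro nn_integral_cong) (auto simp: indicator_def)
  also have "\<dots> = (\<integral>\<^sup>+om. indicator A om * (\<integral>\<^sup>+x. ennreal (f x) \<partial>\<eta> om) \<partial>M)"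
   by (rule nn_disintegration[OF A]) measurable
  also have "\<dots> = (\<integral>\<^sup>+om. ennreal (indicator A om * (\<integral>x. f x \<partial>\<eta> om)) \<partial>M)"
  proof (rule nn_integral_cong_AE)
   show "AE om in M. indicator A om * (\<integral>\<^sup>+x. ennreal (f x) \<partial>\<eta> om) = ennreal (indicator A om * (\<integral>x. f x \<partial>\<eta> om))"
    using AE_integrable[OF f i]
    by eventually_elim (auto simp: nn_integral_eq_integral nn indicator_def)
  qed
  finally show ?thesis .
 qed
 have sp: "space M \<in> sets F" using sub by (metis sets.top subalgebra_def)
 have m [measurable]: "(%om. \<integral>x. f x \<partial>\<eta> om) \<in> borel_measurable M" by (rule integral_measurable_M[OF f])
 have nnI: "0 <= (\<integral>x. f x \<partial>\<eta> om)" for om by (simp add: nn)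
 have "(\<integral>\<^sup>+om. ennreal (\<integral>x. f x \<partial>\<eta> om) \<partial>M) = (\<integral>\<^sup>+om. ennreal (f (X om)) \<partial>M)"
  using gen[OF sp] by (simp cong: nn_integral_cong)
 also have "\<dots> < \<infinity>" using i nn by (simp add: integrable_iff_bounded)
 finally show "integrable M (%om. \<integral>x. f x \<partial>\<eta> om)"
  using nnI by (intro integrableI_nonneg) auto
 have "A \<in> sets M" by (rule F_sets[OF A])
 then show "(\<integral>om. indicator A om * f (X om) \<partial>M) = (\<integral>om. indicator A om * (\<integral>x. f x \<partial>\<eta> om) \<partial>M)"
  using gen[OF A] nn nnI by (subst (1 2) integral_eq_nn_integral) auto
qed

lemma disintegration:
 fixes f :: "'e => real"
 assumes A: "A \<in> sets F" and f [measurable]: "f \<in> borel_measurable borel"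
  and i: "integrable M (%om. f (X om))"
 shows disintegration_integrable: "integrable M (%om. \<integral>x. f x \<partial>\<eta> om)"
  and disintegration_integral: "(\<integral>om. indicator A om * f (X om) \<partial>M) = (\<integral>om. indicator A om * (\<integral>x. f x \<partial>\<eta> om) \<partial>M)"
proof -
 note AM [measurable] = F_sets[OF A]
 define p n where "p x = max 0 (f x)" and "n x = max 0 (- f x)" for x
 have pn: "f x = p x - n x" for x by (simp add: p_def n_def)
 have pm: "p \<in> borel_measurable borel" "n \<in> borel_measurable borel" unfolding p_def n_def by measurable
 have pi: "integrable M (%om. p (X om))" "integrable M (%om. n (X om))"
  unfolding p_def n_def using i by (auto intro!: Bochner_Integration.integrable_max)
 have p0: "0 <= p x" "0 <= n x" for x by (simp_all add: p_def n_def)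
 note P = disintegration_nonneg[OF A pm(1) pi(1) p0(1)] and N = disintegration_nonneg[OF A pm(2) pi(2) p0(2)]
 have ae: "AE om in M. (\<integral>x. p x \<partial>\<eta> om) - (\<integral>x. n x \<partial>\<eta> om) = (\<integral>x. f x \<partial>\<eta> om)"
  using AE_integrable[OF pm(1) pi(1)] AE_integrable[OF pm(2) pi(2)]
  by eventually_elim (simp add: pn)
 have fm [measurable]: "(%om. \<integral>x. f x \<partial>\<eta> om) \<in> borel_measurable M" by (rule integral_measurable_M[OF f])
 note m = integral_measurable_M[OF pm(1)] integral_measurable_M[OF pm(2)]
 have "integrable M (%om. (\<integral>x. p x \<partial>\<eta> om) - (\<integral>x. n x \<partial>\<eta> om))" using P(1) N(1) by simp
 then show "integrable M (%om. \<integral>x. f x \<partial>\<eta> om)"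
  by (rule integrable_cong_AE[THEN iffD1, rotated 3]) (use ae m in auto)
 have im: "integrable M (%om. indicator A om * g om)" if "integrable M g" for g :: "'a => real"
  using integrable_mult_indicator[OF AM that] by simp
 have "(\<integral>om. indicator A om * f (X om) \<partial>M) = (\<integral>om. indicator A om * p (X om) \<partial>M) - (\<integral>om. indicator A om * n (X om) \<partial>M)"
  using im[OF pi(1)] im[OF pi(2)] by (simp add: pn right_diff_distrib)
 also have "\<dots> = (\<integral>om. indicator A om * ((\<integral>x. p x \<partial>\<eta> om) - (\<integral>x. n x \<partial>\<eta> om)) \<partial>M)"
  using im[OF P(1)] im[OF N(1)] by (simp add: P(2) N(2) right_diff_distrib)
 also have "\<dots> = (\<integral>om. indicator A om * (\<integral>x. f x \<partial>\<eta> om) \<partial>M)"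
  using ae m by (intro integral_cong_AE) auto
 finally show "(\<integral>om. indicator A om * f (X om) \<partial>M) = (\<integral>om. indicator A om * (\<integral>x. f x \<partial>\<eta> om) \<partial>M)" .
qed

text \<open>Applied to coordinates, this identifies \<open>cond_mean\<close> with the mean vector of
  the kernel, so that part (i) can be argued with kernels alone.\<close>

lemma cond_exp_eq:
 fixes f :: "'e => real"
 assumes f: "f \<in> borel_measurable borel" and i: "integrable M (%om. f (X om))"
 shows "AE om in M. real_cond_exp M F (%om. f (X om)) om = (\<integral>x. f x \<partial>\<eta> om)"
proof -
 interpret FS: finite_measure_subalgebra M F by (rule finite_subalg)
 have sp: "space M \<in> sets F" using sub by (metis sets.top subalgebra_def)
 show ?thesis
  using disintegration_integral[OF _ f i]
  by (intro FS.real_cond_exp_charact i disintegration_integrable[OF sp f i] integral_measurable_F f)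
   (simp add: set_lebesgue_integral_def)
qed

lemma char_kernel_measurable: "(%om. char_fun (\<eta> om) u) \<in> borel_measurable F"
 unfolding char_fun_def by (rule integral_measurable_F) measurable

text \<open>Cosine and sine are treated separately because \<open>disintegration\<close> is stated
  for real functions.\<close>

lemma char_disintegration:
 assumes A: "A \<in> sets F"
 shows "(CLINT om|M. indicator A om * iexp (u \<bullet> X om)) = (CLINT om|M. indicator A om * char_fun (\<eta> om) u)"
proof -
 note AM [measurable] = F_sets[OF A]
 have cm: "(%x. cos (u \<bullet> x)) \<in> borel_measurable borel" "(%x. sin (u \<bullet> x)) \<in> borel_measurable borel"
  by (auto intro!: borel_measurable_continuous_onI continuous_intros)
 have ci: "integrable M (%om. cos (u \<bullet> X om))" "integrable M (%om. sin (u \<bullet> X om))"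
  by (auto intro!: integrable_const_bound[where B = 1] measurable_compose[OF X_meas cm(1)] measurable_compose[OF X_meas cm(2)])
 have ie: "iexp r = of_real (cos r) + \<i> * of_real (sin r)" for r
  by (simp add: exp_Euler cos_of_real sin_of_real)
 have im: "integrable M (%om. indicator A om * g om)" if "integrable M g" for g :: "'a => real"
  using integrable_mult_indicator[OF AM that] by simp
 have comb: "(CLINT om|M. of_real (p om) + \<i> * of_real (q om)) = of_real (\<integral>om. p om \<partial>M) + \<i> * of_real (\<integral>om. q om \<partial>M)"
  if "integrable M p" "integrable M q" for p q :: "'a => real"
  using that by (subst Bochner_Integration.integral_add) auto
 have L: "(CLINT om|M. indicator A om * iexp (u \<bullet> X om))
   = of_real (\<integral>om. indicator A om * cos (u \<bullet> X om) \<partial>M) + \<i> * of_real (\<integral>om. indicator A om * sin (u \<bullet> X om) \<partial>M)"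
 proof -
  have "(CLINT om|M. indicator A om * iexp (u \<bullet> X om))
    = (CLINT om|M. of_real (indicator A om * cos (u \<bullet> X om)) + \<i> * of_real (indicator A om * sin (u \<bullet> X om)))"
   by (intro Bochner_Integration.integral_cong refl) (simp add: ie distrib_left indicator_def)
  then show ?thesis using comb[OF im[OF ci(1)] im[OF ci(2)]] by simp
 qed
 have ae: "char_fun (\<eta> om) u = of_real (\<integral>x. cos (u \<bullet> x) \<partial>\<eta> om) + \<i> * of_real (\<integral>x. sin (u \<bullet> x) \<partial>\<eta> om)"
  if w: "om \<in> space M" for om
 proof -
  interpret E: prob_space "\<eta> om" by (rule kernel_prob[OF w])
  have bm: "borel_measurable (\<eta> om) = borel_measurable borel"
   using measurable_cong_sets[OF kernel_prob(2)[OF w] refl] .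
  have "integrable (\<eta> om) (%x. cos (u \<bullet> x))" "integrable (\<eta> om) (%x. sin (u \<bullet> x))"
   using cm by (auto intro!: E.integrable_const_bound[where B = 1] simp: bm)
  then show ?thesis unfolding char_fun_def ie by simp
 qed
 have sp: "space M \<in> sets F" using sub by (metis sets.top subalgebra_def)
 have "(CLINT om|M. indicator A om * char_fun (\<eta> om) u)
   = (CLINT om|M. of_real (indicator A om * (\<integral>x. cos (u \<bullet> x) \<partial>\<eta> om)) + \<i> * of_real (indicator A om * (\<integral>x. sin (u \<bullet> x) \<partial>\<eta> om)))"
  by (intro Bochner_Integration.integral_cong refl) (simp add: ae distrib_left indicator_def)
 also have "\<dots> = of_real (\<integral>om. indicator A om * (\<integral>x. cos (u \<bullet> x) \<partial>\<eta> om) \<partial>M)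
   + \<i> * of_real (\<integral>om. indicator A om * (\<integral>x. sin (u \<bullet> x) \<partial>\<eta> om) \<partial>M)"
  by (rule comb[OF im[OF disintegration_integrable[OF sp cm(1) ci(1)]] im[OF disintegration_integrable[OF sp cm(2) ci(2)]]])
 finally show ?thesis
  unfolding L using disintegration_integral[OF A cm(1) ci(1)] disintegration_integral[OF A cm(2) ci(2)] by simp
qed

end

section \<open>Sigma-algebras of processes, freezing, and Brownian increments\<close>

lemma space_process_algebra [simp]: "space (process_algebra M T Z) = space M"
 by (simp add: process_algebra_def space_measure_of_conv)

lemma sets_process_algebra:
 "sets (process_algebra M T Z) = sigma_sets (space M) {Z s -` B \<inter> space M | s B. s \<in> T \<and> B \<in> sets borel}"
 unfolding process_algebra_def by (rule sets_measure_of) auto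

lemma process_algebra_measurable:
 assumes "s \<in> T"
 shows "Z s \<in> borel_measurable (process_algebra M T Z)"
 by (rule measurableI) (use assms in \<open>auto simp: sets_process_algebra\<close>)

lemma process_algebra_le:
 fixes Z :: "real => 'a => 'b::topological_space"
 assumes "\<And>s. s \<in> T ==> Z s \<in> borel_measurable G" "space G = space M"
 shows "sets (process_algebra M T Z) \<subseteq> sets G"
proof -
 have "sigma_sets (space G) {Z s -` B \<inter> space M | s B. s \<in> T \<and> B \<in> sets borel} \<subseteq> sets G"
 proof (intro sets.sigma_sets_subset, clarify)
  fix s B assume "s \<in> T" "B \<in> sets (borel :: 'b measure)"
  then show "Z s -` B \<inter> space M \<in> sets G"
   using measurable_sets[OF assms(1)] assms(2) by metis
 qed
 then show ?thesis using assms(2) by (simp add: sets_process_algebra)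
qed

lemma subalgebra_process_algebra:
 assumes "\<And>s. s \<in> T ==> Z s \<in> borel_measurable M"
 shows "subalgebra M (process_algebra M T Z)"
 using process_algebra_le[of T Z M M] assms by (simp add: subalgebra_def)

lemma process_algebra_mono:
 assumes "T \<subseteq> T'"
 shows "sets (process_algebra M T Z) \<subseteq> sets (process_algebra M T' Z)"
 using assms process_algebra_measurable[of _ T' Z M] by (intro process_algebra_le) auto

lemma exp_half_add:
 "complex_of_real (exp (- a / 2)) * complex_of_real (exp (- b / 2)) = complex_of_real (exp (- (a + b) / 2))"
 by (simp only: of_real_mult[symmetric] exp_add[symmetric]) (simp add: diff_divide_distrib)

lemma iexp_measurable:
 "f \<in> borel_measurable N ==> (%x. iexp (f x)) \<in> borel_measurable N"
 by measurable

context prob_space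
begin

lemma indep_algebras_mono:
 assumes "indep_algebras M F G" "sets F' \<subseteq> sets F" "sets G' \<subseteq> sets G"
 shows "indep_algebras M F' G'"
 using assms unfolding indep_algebras_def indep_sets2_eq by blast

lemma indep_algebras_sym: "indep_algebras M F G ==> indep_algebras M G F"
 unfolding indep_algebras_def indep_sets2_eq by (metis Int_commute mult.commute)

text \<open>Freezing: the identity maps into \<open>F\<close> and into \<open>G\<close> are
  independent random variables, so the law of \<open>(om, om)\<close> on the product is a product
  law and Fubini applies. What is measurable for \<open>F\<close> is thereby treated as a constant
  in the inner integral.\<close>

lemma integral_frozen:
 fixes f :: "'a \<times> 'a => complex"
 assumes ind: "indep_algebras M F G" and F: "subalgebra M F" and G: "subalgebra M G"
  and f [measurable]: "f \<in> borel_measurable (F \<Otimes>\<^sub>M G)" and B: "\<And>z. norm (f z) <= B"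
 shows "(CLINT om|M. f (om, om)) = (CLINT om|M. CLINT om'|M. f (om, om'))"
  and "(%om. CLINT om'|M. f (om, om')) \<in> borel_measurable M"
proof -
 have idF: "(%om. om) \<in> measurable M F" and idG: "(%om. om) \<in> measurable M G"
  using F G by (auto simp: measurable_def subalgebra_def intro!: sets.Int)
 have gen: "sigma_sets (space M) {(%om. om) -` A \<inter> space M | A. A \<in> sets H} = sets H" if "subalgebra M H" for H
 proof -
  have sp: "space M = space H" using that by (simp add: subalgebra_def)
  have "{(%om. om) -` A \<inter> space M | A. A \<in> sets H} = sets H"
   unfolding sp using sets.sets_into_space by (auto simp: Int_absorb2) 
  then show ?thesis unfolding sp by (simp add: sets.sigma_sets_eq)
 qed
 have "indep_var F (%om. om) G (%om. om)"
  unfolding indep_var_eq gen[OF F] gen[OF G] using ind idF idG by (simp add: indep_algebras_def)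
 then have eq: "distr M F (%om. om) \<Otimes>\<^sub>M distr M G (%om. om) = distr M (F \<Otimes>\<^sub>M G) (%om. (om, om))"
  unfolding indep_var_distribution_eq by simp
 interpret DF: prob_space "distr M F (%om. om)" by (rule prob_space_distr[OF idF])
 interpret DG: prob_space "distr M G (%om. om)" by (rule prob_space_distr[OF idG])
 interpret P: pair_prob_space "distr M F (%om. om)" "distr M G (%om. om)" by standard
 have int: "integrable (distr M F (%om. om) \<Otimes>\<^sub>M distr M G (%om. om)) f"
  by (rule P.integrable_const_bound[where B = B]) (use B in auto)
 have fG: "(%y. f (x, y)) \<in> borel_measurable G" if "x \<in> space F" for x
  using measurable_Pair2[OF f that] .
 have inner: "(CLINT y|distr M G (%om. om). f (x, y)) = (CLINT om'|M. f (x, om'))" if "x \<in> space F" for x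
  by (rule integral_distr[OF idG fG[OF that]])
 have outer: "(%x. CLINT y|distr M G (%om. om). f (x, y)) \<in> borel_measurable F"
  by (rule DG.borel_measurable_lebesgue_integral) simp
 have spF: "space F = space M" using F by (simp add: subalgebra_def)
 have idFG: "(%om. (om, om)) \<in> measurable M (F \<Otimes>\<^sub>M G)" using idF idG by simp
 have "(CLINT om|M. f (om, om)) = (CLINT z|distr M (F \<Otimes>\<^sub>M G) (%om. (om, om)). f z)"
  by (rule integral_distr[OF idFG f, symmetric])
 also have "\<dots> = (CLINT x|distr M F (%om. om). CLINT y|distr M G (%om. om). f (x, y))"
  unfolding eq[symmetric] by (rule P.integral_fst'[OF int, symmetric])
 also have "\<dots> = (CLINT om|M. CLINT y|distr M G (%om. om). f (om, y))"
  by (rule integral_distr[OF idF outer])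
 also have "\<dots> = (CLINT om|M. CLINT om'|M. f (om, om'))"
  by (rule Bochner_Integration.integral_cong[OF refl]) (simp add: inner spF)
 finally show "(CLINT om|M. f (om, om)) = (CLINT om|M. CLINT om'|M. f (om, om'))" .
 have mc: "(%om. CLINT om'|M. f (om, om')) \<in> borel_measurable M \<longleftrightarrow>
   (%om. CLINT y|distr M G (%om. om). f (om, y)) \<in> borel_measurable M"
  by (rule measurable_cong) (simp add: inner spF)
 have "(%om. CLINT y|distr M G (%om. om). f (om, y)) \<in> borel_measurable M"
  by (rule measurable_from_subalg[OF F outer])
 then show "(%om. CLINT om'|M. f (om, om')) \<in> borel_measurable M"
  by (rule mc[THEN iffD2])
qed

lemma integral_indep_mult:
 fixes f g :: "'a => complex"
 assumes ind: "indep_algebras M F G" and F: "subalgebra M F" and G: "subalgebra M G"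
  and f [measurable]: "f \<in> borel_measurable F" and g [measurable]: "g \<in> borel_measurable G"
  and B: "\<And>x. norm (f x) <= 1" "\<And>x. norm (g x) <= 1"
 shows "(CLINT om|M. f om * g om) = (CLINT om|M. f om) * (CLINT om|M. g om)"
proof -
 have "(CLINT om|M. (%z. f (fst z) * g (snd z)) (om, om)) = (CLINT om|M. CLINT om'|M. (%z. f (fst z) * g (snd z)) (om, om'))"
  by (rule integral_frozen(1)[OF ind F G, where B = 1]) (use B in \<open>auto simp: norm_mult intro: mult_le_one\<close>)
 then show ?thesis by simp
qed

lemma normal_law_char:
 assumes [measurable]: "Z \<in> borel_measurable M" and "0 <= v" "distr M borel Z = normal_law m v"
 shows "(CLINT om|M. iexp (Z om)) = iexp m * exp (- v / 2)"
proof -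
 have "(CLINT om|M. iexp (Z om)) = char (distr M borel Z) 1"
  unfolding char_def by (subst integral_distr) auto
 then show ?thesis unfolding assms(3) char_normal_law[OF assms(2)] by simp
qed

text \<open>Induction on the number of increments: the last one is independent of the history up to
  \<open>p N\<close>, for which all the others are measurable.\<close>

lemma brownian_increments_char:
 fixes B :: "real => 'a => 'e::euclidean_space"
 assumes bm: "brownian_motion M B"
  and p: "0 <= p 0" "\<And>l. l < N ==> p l <= p (Suc l)"
 shows "(CLINT om|M. iexp (\<Sum>l<N. v l \<bullet> (B (p (Suc l)) om - B (p l) om)))
  = exp (- (\<Sum>l<N. (p (Suc l) - p l) * (norm (v l))\<^sup>2) / 2)"
 using p(2)
proof (induction N)
 case 0
 then show ?case by (simp add: prob_space)
next
 case (Suc N)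
 have Bm: "B s \<in> borel_measurable M" if "0 <= s" for s
  using bm that by (simp add: brownian_motion_def continuous_process_def)
 have mono: "p i <= p j" if "i <= j" "j <= Suc N" for i j
  using that(1,2)
 proof (induction j rule: dec_induct)
  case (step n)
  then show ?case using Suc.prems[of n] by simp
 qed simp
 have p0: "0 <= p l" if "l <= Suc N" for l using mono[of 0 l] p(1) that by simp
 define F where "F = history M B (p N)"
 define D where "D = (%r om. B r om - B (p N) om)"
 define G where "G = process_algebra M {p (Suc N)} D"
 have ind: "indep_algebras M F G"
  unfolding F_def G_def D_def
  using bm p0[of N] Suc.prems[of N] by (simp add: brownian_motion_def)
 have law: "distr M borel (%om. v N \<bullet> (B (p (Suc N)) om - B (p N) om)) = normal_law 0 ((p (Suc N) - p N) * (norm (v N))\<^sup>2)"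
  using bm p0[of N] Suc.prems[of N] by (simp add: brownian_motion_def)
 have F: "subalgebra M F" unfolding F_def by (intro subalgebra_process_algebra Bm) auto
 have G: "subalgebra M G" unfolding G_def D_def
  by (intro subalgebra_process_algebra borel_measurable_diff Bm) (use p0[of "Suc N"] p0[of N] in auto)
 have BF: "B (p l) \<in> borel_measurable F" if "l <= N" for l
  unfolding F_def by (rule process_algebra_measurable) (use p0[of l] mono[of l N] that in auto)
 have DG: "(%om. B (p (Suc N)) om - B (p N) om) \<in> borel_measurable G"
  using process_algebra_measurable[of "p (Suc N)" "{p (Suc N)}" D M] by (simp add: G_def D_def)
 have f: "(%om. iexp (\<Sum>l<N. v l \<bullet> (B (p (Suc l)) om - B (p l) om))) \<in> borel_measurable F"
  by (intro iexp_measurable borel_measurable_sum borel_measurable_inner borel_measurable_const borel_measurable_diff BF) auto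
 have g: "(%om. iexp (v N \<bullet> (B (p (Suc N)) om - B (p N) om))) \<in> borel_measurable G"
  by (intro iexp_measurable borel_measurable_inner borel_measurable_const DG)
 have "(CLINT om|M. iexp (\<Sum>l<Suc N. v l \<bullet> (B (p (Suc l)) om - B (p l) om)))
   = (CLINT om|M. iexp (\<Sum>l<N. v l \<bullet> (B (p (Suc l)) om - B (p l) om)) * iexp (v N \<bullet> (B (p (Suc N)) om - B (p N) om)))"
  by (simp add: distrib_left exp_add)
 also have "\<dots> = (CLINT om|M. iexp (\<Sum>l<N. v l \<bullet> (B (p (Suc l)) om - B (p l) om))) * (CLINT om|M. iexp (v N \<bullet> (B (p (Suc N)) om - B (p N) om)))"
  by (rule integral_indep_mult[OF ind F G f g]) auto
 also have "(CLINT om|M. iexp (\<Sum>l<N. v l \<bullet> (B (p (Suc l)) om - B (p l) om))) = exp (- (\<Sum>l<N. (p (Suc l) - p l) * (norm (v l))\<^sup>2) / 2)"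
  using Suc by simp
 also have "(CLINT om|M. iexp (v N \<bullet> (B (p (Suc N)) om - B (p N) om))) = exp (- ((p (Suc N) - p N) * (norm (v N))\<^sup>2) / 2)"
  using normal_law_char[OF _ _ law] Suc.prems[of N] measurable_from_subalg[OF G DG] by simp
 finally show ?case by (simp only: exp_half_add sum.lessThan_Suc)
qed

text \<open>\<open>F\<close> is independent of noise and initial state jointly, so the random
  coefficients can be frozen and a Gaussian integral remains. Each coefficient may depend on all of
  \<open>F\<close>, whatever its time index; this is what makes anticipating weights harmless.
  \<open>\<zeta>\<close> is a test factor, later an indicator times the phase of the observation
  sum.\<close>

lemma brownian_conditional_char:
 fixes B :: "real => 'a => 'e::euclidean_space" and x0 :: "'a => real^'n"
 assumes bm: "brownian_motion M B"
  and p: "0 <= p 0" "\<And>l. l < N ==> p l <= p (Suc l)"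
  and x0: "indep_algebras M (process_algebra M {0} (%_. x0)) (process_algebra M {0..} B)"
  and x0m: "x0 \<in> borel_measurable M"
  and FG: "indep_algebras M F (process_algebra M {0..} (%t om. (B t om, x0 om)))"
  and F: "subalgebra M F"
  and gx: "\<And>u. (CLINT om|M. iexp (u \<bullet> x0 om)) = iexp (u \<bullet> m0) * exp (- (u \<bullet> (P0 *v u)) / 2)"
  and th0: "tht0 \<in> borel_measurable F" and th: "\<And>l. l < N ==> tht l \<in> borel_measurable F"
  and z: "\<zeta> \<in> borel_measurable F" and zb: "\<And>x. norm (\<zeta> x) <= 1"
 shows "(CLINT om|M. \<zeta> om * iexp (tht0 om \<bullet> x0 om + (\<Sum>l<N. tht l om \<bullet> (B (p (Suc l)) om - B (p l) om))))
  = (CLINT om|M. \<zeta> om * (iexp (tht0 om \<bullet> m0) *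
    exp (- (tht0 om \<bullet> (P0 *v tht0 om) + (\<Sum>l<N. (p (Suc l) - p l) * (norm (tht l om))\<^sup>2)) / 2)))"
proof -
 have Bm: "B s \<in> borel_measurable M" if "0 <= s" for s
  using bm that by (simp add: brownian_motion_def continuous_process_def)
 have p0: "0 <= p l" if "l <= N" for l
  using that
 proof (induction l)
  case (Suc l)
  then show ?case using p(2)[of l] by simp
 qed (use p in simp)
 define G where "G = process_algebra M {0..} (%t om. (B t om, x0 om))"
 define X where "X = process_algebra M {0::real} (%_. x0)"
 define W where "W = process_algebra M {0..} B"
 have G: "subalgebra M G" unfolding G_def
  using Bm x0m by (intro subalgebra_process_algebra borel_measurable_Pair) auto
 have X: "subalgebra M X" unfolding X_def using x0m by (intro subalgebra_process_algebra) auto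
 have W: "subalgebra M W" unfolding W_def using Bm by (intro subalgebra_process_algebra) auto
 have pairG: "(%om. (B s om, x0 om)) \<in> borel_measurable G" if "0 <= s" for s
  using process_algebra_measurable[of s "{0..}" "%t om. (B t om, x0 om)" M] that by (simp add: G_def)
 have BG: "B s \<in> borel_measurable G" if "0 <= s" for s
  using borel_measurable_continuous_on[OF _ pairG[OF that], of fst] by (simp add: continuous_on_fst[OF continuous_on_id])
 have xG: "x0 \<in> borel_measurable G"
  using borel_measurable_continuous_on[OF _ pairG[of 0], of snd] by (simp add: continuous_on_snd[OF continuous_on_id])
 let ?D = "%l om. B (p (Suc l)) om - B (p l) om"
 have DG: "?D l \<in> borel_measurable G" if "l < N" for l
  using that p0[of l] p0[of "Suc l"] by (intro borel_measurable_diff BG) auto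
 have DW: "?D l \<in> borel_measurable W" if "l < N" for l
  using that p0[of l] p0[of "Suc l"] unfolding W_def
  by (intro borel_measurable_diff process_algebra_measurable) auto
 have xX: "x0 \<in> borel_measurable X"
  unfolding X_def using process_algebra_measurable[of 0 "{0::real}" "%_. x0" M] by simp
 define f where "f z = \<zeta> (fst z) * iexp (tht0 (fst z) \<bullet> x0 (snd z) + (\<Sum>l<N. tht l (fst z) \<bullet> ?D l (snd z)))" for z :: "'a \<times> 'a"
 have c1: "(%z. h (fst z)) \<in> borel_measurable (F \<Otimes>\<^sub>M G)" if "h \<in> borel_measurable F"
  for h :: "'a => 'c::topological_space"
  using measurable_compose[OF measurable_fst that] .
 have c2: "(%z. h (snd z)) \<in> borel_measurable (F \<Otimes>\<^sub>M G)" if "h \<in> borel_measurable G"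
  for h :: "'a => 'c::topological_space"
  using measurable_compose[OF measurable_snd that] .
 have fm: "f \<in> borel_measurable (F \<Otimes>\<^sub>M G)"
  unfolding f_def
  by (intro borel_measurable_times c1[OF z] iexp_measurable borel_measurable_add borel_measurable_sum
    borel_measurable_inner c1[OF th0] c2[OF xG] c1[OF th] c2[OF DG]) auto
 have "(CLINT om|M. f (om, om)) = (CLINT om|M. CLINT om'|M. f (om, om'))"
  by (rule integral_frozen(1)[OF FG[folded G_def] F G fm, where B = 1]) (simp add: f_def norm_mult zb)
 also have "\<dots> = (CLINT om|M. \<zeta> om * (iexp (tht0 om \<bullet> m0) *
    exp (- (tht0 om \<bullet> (P0 *v tht0 om) + (\<Sum>l<N. (p (Suc l) - p l) * (norm (tht l om))\<^sup>2)) / 2)))"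
 proof (intro Bochner_Integration.integral_cong refl)
  fix om
  have "(CLINT om'|M. f (om, om')) = \<zeta> om * (CLINT om'|M. iexp (tht0 om \<bullet> x0 om') * iexp (\<Sum>l<N. tht l om \<bullet> ?D l om'))"
   unfolding f_def by (simp add: distrib_left exp_add)
  also have "(CLINT om'|M. iexp (tht0 om \<bullet> x0 om') * iexp (\<Sum>l<N. tht l om \<bullet> ?D l om'))
    = (CLINT om'|M. iexp (tht0 om \<bullet> x0 om')) * (CLINT om'|M. iexp (\<Sum>l<N. tht l om \<bullet> ?D l om'))"
  proof (rule integral_indep_mult[OF x0[folded X_def W_def] X W])
   show "(%om'. iexp (tht0 om \<bullet> x0 om')) \<in> borel_measurable X"
    by (intro iexp_measurable borel_measurable_inner borel_measurable_const xX)
   show "(%om'. iexp (\<Sum>l<N. tht l om \<bullet> ?D l om')) \<in> borel_measurable W"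
    by (intro iexp_measurable borel_measurable_sum borel_measurable_inner borel_measurable_const DW) auto
  qed auto
  also have "\<dots> = iexp (tht0 om \<bullet> m0) * exp (- (tht0 om \<bullet> (P0 *v tht0 om)) / 2) * exp (- (\<Sum>l<N. (p (Suc l) - p l) * (norm (tht l om))\<^sup>2) / 2)"
   by (subst brownian_increments_char[OF bm p]) (auto simp: gx)
  finally show "(CLINT om'|M. f (om, om')) = \<zeta> om * (iexp (tht0 om \<bullet> m0) *
    exp (- (tht0 om \<bullet> (P0 *v tht0 om) + (\<Sum>l<N. (p (Suc l) - p l) * (norm (tht l om))\<^sup>2)) / 2))"
   by (simp only: exp_half_add mult.assoc)
 qed
 finally show ?thesis by (simp add: f_def)
qed

text \<open>The normal law of the sum is read off its characteristic function, so no covariances of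
  increments have to be computed.\<close>

lemma brownian_increments_second_moment:
 fixes B :: "real => 'a => 'e::euclidean_space"
 assumes bm: "brownian_motion M B"
  and p: "0 <= p 0" "\<And>l. l < N ==> p l <= p (Suc l)"
 shows "integrable M (%om. (\<Sum>l<N. v l \<bullet> (B (p (Suc l)) om - B (p l) om))\<^sup>2)"
  and "expectation (%om. (\<Sum>l<N. v l \<bullet> (B (p (Suc l)) om - B (p l) om))\<^sup>2)
   = (\<Sum>l<N. (p (Suc l) - p l) * (norm (v l))\<^sup>2)"
proof -
 have Bm: "B s \<in> borel_measurable M" if "0 <= s" for s
  using bm that by (simp add: brownian_motion_def continuous_process_def)
 have p0: "0 <= p l" if "l <= N" for l
  using that
 proof (induction l)
  case (Suc l)
  then show ?case using p(2)[of l] by simp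
 qed (use p in simp)
 let ?X = "%om. \<Sum>l<N. v l \<bullet> (B (p (Suc l)) om - B (p l) om)"
 let ?v = "\<Sum>l<N. (p (Suc l) - p l) * (norm (v l))\<^sup>2"
 have Xm: "?X \<in> borel_measurable M"
  using p0 by (intro borel_measurable_sum borel_measurable_inner borel_measurable_const borel_measurable_diff Bm) auto
 have v: "0 <= ?v" using p(2) by (intro sum_nonneg mult_nonneg_nonneg) auto
 have law: "distr M borel ?X = normal_law 0 ?v"
 proof (rule normal_law_from_char[OF Xm v])
  fix s
  have "(CLINT om|M. iexp (s * ?X om)) = (CLINT om|M. iexp (\<Sum>l<N. (s *\<^sub>R v l) \<bullet> (B (p (Suc l)) om - B (p l) om)))"
   by (simp only: sum_distrib_left inner_scaleR_left)
  also have "\<dots> = exp (- (\<Sum>l<N. (p (Suc l) - p l) * (norm (s *\<^sub>R v l))\<^sup>2) / 2)"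
   by (rule brownian_increments_char[OF bm p])
  also have "(\<Sum>l<N. (p (Suc l) - p l) * (norm (s *\<^sub>R v l))\<^sup>2) = ?v * s\<^sup>2"
   by (simp add: power_mult_distrib sum_distrib_left ac_simps)
  finally show "(CLINT om|M. iexp (s * ?X om)) = iexp (s * 0) * exp (- ?v * s\<^sup>2 / 2)" by simp
 qed
 show "integrable M (%om. (?X om)\<^sup>2)" "expectation (%om. (?X om)\<^sup>2) = ?v"
  using normal_law_integrable_sq[OF Xm v law] normal_law_variance[OF Xm v law] by simp_all
qed

end

section \<open>Discretisation of the adjoint flow\<close>

text \<open>\<open>j\<close> counts steps back from \<open>m\<close>. The matrix is taken at the
  left end of the step, so that y_{i+1} . (x_{i+1} - x_i - d B_i x_i) = y_{i+1} . x_{i+1} - y_i .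
  x_i holds exactly; this fits left-point stochastic sums.\<close>

primrec euler_back :: "(real => real^'n^'n) => real => nat => real^'n => nat => real^'n" where
 "euler_back B d m u 0 = u"
| "euler_back B d m u (Suc j) = euler_back B d m u j
  + d *\<^sub>R (transpose (B (real (m - Suc j) * d)) *v euler_back B d m u j)"

text \<open>Backward Euler scheme with step \<open>d\<close> for \<open>adjoint_flow\<close>, started from \<open>u\<close> at time \<open>m * d\<close>.\<close>

definition euler :: "(real => real^'n^'n) => real => nat => real^'n => nat => real^'n" where
 "euler B d m u i = euler_back B d m u (m - i)"

lemma euler_end [simp]: "euler B d m u m = u"
 by (simp add: euler_def)

lemma euler_step:
 assumes "i < m"
 shows "euler B d m u i = euler B d m u (Suc i) + d *\<^sub>R (transpose (B (real i * d)) *v euler B d m u (Suc i))"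
proof -
 have "m - i = Suc (m - Suc i)" "m - Suc (m - Suc i) = i" using assms by auto
 then show ?thesis unfolding euler_def by (simp only: euler_back.simps)
qed

lemma euler_cong:
 assumes "\<And>i. i < m ==> B (real i * d) = B' (real i * d)" "i <= m"
 shows "euler B d m u i = euler B' d m u i"
 using assms(2)
proof (induction i rule: inc_induct)
 case (step i)
 then show ?case using assms(1)[of i] by (simp add: euler_step[of i m])
qed simp

lemma euler_bound:
 assumes "\<And>i. i < m ==> norm (B (real i * d)) <= b" "0 <= d" "0 <= b" "i <= m"
 shows "norm (euler B d m u i) <= exp (b * (d * real m)) * norm u"
proof -
 have "norm (euler B d m u i) <= exp (b * (d * real (m - i))) * norm u"
  using assms(4)
 proof (induction i rule: inc_induct)
  case (step i)
  let ?y = "euler B d m u (Suc i)"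
  have "norm (transpose (B (real i * d)) *v ?y) <= norm (B (real i * d)) * norm ?y"
   using norm_matrix_vector_mult_le[of "transpose (B (real i * d))" ?y] by (simp add: norm_transpose)
  also have "\<dots> <= b * norm ?y" using assms(1)[of i] step by (intro mult_right_mono) auto
  finally have "norm (d *\<^sub>R (transpose (B (real i * d)) *v ?y)) <= d * (b * norm ?y)"
   using assms(2) by (simp add: mult_left_mono)
  then have "norm (euler B d m u i) <= norm ?y + d * (b * norm ?y)"
   unfolding euler_step[OF step.hyps(2)[unfolded Suc_le_eq]] if_True
   using norm_triangle_ineq order_trans by (smt (verit, best))
  also have "\<dots> = (1 + b * d) * norm ?y" by (simp add: algebra_simps)
  also have "\<dots> <= exp (b * d) * (exp (b * (d * real (m - Suc i))) * norm u)"
   using assms step.IH by (intro mult_mono) (auto simp: exp_ge_add_one_self)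
  also have "\<dots> = exp (b * (d * real (m - i))) * norm u"
  proof -
   have "m - i = Suc (m - Suc i)" using step by auto
   then have "b * d + b * (d * real (m - Suc i)) = b * (d * real (m - i))" by (simp add: algebra_simps)
   then show ?thesis by (simp flip: exp_add mult.assoc)
  qed
  finally show ?case .
 qed simp
 also have "\<dots> <= exp (b * (d * real m)) * norm u"
  using assms by (intro mult_right_mono) (auto intro!: mult_left_mono)
 finally show ?thesis .
qed

lemma uniform_modulus:
 fixes f :: "real => 'b::real_normed_vector"
 assumes "continuous_on {0..T} f" "0 < e"
 obtains dl where "0 < dl" "\<And>s s'. s \<in> {0..T} ==> s' \<in> {0..T} ==> \<bar>s - s'\<bar> <= dl ==> norm (f s - f s') <= e"
proof -
 have "uniformly_continuous_on {0..T} f" using assms(1) by (intro compact_uniformly_continuous) auto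
 then obtain dl where "0 < dl" "\<And>s s'. s \<in> {0..T} ==> s' \<in> {0..T} ==> dist s' s < dl ==> dist (f s') (f s) < e"
  using assms(2) unfolding uniformly_continuous_on_def by metis
 then show ?thesis
  by (intro that[of "dl / 2"]) (auto simp: dist_norm less_imp_le)
qed

lemma has_integral_near_constant:
 fixes f :: "real => 'b::euclidean_space"
 assumes "(f has_integral I) {a..b}" "a <= b" "\<And>s. s \<in> {a..b} ==> norm (f s - c) <= e"
 shows "norm (I - (b - a) *\<^sub>R c) <= e * (b - a)"
proof -
 have e: "0 <= e" using assms(3)[of a] assms(2) norm_ge_zero[of "f a - c"] by (meson atLeastAtMost_iff order_refl order_trans)
 have "((%s. c) has_integral (b - a) *\<^sub>R c) {a..b}"
  using has_integral_const_real[of c a b] assms(2) by simp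
 then have "((%s. f s - c) has_integral I - (b - a) *\<^sub>R c) {a..b}"
  by (rule has_integral_diff[OF assms(1)])
 from has_integral_bound_real[OF e finite.emptyI this] assms(2,3) show ?thesis by simp
qed

lemma euler_converges:
 assumes y: "adjoint_flow B T u y" and B: "continuous_on {0..T} B" and T: "0 <= T" and e: "0 < e"
 shows "\<exists>m0>0. \<forall>m\<ge>m0. \<forall>i\<le>m. norm (euler B (T / real m) m u i - y (real i * (T / real m))) <= e"
proof -
 obtain b where b: "0 < b" "\<And>s. s \<in> {0..T} ==> norm (B s) <= b"
  using continuous_norm_bounded[OF B] by blast
 have yc: "continuous_on {0..T} y"
  using y unfolding adjoint_flow_def
  by (meson continuous_on_eq_continuous_within has_vector_derivative_continuous)
 have gc: "continuous_on {0..T} (%s. transpose (B s))" by (intro continuous_intros B)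
 obtain Yb where Yb: "0 < Yb" "\<And>s. s \<in> {0..T} ==> norm (y s) <= Yb"
  using continuous_norm_bounded[OF yc] by blast
 \<comment> \<open>Local errors of size eps d, summed over T / d steps and amplified by exp (b T),
   total at most \<open>e\<close>; \<open>T + 1\<close> in place of \<open>T\<close> covers the case
   \<open>T = 0\<close>.\<close>
 define eps where "eps = e / ((T + 1) * exp (b * T))"
 have eps: "0 < eps" using e T by (simp add: eps_def)
 obtain dl1 where d1: "0 < dl1" "\<And>s s'. s \<in> {0..T} ==> s' \<in> {0..T} ==> \<bar>s - s'\<bar> <= dl1 ==> norm (B s - B s') <= eps / (2 * Yb)"
  using uniform_modulus[OF B, of "eps / (2 * Yb)"] eps Yb(1) by auto
 obtain dl2 where d2: "0 < dl2" "\<And>s s'. s \<in> {0..T} ==> s' \<in> {0..T} ==> \<bar>s - s'\<bar> <= dl2 ==> norm (y s - y s') <= eps / (2 * b)"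
  using uniform_modulus[OF yc, of "eps / (2 * b)"] eps b(1) by auto
 obtain m0 :: nat where m0: "T / min dl1 dl2 + 1 < real m0" using reals_Archimedean2 by blast
 have "norm (euler B (T / real m) m u i - y (real i * (T / real m))) <= e" if m: "m0 <= m" and i: "i <= m" for m i
 proof -
  define d where "d = T / real m"
  have pos: "0 < min dl1 dl2" using d1 d2 by simp
  have mpos: "0 < real m" using m0 m T pos by (smt (verit, best) divide_nonneg_pos of_nat_mono)
  have "T / min dl1 dl2 <= real m" using m0 m by linarith
  then have "T <= min dl1 dl2 * real m" by (simp only: pos_divide_le_eq[OF pos] mult.commute)
  then have dd: "d <= min dl1 dl2" by (simp only: d_def pos_divide_le_eq[OF mpos])
  have d0: "0 <= d" using T by (simp add: d_def)
  have dm: "d * real m = T" using mpos by (simp add: d_def)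
  let ?q = "%i. real i * d"
  have q: "?q i \<in> {0..T}" if "i <= m" for i
   using that d0 dm by (auto simp: mult.commute[of d] intro: order_trans[OF mult_right_mono[of "real i" "real m" d]])
  let ?z = "euler B d m u"
  have local: "norm (y (?q i) - (y (?q (Suc i)) + d *\<^sub>R (transpose (B (?q i)) *v y (?q (Suc i))))) <= eps * d" if i: "i < m" for i
  proof -
   have ab: "?q i <= ?q (Suc i)" "?q (Suc i) - ?q i = d" using d0 by (auto simp: algebra_simps)
   have qq: "?q i \<in> {0..T}" "?q (Suc i) \<in> {0..T}" using q[of i] q[of "Suc i"] i by auto
   then have sub: "{?q i..?q (Suc i)} \<subseteq> {0..T}" by auto
   have hi: "((%s. - (transpose (B s) *v y s)) has_integral y (?q (Suc i)) - y (?q i)) {?q i..?q (Suc i)}"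
    by (rule fundamental_theorem_of_calculus_on[OF ab(1) _ sub]) (use y sub in \<open>auto simp: adjoint_flow_def\<close>)
   have nb: "norm (- (transpose (B s) *v y s) - - (transpose (B (?q i)) *v y (?q (Suc i)))) <= eps" if s: "s \<in> {?q i..?q (Suc i)}" for s
   proof -
    have sT: "s \<in> {0..T}" using s sub by auto
    have sd: "\<bar>s - ?q i\<bar> <= min dl1 dl2" "\<bar>s - ?q (Suc i)\<bar> <= min dl1 dl2" using s ab dd by auto
    have "norm (- (transpose (B s) *v y s) - - (transpose (B (?q i)) *v y (?q (Suc i))))
      = norm (transpose (B s - B (?q i)) *v y s + transpose (B (?q i)) *v (y s - y (?q (Suc i))))"
     by (subst norm_minus_commute) (simp add: transpose_linear matrix_vector_linear)
    also have "\<dots> <= norm (B s - B (?q i)) * norm (y s) + norm (B (?q i)) * norm (y s - y (?q (Suc i)))"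
     by (intro norm_triangle_mono) (metis norm_matrix_vector_mult_le norm_transpose)+
    also have "\<dots> <= eps / (2 * Yb) * Yb + b * (eps / (2 * b))"
     using sd by (intro add_mono mult_mono d1 d2 b Yb sT qq) (use eps b Yb in \<open>auto simp: less_imp_le\<close>)
    also have "\<dots> = eps" using Yb(1) b(1) by simp
    finally show ?thesis .
   qed
   have "norm (y (?q (Suc i)) - y (?q i) - d *\<^sub>R (- (transpose (B (?q i)) *v y (?q (Suc i))))) <= eps * d"
    using has_integral_near_constant[OF hi ab(1) nb] unfolding ab(2) by simp
   then show ?thesis by (subst norm_minus_commute) (simp add: algebra_simps)
  qed
  have "norm (?z i - y (?q i)) <= eps * (d * real (m - i)) * exp (b * (d * real (m - i)))"
   using i
  proof (induction i rule: inc_induct)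
   case base
   show ?case using y dm by (simp add: adjoint_flow_def mult.commute)
  next
   case (step i)
   have im: "i < m" using step by simp
   let ?e = "?z (Suc i) - y (?q (Suc i))"
   let ?n = "d * real (m - Suc i)"
   have "real (m - i) = 1 + real (m - Suc i)" using im by (simp add: of_nat_diff)
   then have mi: "d * real (m - i) = d + ?n" by (simp only: distrib_left mult.right_neutral)
   have n0: "0 <= ?n" using d0 by simp
   have "?z i - y (?q i) = (?e + d *\<^sub>R (transpose (B (?q i)) *v ?e))
     - (y (?q i) - (y (?q (Suc i)) + d *\<^sub>R (transpose (B (?q i)) *v y (?q (Suc i)))))"
    by (simp add: euler_step[OF im] matrix_vector_linear algebra_simps)
   then have "norm (?z i - y (?q i)) <= (norm ?e + d * (b * norm ?e)) + eps * d"
   proof -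
    have "norm (transpose (B (?q i)) *v ?e) <= norm (B (?q i)) * norm ?e"
     by (metis norm_matrix_vector_mult_le norm_transpose)
    also have "\<dots> <= b * norm ?e" using q[of i] im by (intro mult_right_mono b) auto
    finally have "norm (d *\<^sub>R (transpose (B (?q i)) *v ?e)) <= d * (b * norm ?e)"
     using d0 by (simp add: mult_left_mono)
    then have "norm (?e + d *\<^sub>R (transpose (B (?q i)) *v ?e)) <= norm ?e + d * (b * norm ?e)"
     by (rule order_trans[OF norm_triangle_ineq add_left_mono])
    then show ?thesis
     unfolding \<open>?z i - y (?q i) = _\<close> using local[OF im]
     by (rule order_trans[OF norm_triangle_ineq4 add_mono])
   qed
   also have "\<dots> = (1 + b * d) * norm ?e + eps * d" by (simp add: algebra_simps)
   also have "\<dots> <= exp (b * d) * (eps * ?n * exp (b * ?n)) + eps * d * exp (b * (d + ?n))"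
   proof (rule add_mono)
    show "(1 + b * d) * norm ?e <= exp (b * d) * (eps * ?n * exp (b * ?n))"
     by (intro mult_mono step.IH) auto
    have "1 <= exp (b * (d + ?n))" using b(1) d0 n0 by simp
    then show "eps * d <= eps * d * exp (b * (d + ?n))" using mult_left_mono[of 1 _ "eps * d"] eps d0 by simp
   qed
   also have "exp (b * d) * (eps * ?n * exp (b * ?n)) = eps * ?n * exp (b * (d + ?n))"
    by (simp add: distrib_left exp_add)
   finally show ?case unfolding mi by (simp add: algebra_simps)
  qed
  also have "\<dots> <= eps * T * exp (b * T)"
  proof -
   have "d * real (m - i) <= T" unfolding dm[symmetric] using d0 by (intro mult_left_mono) auto
   then show ?thesis using eps b(1) d0 T by (intro mult_mono) auto
  qed
  also have "eps * T * exp (b * T) = e * (T / (T + 1))" by (simp add: eps_def)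
  also have "\<dots> <= e * 1" using e T by (intro mult_left_mono) auto
  also have "\<dots> = e" by simp
  finally show ?thesis by (simp add: d_def)
 qed
 moreover have "0 < m0"
 proof -
  have "0 <= T / min dl1 dl2" using T d1(1) d2(1) by (intro divide_nonneg_pos) auto
  then show ?thesis using m0 by linarith
 qed
 ultimately show ?thesis by blast
qed

section \<open>Two-level grids and limits of the discrete sums\<close>

lemma sum_blocks:
 fixes f :: "nat => 'b::comm_monoid_add"
 shows "(\<Sum>l<m * k. f l) = (\<Sum>i<m. \<Sum>l\<in>{i * k..<i * k + k}. f l)"
 by (rule sum.nat_group[symmetric])

lemma block_div: "l \<in> {i * k..<i * k + k} ==> l div k = (i::nat)"
 by (auto simp: div_nat_eqI mult.commute)

lemma block_telescope:
 fixes f :: "nat => 'b::ab_group_add"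
 shows "(\<Sum>l\<in>{i * k..<i * k + k}. f (Suc l) - f l) = f (Suc i * k) - f (i * k)"
 using sum_Suc_diff'[of "i * k" "i * k + k" f] by (simp add: add.commute)

lemma euler_grid:
 assumes "0 <= T" "0 < m" "0 < k" "i < m" "l \<in> {i * k..<i * k + k}"
 defines "h \<equiv> T / (real m * real k)"
 shows "real i * (T / real m) = real (i * k) * h"
  and "real l * h \<in> {0..T}" and "real (Suc l) * h \<in> {0..T}" and "real i * (T / real m) \<in> {0..T}"
  and "real l * h \<in> {real i * (T / real m)..real i * (T / real m) + T / real m}"
  and "real (Suc l) * h \<in> {real i * (T / real m)..real i * (T / real m) + T / real m}"
  and "T / real m = real k * h"
proof -
 have h: "0 <= h" using assms(1) by (simp add: h_def)
 show d: "T / real m = real k * h" using assms(3) by (simp add: h_def)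
 show q: "real i * (T / real m) = real (i * k) * h" unfolding d by simp
 have mk: "real (m * k) * h = T" using assms(2,3) by (simp add: h_def)
 have up: "real n * h <= T" if "n <= m * k" for n
  unfolding mk[symmetric] using that h by (intro mult_right_mono) (auto simp only: of_nat_le_iff)
 have "i * k + k <= m * k" using mult_le_mono1[of "Suc i" m k] assms(4) by simp
 then show "real l * h \<in> {0..T}" "real (Suc l) * h \<in> {0..T}" "real i * (T / real m) \<in> {0..T}"
  unfolding q using up[of l] up[of "Suc l"] up[of "i * k"] h assms(4,5) by auto
 have "real (i * k) * h <= real l * h" "real (i * k) * h <= real (Suc l) * h"
  "real l * h <= real (i * k + k) * h" "real (Suc l) * h <= real (i * k + k) * h"
 proof -
  have "i * k <= l" "i * k <= Suc l" "l <= i * k + k" "Suc l <= i * k + k" using assms(5) by auto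
  note le = this[THEN iffD2[OF of_nat_le_iff[where 'a = real]]]
  show "real (i * k) * h <= real l * h" "real (i * k) * h <= real (Suc l) * h"
   "real l * h <= real (i * k + k) * h" "real (Suc l) * h <= real (i * k + k) * h"
   by (rule mult_right_mono[OF le(1) h] mult_right_mono[OF le(2) h] mult_right_mono[OF le(3) h] mult_right_mono[OF le(4) h])+
 qed
 then show "real l * h \<in> {real i * (T / real m)..real i * (T / real m) + T / real m}"
  "real (Suc l) * h \<in> {real i * (T / real m)..real i * (T / real m) + T / real m}"
  unfolding q unfolding d by (auto simp: algebra_simps)
qed

text \<open>Discrete version of \<open>y T \<bullet> sig T y T - y 0 \<bullet> sig 0 y 0 = \<integral> y s \<bullet> G s y s ds\<close>, valid when
 \<open>sig' = B sig + sig B\<^sup>T + G\<close> and \<open>y' = - B\<^sup>T y\<close>.\<close>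

lemma lyapunov_sum_converges:
 fixes B sig G :: "real => real^'n^'n"
 assumes T: "0 <= T" and B: "continuous_on {0..T} B" and G: "continuous_on {0..T} G"
  and sig: "\<And>s. s \<in> {0..T} ==> (sig has_vector_derivative (B s ** sig s + sig s ** transpose (B s) + G s)) (at s within {0..T})"
  and k: "\<And>m. 0 < k m"
 shows "(%m. let y = euler B (T / real m) m u; h = T / (real m * real (k m)) in
   y 0 \<bullet> (sig 0 *v y 0) + (\<Sum>l<m * k m. h * (y (Suc (l div k m)) \<bullet> (G (real l * h) *v y (Suc (l div k m))))))
  \<longlonglongrightarrow> u \<bullet> (sig T *v u)"
proof (rule LIMSEQ_I)
 fix e :: real assume e: "0 < e"
 have sigc: "continuous_on {0..T} sig"
  using sig by (meson continuous_on_eq_continuous_within has_vector_derivative_continuous)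
 obtain b where b: "0 < b" "\<And>s. s \<in> {0..T} ==> norm (B s) <= b"
  using continuous_norm_bounded[OF B] by blast
 obtain c where c: "0 < c" "\<And>s. s \<in> {0..T} ==> norm (sig s) <= c"
  using continuous_norm_bounded[OF sigc] by blast
 define Yb where "Yb = exp (b * T) * norm u + 1"
 have Yb: "0 < Yb" by (simp add: Yb_def add_nonneg_pos)
 \<comment> \<open>A coarse step contributes four errors of size Yb^2 eps d: two from the integral
   of the derivative of \<open>sig\<close>, one from the term in d^2, one from freezing
   \<open>G\<close> on the block. They sum to 4 Yb^2 eps T, which the 6 keeps below
   \<open>e\<close>.\<close>
 define eps where "eps = e / (6 * Yb\<^sup>2 * (T + 1))"
 have eps: "0 < eps" using e T Yb by (simp add: eps_def)
 define L where "L s = B s ** sig s + sig s ** transpose (B s)" for s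
 have Lc: "continuous_on {0..T} L" unfolding L_def by (intro continuous_intros B sigc)
 obtain dl1 where d1: "0 < dl1" "\<And>s s'. s \<in> {0..T} ==> s' \<in> {0..T} ==> \<bar>s - s'\<bar> <= dl1 ==> norm (L s - L s') <= eps"
  using uniform_modulus[OF Lc eps] by auto
 obtain dl2 where d2: "0 < dl2" "\<And>s s'. s \<in> {0..T} ==> s' \<in> {0..T} ==> \<bar>s - s'\<bar> <= dl2 ==> norm (G s - G s') <= eps"
  using uniform_modulus[OF G eps] by auto
 \<comment> \<open>The third entry controls d^2 y . B sig B^T y, a term that the discrete step
   creates and the differential equation does not have.\<close>
 define dl where "dl = min (min dl1 dl2) (eps / (b * c * b))"
 have dl: "0 < dl" using d1 d2 eps b c by (simp add: dl_def)
 obtain m0 :: nat where m0: "T / dl + 1 < real m0" using reals_Archimedean2 by blast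
 show "\<exists>m0. \<forall>m\<ge>m0. norm ((let y = euler B (T / real m) m u; h = T / (real m * real (k m)) in
   y 0 \<bullet> (sig 0 *v y 0) + (\<Sum>l<m * k m. h * (y (Suc (l div k m)) \<bullet> (G (real l * h) *v y (Suc (l div k m)))))) - u \<bullet> (sig T *v u)) < e"
 proof (intro exI allI impI)
  fix m assume m: "m0 <= m"
  have Tdl: "0 <= T / dl" using T dl by simp
  have m0': "0 < m" using m0 m Tdl by (smt (verit, best) of_nat_0_less_iff of_nat_mono)
  define d where "d = T / real m"
  have "T / dl <= real m" using m0 m by linarith
  then have "T <= dl * real m" by (simp only: pos_divide_le_eq[OF dl] mult.commute)
  then have dd: "d <= dl" using m0' by (simp add: d_def pos_divide_le_eq)
  have d0: "0 <= d" using T by (simp add: d_def)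
  have dm: "d * real m = T" using m0' by (simp add: d_def)
  define h where "h = T / (real m * real (k m))"
  have h0: "0 <= h" using T by (simp add: h_def)
  define y where "y = euler B d m u"
  let ?q = "%i. real i * d"
  note grid = euler_grid[OF T m0' k, of _ _ m, folded h_def, folded d_def]
  have qT: "?q i \<in> {0..T}" if "i < m" for i
   using grid(4)[OF that, of "i * k m"] k[of m] by simp
  have yb: "norm (y i) <= Yb" if "i <= m" for i
  proof -
   have "norm (y i) <= exp (b * (d * real m)) * norm u"
    unfolding y_def
    by (rule euler_bound) (use b d0 that qT in auto)
   then show ?thesis by (simp add: dm Yb_def)
  qed
  have quad: "\<bar>y i \<bullet> (X *v y i)\<bar> <= Yb\<^sup>2 * r" if "i <= m" "norm X <= r" for i r and X :: "real^'n^'n"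
  proof -
   have "\<bar>y i \<bullet> (X *v y i)\<bar> <= norm X * norm (y i) * norm (y i)" by (rule inner_matrix_vector_le)
   also have "\<dots> <= r * Yb * Yb" using that yb[OF that(1)] Yb by (intro mult_mono mult_nonneg_nonneg) (auto intro: order_trans[OF norm_ge_zero])
   finally show ?thesis by (simp add: power2_eq_square ac_simps)
  qed
  let ?a = "%i. y i \<bullet> (sig (?q i) *v y i)"
  let ?g = "%l. h * (y (Suc (l div k m)) \<bullet> (G (real l * h) *v y (Suc (l div k m))))"
  have step: "\<bar>?a (Suc i) - ?a i - (\<Sum>l\<in>{i * k m..<i * k m + k m}. ?g l)\<bar> <= 4 * Yb\<^sup>2 * eps * d" if i: "i < m" for i
  proof -
   have i0: "i * k m \<in> {i * k m..<i * k m + k m}" using k[of m] by simp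
   have qi: "?q i \<in> {0..T}" by (rule grid(4)[OF i i0])
   have qs: "?q (Suc i) \<in> {0..T}"
   proof -
    have "i * k m + k m - 1 \<in> {i * k m..<i * k m + k m}" using k[of m] by auto
    moreover have "Suc (i * k m + k m - 1) = Suc i * k m" using k[of m] by simp
    ultimately have "real (Suc i * k m) * h \<in> {0..T}" using grid(3)[OF i, of "i * k m + k m - 1"] by (simp only:)
    moreover have "real (Suc i * k m) * h = ?q (Suc i)"
     using grid(7)[OF i i0] by (simp add: algebra_simps)
    ultimately show ?thesis by (simp only:)
   qed
   have qd: "?q (Suc i) - ?q i = d" by (simp add: algebra_simps)
   have qle: "?q i <= ?q (Suc i)" using d0 by (simp add: algebra_simps)
   have sub: "{?q i..?q (Suc i)} \<subseteq> {0..T}" using qi qs by auto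
   let ?w = "y (Suc i)"
   have hi: "((%s. B s ** sig s + sig s ** transpose (B s) + G s) has_integral sig (?q (Suc i)) - sig (?q i)) {?q i..?q (Suc i)}"
    by (rule fundamental_theorem_of_calculus_on[OF qle _ sub]) (use sig sub in auto)
   have nb: "norm (B s ** sig s + sig s ** transpose (B s) + G s - (L (?q i) + G (?q i))) <= 2 * eps" if s: "s \<in> {?q i..?q (Suc i)}" for s
   proof -
    have sT: "s \<in> {0..T}" using s sub by auto
    have sd: "\<bar>s - ?q i\<bar> <= dl1" "\<bar>s - ?q i\<bar> <= dl2" using s qd dd by (auto simp: dl_def)
    have "norm (B s ** sig s + sig s ** transpose (B s) + G s - (L (?q i) + G (?q i))) = norm ((L s - L (?q i)) + (G s - G (?q i)))"
     by (simp add: L_def algebra_simps)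
    also have "\<dots> <= eps + eps"
     by (intro norm_triangle_mono d1 d2 sT qi sd)
    finally show ?thesis by simp
   qed
   have n1: "norm (sig (?q (Suc i)) - sig (?q i) - d *\<^sub>R (L (?q i) + G (?q i))) <= 2 * eps * d"
    using has_integral_near_constant[OF hi qle nb] unfolding qd .
   have n2: "norm ((d * d) *\<^sub>R (B (?q i) ** sig (?q i) ** transpose (B (?q i)))) <= eps * d"
   proof -
    have "norm (B (?q i) ** sig (?q i) ** transpose (B (?q i))) <= norm (B (?q i)) * norm (sig (?q i)) * norm (B (?q i))"
     by (rule order_trans[OF norm_matrix_matrix_mult_le])
      (simp add: norm_transpose mult_right_mono norm_matrix_matrix_mult_le)
    also have "\<dots> <= b * c * b" using b c qi by (intro mult_mono) auto
    finally have "d * norm (B (?q i) ** sig (?q i) ** transpose (B (?q i))) <= eps / (b * c * b) * (b * c * b)"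
     using dd d0 eps b c by (intro mult_mono) (auto simp: dl_def)
    also have "\<dots> = eps" using b c by simp
    finally have "d * norm (B (?q i) ** sig (?q i) ** transpose (B (?q i))) * d <= eps * d"
     using d0 by (rule mult_right_mono)
    then show ?thesis using d0 by (simp add: ac_simps)
   qed
   have n3: "norm (\<Sum>l\<in>{i * k m..<i * k m + k m}. h *\<^sub>R (G (real l * h) - G (?q i))) <= eps * d"
   proof -
    have "norm (\<Sum>l\<in>{i * k m..<i * k m + k m}. h *\<^sub>R (G (real l * h) - G (?q i))) <= (\<Sum>l\<in>{i * k m..<i * k m + k m}. h * eps)"
    proof (intro sum_norm_le)
     fix l assume l: "l \<in> {i * k m..<i * k m + k m}"
     have "\<bar>real l * h - ?q i\<bar> <= dl2" using grid(5)[OF i l] dd by (auto simp: dl_def)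
     then have "norm (G (real l * h) - G (?q i)) <= eps" by (intro d2 grid(2)[OF i l] qi)
     then show "norm (h *\<^sub>R (G (real l * h) - G (?q i))) <= h * eps" using h0 by (simp add: mult_left_mono)
    qed
    also have "\<dots> = eps * d" using grid(7)[OF i i0] by simp
    finally show ?thesis .
   qed
   have sumG: "(\<Sum>l\<in>{i * k m..<i * k m + k m}. h *\<^sub>R (G (real l * h) - G (?q i))) = (\<Sum>l\<in>{i * k m..<i * k m + k m}. h *\<^sub>R G (real l * h)) - d *\<^sub>R G (?q i)"
    using grid(7)[OF i i0] by (simp add: scaleR_diff_right sum_subtractf sum_constant_scaleR del: sum_constant)
   have yi: "y i = ?w + d *\<^sub>R (transpose (B (?q i)) *v ?w)"
    unfolding y_def by (rule euler_step[OF i])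
   have Bq: "(transpose (B (?q i)) *v ?w) \<bullet> z = ?w \<bullet> (B (?q i) *v z)" for z
    by (simp add: inner_matrix_vector_transpose[of ?w "B (?q i)"])
   have ai: "?a i = ?w \<bullet> ((sig (?q i) + d *\<^sub>R L (?q i) + (d * d) *\<^sub>R (B (?q i) ** sig (?q i) ** transpose (B (?q i)))) *v ?w)"
    unfolding yi L_def
    by (simp only: matrix_vector_linear inner_add_left inner_add_right inner_scaleR_left inner_scaleR_right Bq
      matrix_vector_mul_assoc[symmetric]) (simp add: algebra_simps)
   have sg: "(\<Sum>l\<in>{i * k m..<i * k m + k m}. ?g l) = ?w \<bullet> ((\<Sum>l\<in>{i * k m..<i * k m + k m}. h *\<^sub>R G (real l * h)) *v ?w)"
   proof -
    have "(\<Sum>l\<in>{i * k m..<i * k m + k m}. ?g l) = (\<Sum>l\<in>{i * k m..<i * k m + k m}. ?w \<bullet> ((h *\<^sub>R G (real l * h)) *v ?w))"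
     by (intro sum.cong refl) (simp add: block_div matrix_vector_linear)
    also have "\<dots> = ?w \<bullet> ((\<Sum>l\<in>{i * k m..<i * k m + k m}. h *\<^sub>R G (real l * h)) *v ?w)"
     by (simp add: bounded_bilinear.sum_left[OF bounded_bilinear_matrix_vector_mult] inner_sum_right)
    finally show ?thesis .
   qed
   have "?a (Suc i) - ?a i - (\<Sum>l\<in>{i * k m..<i * k m + k m}. ?g l)
     = ?w \<bullet> ((sig (?q (Suc i)) - sig (?q i) - d *\<^sub>R (L (?q i) + G (?q i))) *v ?w)
      - ?w \<bullet> (((d * d) *\<^sub>R (B (?q i) ** sig (?q i) ** transpose (B (?q i)))) *v ?w)
      - ?w \<bullet> ((\<Sum>l\<in>{i * k m..<i * k m + k m}. h *\<^sub>R (G (real l * h) - G (?q i))) *v ?w)"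
    unfolding ai sg sumG by (simp add: matrix_vector_linear inner_diff_right inner_add_right algebra_simps)
   moreover have "Suc i <= m" using i by simp
   note quad[OF this n1] quad[OF this n2] quad[OF this n3]
   ultimately show ?thesis by (simp add: algebra_simps)
  qed
  have "(\<Sum>i<m. ?a (Suc i) - ?a i) = ?a m - ?a 0" by (rule sum_lessThan_telescope)
  moreover have "?a m = u \<bullet> (sig T *v u)" using dm by (simp add: y_def mult.commute)
  ultimately have eq: "y 0 \<bullet> (sig 0 *v y 0) + (\<Sum>l<m * k m. ?g l) - u \<bullet> (sig T *v u)
    = - (\<Sum>i<m. ?a (Suc i) - ?a i - (\<Sum>l\<in>{i * k m..<i * k m + k m}. ?g l))"
   unfolding sum_blocks sum_subtractf[of "%i. ?a (Suc i) - ?a i"] by simp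
  have "norm (y 0 \<bullet> (sig 0 *v y 0) + (\<Sum>l<m * k m. ?g l) - u \<bullet> (sig T *v u)) <= (\<Sum>i<m. 4 * Yb\<^sup>2 * eps * d)"
   unfolding eq norm_minus_cancel by (intro sum_norm_le) (use step in auto)
  also have "\<dots> = 4 * Yb\<^sup>2 * eps * T" using dm by (simp add: ac_simps)
  also have "\<dots> < e"
  proof -
   have y: "Yb\<^sup>2 * eps = e / (6 * (T + 1))" using Yb by (simp add: eps_def)
   have "4 * Yb\<^sup>2 * eps * T = 4 * (Yb\<^sup>2 * eps) * T" by simp
   also have "\<dots> = (4 * e / 6) * (T / (T + 1))" unfolding y using T by (simp add: divide_simps)
   also have "\<dots> <= (4 * e / 6) * 1" using e T by (intro mult_left_mono) auto
   also have "\<dots> < e" using e by simp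
   finally show ?thesis .
  qed
  finally show "norm ((let y = euler B (T / real m) m u; h = T / (real m * real (k m)) in
   y 0 \<bullet> (sig 0 *v y 0) + (\<Sum>l<m * k m. h * (y (Suc (l div k m)) \<bullet> (G (real l * h) *v y (Suc (l div k m)))))) - u \<bullet> (sig T *v u)) < e"
   by (simp add: Let_def y_def h_def d_def)
 qed
qed

definition gridp :: "real => nat => nat => nat => real" where
 "gridp T m k l = real l * (T / (real m * real k))"

text \<open>The weights are constant on the \<open>m\<close> coarse blocks of \<open>k\<close> grid points each. On a fixed coarse grid,
 a stochastic integral is approximated by fine Riemann sums at finitely many times only, which is all
 that convergence in probability at fixed times provides.\<close>

definition weight :: "(real => real^'n^'n) => real => nat => nat => real^'n => nat => real^'n" where
 "weight B T m k u l = euler B (T / real m) m u (Suc (l div k))"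

text \<open>Discrete form of the integral of y . (a ds + H (dY - c ds)). Only the observations and
  the gain occur, so the sum is measurable for the history of \<open>Y\<close> as soon as the gain
  is.\<close>

definition obs_sum where
 "obs_sum A C a c H Y T m k u = (\<Sum>l<m * k. weight (%s. A - H s ** C) T m k u l \<bullet>
  ((T / (real m * real k)) *\<^sub>R a + H (gridp T m k l) *v
    (Y (gridp T m k (Suc l)) - Y (gridp T m k l) - (T / (real m * real k)) *\<^sub>R c)))"

text \<open>Integrand against the joint Brownian motion (w, v) for y . (R1h dw - H R2h dv), the
  matrices being moved onto y by transposition. It is a pair so that a single Brownian motion on the
  product space serves.\<close>

definition noise_coef where
 "noise_coef A C R1h R2h H T m k u l =
  (let y = weight (%s. A - H s ** C) T m k u l in (R1h *v y, - (R2h *v (transpose (H (gridp T m k l)) *v y))))"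

definition noise_sum where
 "noise_sum A C R1h R2h H w T m k u =
  (\<Sum>l<m * k. noise_coef A C R1h R2h H T m k u l \<bullet> (w (gridp T m k (Suc l)) - w (gridp T m k l)))"

text \<open>Error of the fine Riemann sum against the stochastic integral up to the
  \<open>i\<close>-th coarse time \<open>q\<close>; the integral is expressed through the equation
  that it satisfies, and \<open>Z\<close> is the integrator of the gain. With the signal in place of
  the diffusion, both \<open>Z\<close> and the defect vanish.\<close>

definition riemann_defect where
 "riemann_defect A C a c R1h R2h H x w v Y T m k i =
  (let q = real i * (T / real m);
    Z = (%s. Y s - (integral {0..s} (%r. C *v x r + c) + R2h *v v s)) in
  (x q - x 0 - integral {0..q} (%r. A *v x r + a) - R1h *v w q)
   - (\<Sum>l<i * k. H (gridp T m k l) *v (Z (gridp T m k (Suc l)) - Z (gridp T m k l))))"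

text \<open>A statement about single paths; all probability is hidden in \<open>small\<close>.
  Summation by parts with the Euler weights turns u . x T into the sums, up to consistency errors of
  the drift, which vanish with the mesh, and increments of the defects between coarse times. There
  are m of these, each of order (m + 1)^-2, so their total vanishes; this is the reason for the rate
  in \<open>small\<close>.\<close>

lemma pathwise_representation:
 fixes x w :: "real => real^'n" and v Y :: "real => real^'m" and H :: "real => real^'m^'n"
  and A R1h :: "real^'n^'n" and C :: "real^'n^'m" and R2h :: "real^'m^'m" and k :: "nat => nat"
 assumes T: "0 <= T" and x: "continuous_on {0..T} x" and H: "continuous_on {0..T} H"
  and sym: "symmetric_mat R1h" "symmetric_mat R2h"
  and k: "\<And>m. 0 < k m"
  and small: "\<forall>\<^sub>F m in sequentially. \<forall>i\<le>m. norm (riemann_defect A C a c R1h R2h H x w v Y T m (k m) i) <= 1 / (real m + 1)\<^sup>2"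
 shows "(%m. obs_sum A C a c H Y T m (k m) u + (euler (%s. A - H s ** C) (T / real m) m u 0 \<bullet> x 0
   + noise_sum A C R1h R2h H (%s. (w s, v s)) T m (k m) u)) \<longlonglongrightarrow> u \<bullet> x T"
proof (rule LIMSEQ_I)
 fix e :: real assume e: "0 < e"
 define B where "B s = A - H s ** C" for s
 have Bc: "continuous_on {0..T} B" unfolding B_def by (intro continuous_intros H)
 obtain b where b: "0 < b" "\<And>s. s \<in> {0..T} ==> norm (B s) <= b"
  using continuous_norm_bounded[OF Bc] by blast
 obtain xb where xb: "0 < xb" "\<And>s. s \<in> {0..T} ==> norm (x s) <= xb"
  using continuous_norm_bounded[OF x] by blast
 obtain Hb where Hb: "0 < Hb" "\<And>s. s \<in> {0..T} ==> norm (H s) <= Hb"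
  using continuous_norm_bounded[OF H] by blast
 define Yb where "Yb = exp (b * T) * norm u + 1"
 have Yb: "0 < Yb" by (simp add: Yb_def add_nonneg_pos)
 define D where "D = norm A + Hb * norm C + norm C * xb + 1"
 have D: "0 < D" using Hb xb by (simp add: D_def add_nonneg_pos)
 define eps where "eps = e / (4 * Yb * (T + 1) * D)"
 have eps: "0 < eps" using e T Yb D by (simp add: eps_def)
 obtain dl1 where d1: "0 < dl1" "\<And>s s'. s \<in> {0..T} ==> s' \<in> {0..T} ==> \<bar>s - s'\<bar> <= dl1 ==> norm (x s - x s') <= eps"
  using uniform_modulus[OF x eps] by auto
 obtain dl2 where d2: "0 < dl2" "\<And>s s'. s \<in> {0..T} ==> s' \<in> {0..T} ==> \<bar>s - s'\<bar> <= dl2 ==> norm (H s - H s') <= eps"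
  using uniform_modulus[OF H eps] by auto
 define dl where "dl = min dl1 dl2"
 have dl: "0 < dl" using d1 d2 by (simp add: dl_def)
 \<comment> \<open>T / dl makes the coarse mesh at most \<open>dl\<close>; 8 Yb / e makes the total
   contribution 2 Yb / (m + 1) of the defects at most e / 4.\<close>
 obtain m1 :: nat where m1: "T / dl + 1 + 8 * Yb / e < real m1" using reals_Archimedean2 by blast
 obtain m2 where m2: "\<And>m i. m2 <= m ==> i <= m ==>
   norm (riemann_defect A C a c R1h R2h H x w v Y T m (k m) i) <= 1 / (real m + 1)\<^sup>2"
  using small unfolding eventually_sequentially by blast
 show "\<exists>m0. \<forall>m\<ge>m0. norm (obs_sum A C a c H Y T m (k m) u + (euler (%s. A - H s ** C) (T / real m) m u 0 \<bullet> x 0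
   + noise_sum A C R1h R2h H (%s. (w s, v s)) T m (k m) u) - u \<bullet> x T) < e"
 proof (intro exI[of _ "max m1 m2"] allI impI)
  fix m assume "max m1 m2 <= m"
  then have m: "m1 <= m" "m2 <= m" by auto
  have Tdl: "0 <= T / dl" "0 < 8 * Yb / e" using T dl Yb e by auto
  have m1m: "real m1 <= real m" using m by simp
  have m0': "0 < m" using m1 m1m Tdl by linarith
  define d where "d = T / real m"
  have "T / dl <= real m" using m1 m1m Tdl by linarith
  then have "T <= dl * real m" by (simp only: pos_divide_le_eq[OF dl] mult.commute)
  then have dd: "d <= dl" using m0' by (simp add: d_def pos_divide_le_eq)
  have d0: "0 <= d" using T by (simp add: d_def)
  have dm: "d * real m = T" using m0' by (simp add: d_def)
  define h where "h = T / (real m * real (k m))"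
  have h0: "0 <= h" using T by (simp add: h_def)
  define y where "y = euler B d m u"
  define p where "p l = real l * h" for l
  let ?q = "%i. real i * d"
  note grid = euler_grid[OF T m0' k, of _ _ m, folded h_def, folded d_def]
  have pg: "gridp T m (k m) l = p l" for l by (simp add: gridp_def p_def h_def)
  have wy: "weight (%s. A - H s ** C) T m (k m) u l = y (Suc (l div k m))" for l
   by (simp add: weight_def y_def d_def B_def[abs_def])
  have qT: "?q i \<in> {0..T}" if "i < m" for i
   using grid(4)[OF that, of "i * k m"] k[of m] by simp
  have yb: "norm (y i) <= Yb" if "i <= m" for i
  proof -
   have "norm (y i) <= exp (b * (d * real m)) * norm u"
    unfolding y_def by (rule euler_bound) (use b d0 that qT in auto)
   then show ?thesis by (simp add: dm Yb_def)
  qed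
  define I where "I s = x s - x 0 - integral {0..s} (%r. A *v x r + a) - R1h *v w s" for s
  define Z where "Z s = Y s - (integral {0..s} (%r. C *v x r + c) + R2h *v v s)" for s
  define rd where "rd i = I (?q i) - (\<Sum>l<i * k m. H (p l) *v (Z (p (Suc l)) - Z (p l)))" for i
  have rdb: "norm (rd i) <= 1 / (real m + 1)\<^sup>2" if "i <= m" for i
   using m2[OF m(2) that]
   by (simp add: riemann_defect_def Let_def rd_def I_def Z_def pg d_def)
  let ?obs = "%l. y (Suc (l div k m)) \<bullet> (h *\<^sub>R a + H (p l) *v (Y (p (Suc l)) - Y (p l) - h *\<^sub>R c))"
  let ?noi = "%l. (R1h *v y (Suc (l div k m))) \<bullet> (w (p (Suc l)) - w (p l))
    - (R2h *v (transpose (H (p l)) *v y (Suc (l div k m)))) \<bullet> (v (p (Suc l)) - v (p l))"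
  have qk: "?q i = p (i * k m)" for i
   using k[of m] by (simp add: p_def d_def h_def)
  have step: "\<bar>y (Suc i) \<bullet> x (?q (Suc i)) - y i \<bullet> x (?q i) - (\<Sum>l\<in>{i * k m..<i * k m + k m}. ?obs l + ?noi l)
    - y (Suc i) \<bullet> (rd (Suc i) - rd i)\<bar> <= Yb * (D * eps * d)" if i: "i < m" for i
  proof -
   let ?Bl = "{i * k m..<i * k m + k m}"
   let ?w = "y (Suc i)"
   have i0: "i * k m \<in> ?Bl" using k[of m] by simp
   have d: "d = real (k m) * h" by (rule grid(7)[OF i i0])
   define J1 where "J1 l = integral {p l..p (Suc l)} (%r. A *v x r + a)" for l
   define J2 where "J2 l = integral {p l..p (Suc l)} (%r. C *v x r + c)" for l
   have ple: "p l <= p (Suc l)" "p (Suc l) - p l = h" for l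
    using h0 by (simp_all add: p_def algebra_simps)
   have pT: "p l \<in> {0..T}" "p (Suc l) \<in> {0..T}" if "l \<in> ?Bl" for l
    using grid(2,3)[OF i that] by (simp_all add: p_def)
   have c1: "continuous_on {0..T} (%r. A *v x r + a)" and c2: "continuous_on {0..T} (%r. C *v x r + c)"
    by (intro continuous_intros x)+
   have split: "integral {0..p (Suc l)} f - integral {0..p l} f = integral {p l..p (Suc l)} f"
    if l: "l \<in> ?Bl" and f: "continuous_on {0..T} f" for l and f :: "real => 'z::euclidean_space"
   proof -
    have "f integrable_on {0..p (Suc l)}"
     by (intro integrable_continuous_real continuous_on_subset[OF f]) (use pT[OF l] in auto)
    from Henstock_Kurzweil_Integration.integral_combine[OF _ ple(1) this] show ?thesis
     using pT[OF l] by (simp add: algebra_simps)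
   qed
   have Idiff: "x (p (Suc l)) - x (p l) = (I (p (Suc l)) - I (p l)) + J1 l + R1h *v (w (p (Suc l)) - w (p l))" if l: "l \<in> ?Bl" for l
    using split[OF l c1] by (simp add: I_def J1_def matrix_vector_linear algebra_simps)
   have Zdiff: "Z (p (Suc l)) - Z (p l) = Y (p (Suc l)) - Y (p l) - J2 l - R2h *v (v (p (Suc l)) - v (p l))" if l: "l \<in> ?Bl" for l
    using split[OF l c2] by (simp add: Z_def J2_def matrix_vector_linear algebra_simps)
   have xsum: "x (?q (Suc i)) - x (?q i) = (\<Sum>l\<in>?Bl. x (p (Suc l)) - x (p l))"
    unfolding qk block_telescope[of "%l. x (p l)"] ..
   have Isum: "I (?q (Suc i)) - I (?q i) = (\<Sum>l\<in>?Bl. I (p (Suc l)) - I (p l))"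
    unfolding qk block_telescope[of "%l. I (p l)"] ..
   have rsum: "rd (Suc i) - rd i = (\<Sum>l\<in>?Bl. I (p (Suc l)) - I (p l)) - (\<Sum>l\<in>?Bl. H (p l) *v (Z (p (Suc l)) - Z (p l)))"
   proof -
    have "(\<Sum>l<Suc i * k m. H (p l) *v (Z (p (Suc l)) - Z (p l))) = (\<Sum>l<i * k m. H (p l) *v (Z (p (Suc l)) - Z (p l))) + (\<Sum>l\<in>?Bl. H (p l) *v (Z (p (Suc l)) - Z (p l)))"
     unfolding sum_blocks by simp
    then show ?thesis unfolding rd_def Isum[symmetric] by simp
   qed
   \<comment> \<open>Drift over one fine step minus its frozen value: \<open>B\<close> and
     \<open>x\<close> are frozen at the coarse time, while the constant part keeps the gain at the
     fine time.\<close>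
   define E where "E l = (J1 l - H (p l) *v J2 l) - h *\<^sub>R (a - H (p l) *v c + B (?q i) *v x (?q i))" for l
   have Eb: "norm (E l) <= D * eps * h" if l: "l \<in> ?Bl" for l
   proof -
    have sub: "{p l..p (Suc l)} \<subseteq> {0..T}" using pT[OF l] by auto
    have h1: "((%r. A *v x r + a) has_integral J1 l) {p l..p (Suc l)}"
     unfolding J1_def by (intro integrable_integral integrable_continuous_real continuous_on_subset[OF c1 sub])
    have "((%r. C *v x r + c) has_integral J2 l) {p l..p (Suc l)}"
     unfolding J2_def by (intro integrable_integral integrable_continuous_real continuous_on_subset[OF c2 sub])
    from has_integral_linear[OF this matrix_vector_mul_bounded_linear[of "H (p l)"]]
    have "((%r. H (p l) *v (C *v x r + c)) has_integral H (p l) *v J2 l) {p l..p (Suc l)}"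
     by (simp add: o_def)
    from has_integral_diff[OF h1 this]
    have hi: "((%r. (A *v x r + a) - H (p l) *v (C *v x r + c)) has_integral J1 l - H (p l) *v J2 l) {p l..p (Suc l)}" .
    have "norm ((A *v x r + a) - H (p l) *v (C *v x r + c) - (a - H (p l) *v c + B (?q i) *v x (?q i))) <= D * eps"
     if r: "r \<in> {p l..p (Suc l)}" for r
    proof -
     have rT: "r \<in> {0..T}" using r sub by auto
     have rq: "\<bar>r - ?q i\<bar> <= dl1" "\<bar>p l - ?q i\<bar> <= dl2"
      using r grid(5,6)[OF i l] dd by (auto simp: dl_def p_def)
     have "(A *v x r + a) - H (p l) *v (C *v x r + c) - (a - H (p l) *v c + B (?q i) *v x (?q i))
       = (A *v (x r - x (?q i)) - H (p l) *v (C *v (x r - x (?q i)))) - (H (p l) - H (?q i)) *v (C *v x (?q i))"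
      by (simp add: B_def matrix_vector_linear matrix_vector_mul_assoc[symmetric] algebra_simps)
     also have "norm \<dots> <= (norm A * eps + Hb * (norm C * eps)) + eps * (norm C * xb)"
     proof (intro order_trans[OF norm_triangle_ineq4] add_mono)
      have dx: "norm (x r - x (?q i)) <= eps" by (intro d1 rT qT i rq)
      show "norm (A *v (x r - x (?q i))) <= norm A * eps"
       by (intro order_trans[OF norm_matrix_vector_mult_le] mult_left_mono dx) auto
      have "norm (C *v (x r - x (?q i))) <= norm C * eps"
       by (intro order_trans[OF norm_matrix_vector_mult_le] mult_left_mono dx) auto
      then show "norm (H (p l) *v (C *v (x r - x (?q i)))) <= Hb * (norm C * eps)"
       using order_trans[OF norm_matrix_vector_mult_le mult_mono[OF Hb(2)[OF pT(1)[OF l]]]] Hb(1) by simp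
      have "norm (C *v x (?q i)) <= norm C * xb"
       by (intro order_trans[OF norm_matrix_vector_mult_le] mult_left_mono xb qT i) auto
      then show "norm ((H (p l) - H (?q i)) *v (C *v x (?q i))) <= eps * (norm C * xb)"
       using order_trans[OF norm_matrix_vector_mult_le mult_mono[OF d2(2)[OF pT(1)[OF l] qT[OF i] rq(2)]]] eps by simp
     qed
     also have "\<dots> <= D * eps" using eps by (simp add: D_def algebra_simps)
     finally show ?thesis .
    qed
    from has_integral_near_constant[OF hi ple(1) this] show ?thesis
     unfolding E_def ple(2) by simp
   qed
   have yi: "y i = ?w + d *\<^sub>R (transpose (B (?q i)) *v ?w)"
    unfolding y_def by (rule euler_step[OF i])
   have yx: "y i \<bullet> x (?q i) = ?w \<bullet> x (?q i) + ?w \<bullet> (d *\<^sub>R (B (?q i) *v x (?q i)))"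
    unfolding yi by (simp add: inner_add_left inner_matrix_vector_transpose[of ?w "B (?q i)"])
   have dsum: "d *\<^sub>R (B (?q i) *v x (?q i)) = (\<Sum>l\<in>?Bl. h *\<^sub>R (B (?q i) *v x (?q i)))"
    by (simp add: d sum_constant_scaleR del: sum_constant)
   have terms: "?obs l + ?noi l = ?w \<bullet> (h *\<^sub>R a + H (p l) *v (Y (p (Suc l)) - Y (p l) - h *\<^sub>R c)
     + R1h *v (w (p (Suc l)) - w (p l)) - H (p l) *v (R2h *v (v (p (Suc l)) - v (p l))))" if l: "l \<in> ?Bl" for l
   proof -
    have "?w \<bullet> (R1h *v z) = (R1h *v ?w) \<bullet> z" for z
     using inner_matrix_vector_transpose[of ?w R1h z] sym(1) by (simp add: symmetric_mat_def)
    moreover have "?w \<bullet> (H (p l) *v (R2h *v z)) = (R2h *v (transpose (H (p l)) *v ?w)) \<bullet> z" for z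
     using inner_matrix_vector_transpose[of ?w "H (p l)" "R2h *v z"] inner_matrix_vector_transpose[of "transpose (H (p l)) *v ?w" R2h z] sym(2)
     by (simp add: symmetric_mat_def)
    ultimately show ?thesis unfolding block_div[OF l] by (simp add: inner_add_right inner_diff_right)
   qed
   have "y (Suc i) \<bullet> x (?q (Suc i)) - y i \<bullet> x (?q i) - (\<Sum>l\<in>?Bl. ?obs l + ?noi l) - y (Suc i) \<bullet> (rd (Suc i) - rd i)
     = ?w \<bullet> (\<Sum>l\<in>?Bl. E l)"
   proof -
    have "(\<Sum>l\<in>?Bl. ?obs l + ?noi l) = ?w \<bullet> (\<Sum>l\<in>?Bl. h *\<^sub>R a + H (p l) *v (Y (p (Suc l)) - Y (p l) - h *\<^sub>R c)
     + R1h *v (w (p (Suc l)) - w (p l)) - H (p l) *v (R2h *v (v (p (Suc l)) - v (p l))))"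
     unfolding inner_sum_right by (rule sum.cong[OF refl terms])
    then have "y (Suc i) \<bullet> x (?q (Suc i)) - y i \<bullet> x (?q i) - (\<Sum>l\<in>?Bl. ?obs l + ?noi l) - y (Suc i) \<bullet> (rd (Suc i) - rd i)
     = ?w \<bullet> ((x (?q (Suc i)) - x (?q i)) - d *\<^sub>R (B (?q i) *v x (?q i)) - (\<Sum>l\<in>?Bl. h *\<^sub>R a + H (p l) *v (Y (p (Suc l)) - Y (p l) - h *\<^sub>R c)
     + R1h *v (w (p (Suc l)) - w (p l)) - H (p l) *v (R2h *v (v (p (Suc l)) - v (p l)))) - (rd (Suc i) - rd i))"
     unfolding yx by (simp add: inner_diff_right)
    also have "(x (?q (Suc i)) - x (?q i)) - d *\<^sub>R (B (?q i) *v x (?q i)) - (\<Sum>l\<in>?Bl. h *\<^sub>R a + H (p l) *v (Y (p (Suc l)) - Y (p l) - h *\<^sub>R c)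
     + R1h *v (w (p (Suc l)) - w (p l)) - H (p l) *v (R2h *v (v (p (Suc l)) - v (p l)))) - (rd (Suc i) - rd i) = (\<Sum>l\<in>?Bl. E l)"
     unfolding xsum dsum rsum sum_subtractf[symmetric]
     by (rule sum.cong[OF refl]) (simp add: Idiff Zdiff E_def matrix_vector_linear algebra_simps)
    finally show ?thesis .
   qed
   also have "\<bar>\<dots>\<bar> <= norm ?w * norm (\<Sum>l\<in>?Bl. E l)" by (rule Cauchy_Schwarz_ineq2)
   also have "\<dots> <= Yb * (D * eps * d)"
   proof (intro mult_mono yb)
    have "norm (\<Sum>l\<in>?Bl. E l) <= (\<Sum>l\<in>?Bl. D * eps * h)" by (intro sum_norm_le Eb)
    then show "norm (\<Sum>l\<in>?Bl. E l) <= D * eps * d" by (simp add: d ac_simps)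
   qed (use i Yb in auto)
   finally show ?thesis .
  qed
  have rstep: "\<bar>y (Suc i) \<bullet> (rd (Suc i) - rd i)\<bar> <= Yb * (2 / (real m + 1)\<^sup>2)" if i: "i < m" for i
  proof -
   have "\<bar>y (Suc i) \<bullet> (rd (Suc i) - rd i)\<bar> <= norm (y (Suc i)) * norm (rd (Suc i) - rd i)" by (rule Cauchy_Schwarz_ineq2)
   also have "\<dots> <= Yb * (1 / (real m + 1)\<^sup>2 + 1 / (real m + 1)\<^sup>2)"
    by (intro mult_mono yb order_trans[OF norm_triangle_ineq4] add_mono rdb) (use i Yb in auto)
   finally show ?thesis by simp
  qed
  have os: "obs_sum A C a c H Y T m (k m) u = (\<Sum>l<m * k m. ?obs l)"
   unfolding obs_sum_def wy pg h_def ..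
  have ns: "noise_sum A C R1h R2h H (%s. (w s, v s)) T m (k m) u = (\<Sum>l<m * k m. ?noi l)"
   unfolding noise_sum_def noise_coef_def Let_def wy pg by simp
  have eu: "euler (%s. A - H s ** C) (T / real m) m u 0 = y 0"
   by (simp add: y_def d_def B_def[abs_def])
  have "(\<Sum>i<m. y (Suc i) \<bullet> x (?q (Suc i)) - y i \<bullet> x (?q i)) = y m \<bullet> x (?q m) - y 0 \<bullet> x (?q 0)"
   by (rule sum_lessThan_telescope)
  then have tel: "(\<Sum>i<m. y (Suc i) \<bullet> x (?q (Suc i)) - y i \<bullet> x (?q i)) = u \<bullet> x T - y 0 \<bullet> x 0"
   using dm by (simp add: y_def mult.commute)
  have lhs: "(\<Sum>l<m * k m. ?obs l) + (y 0 \<bullet> x 0 + (\<Sum>l<m * k m. ?noi l)) - u \<bullet> x T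
    = - (\<Sum>i<m. (y (Suc i) \<bullet> x (?q (Suc i)) - y i \<bullet> x (?q i) - (\<Sum>l\<in>{i * k m..<i * k m + k m}. ?obs l + ?noi l)
    - y (Suc i) \<bullet> (rd (Suc i) - rd i)) + y (Suc i) \<bullet> (rd (Suc i) - rd i))"
   (is "?lhs = - (\<Sum>i<m. ?t i + ?s i)")
  proof -
   have "(\<Sum>i<m. ?t i + ?s i) = (\<Sum>i<m. y (Suc i) \<bullet> x (?q (Suc i)) - y i \<bullet> x (?q i)) - (\<Sum>l<m * k m. ?obs l + ?noi l)"
    unfolding sum_blocks sum_subtractf[symmetric] by (rule sum.cong[OF refl]) simp
   then show ?thesis unfolding tel by (simp add: sum.distrib)
  qed
  have "norm ((\<Sum>l<m * k m. ?obs l) + (y 0 \<bullet> x 0 + (\<Sum>l<m * k m. ?noi l)) - u \<bullet> x T) <= (\<Sum>i<m. Yb * (D * eps * d) + Yb * (2 / (real m + 1)\<^sup>2))"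
   unfolding lhs norm_minus_cancel
  proof (rule sum_norm_le)
   fix i assume "i \<in> {..<m}"
   then have i: "i < m" by simp
   show "norm (?t i + ?s i) <= Yb * (D * eps * d) + Yb * (2 / (real m + 1)\<^sup>2)"
    unfolding real_norm_def by (rule order_trans[OF abs_triangle_ineq add_mono[OF step[OF i] rstep[OF i]]])
  qed
  also have "\<dots> = real m * (Yb * (D * eps * d) + Yb * (2 / (real m + 1)\<^sup>2))"
   by (simp only: sum_constant card_lessThan)
  also have "\<dots> = Yb * D * eps * (d * real m) + real m * (Yb * (2 / (real m + 1)\<^sup>2))"
   by (simp only: distrib_left mult.assoc mult.left_commute mult.commute)
  also have "\<dots> = Yb * D * eps * T + real m * (Yb * (2 / (real m + 1)\<^sup>2))"
   by (simp only: dm)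
  also have "\<dots> < e"
  proof -
   have y: "Yb * D * eps = e / (4 * (T + 1))" using Yb D by (simp add: eps_def)
   have "Yb * D * eps * T = (e / 4) * (T / (T + 1))" unfolding y using T by (simp add: divide_simps)
   also have "\<dots> <= (e / 4) * 1" using e T by (intro mult_left_mono) auto
   finally have a: "Yb * D * eps * T <= e / 4" by simp
   have "real m * (Yb * (2 / (real m + 1)\<^sup>2)) <= (real m + 1) * (Yb * (2 / (real m + 1)\<^sup>2))"
    using Yb by (intro mult_right_mono) auto
   also have "\<dots> = 2 * Yb / (real m + 1)" by (simp add: power2_eq_square)
   also have "\<dots> <= e / 4"
   proof -
    have "8 * Yb / e <= real m + 1" using m1 m1m Tdl by linarith
    then have "8 * Yb <= e * (real m + 1)" using e by (simp add: pos_divide_le_eq mult.commute)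
    then show ?thesis by (simp add: pos_divide_le_eq)
   qed
   finally show ?thesis using a e by linarith
  qed
  finally show "norm (obs_sum A C a c H Y T m (k m) u + (euler (%s. A - H s ** C) (T / real m) m u 0 \<bullet> x 0
   + noise_sum A C R1h R2h H (%s. (w s, v s)) T m (k m) u) - u \<bullet> x T) < e"
   unfolding os ns eu .
 qed
qed

section \<open>From L1 approximation to Gaussian characteristic functions\<close>

context prob_space
begin

text \<open>A bounded \<open>F\<close>-measurable function is controlled in \<open>L\<^sup>1\<close> by its integrals over the sets of \<open>F\<close>: test
 against the sets where its real and imaginary parts are nonnegative.\<close>

lemma L1_by_indicators:
 fixes d dl :: "'a => complex"
 assumes F: "subalgebra M F" and d: "d \<in> borel_measurable F" and db: "\<And>x. x \<in> space M ==> norm (d x) <= B"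
  and dl: "integrable M dl"
  and eq: "\<And>A. A \<in> sets F ==> (CLINT om|M. indicator A om * d om) = (CLINT om|M. indicator A om * dl om)"
 shows "expectation (%om. norm (d om)) <= 4 * expectation (%om. norm (dl om))"
proof -
 have dM [measurable]: "d \<in> borel_measurable M" by (rule measurable_from_subalg[OF F d])
 have di: "integrable M d" by (rule integrable_const_bound[where B = B]) (use db in auto)
 have spF: "space F = space M" using F by (simp add: subalgebra_def)
 have setsF: "A \<in> sets M" if "A \<in> sets F" for A using F that by (auto simp: subalgebra_def)
 have one: "expectation (%om. \<bar>p (d om)\<bar>) <= 2 * expectation (%om. norm (dl om))"
  if p: "bounded_linear p" and pn: "\<And>z. \<bar>p z\<bar> <= norm z" for p :: "complex => real"
 proof -
  interpret p: bounded_linear p by fact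
  define A where "A = {om \<in> space F. 0 <= p (d om)}"
  have pm: "p \<in> borel_measurable borel" by (intro borel_measurable_continuous_onI p.continuous_on continuous_on_id)
  have AF: "A \<in> sets F" unfolding A_def using measurable_compose[OF d pm] by measurable
  have cF: "space F - A \<in> sets F" using AF by auto
  have pd: "p (indicator E om * d om) = indicator E om * p (d om)" for E om
   by (simp add: indicator_def p.zero)
  have ii: "integrable M (%om. indicator E om * f om)" if "E \<in> sets F" "integrable M f" for E and f :: "'a => complex"
  proof -
   have "integrable M (%om. indicator E om *\<^sub>R f om)" using integrable_mult_indicator[OF setsF[OF that(1)] that(2)] .
   moreover have "(%om. indicator E om *\<^sub>R f om) = (%om. indicator E om * f om)"
    by (auto simp: fun_eq_iff indicator_def)
   ultimately show ?thesis by simp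
  qed
  have bd: "\<bar>expectation (%om. indicator E om * p (d om))\<bar> <= expectation (%om. norm (dl om))" if E: "E \<in> sets F" for E
  proof -
   have "expectation (%om. indicator E om * p (d om)) = p (CLINT om|M. indicator E om * d om)"
    using integral_bounded_linear[OF p ii[OF E di]] by (simp add: pd)
   also have "\<dots> = p (CLINT om|M. indicator E om * dl om)" by (simp add: eq[OF E])
   also have "\<bar>\<dots>\<bar> <= norm (CLINT om|M. indicator E om * dl om)" by (rule pn)
   also have "\<dots> <= expectation (%om. norm (indicator E om * dl om))" by (rule integral_norm_bound)
   also have "\<dots> <= expectation (%om. norm (dl om))"
    by (intro integral_mono integrable_norm ii[OF E dl] dl) (auto simp: indicator_def norm_mult)
   finally show ?thesis .
  qed
  have pi: "integrable M (%om. indicator E om * p (d om))" if "E \<in> sets F" for E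
   using integrable_bounded_linear[OF p ii[OF that di]] by (simp add: pd)
  have "expectation (%om. \<bar>p (d om)\<bar>) = expectation (%om. indicator A om * p (d om) - indicator (space F - A) om * p (d om))"
   by (intro Bochner_Integration.integral_cong refl) (auto simp: A_def spF indicator_def)
  also have "\<dots> = expectation (%om. indicator A om * p (d om)) - expectation (%om. indicator (space F - A) om * p (d om))"
   using pi[OF AF] pi[OF cF] by simp
  also have "\<dots> <= 2 * expectation (%om. norm (dl om))" using bd[OF AF] bd[OF cF] by linarith
  finally show ?thesis .
 qed
 have "expectation (%om. norm (d om)) <= expectation (%om. \<bar>Re (d om)\<bar> + \<bar>Im (d om)\<bar>)"
  using di by (intro integral_mono integrable_norm) (auto intro!: cmod_le)
 also have "\<dots> = expectation (%om. \<bar>Re (d om)\<bar>) + expectation (%om. \<bar>Im (d om)\<bar>)"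
  using di by simp
 also have "\<dots> <= 2 * expectation (%om. norm (dl om)) + 2 * expectation (%om. norm (dl om))"
  by (intro add_mono one bounded_linear_Re bounded_linear_Im abs_Re_le_cmod abs_Im_le_cmod)
 finally show ?thesis by simp
qed

lemma bounded_AE_convergence_L1:
 fixes f :: "nat => 'a => complex"
 assumes [measurable]: "\<And>n. f n \<in> borel_measurable M" "g \<in> borel_measurable M"
  and b: "\<And>n x. x \<in> space M ==> norm (f n x) <= B" "\<And>x. x \<in> space M ==> norm (g x) <= B"
  and lim: "AE om in M. (%n. f n om) \<longlonglongrightarrow> g om"
 shows "(%n. expectation (%om. norm (f n om - g om))) \<longlonglongrightarrow> 0"
proof -
 have "(%n. expectation (%om. norm (f n om - g om))) \<longlonglongrightarrow> expectation (%om. 0)"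
 proof (rule integral_dominated_convergence[where w = "%_. B + B"])
  show "AE om in M. (%n. norm (f n om - g om)) \<longlonglongrightarrow> 0"
   using lim by eventually_elim (simp add: tendsto_norm_zero LIM_zero)
  show "AE om in M. norm (norm (f n om - g om)) <= B + B" for n
  proof (rule AE_I2)
   fix om assume w: "om \<in> space M"
   have "norm (f n om - g om) <= norm (f n om) + norm (g om)" by (rule norm_triangle_ineq4)
   also have "\<dots> <= B + B" by (intro add_mono b w)
   finally show "norm (norm (f n om - g om)) <= B + B" by simp
  qed
 qed auto
 then show ?thesis by simp
qed

end

lemma norm_char_fun_le:
 assumes "prob_space \<eta>"
 shows "norm (char_fun \<eta> u) <= 1"
proof -
 interpret prob_space \<eta> by fact
 have "norm (char_fun \<eta> u) <= expectation (%x. norm (iexp (u \<bullet> x)))"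
  unfolding char_fun_def by (rule integral_norm_bound)
 then show ?thesis by (simp add: prob_space)
qed

lemma char_fun_continuous:
 fixes \<eta> :: "'e::euclidean_space measure"
 assumes "prob_space \<eta>" and [measurable_cong]: "sets \<eta> = sets borel"
 shows "continuous_on UNIV (char_fun \<eta>)"
proof -
 interpret prob_space \<eta> by fact
 show ?thesis
  unfolding char_fun_def continuous_on_sequentially
 proof (intro allI ballI impI)
  fix u and a :: 'e assume h: "a \<in> UNIV" "(\<forall>n. u n \<in> UNIV) \<and> u \<longlonglongrightarrow> a"
  have "(%n. CLINT x|\<eta>. iexp (u n \<bullet> x)) \<longlonglongrightarrow> (CLINT x|\<eta>. iexp (a \<bullet> x))"
   by (rule integral_dominated_convergence[where w = "%_. 1"]) (use h in \<open>auto intro!: tendsto_intros\<close>)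
  then show "((%u. CLINT x|\<eta>. iexp (u \<bullet> x)) \<circ> u) \<longlonglongrightarrow> (CLINT x|\<eta>. iexp (a \<bullet> x))"
   by (simp add: o_def)
 qed
qed

lemma symmetric_form_eq:
 assumes "symmetric_mat B" "symmetric_mat B'" "\<And>x. x \<bullet> (B *v x) = x \<bullet> (B' *v x)"
 shows "B = (B' :: real^'n^'n)"
proof -
 have "x \<bullet> (B *v y) = x \<bullet> (B' *v y)" for x y
  using assms(3)[of "x + y"] assms(3)[of x] assms(3)[of y]
   symmetric_mat_inner[OF assms(1), of x y] symmetric_mat_inner[OF assms(2), of x y]
  by (simp add: matrix_vector_linear inner_add_left inner_add_right)
 then have "B *v y = B' *v y" for y using vector_eq_ldot[of "B *v y" "B' *v y"] by blast
 then show ?thesis by (simp add: matrix_eq)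
qed

text \<open>Multiplicativity transports the derivative from 0 to every point, so \<psi>' = z \<psi>,
  and \<psi> s exp (- z s) is constant.\<close>

lemma exponential_from_multiplicative:
 fixes \<psi> :: "real => complex"
 assumes mult: "\<And>s r. \<psi> (s + r) = \<psi> s * \<psi> r" and one: "\<psi> 0 = 1"
  and d: "(\<psi> has_vector_derivative z) (at 0)"
 shows "\<psi> s = exp (z * s)"
proof -
 have ds: "(\<psi> has_vector_derivative \<psi> s * z) (at s)" for s
 proof -
  have "((%r. \<psi> (r - s)) has_vector_derivative z) (at s)"
  proof -
   have "((\<psi> \<circ> (%r. r - s)) has_vector_derivative 1 *\<^sub>R z) (at s)"
    by (rule vector_diff_chain_at) (use d in \<open>auto intro!: derivative_eq_intros\<close>)
   then show ?thesis by (simp add: o_def)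
  qed
  then have "((%r. \<psi> s * \<psi> (r - s)) has_vector_derivative \<psi> s * z) (at s)"
   by (rule has_vector_derivative_mult_right)
  moreover have "\<psi> s * \<psi> (r - s) = \<psi> r" for r using mult[of s "r - s"] by simp
  ultimately show ?thesis by simp
 qed
 have e: "((%s. exp (- z * of_real s)) has_vector_derivative exp (- z * of_real s) * - z) (at s)" for s
 proof -
  have "((%w. exp (- z * w)) has_field_derivative exp (- z * of_real s) * - z) (at (of_real s))"
   by (auto intro!: derivative_eq_intros)
  from has_vector_derivative_real_field[OF this] show ?thesis .
 qed
 have "((%s. \<psi> s * exp (- z * of_real s)) has_vector_derivative 0) (at s)" for s
  using has_vector_derivative_mult[OF ds[of s] e[of s]] by (simp add: algebra_simps)
 then have "((%s. \<psi> s * exp (- z * of_real s)) has_derivative (%h. 0)) (at s within UNIV)" for s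
  by (simp add: has_vector_derivative_def)
 from has_derivative_zero_constant[OF convex_UNIV this] obtain c where c: "\<And>s. \<psi> s * exp (- z * of_real s) = c" by auto
 have "c = 1" using c[of 0] one by simp
 then have "\<psi> s * exp (- z * of_real s) = 1" using c by simp
 then show ?thesis by (simp add: exp_minus field_simps)
qed

text \<open>Dividing the characteristic function by the factor belonging to \<open>\<Sigma>\<close>
  leaves, on each line through 0, a multiplicative function with a derivative at 0, hence the
  exponential of i times the mean. That \<open>\<Sigma>\<close> is nonnegative and equals the
  covariance is a result, not an input. A dense set suffices for \<open>mult\<close>, because it
  will be known almost surely for countably many pairs.\<close>

lemma gaussian_from_multiplicative_char:
 fixes \<eta> :: "(real^'n) measure" and \<Sigma> :: "real^'n^'n"
 assumes \<eta>: "prob_space \<eta>" "sets \<eta> = sets borel" and sq: "integrable \<eta> (%x. (norm x)\<^sup>2)"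
  and sym: "symmetric_mat \<Sigma>" and D: "closure D = UNIV"
  and mult: "\<And>u v. u \<in> D ==> v \<in> D ==>
   char_fun \<eta> (u + v) * exp (- (u \<bullet> (\<Sigma> *v u) + v \<bullet> (\<Sigma> *v v)) / 2)
    = char_fun \<eta> u * char_fun \<eta> v * exp (- ((u + v) \<bullet> (\<Sigma> *v (u + v))) / 2)"
 shows "char_fun \<eta> u = iexp (u \<bullet> mean_vec \<eta>) * exp (- (u \<bullet> (\<Sigma> *v u)) / 2)"
  and "cov_matrix \<eta> = \<Sigma>" and "psd \<Sigma>"
proof -
 interpret E: prob_space \<eta> by fact
 note [measurable_cong] = \<eta>(2)
 have cc: "continuous_on UNIV (char_fun \<eta>)" by (rule char_fun_continuous[OF \<eta>])
 have mult': "char_fun \<eta> (u + v) * exp (- (u \<bullet> (\<Sigma> *v u) + v \<bullet> (\<Sigma> *v v)) / 2)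
    = char_fun \<eta> u * char_fun \<eta> v * exp (- ((u + v) \<bullet> (\<Sigma> *v (u + v))) / 2)" for u v
 proof -
  let ?P = "{z. char_fun \<eta> (fst z + snd z) * complex_of_real (exp (- (fst z \<bullet> (\<Sigma> *v fst z) + snd z \<bullet> (\<Sigma> *v snd z)) / 2))
    = char_fun \<eta> (fst z) * char_fun \<eta> (snd z) * complex_of_real (exp (- ((fst z + snd z) \<bullet> (\<Sigma> *v (fst z + snd z))) / 2))}"
  have "closed ?P"
   by (intro closed_Collect_eq continuous_intros continuous_on_compose2[OF cc]) auto
  moreover have "D \<times> D \<subseteq> ?P" using mult by auto
  ultimately have sub: "closure (D \<times> D) \<subseteq> ?P" by (rule closure_minimal[rotated])
  have "(u, v) \<in> closure (D \<times> D)" by (simp only: closure_Times D) simp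
  then have "(u, v) \<in> ?P" by (rule subsetD[OF sub])
  then show ?thesis by simp
 qed
 have lin_int: "integrable \<eta> (%x. u \<bullet> x)" "integrable \<eta> (%x. (u \<bullet> x)\<^sup>2)" for u
 proof -
  show s: "integrable \<eta> (%x. (u \<bullet> x)\<^sup>2)"
  proof (rule Bochner_Integration.integrable_bound)
   show "integrable \<eta> (%x. (norm u)\<^sup>2 * (norm x)\<^sup>2)" using sq by simp
   have "(u \<bullet> x)\<^sup>2 <= (norm u)\<^sup>2 * (norm x)\<^sup>2" for x
    using Cauchy_Schwarz_ineq[of u x] by (simp add: power2_norm_eq_inner)
   then show "AE x in \<eta>. norm ((u \<bullet> x)\<^sup>2) <= norm ((norm u)\<^sup>2 * (norm x)\<^sup>2)" by simp
  qed simp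
  show "integrable \<eta> (%x. u \<bullet> x)"
  proof (rule Bochner_Integration.integrable_bound)
   show "integrable \<eta> (%x. 1 + (u \<bullet> x)\<^sup>2)" using s by simp
   have "\<bar>r\<bar> <= 1 + r\<^sup>2" for r :: real
    using zero_le_power2[of "\<bar>r\<bar> - 1/2"] by (simp add: power2_eq_square algebra_simps)
   then show "AE x in \<eta>. norm (u \<bullet> x) <= norm (1 + (u \<bullet> x)\<^sup>2)" by simp
  qed simp
 qed
 have comp: "integrable \<eta> (%x. x $ i)" for i
  using lin_int(1)[of "axis i 1"] by (simp add: inner_axis')
 have mean: "E.expectation (%x. u \<bullet> x) = u \<bullet> mean_vec \<eta>" for u
  using comp by (simp add: inner_vec_def mean_vec_def)
 let ?q = "%u. u \<bullet> (\<Sigma> *v u)"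
 have key: "char_fun \<eta> (s *\<^sub>R u) = iexp (s * (u \<bullet> mean_vec \<eta>)) * exp (- ?q u * s\<^sup>2 / 2)" for u s
 proof -
  \<comment> \<open>The Gaussian factor is removed by multiplication with its reciprocal, which
    makes sense although \<open>\<Sigma>\<close> is not yet known to be nonnegative.\<close>
  define \<psi> where "\<psi> s = char_fun \<eta> (s *\<^sub>R u) * complex_of_real (exp (s\<^sup>2 * ?q u / 2))" for s
  have "\<psi> (s + r) = \<psi> s * \<psi> r" for s r
  proof -
   let ?e = "%x. complex_of_real (exp x)"
   have m: "char_fun \<eta> ((s + r) *\<^sub>R u) * ?e (- (s\<^sup>2 * ?q u + r\<^sup>2 * ?q u) / 2) = char_fun \<eta> (s *\<^sub>R u) * char_fun \<eta> (r *\<^sub>R u) * ?e (- ((s + r)\<^sup>2 * ?q u) / 2)"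
   proof -
    have a: "s *\<^sub>R u + r *\<^sub>R u = (s + r) *\<^sub>R u" by (simp add: scaleR_add_left)
    have q: "?q (c *\<^sub>R u) = c\<^sup>2 * ?q u" for c
     by (simp add: matrix_vector_linear power2_eq_square)
    show ?thesis using mult'[of "s *\<^sub>R u" "r *\<^sub>R u"] unfolding a q .
   qed
   \<comment> \<open>Both sides of \<open>m\<close> are multiplied by the same three exponentials;
     this turns the left side into \<psi> (s + r) and the right side into \<psi> s \<psi> r without
     a division.\<close>
   have c1: "- (s\<^sup>2 * ?q u + r\<^sup>2 * ?q u) / 2 + (s\<^sup>2 * ?q u / 2 + r\<^sup>2 * ?q u / 2 + (s + r)\<^sup>2 * ?q u / 2) = (s + r)\<^sup>2 * ?q u / 2"
    by (simp add: field_simps)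
   have c2: "- ((s + r)\<^sup>2 * ?q u) / 2 + (s\<^sup>2 * ?q u / 2 + r\<^sup>2 * ?q u / 2 + (s + r)\<^sup>2 * ?q u / 2) = s\<^sup>2 * ?q u / 2 + r\<^sup>2 * ?q u / 2"
    by (simp add: field_simps)
   have e1: "?e (- (s\<^sup>2 * ?q u + r\<^sup>2 * ?q u) / 2) * (?e (s\<^sup>2 * ?q u / 2) * ?e (r\<^sup>2 * ?q u / 2) * ?e ((s + r)\<^sup>2 * ?q u / 2)) = ?e ((s + r)\<^sup>2 * ?q u / 2)"
    by (simp only: of_real_mult[symmetric] exp_add[symmetric] c1)
   have e2: "?e (- ((s + r)\<^sup>2 * ?q u) / 2) * (?e (s\<^sup>2 * ?q u / 2) * ?e (r\<^sup>2 * ?q u / 2) * ?e ((s + r)\<^sup>2 * ?q u / 2)) = ?e (s\<^sup>2 * ?q u / 2) * ?e (r\<^sup>2 * ?q u / 2)"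
    by (simp only: of_real_mult[symmetric] exp_add[symmetric] c2)
   have "char_fun \<eta> ((s + r) *\<^sub>R u) * ?e (- (s\<^sup>2 * ?q u + r\<^sup>2 * ?q u) / 2) * (?e (s\<^sup>2 * ?q u / 2) * ?e (r\<^sup>2 * ?q u / 2) * ?e ((s + r)\<^sup>2 * ?q u / 2))
     = char_fun \<eta> (s *\<^sub>R u) * char_fun \<eta> (r *\<^sub>R u) * ?e (- ((s + r)\<^sup>2 * ?q u) / 2) * (?e (s\<^sup>2 * ?q u / 2) * ?e (r\<^sup>2 * ?q u / 2) * ?e ((s + r)\<^sup>2 * ?q u / 2))"
    by (simp only: m)
   then show ?thesis
    unfolding mult.assoc[of _ "?e (- (s\<^sup>2 * ?q u + r\<^sup>2 * ?q u) / 2)"] mult.assoc[of _ "?e (- ((s + r)\<^sup>2 * ?q u) / 2)"] e1 e2 \<psi>_def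
    by (simp only: ac_simps)
  qed
  moreover have "\<psi> 0 = 1" by (simp add: \<psi>_def char_fun_def E.prob_space)
  moreover have "(\<psi> has_vector_derivative \<i> * (u \<bullet> mean_vec \<eta>)) (at 0)"
  proof -
   let ?\<mu> = "u \<bullet> mean_vec \<eta>" and ?m2 = "E.expectation (%x. (u \<bullet> x)\<^sup>2)"
   let ?L = "distr \<eta> borel (%x. u \<bullet> x)"
   have Lm: "(%x. u \<bullet> x) \<in> borel_measurable \<eta>" by simp
   interpret L: real_distribution ?L by (rule E.real_distribution_distr[OF Lm])
   have ch: "char ?L s = char_fun \<eta> (s *\<^sub>R u)" for s
    unfolding char_def char_fun_def by (subst integral_distr[OF Lm]) auto
   \<comment> \<open>First-order Taylor expansion of the characteristic function on the line, with a
     remainder controlled by the second moment; it yields the derivative at 0.\<close>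
   have est: "norm (char_fun \<eta> (s *\<^sub>R u) - (1 + (\<i> * s) * ?\<mu>)) <= s\<^sup>2 * ?m2" for s
   proof -
    have im: "integrable ?L (%x. x ^ k)" if "k <= 1" for k
    proof -
     have "k = 0 \<or> k = 1" using that by auto
     then show ?thesis using lin_int(1)[of u] by (auto simp: integrable_distr_eq L.emeasure_eq_measure)
    qed
    have i2: "integrable ?L (%x. x\<^sup>2)" using lin_int(2)[of u] by (subst integrable_distr_eq[OF Lm]) auto
    have E2: "(\<integral>x. x\<^sup>2 \<partial>?L) = ?m2" by (subst integral_distr[OF Lm]) auto
    have E1: "(\<integral>x. x \<partial>?L) = ?\<mu>" by (subst integral_distr[OF Lm]) (auto simp: mean)
    have "norm (char ?L s - (\<Sum>k\<le>1. ((\<i> * s) ^ k / fact k) * L.expectation (%x. x ^ k)))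
      <= (\<bar>s\<bar> ^ 1 / fact (Suc 1)) * L.expectation (%x. min (2 * \<bar>x\<bar> ^ 1 * Suc 1) (\<bar>s\<bar> * \<bar>x\<bar> ^ Suc 1))"
     by (rule L.char_approx2[OF im])
    also have "(\<Sum>k\<le>1. ((\<i> * s) ^ k / fact k) * L.expectation (%x. x ^ k)) = 1 + (\<i> * s) * ?\<mu>"
     using E1 by (simp add: L.prob_space[simplified])
    also have "L.expectation (%x. min (2 * \<bar>x\<bar> ^ 1 * Suc 1) (\<bar>s\<bar> * \<bar>x\<bar> ^ Suc 1)) <= L.expectation (%x. \<bar>s\<bar> * x\<^sup>2)"
    proof (rule integral_mono')
     show "integrable ?L (%x. \<bar>s\<bar> * x\<^sup>2)" using i2 by simp
    qed (auto simp: power2_eq_square min_def)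
    then have "(\<bar>s\<bar> ^ 1 / fact (Suc 1)) * L.expectation (%x. min (2 * \<bar>x\<bar> ^ 1 * Suc 1) (\<bar>s\<bar> * \<bar>x\<bar> ^ Suc 1))
      <= (\<bar>s\<bar> ^ 1 / fact (Suc 1)) * (\<bar>s\<bar> * ?m2)"
     using E2 by (intro mult_left_mono) auto
    also have "\<dots> <= s\<^sup>2 * ?m2"
    proof -
     have h1: "(\<bar>s\<bar> ^ 1 / fact (Suc 1)) * (\<bar>s\<bar> * ?m2) = s\<^sup>2 * ?m2 / 2"
      using abs_mult_self_eq[of s] by (simp add: power2_eq_square mult.assoc[symmetric])
     have "0 <= s\<^sup>2 * ?m2" by (intro mult_nonneg_nonneg Bochner_Integration.integral_nonneg) auto
     then show ?thesis unfolding h1 by simp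
    qed
    finally show ?thesis unfolding ch by simp
   qed
   have d1: "((%s. char_fun \<eta> (s *\<^sub>R u)) has_vector_derivative \<i> * ?\<mu>) (at 0)"
    unfolding has_vector_derivative_def has_derivative_at
   proof (intro conjI)
    show "bounded_linear (%x. x *\<^sub>R (\<i> * complex_of_real ?\<mu>))" by (rule bounded_linear_scaleR_left)
    show "(%h. norm (char_fun \<eta> ((0 + h) *\<^sub>R u) - char_fun \<eta> (0 *\<^sub>R u) - h *\<^sub>R (\<i> * complex_of_real ?\<mu>)) / norm h) \<midarrow>0\<rightarrow> 0"
    proof (rule tendsto_sandwich[of "%_. 0" _ _ "%h. \<bar>h\<bar> * ?m2"])
     show "\<forall>\<^sub>F h in at 0. norm (char_fun \<eta> ((0 + h) *\<^sub>R u) - char_fun \<eta> (0 *\<^sub>R u) - h *\<^sub>R (\<i> * complex_of_real ?\<mu>)) / norm h <= \<bar>h\<bar> * ?m2"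
     proof (rule eventually_at_filter[THEN iffD2, OF always_eventually], intro allI impI)
      fix h :: real assume h: "h ~= 0"
      have "norm (char_fun \<eta> (h *\<^sub>R u) - (1 + (\<i> * h) * ?\<mu>)) / \<bar>h\<bar> <= (h\<^sup>2 * ?m2) / \<bar>h\<bar>"
       by (intro divide_right_mono est) simp
      also have "\<dots> = \<bar>h\<bar> * ?m2"
      proof -
       have h2: "h\<^sup>2 = \<bar>h\<bar> * \<bar>h\<bar>" by (simp add: power2_eq_square)
       have "\<bar>h\<bar> ~= 0" using h by simp
       then show ?thesis unfolding h2 mult.assoc by (rule nonzero_mult_div_cancel_left)
      qed
      finally show "norm (char_fun \<eta> ((0 + h) *\<^sub>R u) - char_fun \<eta> (0 *\<^sub>R u) - h *\<^sub>R (\<i> * complex_of_real ?\<mu>)) / norm h <= \<bar>h\<bar> * ?m2"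
       by (simp add: char_fun_def E.prob_space scaleR_conv_of_real algebra_simps)
     qed
     show "(%h. \<bar>h\<bar> * ?m2) \<midarrow>0\<rightarrow> 0" by (auto intro!: tendsto_eq_intros)
    qed auto
   qed
   have d2: "((%s. complex_of_real (exp (s\<^sup>2 * ?q u / 2))) has_vector_derivative complex_of_real 0) (at 0)"
    by (rule has_vector_derivative_of_real) (auto intro!: derivative_eq_intros simp flip: has_real_derivative_iff_has_vector_derivative)
   have d3: "char_fun \<eta> (0 *\<^sub>R u) * complex_of_real 0 + (\<i> * ?\<mu>) * complex_of_real (exp (0\<^sup>2 * ?q u / 2)) = \<i> * ?\<mu>"
    by simp
   show ?thesis
    unfolding \<psi>_def using has_vector_derivative_mult[OF d1 d2] unfolding d3 by simp
  qed
  ultimately have "\<psi> s = exp (\<i> * (u \<bullet> mean_vec \<eta>) * s)" by (rule exponential_from_multiplicative)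
  then have "char_fun \<eta> (s *\<^sub>R u) * complex_of_real (exp (s\<^sup>2 * ?q u / 2)) * exp (- ?q u * s\<^sup>2 / 2)
    = exp (\<i> * (u \<bullet> mean_vec \<eta>) * s) * exp (- ?q u * s\<^sup>2 / 2)"
   by (simp add: \<psi>_def)
  moreover have "complex_of_real (exp (s\<^sup>2 * ?q u / 2)) * complex_of_real (exp (- ?q u * s\<^sup>2 / 2)) = 1"
   by (simp only: of_real_mult[symmetric] exp_add[symmetric]) simp
  ultimately have "char_fun \<eta> (s *\<^sub>R u) = exp (\<i> * (u \<bullet> mean_vec \<eta>) * s) * exp (- ?q u * s\<^sup>2 / 2)"
   by (simp only: mult.assoc mult_1_right)
  moreover have "\<i> * (u \<bullet> mean_vec \<eta>) * s = \<i> * complex_of_real (s * (u \<bullet> mean_vec \<eta>))" by simp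
  ultimately show ?thesis by (simp only:)
 qed
 show "char_fun \<eta> u = iexp (u \<bullet> mean_vec \<eta>) * exp (- ?q u / 2)" using key[of 1 u] by simp
 \<comment> \<open>The modulus of a characteristic function is at most 1, which forces the form of
   \<open>\<Sigma>\<close> to be nonnegative.\<close>
 have q0: "0 <= ?q u" for u
 proof -
  have "exp (- ?q u / 2) <= 1" using norm_char_fun_le[OF \<eta>(1), of u] key[of 1 u] by (simp add: norm_mult)
  then show ?thesis by simp
 qed
 then show "psd \<Sigma>" using sym by (simp add: psd_def)
 have var: "E.expectation (%x. (u \<bullet> x - u \<bullet> mean_vec \<eta>)\<^sup>2) = ?q u" for u
 proof (rule E.normal_law_variance[OF _ q0])
  show "distr \<eta> borel (%x. u \<bullet> x) = normal_law (u \<bullet> mean_vec \<eta>) (?q u)"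
  proof (rule E.normal_law_from_char[OF _ q0])
   fix s show "(CLINT x|\<eta>. iexp (s * (u \<bullet> x))) = iexp (s * (u \<bullet> mean_vec \<eta>)) * exp (- ?q u * s\<^sup>2 / 2)"
    using key[of s u] by (simp add: char_fun_def)
  qed simp
 qed simp
 have cint: "integrable \<eta> (%x. (x $ i - mean_vec \<eta> $ i) * (x $ j - mean_vec \<eta> $ j))" for i j
 proof (rule Bochner_Integration.integrable_bound)
  have "integrable \<eta> (%x. (x $ i)\<^sup>2)" "integrable \<eta> (%x. (x $ j)\<^sup>2)"
   using lin_int(2)[of "axis i 1"] lin_int(2)[of "axis j 1"] by (simp_all add: inner_axis')
  then show "integrable \<eta> (%x. (x $ i - mean_vec \<eta> $ i)\<^sup>2 + (x $ j - mean_vec \<eta> $ j)\<^sup>2)"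
   using comp[of i] comp[of j] by (simp add: power2_diff)
  have "\<bar>p * q\<bar> <= p\<^sup>2 + q\<^sup>2" for p q :: real
   using sum_squares_bound[of "\<bar>p\<bar>" "\<bar>q\<bar>"] mult_nonneg_nonneg[OF abs_ge_zero[of p] abs_ge_zero[of q]]
   unfolding abs_mult power2_abs by linarith
  then show "AE x in \<eta>. norm ((x $ i - mean_vec \<eta> $ i) * (x $ j - mean_vec \<eta> $ j))
    <= norm ((x $ i - mean_vec \<eta> $ i)\<^sup>2 + (x $ j - mean_vec \<eta> $ j)\<^sup>2)" by simp
 qed simp
 show "cov_matrix \<eta> = \<Sigma>"
 proof (rule symmetric_form_eq[OF _ sym])
  show "symmetric_mat (cov_matrix \<eta>)"
   by (simp add: symmetric_mat_def cov_matrix_def transpose_def vec_eq_iff mult.commute)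
  fix u
  have "u \<bullet> (cov_matrix \<eta> *v u) = (\<Sum>i\<in>UNIV. \<Sum>j\<in>UNIV. E.expectation (%x. u $ i * u $ j * ((x $ i - mean_vec \<eta> $ i) * (x $ j - mean_vec \<eta> $ j))))"
   by (simp add: inner_vec_def matrix_vector_mult_def cov_matrix_def sum_distrib_left ac_simps)
  also have "\<dots> = E.expectation (%x. \<Sum>i\<in>UNIV. \<Sum>j\<in>UNIV. u $ i * u $ j * ((x $ i - mean_vec \<eta> $ i) * (x $ j - mean_vec \<eta> $ j)))"
   using cint by (simp add: Bochner_Integration.integral_sum)
  also have "\<dots> = E.expectation (%x. (u \<bullet> x - u \<bullet> mean_vec \<eta>)\<^sup>2)"
  proof (intro Bochner_Integration.integral_cong refl)
   fix x
   have "(u \<bullet> x - u \<bullet> mean_vec \<eta>) = (\<Sum>i\<in>UNIV. u $ i * (x $ i - mean_vec \<eta> $ i))"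
    by (simp add: inner_vec_def sum_subtractf right_diff_distrib)
   then show "(\<Sum>i\<in>UNIV. \<Sum>j\<in>UNIV. u $ i * u $ j * ((x $ i - mean_vec \<eta> $ i) * (x $ j - mean_vec \<eta> $ j))) = (u \<bullet> x - u \<bullet> mean_vec \<eta>)\<^sup>2"
    by (simp add: power2_eq_square sum_product ac_simps)
  qed
  finally show "u \<bullet> (cov_matrix \<eta> *v u) = u \<bullet> (\<Sigma> *v u)" using var by simp
 qed
qed

section \<open>Grid schemes: dependence on the gain, linearity, measurability\<close>

lemma gridp_bounds:
 assumes "0 <= T" "l <= m * k"
 shows "0 <= gridp T m k l" "gridp T m k l <= T"
proof -
 show "0 <= gridp T m k l" using assms by (simp add: gridp_def)
 show "gridp T m k l <= T"
 proof (cases "m * k = 0")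
  case True
  then show ?thesis using assms by (auto simp: gridp_def)
 next
  case False
  then have p: "0 < real m * real k" by simp
  have "real l <= real m * real k" using assms(2) by (metis of_nat_le_iff of_nat_mult)
  then have "real l * T <= (real m * real k) * T" using assms(1) by (rule mult_right_mono)
  then show ?thesis unfolding gridp_def using pos_divide_le_eq[OF p, of "real l * T" T] by (simp add: mult.commute)
 qed
qed

lemma gridp_coarse: "0 < k ==> gridp T m k (i * k) = real i * (T / real m)"
 by (simp add: gridp_def)

lemma gridp_Suc: "gridp T m k (Suc l) - gridp T m k l = T / (real m * real k)"
 by (simp add: gridp_def algebra_simps add_divide_distrib)

lemma gridp_mono: "0 <= T ==> gridp T m k l <= gridp T m k (Suc l)"
 unfolding gridp_def by (intro mult_right_mono) auto

lemma coarse_bounds: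
 assumes "0 <= T" "i <= m"
 shows "0 <= real i * (T / real m)" "real i * (T / real m) <= T"
 using gridp_bounds[of T i m 1] gridp_coarse[of 1 T m i] assms by simp_all

text \<open>The schemes see the gain at grid times only. Gains that agree almost surely at each
  fixed time may therefore be exchanged, as all grids together have countably many times.\<close>

lemma euler_grid_cong:
 assumes k: "0 < k" and eq: "\<And>l. l < m * k ==> H (gridp T m k l) = H' (gridp T m k l)" and i: "i <= m"
 shows "euler (%s. A - H s ** C) (T / real m) m u i = euler (%s. A - H' s ** C) (T / real m) m u i"
proof (rule euler_cong[OF _ i])
 fix j assume j: "j < m"
 show "A - H (real j * (T / real m)) ** C = A - H' (real j * (T / real m)) ** C"
  using eq[of "j * k"] j k unfolding gridp_coarse[OF k] by simp
qed

lemma weight_cong: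
 assumes k: "0 < k" and eq: "\<And>l. l < m * k ==> H (gridp T m k l) = H' (gridp T m k l)" and l: "l < m * k"
 shows "weight (%s. A - H s ** C) T m k u l = weight (%s. A - H' s ** C) T m k u l"
proof -
 have "Suc (l div k) <= m" using l k by (simp add: less_mult_imp_div_less Suc_leI)
 then show ?thesis unfolding weight_def by (intro euler_grid_cong[OF k]) (rule eq)
qed

lemma obs_sum_cong:
 assumes k: "0 < k" and eq: "\<And>l. l < m * k ==> H (gridp T m k l) = H' (gridp T m k l)"
 shows "obs_sum A C a c H Y T m k u = obs_sum A C a c H' Y T m k u"
proof -
 have "weight (%s. A - H s ** C) T m k u l = weight (%s. A - H' s ** C) T m k u l" if "l < m * k" for l
  by (rule weight_cong[OF k _ that]) (rule eq)
 then show ?thesis unfolding obs_sum_def using eq by (intro sum.cong) auto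
qed

lemma noise_coef_cong:
 assumes k: "0 < k" and eq: "\<And>l. l < m * k ==> H (gridp T m k l) = H' (gridp T m k l)" and l: "l < m * k"
 shows "noise_coef A C R1h R2h H T m k u l = noise_coef A C R1h R2h H' T m k u l"
proof -
 have "weight (%s. A - H s ** C) T m k u l = weight (%s. A - H' s ** C) T m k u l"
  by (rule weight_cong[OF k _ l]) (rule eq)
 then show ?thesis unfolding noise_coef_def Let_def eq[OF l] by simp
qed

lemma riemann_defect_cong:
 assumes k: "0 < k" and eq: "\<And>l. l < m * k ==> H (gridp T m k l) = H' (gridp T m k l)" and i: "i <= m"
 shows "riemann_defect A C a c R1h R2h H x w v Y T m k i = riemann_defect A C a c R1h R2h H' x w v Y T m k i"
proof -
 have "i * k <= m * k" using i by simp
 then have "(\<Sum>l<i * k. H (gridp T m k l) *v (Z (gridp T m k (Suc l)) - Z (gridp T m k l)))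
   = (\<Sum>l<i * k. H' (gridp T m k l) *v (Z (gridp T m k (Suc l)) - Z (gridp T m k l)))" for Z
  by (intro sum.cong refl) (simp add: eq less_le_trans)
 then show ?thesis unfolding riemann_defect_def Let_def by simp
qed

text \<open>Linearity in the terminal value is the source of the multiplicative identity for the
  conditional characteristic functions.\<close>

lemma euler_add:
 assumes "i <= m"
 shows "euler B d m (u + v) i = euler B d m u i + euler B d m v i"
 using assms
proof (induction rule: inc_induct)
 case (step n)
 then show ?case by (simp add: euler_step matrix_vector_linear algebra_simps)
qed simp

lemma weight_add:
 assumes "0 < k" "l < m * k"
 shows "weight B T m k (u + v) l = weight B T m k u l + weight B T m k v l"
proof -
 have "Suc (l div k) <= m" using assms by (simp add: less_mult_imp_div_less Suc_leI)
 then show ?thesis unfolding weight_def by (rule euler_add)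
qed

lemma obs_sum_add:
 assumes "0 < k"
 shows "obs_sum A C a c H Y T m k (u + v) = obs_sum A C a c H Y T m k u + obs_sum A C a c H Y T m k v"
 unfolding obs_sum_def using assms by (simp add: weight_add inner_add_left sum.distrib)

text \<open>The conditional variance of \<^const>\<open>noise_sum\<close> plus that of the initial term.\<close>

definition quad_var where
 "quad_var P0 A C R1h R2h H T m k u =
  (let y = euler (%s. A - H s ** C) (T / real m) m u 0 in y \<bullet> (P0 *v y)
    + (\<Sum>l<m * k. (gridp T m k (Suc l) - gridp T m k l) * (norm (noise_coef A C R1h R2h H T m k u l))\<^sup>2))"

lemma quad_var_cong:
 assumes k: "0 < k" and eq: "\<And>l. l < m * k ==> H (gridp T m k l) = H' (gridp T m k l)"
 shows "quad_var P0 A C R1h R2h H T m k u = quad_var P0 A C R1h R2h H' T m k u"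
proof -
 have e: "euler (%s. A - H s ** C) (T / real m) m u 0 = euler (%s. A - H' s ** C) (T / real m) m u 0"
  by (rule euler_grid_cong[OF k]) (auto intro: eq)
 have "noise_coef A C R1h R2h H T m k u l = noise_coef A C R1h R2h H' T m k u l" if "l < m * k" for l
  by (rule noise_coef_cong[OF k _ that]) (rule eq)
 then show ?thesis unfolding quad_var_def Let_def e by (auto intro!: sum.cong)
qed

lemma quad_var_nonneg:
 assumes "0 <= T" "psd P0"
 shows "0 <= quad_var P0 A C R1h R2h H T m k u"
 unfolding quad_var_def Let_def using assms
 by (intro add_nonneg_nonneg sum_nonneg mult_nonneg_nonneg) (auto simp: psd_def gridp_mono)

lemma noise_coef_norm:
 fixes R1h :: "real^'n^'n" and R2h :: "real^'m^'m" and C :: "real^'n^'m"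
 assumes "symmetric_mat R1h" "symmetric_mat R2h"
 shows "(norm (noise_coef A C R1h R2h H T m k u l))\<^sup>2
  = weight (%s. A - H s ** C) T m k u l \<bullet>
   ((R1h ** R1h + H (gridp T m k l) ** (R2h ** R2h) ** transpose (H (gridp T m k l))) *v weight (%s. A - H s ** C) T m k u l)"
proof -
 define y where "y = weight (%s. A - H s ** C) T m k u l"
 define G where "G = H (gridp T m k l)"
 have t: "transpose R1h = R1h" "transpose R2h = R2h" using assms by (auto simp: symmetric_mat_def)
 have "(norm (noise_coef A C R1h R2h H T m k u l))\<^sup>2 = (R1h *v y) \<bullet> (R1h *v y) + (R2h *v (transpose G *v y)) \<bullet> (R2h *v (transpose G *v y))"
  by (simp add: noise_coef_def Let_def y_def[symmetric] G_def[symmetric] norm_Pair power2_norm_eq_inner)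
 also have "(R1h *v y) \<bullet> (R1h *v y) = y \<bullet> ((R1h ** R1h) *v y)"
  using inner_matrix_vector_transpose[of y R1h "R1h *v y"] t by (simp add: matrix_vector_mul_assoc)
 also have "(R2h *v (transpose G *v y)) \<bullet> (R2h *v (transpose G *v y)) = (transpose G *v y) \<bullet> ((R2h ** R2h) *v (transpose G *v y))"
  using inner_matrix_vector_transpose[of "transpose G *v y" R2h "R2h *v (transpose G *v y)"] t by (simp add: matrix_vector_mul_assoc matrix_mul_assoc)
 also have "\<dots> = y \<bullet> ((G ** (R2h ** R2h) ** transpose G) *v y)"
  using inner_matrix_vector_transpose[of y G "(R2h ** R2h) *v (transpose G *v y)"] by (simp add: matrix_vector_mul_assoc matrix_mul_assoc)
 finally show ?thesis by (simp add: y_def G_def matrix_vector_linear inner_add_right)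
qed

text \<open>\<open>sig\<close> is the covariance of the linear equation with gain \<open>H\<close>,
  noise covariance R1 + H R2 H^T and initial covariance \<open>P0\<close>. The gain is arbitrary
  here; its link with \<open>sig\<close> is made in \<open>covariance_riccati\<close>.\<close>

lemma quad_var_converges:
 fixes R1h :: "real^'n^'n" and R2h :: "real^'m^'m" and C :: "real^'n^'m"
 assumes T: "0 <= T" and H: "continuous_on {0..T} H" and sym: "symmetric_mat R1h" "symmetric_mat R2h"
  and sig: "\<And>s. s \<in> {0..T} ==> (sig has_vector_derivative ((A - H s ** C) ** sig s + sig s ** transpose (A - H s ** C)
   + (R1h ** R1h + H s ** (R2h ** R2h) ** transpose (H s)))) (at s within {0..T})"
  and sig0: "sig 0 = P0" and k: "\<And>m. 0 < k m"
 shows "(%m. quad_var P0 A C R1h R2h H T m (k m) u) \<longlonglongrightarrow> u \<bullet> (sig T *v u)"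
proof -
 have c: "continuous_on {0..T} (%s. A - H s ** C)"
  "continuous_on {0..T} (%s. R1h ** R1h + H s ** (R2h ** R2h) ** transpose (H s))"
  by (intro continuous_intros H)+
 show ?thesis
  using lyapunov_sum_converges[OF T c sig, where k = k and u = u] k
  unfolding quad_var_def Let_def gridp_Suc noise_coef_norm[OF sym] sig0 weight_def
  unfolding gridp_def by simp
qed



lemma lyapunov_exists:
 fixes B G :: "real => real^'n^'n"
 assumes T: "0 <= T" and B: "continuous_on {0..T} B" and G: "continuous_on {0..T} G"
  and sym: "\<And>s. symmetric_mat (G s)" "symmetric_mat P0"
 shows "\<exists>sig. sig 0 = P0 \<and> (\<forall>s. symmetric_mat (sig s)) \<and>
  (\<forall>s\<in>{0..T}. (sig has_vector_derivative (B s ** sig s + sig s ** transpose (B s) + G s)) (at s within {0..T}))"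
proof -
 obtain b where b: "0 < b" "\<And>s. s \<in> {0..T} ==> norm (B s) <= b"
  using continuous_norm_bounded[OF B] by blast
 have "\<exists>x. x 0 = P0 \<and> (\<forall>s\<in>{0..T}. (x has_vector_derivative (%s z. B s ** z + z ** transpose (B s) + G s) s (x s)) (at s within {0..T}))"
 proof (rule picard_global[of T _ "2 * b"])
  show "norm ((B s ** z + z ** transpose (B s) + G s) - (B s ** z' + z' ** transpose (B s) + G s)) <= 2 * b * norm (z - z')"
   if "s \<in> {0..T}" for s z z'
  proof -
   have "(B s ** z + z ** transpose (B s) + G s) - (B s ** z' + z' ** transpose (B s) + G s) = B s ** (z - z') + (z - z') ** transpose (B s)"
    by (simp add: matrix_mult_linear)
   also have "norm \<dots> <= norm (B s) * norm (z - z') + norm (z - z') * norm (transpose (B s))"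
    by (intro norm_triangle_le add_mono norm_matrix_matrix_mult_le)
   also have "\<dots> = 2 * norm (B s) * norm (z - z')" by (simp add: norm_transpose)
   also have "\<dots> <= 2 * b * norm (z - z')" using b(2)[OF that] by (intro mult_right_mono) auto
   finally show ?thesis .
  qed
 qed (use T b in \<open>auto intro!: continuous_intros B G\<close>)
 then obtain x where x: "x 0 = P0" "\<And>s. s \<in> {0..T} ==> (x has_vector_derivative (B s ** x s + x s ** transpose (B s) + G s)) (at s within {0..T})"
  by auto
 \<comment> \<open>The equation is linear and compatible with transposition, so the symmetric part
   of a solution is again a solution.\<close>
 define sig where "sig s = (1/2) *\<^sub>R (x s + transpose (x s))" for s
 show ?thesis
 proof (intro exI[of _ sig] conjI allI ballI)
  show "sig 0 = P0" using sym(2) by (simp add: sig_def x symmetric_mat_def scaleR_2[symmetric])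
  show "symmetric_mat (sig s)" for s
   unfolding sig_def symmetric_mat_def by (simp add: transpose_def vec_eq_iff add.commute)
  fix s assume s: "s \<in> {0..T}"
  have "(sig has_vector_derivative (1/2) *\<^sub>R ((B s ** x s + x s ** transpose (B s) + G s) + transpose (B s ** x s + x s ** transpose (B s) + G s))) (at s within {0..T})"
   unfolding sig_def[abs_def]
   by (intro bounded_linear.has_vector_derivative[OF bounded_linear_scaleR_right] has_vector_derivative_add x(2) s
     bounded_linear.has_vector_derivative[OF bounded_linear_transpose])
  moreover have "(1/2) *\<^sub>R ((B s ** x s + x s ** transpose (B s) + G s) + transpose (B s ** x s + x s ** transpose (B s) + G s))
   = B s ** sig s + sig s ** transpose (B s) + G s"
  proof -
   have "G s = (1/2) *\<^sub>R (G s + G s)" by (simp add: scaleR_2[symmetric])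
   moreover have "transpose (G s) = G s" using sym(1) by (simp add: symmetric_mat_def)
   ultimately show ?thesis
    by (simp add: sig_def transpose_linear matrix_transpose_mul matrix_mult_linear scaleR_add_right)
  qed
  ultimately show "(sig has_vector_derivative (B s ** sig s + sig s ** transpose (B s) + G s)) (at s within {0..T})" by simp
 qed
qed

lemma borel_measurable_matrix_vector_mult [measurable]:
 fixes f :: "'a => real^'n^'m"
 assumes [measurable]: "f \<in> borel_measurable F" "g \<in> borel_measurable F"
 shows "(%x. f x *v g x) \<in> borel_measurable F"
 by (rule borel_measurable_continuous_Pair[where H = "%x y. x *v y"])
  (auto intro!: continuous_intros simp: split_beta)

lemma borel_measurable_matrix_matrix_mult [measurable]:
 fixes f :: "'a => real^'n^'m" and g :: "'a => real^'k^'n"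
 assumes [measurable]: "f \<in> borel_measurable F" "g \<in> borel_measurable F"
 shows "(%x. f x ** g x) \<in> borel_measurable F"
 by (rule borel_measurable_continuous_Pair[where H = "%x y. x ** y"])
  (auto intro!: continuous_intros simp: split_beta)

lemma borel_measurable_transpose [measurable]:
 fixes f :: "'a => real^'n^'m"
 assumes [measurable]: "f \<in> borel_measurable F"
 shows "(%x. transpose (f x)) \<in> borel_measurable F"
 by (rule borel_measurable_continuous_on[where f = transpose]) (auto intro!: continuous_intros)

lemma euler_measurable:
 fixes B :: "real => 'a => real^'n^'n"
 assumes B: "\<And>s. s \<in> {0..T} ==> B s \<in> borel_measurable F" and T: "0 <= T" and i: "i <= m"
 shows "(%om. euler (%s. B s om) (T / real m) m u i) \<in> borel_measurable F"
 using i
proof (induction rule: inc_induct)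
 case (step n)
 then have "real n * (T / real m) \<in> {0..T}" using coarse_bounds[OF T, of n m] by auto
 from B[OF this] have [measurable]: "B (real n * (T / real m)) \<in> borel_measurable F" .
 have [measurable]: "(%om. euler (%s. B s om) (T / real m) m u (Suc n)) \<in> borel_measurable F" by fact
 have n: "n < m" using step by simp
 show ?case unfolding euler_step[OF n] by measurable
qed simp

lemma
 fixes H :: "real => 'a => real^'m^'n" and C :: "real^'n^'m" and Y :: "real => 'a => real^'m"
 assumes H: "\<And>s. s \<in> {0..T} ==> H s \<in> borel_measurable F" and T: "0 <= T" and k: "0 < k"
 shows noise_coef_measurable: "l < m * k ==> (%om. noise_coef A C R1h R2h (%s. H s om) T m k u l) \<in> borel_measurable F"
  and obs_sum_measurable: "(\<And>s. s \<in> {0..T} ==> Y s \<in> borel_measurable F) ==>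
   (%om. obs_sum A C a c (%s. H s om) (%s. Y s om) T m k u) \<in> borel_measurable F"
  and euler_filter_measurable: "i <= m ==> (%om. euler (%s. A - H s om ** C) (T / real m) m u i) \<in> borel_measurable F"
proof -
 show e: "(%om. euler (%s. A - H s om ** C) (T / real m) m u i) \<in> borel_measurable F" if "i <= m" for i
 proof (rule euler_measurable[OF _ T that])
  fix s assume "s \<in> {0..T}"
  from H[OF this] have [measurable]: "H s \<in> borel_measurable F" .
  show "(%om. A - H s om ** C) \<in> borel_measurable F" by measurable
 qed
 have w: "(%om. weight (%s. A - H s om ** C) T m k u l) \<in> borel_measurable F" if "l < m * k" for l
  unfolding weight_def using that k by (intro e) (simp add: less_mult_imp_div_less Suc_leI)
 have g: "gridp T m k l \<in> {0..T}" if "l <= m * k" for l using gridp_bounds[OF T that] by simp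
 show "(%om. noise_coef A C R1h R2h (%s. H s om) T m k u l) \<in> borel_measurable F" if l: "l < m * k"
 proof -
  note [measurable] = w[OF l] H[OF g[OF less_imp_le[OF l]]]
  show ?thesis unfolding noise_coef_def Let_def by measurable
 qed
 show "(%om. obs_sum A C a c (%s. H s om) (%s. Y s om) T m k u) \<in> borel_measurable F"
  if Y: "\<And>s. s \<in> {0..T} ==> Y s \<in> borel_measurable F"
  unfolding obs_sum_def
 proof (rule borel_measurable_sum)
  fix l assume "l \<in> {..<m * k}"
  then have l: "l < m * k" by simp
  note [measurable] = w[OF l] H[OF g[OF less_imp_le[OF l]]] Y[OF g[OF less_imp_le[OF l]]] Y[OF g[OF Suc_leI[OF l]]]
  show "(%om. weight (%s. A - H s om ** C) T m k u l \<bullet>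
    ((T / (real m * real k)) *\<^sub>R a + H (gridp T m k l) om *v
     (Y (gridp T m k (Suc l)) om - Y (gridp T m k l) om - (T / (real m * real k)) *\<^sub>R c))) \<in> borel_measurable F"
   by measurable
 qed
qed

section \<open>The conditional law of the diffusion\<close>

locale kalman_filter = prob_space M for M :: "'w measure" +
 fixes A R1h P0 :: "real^'n^'n" and C :: "real^'n^'m" and R2h :: "real^'m^'m" and a m0 :: "real^'n" and c :: "real^'m"
  and X Xb Wb :: "real => 'w => real^'n" and Y Vb :: "real => 'w => real^'m"
  and \<eta> :: "real => 'w => (real^'n) measure" and Q :: "real => 'w => real^'n^'n"
 assumes sym1: "symmetric_mat R1h" and sym2: "symmetric_mat R2h" and inv2: "invertible R2h"
  and diffusion: "kalman_bucy_diffusion M A a C c R1h R2h X Y Wb Vb Xb \<eta>"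
  and X: "continuous_process M X" and Y: "continuous_process M Y"
  and x0_char: "\<And>u. (CLINT om|M. iexp (u \<bullet> Xb 0 om)) = iexp (u \<bullet> m0) * exp (- (u \<bullet> (P0 *v u)) / 2)"
  and P0: "psd P0"
  and Q: "continuous_process M Q" and Q_eq: "\<And>t. 0 <= t ==> AE om in M. Q t om = cov_matrix (\<eta> t om)"
begin

definition gain :: "real^'m^'n" where "gain = transpose C ** matrix_inv (R2h ** R2h)"

definition info :: "real^'n^'n" where "info = transpose C ** matrix_inv (R2h ** R2h) ** C"

text \<open>\<open>Q\<close> has continuous paths but, as a modification, need not be measurable for
  the history of \<open>Y\<close>, which is not completed. Written through first and second moments,
  \<open>cov_F\<close> is measurable for the history at its own time, and it equals the covariance
  wherever second moments are finite. Path properties are taken from \<open>Q\<close>, measurability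
  from \<open>cov_F\<close>; on grids the two agree almost surely.\<close>

definition cov_F :: "real => 'w => real^'n^'n" where
 "cov_F t om = (\<chi> i j. (\<integral>x. x $ i * x $ j \<partial>\<eta> t om) - (\<integral>x. x $ i \<partial>\<eta> t om) * (\<integral>x. x $ j \<partial>\<eta> t om))"

lemma
 shows bm: "brownian_motion M (%t om. (Wb t om, Vb t om))"
  and indep_x0: "indep_algebras M (process_algebra M {0} Xb) (process_algebra M {0..} (%t om. (Wb t om, Vb t om)))"
  and indep_XY: "indep_algebras M (process_algebra M {0..} (%t om. (Wb t om, Vb t om, Xb 0 om)))
           (process_algebra M {0..} (%t om. (X t om, Y t om)))"
  and Xb: "continuous_process M Xb"
  and Xb_sq: "0 <= t ==> integrable M (%om. (norm (Xb t om))\<^sup>2)"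
  and cond_law: "0 <= t ==> is_cond_law M (history M Y t) (Xb t) (\<eta> t)"
  and stoch_int: "0 <= t ==> has_stochastic_integral M
    (%s om. cov_matrix (\<eta> s om) ** transpose C ** matrix_inv (R2h ** R2h))
    (%s om. Y s om - (integral {0..s} (%r. C *v Xb r om + c) + R2h *v Vb s om))
    t
    (%om. Xb t om - Xb 0 om - integral {0..t} (%s. A *v Xb s om + a) - R1h *v Wb t om)"
proof -
 note d = diffusion[unfolded kalman_bucy_diffusion_def]
 show "brownian_motion M (%t om. (Wb t om, Vb t om))" by (rule d[THEN conjunct1])
 note d = d[THEN conjunct2]
 show "indep_algebras M (process_algebra M {0} Xb) (process_algebra M {0..} (%t om. (Wb t om, Vb t om)))"
  by (rule d[THEN conjunct1])
 note d = d[THEN conjunct2]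
 show "indep_algebras M (process_algebra M {0..} (%t om. (Wb t om, Vb t om, Xb 0 om)))
           (process_algebra M {0..} (%t om. (X t om, Y t om)))" by (rule d[THEN conjunct1])
 note d = d[THEN conjunct2]
 show "continuous_process M Xb" by (rule d[THEN conjunct1])
 note d = d[THEN conjunct2]
 show "0 <= t ==> integrable M (%om. (norm (Xb t om))\<^sup>2)" by (rule d[THEN conjunct1, rule_format])
 note d = d[THEN conjunct2]
 show "0 <= t ==> is_cond_law M (history M Y t) (Xb t) (\<eta> t)" by (rule d[THEN conjunct1, rule_format])
 note d = d[THEN conjunct2, THEN conjunct2]
 show "0 <= t ==> has_stochastic_integral M
    (%s om. cov_matrix (\<eta> s om) ** transpose C ** matrix_inv (R2h ** R2h))
    (%s om. Y s om - (integral {0..s} (%r. C *v Xb r om + c) + R2h *v Vb s om))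
    t
    (%om. Xb t om - Xb 0 om - integral {0..t} (%s. A *v Xb s om + a) - R1h *v Wb t om)" by (rule d[rule_format])
qed

lemma Y_measurable: "0 <= t ==> Y t \<in> borel_measurable M"
 by (rule Y[unfolded continuous_process_def, THEN conjunct1, rule_format])

lemma Xb_measurable: "0 <= t ==> Xb t \<in> borel_measurable M"
 by (rule Xb[unfolded continuous_process_def, THEN conjunct1, rule_format])

lemma history_sub: "0 <= t ==> subalgebra M (history M Y t)"
 by (rule subalgebra_process_algebra) (rule Y_measurable, simp)

lemma conditional: "0 <= t ==> conditional_law M (history M Y t) (Xb t) (\<eta> t)"
 by (intro conditional_law.intro conditional_law_axioms.intro prob_space_axioms history_sub cond_law Xb_measurable)

lemma Y_history: "s \<in> {0..t} ==> Y s \<in> borel_measurable (history M Y t)"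
 by (rule process_algebra_measurable)

lemma cov_F_measurable:
 assumes "s \<in> {0..t}"
 shows "cov_F s \<in> borel_measurable (history M Y t)"
proof -
 have s: "0 <= s" using assms by simp
 interpret L: conditional_law M "history M Y s" "Xb s" "\<eta> s" by (rule conditional[OF s])
 have m: "(%om. \<integral>x. x $ i \<partial>\<eta> s om) \<in> borel_measurable (history M Y s)"
  "(%om. \<integral>x. x $ i * x $ j \<partial>\<eta> s om) \<in> borel_measurable (history M Y s)" for i j
  by (auto intro!: L.integral_measurable_F)
 have "cov_F s \<in> borel_measurable (history M Y s)"
 proof (subst borel_measurable_euclidean_space, intro ballI)
  fix b :: "real^'n^'n" assume "b \<in> Basis"
  then obtain i j where "b = axis i (axis j 1)" by (auto simp: Basis_vec_def)
  then have "(%om. cov_F s om \<bullet> b) = (%om. (\<integral>x. x $ i * x $ j \<partial>\<eta> s om) - (\<integral>x. x $ i \<partial>\<eta> s om) * (\<integral>x. x $ j \<partial>\<eta> s om))"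
   by (simp add: cov_F_def inner_axis)
  then show "(%om. cov_F s om \<bullet> b) \<in> borel_measurable (history M Y s)"
   using m by simp
 qed
 moreover have "sets (history M Y s) \<subseteq> sets (history M Y t)"
  by (rule process_algebra_mono) (use assms in auto)
 ultimately show ?thesis by (intro measurable_from_subalg[of "history M Y t" "history M Y s"]) (simp_all add: subalgebra_def)
qed

lemma AE_square_integrable: "0 <= t ==> AE om in M. integrable (\<eta> t om) (%x. (norm x)\<^sup>2)"
proof -
 assume t: "0 <= t"
 interpret L: conditional_law M "history M Y t" "Xb t" "\<eta> t" by (rule conditional[OF t])
 show ?thesis by (rule L.AE_integrable) (use Xb_sq[OF t] in auto)
qed

lemma cov_F_eq: "0 <= t ==> AE om in M. cov_F t om = cov_matrix (\<eta> t om)"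
proof -
 assume t: "0 <= t"
 interpret L: conditional_law M "history M Y t" "Xb t" "\<eta> t" by (rule conditional[OF t])
 show ?thesis using AE_square_integrable[OF t] AE_space
 proof eventually_elim
  case (elim om)
  interpret E: prob_space "\<eta> t om" using L.kernel_prob elim by simp
  have kb: "sets (\<eta> t om) = sets borel" using L.kernel_prob elim by simp
  have sq: "integrable (\<eta> t om) (%x. x $ i * x $ j)" for i j
  proof (rule Bochner_Integration.integrable_bound[OF elim(1)])
   have "\<bar>x $ i\<bar> * \<bar>x $ j\<bar> <= norm x * norm x" for x :: "real^'n"
    by (intro mult_mono component_le_norm_cart) auto
   then show "AE x in \<eta> t om. norm (x $ i * x $ j) <= norm ((norm x)\<^sup>2)"
    by (simp add: abs_mult power2_eq_square)
   show "(%x. x $ i * x $ j) \<in> borel_measurable (\<eta> t om)"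
    unfolding measurable_cong_sets[OF kb refl] by measurable
  qed
  have one: "integrable (\<eta> t om) (%x. x $ i)" for i
  proof (rule E.square_integrable_imp_integrable)
   show "(%x. x $ i) \<in> borel_measurable (\<eta> t om)"
    unfolding measurable_cong_sets[OF kb refl] by measurable
   show "integrable (\<eta> t om) (%x. (x $ i)\<^sup>2)" using sq[of i i] by (simp add: power2_eq_square)
  qed
  have "(\<integral>x. (x $ i - \<mu> i) * (x $ j - \<mu> j) \<partial>\<eta> t om) = (\<integral>x. x $ i * x $ j \<partial>\<eta> t om) - \<mu> i * \<mu> j"
   if "\<mu> = (%i. \<integral>x. x $ i \<partial>\<eta> t om)" for i j \<mu>
  proof -
   have "(\<integral>x. (x $ i - \<mu> i) * (x $ j - \<mu> j) \<partial>\<eta> t om) = (\<integral>x. x $ i * x $ j - \<mu> j * x $ i - \<mu> i * x $ j + \<mu> i * \<mu> j \<partial>\<eta> t om)"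
    by (intro Bochner_Integration.integral_cong refl) (simp add: algebra_simps)
   also have "\<dots> = (\<integral>x. x $ i * x $ j \<partial>\<eta> t om) - \<mu> j * \<mu> i - \<mu> i * \<mu> j + \<mu> i * \<mu> j"
    using sq one by (simp add: that E.prob_space)
   finally show ?thesis by simp
  qed
  from this[OF refl] show ?case by (simp add: cov_F_def cov_matrix_def mean_vec_def vec_eq_iff)
 qed
qed

lemma gain_rearrange: "Z ** transpose C ** matrix_inv (R2h ** R2h) = Z ** gain"
 by (simp add: gain_def matrix_mul_assoc)

lemma gain_C: "gain ** C = info"
 by (simp add: gain_def info_def)

lemma R2_symmetric: "transpose (R2h ** R2h) = R2h ** R2h"
 using sym2 by (simp add: symmetric_mat_def matrix_transpose_mul)

lemma R2_inv: "symmetric_mat (matrix_inv (R2h ** R2h))" "matrix_inv (R2h ** R2h) ** (R2h ** R2h) = mat 1"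
proof -
 have inv: "invertible (R2h ** R2h)" using inv2 by (simp add: invertible_mult)
 show "symmetric_mat (matrix_inv (R2h ** R2h))"
  using symmetric_matrix_inv[of "R2h ** R2h"] R2_symmetric inv by (simp add: symmetric_mat_def)
 show "matrix_inv (R2h ** R2h) ** (R2h ** R2h) = mat 1"
  using inv by (rule matrix_inv_mult(1))
qed

text \<open>The observation noise fed in through the gain contributes the quadratic term of the
  Riccati equation; this turns the Lyapunov equation of \<open>quad_var_converges\<close> into that
  equation.\<close>

lemma gain_quadratic: "(Z ** gain) ** (R2h ** R2h) ** transpose (Z ** gain) = Z ** info ** transpose Z"
proof -
 have t: "transpose (matrix_inv (R2h ** R2h)) = matrix_inv (R2h ** R2h)"
  using R2_inv(1) by (simp add: symmetric_mat_def)
 have "(Z ** gain) ** (R2h ** R2h) ** transpose (Z ** gain)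
   = Z ** transpose C ** (matrix_inv (R2h ** R2h) ** (R2h ** R2h)) ** matrix_inv (R2h ** R2h) ** C ** transpose Z"
  by (simp only: gain_def matrix_transpose_mul t transpose_transpose matrix_mul_assoc)
 also have "\<dots> = Z ** info ** transpose Z"
  unfolding R2_inv(2) by (simp add: info_def matrix_mul_assoc)
 finally show ?thesis .
qed

lemma info_symmetric: "symmetric_mat info"
 using R2_inv(1) by (simp add: symmetric_mat_def info_def matrix_transpose_mul matrix_mul_assoc)

text \<open>\<open>kap m\<close> is the number of fine steps in each of the \<open>m\<close> coarse
  blocks. The rate is the one that \<open>pathwise_representation\<close> asks for.\<close>

definition good_subdivision :: "real => (nat => nat) => bool" where
 "good_subdivision T kap \<longleftrightarrow> (\<forall>m. 0 < kap m) \<and> (AE om in M. \<forall>\<^sub>F m in sequentially. \<forall>i\<le>m.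
  norm (riemann_defect A C a c R1h R2h (%s. Q s om ** gain) (%s. Xb s om) (%s. Wb s om) (%s. Vb s om) (%s. Y s om) T m (kap m) i)
   <= 1 / (real m + 1)\<^sup>2)"

lemma AE_grid:
 assumes "0 <= T" "\<And>t. 0 <= t ==> AE om in M. f t om = g t om"
 shows "AE om in M. \<forall>m k l. l <= m * k --> f (gridp T m k l) om = g (gridp T m k l) om"
proof -
 have "AE om in M. l <= m * k --> f (gridp T m k l) om = g (gridp T m k l) om" for m k l
  using assms(2)[of "gridp T m k l"] gridp_bounds(1)[OF assms(1), of l m k] by (cases "l <= m * k") auto
 then show ?thesis by (simp add: AE_all_countable)
qed

text \<open>Convergence in probability at the finitely many coarse times lets the fine mesh be
  chosen, for each m, such that large defects have small probability; Borel-Cantelli makes this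
  almost sure. Every subdivision finer than \<open>kap0\<close> is good, so that two diffusions can
  share one.\<close>

lemma good_subdivisions_exist:
 assumes T: "0 <= T"
 shows "\<exists>kap0. \<forall>kap. (\<forall>m. kap0 m <= kap m) --> good_subdivision T kap"
proof -
 define H where "H s om = cov_matrix (\<eta> s om) ** transpose C ** matrix_inv (R2h ** R2h)" for s om
 define Z where "Z s om = Y s om - (integral {0..s} (%r. C *v Xb r om + c) + R2h *v Vb s om)" for s om
 define I where "I s om = Xb s om - Xb 0 om - integral {0..s} (%s. A *v Xb s om + a) - R1h *v Wb s om" for s om
 have si: "has_stochastic_integral M H Z t (I t)" if "0 <= t" for t
  using stoch_int[OF that] unfolding H_def[abs_def] Z_def[abs_def] I_def[abs_def] .
 define D where "D m k i om = riemann_defect A C a c R1h R2h (%s. H s om) (%s. Xb s om) (%s. Wb s om) (%s. Vb s om) (%s. Y s om) T m k i" for m k i om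
 define q where "q m i = real i * (T / real m)" for m i :: nat
 have q0: "0 <= q m i" for m i using T by (simp add: q_def)
 have D_eq: "D m k i om = I (q m i) om - (\<Sum>l<i * k. H (gridp T m k l) om *v (Z (gridp T m k (Suc l)) om - Z (gridp T m k l) om))" for m k i om
  by (simp add: D_def riemann_defect_def Let_def I_def Z_def q_def)
 have gq: "gridp T m k l \<in> {0..q m i}" if "l <= i * k" "0 < k" for m k l i
 proof -
  have "real l <= real (i * k)" using that by (simp only: of_nat_le_iff)
  then have "gridp T m k l <= gridp T m k (i * k)" unfolding gridp_def using T by (intro mult_right_mono) auto
  then show ?thesis using T gridp_coarse[OF that(2), of T m i] by (simp add: q_def gridp_def)
 qed
 have Dm: "D m k i \<in> borel_measurable M" if k: "0 < k" for m k i
 proof -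
  have m: "I (q m i) \<in> borel_measurable M" "\<And>s. s \<in> {0..q m i} ==> H s \<in> borel_measurable M"
   "\<And>s. s \<in> {0..q m i} ==> Z s \<in> borel_measurable M"
   using si[OF q0[of m i]] unfolding has_stochastic_integral_def by auto
  have "(%om. I (q m i) om - (\<Sum>l<i * k. H (gridp T m k l) om *v (Z (gridp T m k (Suc l)) om - Z (gridp T m k l) om))) \<in> borel_measurable M"
  proof (intro borel_measurable_diff m borel_measurable_sum borel_measurable_matrix_vector_mult)
   fix l assume "l \<in> {..<i * k}"
   then have l: "l <= i * k" "Suc l <= i * k" by auto
   show "gridp T m k l \<in> {0..q m i}" "gridp T m k (Suc l) \<in> {0..q m i}" "gridp T m k l \<in> {0..q m i}"
    using gq[OF l(1) k, of m] gq[OF l(2) k, of m] by simp_all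
  qed
  then show ?thesis unfolding D_eq[abs_def] .
 qed
 define e where "e m = 1 / (real m + 1)\<^sup>2" for m :: nat
 \<comment> \<open>The division by m + 1 pays for the union over the m + 1 coarse times; the
   resulting probabilities are summable.\<close>
 define d where "d m = (1/2)^m / (real m + 1)" for m :: nat
 have ed: "0 < e m" "0 < d m" for m by (auto simp: e_def d_def)
 have "\<forall>\<^sub>F k in sequentially. \<forall>i\<in>{..m}. measure M {om\<in>space M. e m <= norm (D m k i om)} < d m" for m
 proof (rule eventually_ball_finite, simp, intro ballI)
  fix i
  obtain dl where dl: "0 < dl" "\<forall>(N::nat) p. p 0 = 0 \<and> p N = q m i \<and> (\<forall>k<N. p k <= p (Suc k) \<and> p (Suc k) - p k < dl) -->
    measure M {om\<in>space M. e m <= norm ((\<Sum>k<N. H (p k) om *v (Z (p (Suc k)) om - Z (p k) om)) - I (q m i) om)} < d m"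
   using si[OF q0[of m i], unfolded has_stochastic_integral_def, THEN conjunct2, THEN conjunct2, rule_format, OF ed(1)[of m] ed(2)[of m]]
   by (elim exE conjE) (rule that)
  have "(%k. (T / real m) * (1 / real k)) \<longlonglongrightarrow> (T / real m) * 0"
   by (intro tendsto_intros lim_1_over_n)
  then have "\<forall>\<^sub>F k in sequentially. (T / real m) * (1 / real k) < dl"
   using dl(1) by (intro order_tendstoD) auto
  then show "\<forall>\<^sub>F k in sequentially. measure M {om\<in>space M. e m <= norm (D m k i om)} < d m"
   using eventually_gt_at_top[of 0]
  proof eventually_elim
   case (elim k)
   have "measure M {om\<in>space M. e m <= norm ((\<Sum>l<i * k. H (gridp T m k l) om *v (Z (gridp T m k (Suc l)) om - Z (gridp T m k l) om)) - I (q m i) om)} < d m"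
   proof (rule dl(2)[rule_format], intro conjI allI impI)
    show "gridp T m k (i * k) = q m i" using gridp_coarse[OF elim(2)] by (simp add: q_def)
    show "gridp T m k l <= gridp T m k (Suc l)" for l by (rule gridp_mono[OF T])
    show "gridp T m k (Suc l) - gridp T m k l < dl" for l unfolding gridp_Suc using elim(1) by simp
   qed (simp add: gridp_def)
   then show ?case unfolding D_eq by (subst norm_minus_commute)
  qed
 qed
 then have "\<exists>k0. \<forall>k\<ge>k0. \<forall>i\<in>{..m}. measure M {om\<in>space M. e m <= norm (D m k i om)} < d m" for m
  unfolding eventually_sequentially by blast
 then obtain k0 where k0: "\<And>m k i. k0 m <= k ==> i <= m ==> measure M {om\<in>space M. e m <= norm (D m k i om)} < d m"
  by (metis atMost_iff)
 show ?thesis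
 proof (intro exI[of _ "%m. max 1 (k0 m)"] allI impI)
  fix kap assume "\<forall>m. max 1 (k0 m) <= kap m"
  then have kap: "0 < kap m" "k0 m <= kap m" for m by (auto simp: Suc_le_eq)
  define E where "E m i = {om\<in>space M. e m <= norm (D m (kap m) i om)}" for m i
  have Em [measurable]: "E m i \<in> sets M" for m i unfolding E_def using Dm[OF kap(1)] by measurable
  have meas: "measure M (\<Union>i\<le>m. E m i) <= (1/2)^m" for m
  proof -
   have "measure M (\<Union>i\<le>m. E m i) <= (\<Sum>i\<le>m. measure M (E m i))"
    by (rule measure_UNION_le) auto
   also have "\<dots> <= (\<Sum>i\<le>m. d m)" using k0[OF kap(2)] by (intro sum_mono) (auto simp: E_def intro: less_imp_le)
   also have "\<dots> = (1/2)^m" by (simp add: d_def add.commute)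
   finally show ?thesis .
  qed
  have "AE om in M. \<forall>\<^sub>F m in sequentially. om \<in> space M - (\<Union>i\<le>m. E m i)"
  proof (rule borel_cantelli_AE1)
   show "summable (%m. measure M (\<Union>i\<le>m. E m i))"
    by (rule summable_comparison_test'[of "%m. (1/2::real)^m" 0]) (use meas in \<open>auto intro: summable_geometric\<close>)
  qed (auto simp: emeasure_eq_measure)
  moreover have "AE om in M. \<forall>m k l. l <= m * k --> Q (gridp T m k l) om ** gain = H (gridp T m k l) om"
  proof (rule AE_grid[OF T])
   fix t :: real assume "0 <= t"
   from Q_eq[OF this] show "AE om in M. Q t om ** gain = H t om"
    by eventually_elim (simp add: H_def gain_rearrange)
  qed
  ultimately have "AE om in M. \<forall>\<^sub>F m in sequentially. \<forall>i\<le>m.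
   norm (riemann_defect A C a c R1h R2h (%s. Q s om ** gain) (%s. Xb s om) (%s. Wb s om) (%s. Vb s om) (%s. Y s om) T m (kap m) i) <= 1 / (real m + 1)\<^sup>2"
  proof eventually_elim
   case (elim om)
   note grid = elim(2)[rule_format, OF less_imp_le]
   from elim(1) show ?case
   proof eventually_elim
    case (elim m)
    show ?case
    proof (intro allI impI)
     fix i assume i: "i <= m"
     have "riemann_defect A C a c R1h R2h (%s. Q s om ** gain) (%s. Xb s om) (%s. Wb s om) (%s. Vb s om) (%s. Y s om) T m (kap m) i = D m (kap m) i om"
      unfolding D_def
      by (rule riemann_defect_cong[where H = "%s. Q s om ** gain" and H' = "%s. H s om", OF kap(1) _ i]) (rule grid)
     moreover have "om \<notin> E m i" "om \<in> space M" using elim i by auto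
     ultimately show "norm (riemann_defect A C a c R1h R2h (%s. Q s om ** gain) (%s. Xb s om) (%s. Wb s om) (%s. Vb s om) (%s. Y s om) T m (kap m) i) <= 1 / (real m + 1)\<^sup>2"
      by (simp add: E_def e_def)
    qed
   qed
  qed
  then show "good_subdivision T kap" using kap by (simp add: good_subdivision_def)
 qed
qed

lemma noise_independent:
 assumes t: "0 <= t"
 shows "indep_algebras M (history M Y t) (process_algebra M {0..} (%t om. ((Wb t om, Vb t om), Xb 0 om)))"
  and "indep_algebras M (process_algebra M {0} (%_. Xb 0)) (process_algebra M {0..} (%t om. (Wb t om, Vb t om)))"
proof -
 have 1: "sets (history M Y t) \<subseteq> sets (process_algebra M {0..} (%t om. (X t om, Y t om)))"
 proof (rule process_algebra_le)
  fix s assume "s \<in> {0..t}"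
  then have [measurable]: "(%om. (X s om, Y s om)) \<in> borel_measurable (process_algebra M {0..} (%t om. (X t om, Y t om)))"
   by (intro process_algebra_measurable) auto
  have "(%om. snd (X s om, Y s om)) \<in> borel_measurable (process_algebra M {0..} (%t om. (X t om, Y t om)))"
   by (rule borel_measurable_continuous_on) (auto intro!: continuous_intros)
  then show "Y s \<in> borel_measurable (process_algebra M {0..} (%t om. (X t om, Y t om)))" by simp
 qed simp
 have 2: "sets (process_algebra M {0..} (%t om. ((Wb t om, Vb t om), Xb 0 om))) \<subseteq> sets (process_algebra M {0..} (%t om. (Wb t om, Vb t om, Xb 0 om)))"
 proof (rule process_algebra_le)
  fix s :: real assume "s \<in> {0..}"
  then have [measurable]: "(%om. (Wb s om, Vb s om, Xb 0 om)) \<in> borel_measurable (process_algebra M {0..} (%t om. (Wb t om, Vb t om, Xb 0 om)))"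
   by (rule process_algebra_measurable)
  have "(%om. (%z. ((fst z, fst (snd z)), snd (snd z))) (Wb s om, Vb s om, Xb 0 om)) \<in> borel_measurable (process_algebra M {0..} (%t om. (Wb t om, Vb t om, Xb 0 om)))"
   by (rule borel_measurable_continuous_on) (auto intro!: continuous_intros)
  then show "(%om. ((Wb s om, Vb s om), Xb 0 om)) \<in> borel_measurable (process_algebra M {0..} (%t om. (Wb t om, Vb t om, Xb 0 om)))" by simp
 qed simp
 show "indep_algebras M (history M Y t) (process_algebra M {0..} (%t om. ((Wb t om, Vb t om), Xb 0 om)))"
  by (rule indep_algebras_mono[OF indep_algebras_sym[OF indep_XY] 1 2])
 have "sets (process_algebra M {0::real} (%_. Xb 0)) \<subseteq> sets (process_algebra M {0} Xb)"
  by (rule process_algebra_le) (auto intro: process_algebra_measurable)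
 then show "indep_algebras M (process_algebra M {0} (%_. Xb 0)) (process_algebra M {0..} (%t om. (Wb t om, Vb t om)))"
  by (rule indep_algebras_mono[OF indep_x0]) simp
qed

end

context kalman_filter
begin

lemma gain_F_measurable:
 assumes "s \<in> {0..t}"
 shows "(%om. cov_F s om ** gain) \<in> borel_measurable (history M Y t)"
proof -
 have [measurable]: "cov_F s \<in> borel_measurable (history M Y t)" by (rule cov_F_measurable[OF assms])
 show ?thesis by measurable
qed

lemma cov_F_grid:
 assumes "0 <= T"
 shows "AE om in M. \<forall>m k l. l <= m * k --> cov_F (gridp T m k l) om = Q (gridp T m k l) om"
proof (rule AE_grid[OF assms])
 fix t :: real assume t: "0 <= t"
 from cov_F_eq[OF t] Q_eq[OF t] show "AE om in M. cov_F t om = Q t om" by eventually_elim simp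
qed

lemma Q_continuous: "om \<in> space M ==> continuous_on {0..} (%s. Q s om)"
 and Xb_continuous: "om \<in> space M ==> continuous_on {0..} (%s. Xb s om)"
 using Q Xb unfolding continuous_process_def by blast+

lemma gain_continuous: "om \<in> space M ==> continuous_on {0..T} (%s. Q s om ** gain)"
 by (intro continuous_intros continuous_on_subset[OF Q_continuous]) auto

lemma Xb_representation:
 assumes T: "0 <= T" and good: "good_subdivision T kap"
 shows "AE om in M. (%m. obs_sum A C a c (%s. Q s om ** gain) (%s. Y s om) T m (kap m) u
  + (euler (%s. A - Q s om ** gain ** C) (T / real m) m u 0 \<bullet> Xb 0 om
   + noise_sum A C R1h R2h (%s. Q s om ** gain) (%s. (Wb s om, Vb s om)) T m (kap m) u)) \<longlonglongrightarrow> u \<bullet> Xb T om"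
proof -
 have k: "\<And>m. 0 < kap m" using good by (simp add: good_subdivision_def)
 from good have "AE om in M. \<forall>\<^sub>F m in sequentially. \<forall>i\<le>m.
  norm (riemann_defect A C a c R1h R2h (%s. Q s om ** gain) (%s. Xb s om) (%s. Wb s om) (%s. Vb s om) (%s. Y s om) T m (kap m) i)
   <= 1 / (real m + 1)\<^sup>2" by (simp add: good_subdivision_def)
 then show ?thesis using AE_space
 proof eventually_elim
  case (elim om)
  have x: "continuous_on {0..T} (%s. Xb s om)" by (rule continuous_on_subset[OF Xb_continuous[OF elim(2)]]) auto
  show ?case by (rule pathwise_representation[OF T x gain_continuous[OF elim(2)] sym1 sym2 k elim(1)])
 qed
qed

section \<open>Conditional characteristic functions of the discretised state\<close>

definition cond_char :: "real => nat => nat => real^'n => 'w => complex" where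
 "cond_char T m k u om =
  iexp (obs_sum A C a c (%s. cov_F s om ** gain) (%s. Y s om) T m k u
   + euler (%s. A - cov_F s om ** gain ** C) (T / real m) m u 0 \<bullet> m0)
  * exp (- quad_var P0 A C R1h R2h (%s. cov_F s om ** gain) T m k u / 2)"

lemma cond_char_measurable:
 assumes T: "0 <= T" and k: "0 < k"
 shows "cond_char T m k u \<in> borel_measurable (history M Y T)"
proof -
 note H = gain_F_measurable[of _ T]
 have [measurable]: "(%om. obs_sum A C a c (%s. cov_F s om ** gain) (%s. Y s om) T m k u) \<in> borel_measurable (history M Y T)"
  by (rule obs_sum_measurable[OF H T k Y_history])
 have [measurable]: "(%om. euler (%s. A - cov_F s om ** gain ** C) (T / real m) m u 0) \<in> borel_measurable (history M Y T)"
  by (rule euler_filter_measurable[OF H T k le0])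
 have nc: "(%om. noise_coef A C R1h R2h (%s. cov_F s om ** gain) T m k u l) \<in> borel_measurable (history M Y T)" if "l < m * k" for l
  by (rule noise_coef_measurable[OF H T k that])
 have [measurable]: "(%om. quad_var P0 A C R1h R2h (%s. cov_F s om ** gain) T m k u) \<in> borel_measurable (history M Y T)"
  unfolding quad_var_def Let_def
  by (intro borel_measurable_add borel_measurable_sum borel_measurable_times borel_measurable_power borel_measurable_norm nc borel_measurable_const)
   (measurable, auto intro: nc)
 show ?thesis unfolding cond_char_def[abs_def] by measurable
qed

lemma cond_char_norm:
 assumes "0 <= T"
 shows "norm (cond_char T m k u om) <= 1"
 using quad_var_nonneg[OF assms P0] by (simp add: cond_char_def norm_mult)

text \<open>Conditionally on the observations up to time \<open>T\<close>, the linear functional \<^const>\<open>noise_sum\<close> of the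
 independent noise is centred Gaussian, hence \<^const>\<open>cond_char\<close> is the conditional characteristic
 function of the discretised state.\<close>

lemma cond_char_converges:
 assumes T: "0 <= T" and good: "good_subdivision T kap"
 shows "(%m. expectation (%om. norm (cond_char T m (kap m) u om - char_fun (\<eta> T om) u))) \<longlonglongrightarrow> 0"
proof -
 have k: "0 < kap m" for m using good by (simp add: good_subdivision_def)
 interpret L: conditional_law M "history M Y T" "Xb T" "\<eta> T" by (rule conditional[OF T])
 let ?H = "%om s. cov_F s om ** gain"
 define ob where "ob m om = obs_sum A C a c (?H om) (%s. Y s om) T m (kap m) u" for m om
 define y0 where "y0 m om = euler (%s. A - cov_F s om ** gain ** C) (T / real m) m u 0" for m om
 define no where "no m om = noise_sum A C R1h R2h (?H om) (%s. (Wb s om, Vb s om)) T m (kap m) u" for m om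
 note H = gain_F_measurable[of _ T]
 have obm [measurable]: "ob m \<in> borel_measurable (history M Y T)" for m
  unfolding ob_def[abs_def] by (rule obs_sum_measurable[OF H T k Y_history])
 have y0m [measurable]: "y0 m \<in> borel_measurable (history M Y T)" for m
  unfolding y0_def[abs_def] by (rule euler_filter_measurable[OF H T k le0])
 have ncm: "(%om. noise_coef A C R1h R2h (?H om) T m (kap m) u l) \<in> borel_measurable (history M Y T)" if "l < m * kap m" for m l
  by (rule noise_coef_measurable[OF H T k that])
 note fromF = measurable_from_subalg[OF history_sub[OF T]]
 have x0m [measurable]: "Xb 0 \<in> borel_measurable M" by (rule Xb_measurable) simp
 have xTm [measurable]: "Xb T \<in> borel_measurable M" by (rule Xb_measurable[OF T])
 have Bm: "(%om. (Wb s om, Vb s om)) \<in> borel_measurable M" if "0 <= s" for s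
  using bm that unfolding brownian_motion_def continuous_process_def by blast
 have nom [measurable]: "no m \<in> borel_measurable M" for m
  unfolding no_def[abs_def] noise_sum_def
 proof (rule borel_measurable_sum)
  fix l assume "l \<in> {..<m * kap m}"
  then have l: "l < m * kap m" by simp
  have g: "0 <= gridp T m (kap m) l" for l using T by (simp add: gridp_def)
  show "(%om. noise_coef A C R1h R2h (?H om) T m (kap m) u l \<bullet>
    ((Wb (gridp T m (kap m) (Suc l)) om, Vb (gridp T m (kap m) (Suc l)) om) - (Wb (gridp T m (kap m) l) om, Vb (gridp T m (kap m) l) om))) \<in> borel_measurable M"
   by (intro borel_measurable_inner borel_measurable_diff Bm g fromF[OF ncm[OF l]])
 qed
 have obM [measurable]: "ob m \<in> borel_measurable M" and y0M [measurable]: "y0 m \<in> borel_measurable M" for m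
  by (rule fromF[OF obm], rule fromF[OF y0m])
 define Z where "Z m om = iexp (ob m om + (y0 m om \<bullet> Xb 0 om + no m om))" for m om
 have Zm [measurable]: "Z m \<in> borel_measurable M" for m unfolding Z_def[abs_def] by measurable
 have "AE om in M. (%m. Z m om) \<longlonglongrightarrow> iexp (u \<bullet> Xb T om)"
  using Xb_representation[OF T good, of u] cov_F_grid[OF T]
 proof eventually_elim
  case (elim om)
  have eq: "cov_F (gridp T m (kap m) l) om ** gain = Q (gridp T m (kap m) l) om ** gain" if "l < m * kap m" for m l
   using elim(2)[rule_format, OF less_imp_le[OF that]] by simp
  have "obs_sum A C a c (%s. Q s om ** gain) (%s. Y s om) T m (kap m) u = ob m om" for m
   unfolding ob_def by (rule obs_sum_cong[OF k, symmetric]) (rule eq)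
  moreover have "euler (%s. A - Q s om ** gain ** C) (T / real m) m u 0 = y0 m om" for m
   unfolding y0_def by (rule euler_grid_cong[where H = "%s. cov_F s om ** gain" and H' = "%s. Q s om ** gain", OF k, symmetric]) (rule eq, auto)
  moreover have "noise_sum A C R1h R2h (%s. Q s om ** gain) (%s. (Wb s om, Vb s om)) T m (kap m) u = no m om" for m
  proof -
   have "noise_coef A C R1h R2h (?H om) T m (kap m) u l = noise_coef A C R1h R2h (%s. Q s om ** gain) T m (kap m) u l" if "l < m * kap m" for l
    by (rule noise_coef_cong[OF k _ that]) (rule eq)
   then show ?thesis unfolding no_def noise_sum_def by (intro sum.cong) auto
  qed
  ultimately have "(%m. ob m om + (y0 m om \<bullet> Xb 0 om + no m om)) \<longlonglongrightarrow> u \<bullet> Xb T om" using elim(1) by simp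
  then show ?case unfolding Z_def by (intro tendsto_intros)
 qed
 then have Zlim: "(%m. expectation (%om. norm (Z m om - iexp (u \<bullet> Xb T om)))) \<longlonglongrightarrow> 0"
  by (intro bounded_AE_convergence_L1[where B = 1]) (auto simp: Z_def)
 \<comment> \<open>Over every set of the observation algebra, \<open>Z m\<close> has the same
   integral as \<open>cond_char\<close> by freezing, and the exponential of the state has the same
   integral as the conditional characteristic function. The distance of the conditional objects is
   therefore at most 4 times that of the random variables.\<close>
 have bound: "expectation (%om. norm (cond_char T m (kap m) u om - char_fun (\<eta> T om) u))
   <= 4 * expectation (%om. norm (Z m om - iexp (u \<bullet> Xb T om)))" for m
 proof (rule L1_by_indicators[where B = 2, OF history_sub[OF T]])
  note [measurable] = cond_char_measurable[OF T k, of m m u] L.char_kernel_measurable[of u]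
  show "(%om. cond_char T m (kap m) u om - char_fun (\<eta> T om) u) \<in> borel_measurable (history M Y T)" by measurable
  have cf: "norm (char_fun (\<eta> T om) u) <= 1" if "om \<in> space M" for om
   by (rule norm_char_fun_le[OF L.kernel_prob(1)[OF that]])
  show "norm (cond_char T m (kap m) u om - char_fun (\<eta> T om) u) <= 2" if "om \<in> space M" for om
   using norm_triangle_ineq4[of "cond_char T m (kap m) u om" "char_fun (\<eta> T om) u"] cf[OF that] cond_char_norm[OF T, of m "kap m" u om] by simp
  have intZ: "integrable M (Z m)" by (rule integrable_const_bound[where B = 1]) (auto simp: Z_def)
  have intX: "integrable M (%om. iexp (u \<bullet> Xb T om))" by (rule integrable_const_bound[where B = 1]) (auto intro!: iexp_measurable)
  show "integrable M (%om. Z m om - iexp (u \<bullet> Xb T om))" using intZ intX by simp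
  fix E assume E: "E \<in> sets (history M Y T)"
  then have EM [measurable]: "E \<in> sets M" by (rule L.F_sets)
  have ccM [measurable]: "cond_char T m (kap m) u \<in> borel_measurable M" by (rule fromF[OF cond_char_measurable[OF T k]])
  have chM [measurable]: "(%om. char_fun (\<eta> T om) u) \<in> borel_measurable M" by (rule fromF[OF L.char_kernel_measurable])
  have icc: "integrable M (cond_char T m (kap m) u)" by (rule integrable_const_bound[where B = 1]) (use cond_char_norm[OF T] in auto)
  have ich: "integrable M (%om. char_fun (\<eta> T om) u)" by (rule integrable_const_bound[where B = 1]) (use cf in auto)
  have ind: "integrable M (%om. indicator E om * f om)" if f: "integrable M f" for f :: "'w => complex"
   using integrable_mult_indicator[OF EM f] by (simp add: indicator_scaleR_eq_if indicator_times_eq_if)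
  have "(CLINT om|M. (indicator E om * iexp (ob m om)) * iexp (y0 m om \<bullet> Xb 0 om + no m om))
   = (CLINT om|M. (indicator E om * iexp (ob m om)) * (iexp (y0 m om \<bullet> m0) * exp (- quad_var P0 A C R1h R2h (?H om) T m (kap m) u / 2)))"
   unfolding no_def noise_sum_def quad_var_def Let_def y0_def[symmetric]
  proof (rule brownian_conditional_char[where B = "%t om. (Wb t om, Vb t om)" and F = "history M Y T"
     and ?tht0.0 = "y0 m" and p = "gridp T m (kap m)" and tht = "%l om. noise_coef A C R1h R2h (?H om) T m (kap m) u l" and ?x0.0 = "Xb 0"])
   show "indep_algebras M (process_algebra M {0} (%_. Xb 0)) (process_algebra M {0..} (%t om. (Wb t om, Vb t om)))"
    by (rule noise_independent[OF T])
   show "indep_algebras M (history M Y T) (process_algebra M {0..} (%t om. ((Wb t om, Vb t om), Xb 0 om)))"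
    by (rule noise_independent[OF T])
   show "gridp T m (kap m) l <= gridp T m (kap m) (Suc l)" for l by (rule gridp_mono[OF T])
   show "(%om. indicator E om * iexp (ob m om)) \<in> borel_measurable (history M Y T)"
    using E by (intro borel_measurable_times borel_measurable_indicator iexp_measurable obm)
   show "norm (indicator E x * iexp (ob m x)) <= 1" for x by (simp add: norm_mult indicator_def)
  qed (auto simp: gridp_def bm x0m history_sub[OF T] x0_char y0m ncm)
  then have 1: "(CLINT om|M. indicator E om * Z m om) = (CLINT om|M. indicator E om * cond_char T m (kap m) u om)"
   by (simp add: Z_def cond_char_def ob_def[symmetric] y0_def[symmetric] exp_add distrib_left mult.assoc)
  have 2: "(CLINT om|M. indicator E om * iexp (u \<bullet> Xb T om)) = (CLINT om|M. indicator E om * char_fun (\<eta> T om) u)"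
   by (rule L.char_disintegration[OF E])
  show "(CLINT om|M. indicator E om * (cond_char T m (kap m) u om - char_fun (\<eta> T om) u)) = (CLINT om|M. indicator E om * (Z m om - iexp (u \<bullet> Xb T om)))"
   unfolding right_diff_distrib
   using ind[OF intZ] ind[OF intX] ind[OF icc] ind[OF ich] 1 2 by simp
 qed
 show ?thesis
 proof (rule tendsto_sandwich[of "%_. 0"])
  show "(%m. 4 * expectation (%om. norm (Z m om - iexp (u \<bullet> Xb T om)))) \<longlonglongrightarrow> 0"
   using tendsto_mult_right_zero[OF Zlim, of 4] by simp
 qed (use bound in auto)
qed

end

context kalman_filter
begin

text \<open>\<open>sig\<close> may still be random. At each level m, \<open>cond_char\<close>
  satisfies the multiplicative identity exactly, because its phase is linear in u; L1 convergence
  passes the identity to the limit along a subsequence, pair by pair for countably many pairs. Only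
  the exponentials converge here, not the phases.\<close>

lemma conditional_gaussian:
 assumes T: "0 <= T"
  and sig: "AE om in M. symmetric_mat (sig om) \<and> (\<forall>kap u. (\<forall>m. 0 < kap m) -->
   (%m. quad_var P0 A C R1h R2h (%s. Q s om ** gain) T m (kap m) u) \<longlonglongrightarrow> u \<bullet> (sig om *v u))"
 shows "AE om in M. cov_matrix (\<eta> T om) = sig om \<and> psd (sig om) \<and>
  (\<forall>u. char_fun (\<eta> T om) u = iexp (u \<bullet> mean_vec (\<eta> T om)) * exp (- (u \<bullet> (sig om *v u)) / 2))"
proof -
 interpret L: conditional_law M "history M Y T" "Xb T" "\<eta> T" by (rule conditional[OF T])
 obtain kap where good: "good_subdivision T kap" using good_subdivisions_exist[OF T] by blast
 have k: "0 < kap m" for m using good by (simp add: good_subdivision_def)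
 obtain D :: "(real^'n) set" where D: "countable D" "closure D = UNIV"
 proof -
  obtain D :: "(real^'n) set" where D: "countable D" "\<And>X. open X ==> X ~= {} ==> \<exists>d\<in>D. d \<in> X"
   by (rule countable_dense_setE) blast
  have "closure D = UNIV"
   using D(2) by (auto simp: closure_iff_nhds_not_empty) (metis IntI empty_iff interior_subset open_interior interior_maximal subset_iff)
  then show ?thesis using D that by blast
 qed
 define \<phi> where "\<phi> u om = char_fun (\<eta> T om) u" for u om
 note fromF = measurable_from_subalg[OF history_sub[OF T]]
 have \<phi>m: "\<phi> u \<in> borel_measurable M" for u unfolding \<phi>_def[abs_def] by (rule fromF[OF L.char_kernel_measurable])
 have cm: "cond_char T m (kap m) u \<in> borel_measurable M" for m u by (rule fromF[OF cond_char_measurable[OF T k]])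
 define g where "g m u om = norm (cond_char T m (kap m) u om - \<phi> u om)" for m u om
 have gm: "g m u \<in> borel_measurable M" for m u
  unfolding g_def[abs_def] using cm[of m u] \<phi>m[of u] by measurable
 have \<phi>b: "norm (\<phi> u om) <= 1" if "om \<in> space M" for u om
  unfolding \<phi>_def by (rule norm_char_fun_le[OF L.kernel_prob(1)[OF that]])
 have gi: "integrable M (g m u)" for m u
 proof (rule integrable_const_bound[where B = 2])
  show "AE om in M. norm (g m u om) <= 2"
   using AE_space
  proof eventually_elim
   case (elim om)
   show ?case using norm_triangle_ineq4[of "cond_char T m (kap m) u om" "\<phi> u om"] \<phi>b[OF elim, of u] cond_char_norm[OF T, of m "kap m" u om]
    by (simp add: g_def)
  qed
 qed (rule gm)
 have glim: "(%m. expectation (g m u)) \<longlonglongrightarrow> 0" for u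
  using cond_char_converges[OF T good, of u] by (simp add: g_def[abs_def] \<phi>_def)
 have mult: "AE om in M. \<phi> (u + v) om * exp (- (u \<bullet> (sig om *v u) + v \<bullet> (sig om *v v)) / 2)
    = \<phi> u om * \<phi> v om * exp (- ((u + v) \<bullet> (sig om *v (u + v))) / 2)" for u v
 proof -
  \<comment> \<open>Adding the three errors gives one subsequence that serves \<open>u\<close>,
    \<open>v\<close> and \<open>u + v\<close>.\<close>
  define f where "f m om = g m u om + (g m v om + g m (u + v) om)" for m om
  have fi: "integrable M (f m)" for m unfolding f_def[abs_def] using gi by simp
  have "(%m. expectation (g m u) + (expectation (g m v) + expectation (g m (u + v)))) \<longlonglongrightarrow> 0 + (0 + 0)"
   by (intro tendsto_intros glim)
  moreover have "expectation (%om. norm (f m om)) = expectation (g m u) + (expectation (g m v) + expectation (g m (u + v)))" for m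
  proof -
   have "norm (f m om) = g m u om + (g m v om + g m (u + v) om)" for om by (simp add: f_def g_def)
   then show ?thesis using gi by simp
  qed
  ultimately have "(%m. expectation (%om. norm (f m om))) \<longlonglongrightarrow> 0" by simp
  from tendsto_L1_AE_subseq[OF fi this] obtain r where r: "strict_mono r" "AE om in M. (%n. f (r n) om) \<longlonglongrightarrow> 0" by blast
  from r(2) sig cov_F_grid[OF T] show ?thesis
  proof eventually_elim
   case (elim om)
   define V where "V m w = quad_var P0 A C R1h R2h (%s. cov_F s om ** gain) T m (kap m) w" for m w
   have eq: "cov_F (gridp T m (kap m) l) om ** gain = Q (gridp T m (kap m) l) om ** gain" if "l < m * kap m" for m l
    using elim(3)[rule_format, OF less_imp_le[OF that]] by simp
   have VQ: "V m w = quad_var P0 A C R1h R2h (%s. Q s om ** gain) T m (kap m) w" for m w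
    unfolding V_def by (rule quad_var_cong[OF k]) (rule eq)
   have "(%m. V m w) \<longlonglongrightarrow> w \<bullet> (sig om *v w)" for w unfolding VQ using elim(2) k by blast
   then have Vl: "(%n. V (r n) w) \<longlonglongrightarrow> w \<bullet> (sig om *v w)" for w
    using LIMSEQ_subseq_LIMSEQ[OF _ r(1)] by (auto simp: o_def)
   have cl: "(%n. cond_char T (r n) (kap (r n)) w om) \<longlonglongrightarrow> \<phi> w om" if w: "w \<in> {u, v, u + v}" for w
   proof -
    have "(%n. norm (cond_char T (r n) (kap (r n)) w om - \<phi> w om)) \<longlonglongrightarrow> 0"
    proof (rule tendsto_sandwich[OF _ _ tendsto_const elim(1)])
     show "\<forall>\<^sub>F n in sequentially. norm (cond_char T (r n) (kap (r n)) w om - \<phi> w om) <= f (r n) om"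
      using w by (auto simp: f_def g_def intro!: always_eventually)
    qed simp
    then show ?thesis by (rule LIM_zero_cancel[OF tendsto_norm_zero_cancel])
   qed
   have id: "cond_char T m (kap m) (u + v) om * exp (- (V m u + V m v) / 2) = cond_char T m (kap m) u om * cond_char T m (kap m) v om * exp (- V m (u + v) / 2)" for m
   proof -
    have e: "complex_of_real (exp (- (V m u + V m v) / 2)) = complex_of_real (exp (- V m u / 2)) * complex_of_real (exp (- V m v / 2))"
     by (rule exp_half_add[symmetric])
    show ?thesis
     unfolding cond_char_def V_def[symmetric] e obs_sum_add[OF k] euler_add[OF le0]
     by (simp add: inner_add_left distrib_left exp_add)
   qed
   have l1: "(%n. cond_char T (r n) (kap (r n)) (u + v) om * complex_of_real (exp (- (V (r n) u + V (r n) v) / 2)))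
     \<longlonglongrightarrow> \<phi> (u + v) om * complex_of_real (exp (- (u \<bullet> (sig om *v u) + v \<bullet> (sig om *v v)) / 2))"
    by (intro tendsto_intros cl Vl) auto
   have l2: "(%n. cond_char T (r n) (kap (r n)) u om * cond_char T (r n) (kap (r n)) v om * complex_of_real (exp (- V (r n) (u + v) / 2)))
     \<longlonglongrightarrow> \<phi> u om * \<phi> v om * complex_of_real (exp (- ((u + v) \<bullet> (sig om *v (u + v))) / 2))"
    by (intro tendsto_intros cl Vl) auto
   show ?case by (rule LIMSEQ_unique[OF l1]) (unfold id, rule l2)
  qed
 qed
 have "AE om in M. \<forall>u\<in>D. \<forall>v\<in>D. \<phi> (u + v) om * exp (- (u \<bullet> (sig om *v u) + v \<bullet> (sig om *v v)) / 2)
    = \<phi> u om * \<phi> v om * exp (- ((u + v) \<bullet> (sig om *v (u + v))) / 2)"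
  by (intro AE_ball_countable' D(1) mult)
 with AE_square_integrable[OF T] sig AE_space show ?thesis
 proof eventually_elim
  case (elim om)
  note g = gaussian_from_multiplicative_char[OF L.kernel_prob(1)[OF elim(3)] L.kernel_prob(2)[OF elim(3)] elim(1) elim(2)[THEN conjunct1] D(2)]
  have m: "\<And>u v. u \<in> D ==> v \<in> D ==> char_fun (\<eta> T om) (u + v) * exp (- (u \<bullet> (sig om *v u) + v \<bullet> (sig om *v v)) / 2)
    = char_fun (\<eta> T om) u * char_fun (\<eta> T om) v * exp (- ((u + v) \<bullet> (sig om *v (u + v))) / 2)"
   using elim(4) unfolding \<phi>_def by blast
  show ?case using g[OF m] by blast
 qed
qed

text \<open>Closes the loop: along each path \<open>sig\<close> solves the linear Lyapunov equation
  whose gain is built from \<open>Q\<close>; Gaussianity identifies \<open>sig\<close> with the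
  conditional covariance, that is, with \<open>Q\<close> itself. The linear equation for
  \<open>sig\<close> then becomes the Riccati equation for \<open>Q\<close>, and uniqueness makes
  almost all paths agree.\<close>

lemma covariance_riccati:
 assumes rs: "riccati_stable A info (R1h ** R1h) P \<mu> r"
 shows "\<exists>Pt. riccati_stable.sol A info (R1h ** R1h) P0 Pt \<and>
  (\<forall>t\<ge>0. AE om in M. Q t om = Pt t \<and> cov_matrix (\<eta> t om) = Pt t \<and>
   (\<forall>u. char_fun (\<eta> t om) u = iexp (u \<bullet> mean_vec (\<eta> t om)) * exp (- (u \<bullet> (Pt t *v u)) / 2)))"
proof -
 interpret RS: riccati_stable A info "R1h ** R1h" P \<mu> r by fact
 define G where "G om s = R1h ** R1h + (Q s om ** gain) ** (R2h ** R2h) ** transpose (Q s om ** gain)" for om s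
 define B where "B om s = A - Q s om ** gain ** C" for om s
 have R1: "transpose R1h = R1h" using sym1 by (simp add: symmetric_mat_def)
 have Gsym: "symmetric_mat (G om s)" for om s
  using R2_symmetric by (simp add: symmetric_mat_def G_def transpose_linear matrix_transpose_mul matrix_mul_assoc R1)
 have P0sym: "symmetric_mat P0" using P0 by (simp add: psd_def)
 have "\<exists>sig. sig 0 = P0 \<and> (\<forall>s. symmetric_mat (sig s)) \<and>
   (\<forall>s\<in>{0..real N}. (sig has_vector_derivative (B om s ** sig s + sig s ** transpose (B om s) + G om s)) (at s within {0..real N}))"
  if "om \<in> space M" for om and N :: nat
 proof (rule lyapunov_exists[OF _ _ _ Gsym P0sym])
  show "continuous_on {0..real N} (B om)" "continuous_on {0..real N} (G om)"
   unfolding B_def[abs_def] G_def[abs_def] by (intro continuous_intros gain_continuous that)+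
 qed simp
 then obtain sig where sig: "\<And>om N. om \<in> space M ==> sig om N 0 = P0" "\<And>om N s. om \<in> space M ==> symmetric_mat (sig om N s)"
  "\<And>om N s. om \<in> space M ==> s \<in> {0..real N} ==>
   (sig om N has_vector_derivative (B om s ** sig om N s + sig om N s ** transpose (B om s) + G om s)) (at s within {0..real N})"
  by metis
 have gauss: "AE om in M. cov_matrix (\<eta> t om) = sig om N t \<and> psd (sig om N t) \<and>
  (\<forall>u. char_fun (\<eta> t om) u = iexp (u \<bullet> mean_vec (\<eta> t om)) * exp (- (u \<bullet> (sig om N t *v u)) / 2))" if t: "0 <= t" "t <= real N" for t N
 proof (rule conditional_gaussian[OF t(1)], rule AE_I2, intro conjI allI impI)
  fix om assume w: "om \<in> space M"
  show "symmetric_mat (sig om N t)" by (rule sig(2)[OF w])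
  fix kap :: "nat => nat" and u assume k: "\<forall>m. 0 < kap m"
  show "(%m. quad_var P0 A C R1h R2h (%s. Q s om ** gain) t m (kap m) u) \<longlonglongrightarrow> u \<bullet> (sig om N t *v u)"
  proof (rule quad_var_converges[where H = "%s. Q s om ** gain" and sig = "sig om N" and T = t and ?P0.0 = P0 and k = kap and A = A and C = C, OF t(1) gain_continuous[OF w] sym1 sym2 _ sig(1)[OF w]])
   fix s assume s: "s \<in> {0..t}"
   then have "s \<in> {0..real N}" using t by simp
   from sig(3)[OF w this] show "(sig om N has_vector_derivative ((A - Q s om ** gain ** C) ** sig om N s + sig om N s ** transpose (A - Q s om ** gain ** C)
    + (R1h ** R1h + (Q s om ** gain) ** (R2h ** R2h) ** transpose (Q s om ** gain)))) (at s within {0..t})"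
    unfolding B_def G_def by (rule has_vector_derivative_within_subset) (use t in auto)
  qed (use k in auto)
 qed
 \<comment> \<open>One null set for all rational times and all horizons \<open>N\<close>; continuity
   of both sides extends the identity to all times.\<close>
 have "AE om in M. \<forall>q\<in>\<rat>. \<forall>N::nat. 0 <= q \<and> q <= real N --> Q q om = sig om N q \<and> psd (sig om N q)"
 proof (rule AE_ball_countable', unfold AE_all_countable, intro allI)
  fix q :: real and N :: nat
  show "AE om in M. 0 <= q \<and> q <= real N --> Q q om = sig om N q \<and> psd (sig om N q)"
  proof (cases "0 <= q \<and> q <= real N")
   case True
   with gauss[of q N] Q_eq[of q] show ?thesis by auto
  next
   case False
   then show ?thesis by (intro AE_I2) auto
  qed
 qed (rule countable_rat)
 then have solAE: "AE om in M. RS.sol P0 (%t. Q t om)"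
  using AE_space
 proof eventually_elim
  case (elim om)
  note w = elim(2)
  have rat: "Q q om = sig om N q" "psd (Q q om)" if "q \<in> \<rat>" "0 <= q" "q <= real N" for q N
   using elim(1) that by auto
  have dense: "closure ({0..real N} \<inter> \<rat>) = {0..real N}" if "0 < N" for N
   using closure_convex_Int_superset[of "{0..real N}" \<rat>] that Rats_closure_real by simp
  have eqN: "Q s om = sig om N s" if s: "s \<in> {0..real N}" and N: "0 < N" for s N
  proof -
   have csig: "continuous_on {0..real N} (sig om N)"
    using sig(3)[OF w] by (meson continuous_on_eq_continuous_within has_vector_derivative_continuous)
   have cQ: "continuous_on {0..real N} (%s. Q s om)" by (rule continuous_on_subset[OF Q_continuous[OF w]]) auto
   have "Q s om - sig om N s = 0"
    by (rule continuous_constant_on_closure[where S = "{0..real N} \<inter> \<rat>" and f = "%s. Q s om - sig om N s"])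
     (use rat s in \<open>auto simp: dense[OF N] intro!: continuous_intros csig cQ\<close>)
   then show ?thesis by simp
  qed
  have Qsym: "symmetric_mat (Q s om)" if "0 <= s" for s
  proof -
   obtain N :: nat where N: "s < real N" using reals_Archimedean2 by blast
   then have "Q s om = sig om N s" using that by (intro eqN) auto
   then show ?thesis using sig(2)[OF w] by simp
  qed
  show "RS.sol P0 (%t. Q t om)"
   unfolding RS.sol_def
  proof (intro conjI allI impI)
   show "Q 0 om = P0" using eqN[of 0 1] sig(1)[OF w, of 1] by simp
  next
   fix t :: real assume t: "0 <= t"
   obtain N :: nat where N: "t < real N" using reals_Archimedean2 by blast
   then have N0: "0 < N" using t by (cases N) auto
   show "psd (Q t om)"
    unfolding psd_def
   proof (intro conjI allI)
    show "symmetric_mat (Q t om)" by (rule Qsym[OF t])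
    fix x
    have cQ: "continuous_on {0..real N} (%s. x \<bullet> (Q s om *v x))"
     by (intro continuous_intros continuous_on_subset[OF Q_continuous[OF w]]) auto
    show "0 <= x \<bullet> (Q t om *v x)"
     by (rule continuous_ge_on_closure[where S = "{0..real N} \<inter> \<rat>" and f = "%s. x \<bullet> (Q s om *v x)"])
      (use rat(2) t N cQ in \<open>auto simp: dense[OF N0] psd_def\<close>)
   qed
   have st: "transpose (Q t om) = Q t om" "transpose info = info"
    using Qsym[OF t] info_symmetric by (auto simp: symmetric_mat_def)
   have field: "B om t ** Q t om + Q t om ** transpose (B om t) + G om t = riccati_field A info (R1h ** R1h) (Q t om)"
   proof -
    have b: "B om t = A - Q t om ** info" by (simp add: B_def matrix_mul_assoc[symmetric] gain_C)
    have g: "G om t = R1h ** R1h + Q t om ** info ** Q t om" by (simp only: G_def gain_quadratic st)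
    show ?thesis unfolding b g riccati_field_def
     by (simp add: matrix_mult_linear transpose_linear matrix_transpose_mul st matrix_mul_assoc)
   qed
   have tN: "t \<in> {0..real N}" using t N by simp
   have "(sig om N has_vector_derivative (B om t ** Q t om + Q t om ** transpose (B om t) + G om t)) (at t within {0..real N})"
    using sig(3)[OF w tN] eqN[OF tN N0] by simp
   then have "((%s. Q s om) has_vector_derivative riccati_field A info (R1h ** R1h) (Q t om)) (at t within {0..real N})"
    unfolding field by (rule has_vector_derivative_transform[OF tN, rotated]) (use eqN N0 in auto)
   moreover have "at t within {0..real N} = at t within {0..}"
    by (rule at_within_nhd[of _ "{..<real N}"]) (use N in auto)
   ultimately show "((%t. Q t om) has_vector_derivative riccati_field A info (R1h ** R1h) (Q t om)) (at t within {0..})" by simp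
  qed
 qed
 \<comment> \<open>Any single path on which \<open>Q\<close> solves the Riccati equation represents
   the deterministic solution.\<close>
 then obtain om0 where om0: "RS.sol P0 (%t. Q t om0)"
  using eventually_happens[OF solAE] ae_filter_eq_bot_iff emeasure_space_1 by fastforce
 show ?thesis
 proof (intro exI conjI allI impI)
  show "RS.sol P0 (%t. Q t om0)" by fact
  fix t :: real assume t: "0 <= t"
  obtain N :: nat where N: "t < real N" using reals_Archimedean2 by blast
  from gauss[OF t less_imp_le[OF N]] Q_eq[OF t] solAE
  show "AE om in M. Q t om = Q t om0 \<and> cov_matrix (\<eta> t om) = Q t om0 \<and>
   (\<forall>u. char_fun (\<eta> t om) u = iexp (u \<bullet> mean_vec (\<eta> t om)) * exp (- (u \<bullet> (Q t om0 *v u)) / 2))"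
  proof eventually_elim
   case (elim om)
   have "Q t om = Q t om0" using RS.sol_unique[OF elim(3) om0 t] .
   then show ?case using elim by simp
  qed
 qed
qed

lemma mean_vec_measurable:
 assumes "0 <= t"
 shows "(%om. mean_vec (\<eta> t om)) \<in> borel_measurable (history M Y t)"
proof -
 interpret L: conditional_law M "history M Y t" "Xb t" "\<eta> t" by (rule conditional[OF assms])
 show ?thesis
 proof (subst borel_measurable_euclidean_space, intro ballI)
  fix b :: "real^'n" assume "b \<in> Basis"
  then obtain i where "b = axis i 1" by (auto simp: Basis_vec_def)
  then show "(%om. mean_vec (\<eta> t om) \<bullet> b) \<in> borel_measurable (history M Y t)"
   by (auto simp: mean_vec_def inner_axis intro!: L.integral_measurable_F)
 qed
qed

text \<open>With a deterministic covariance the Gaussian factor of \<open>cond_char\<close> is a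
  number. Removing it leaves the phase, whose exponential converges in L1 to that of the conditional
  mean; the phase itself is controlled only modulo 2 pi.\<close>

lemma mean_approximation:
 assumes rs: "riccati_stable A info (R1h ** R1h) P \<mu> r"
  and Pt: "riccati_stable.sol A info (R1h ** R1h) P0 Pt" "\<And>t. 0 <= t ==> AE om in M. Q t om = Pt t"
  and T: "0 <= T" and good: "good_subdivision T kap"
  and char: "AE om in M. char_fun (\<eta> T om) u = iexp (u \<bullet> mean_vec (\<eta> T om)) * exp (- (u \<bullet> (Pt T *v u)) / 2)"
 shows "(%m. expectation (%om. norm (iexp (obs_sum A C a c (%s. Pt s ** gain) (%s. Y s om) T m (kap m) u
   + euler (%s. A - Pt s ** gain ** C) (T / real m) m u 0 \<bullet> m0) - iexp (u \<bullet> mean_vec (\<eta> T om))))) \<longlonglongrightarrow> 0"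
proof -
 interpret RS: riccati_stable A info "R1h ** R1h" P \<mu> r by fact
 interpret L: conditional_law M "history M Y T" "Xb T" "\<eta> T" by (rule conditional[OF T])
 have k: "0 < kap m" for m using good by (simp add: good_subdivision_def)
 note fromF = measurable_from_subalg[OF history_sub[OF T]]
 define V where "V m = quad_var P0 A C R1h R2h (%s. Pt s ** gain) T m (kap m) u" for m
 define v where "v = u \<bullet> (Pt T *v u)"
 define \<Phi> where "\<Phi> m om = iexp (obs_sum A C a c (%s. Pt s ** gain) (%s. Y s om) T m (kap m) u
   + euler (%s. A - Pt s ** gain ** C) (T / real m) m u 0 \<bullet> m0)" for m om
 define \<Psi> where "\<Psi> om = iexp (u \<bullet> mean_vec (\<eta> T om))" for om
 define g where "g m om = norm (cond_char T m (kap m) u om - char_fun (\<eta> T om) u)" for m om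
 have Vl: "V \<longlonglongrightarrow> v"
  unfolding V_def v_def
 proof (rule quad_var_converges[where H = "%s. Pt s ** gain" and sig = Pt and T = T and ?P0.0 = P0 and k = kap and A = A and C = C, OF T _ sym1 sym2 _ RS.sol_0[OF Pt(1)]])
  show "continuous_on {0..T} (%s. Pt s ** gain)" by (intro continuous_intros RS.sol_continuous[OF Pt(1)]) auto
  fix s assume s: "s \<in> {0..T}"
  have st: "transpose (Pt s) = Pt s" "transpose info = info"
   using RS.sol_sym[OF Pt(1), of s] s info_symmetric by (auto simp: symmetric_mat_def)
  have b: "A - Pt s ** gain ** C = A - Pt s ** info" by (simp add: matrix_mul_assoc[symmetric] gain_C)
  have g: "(Pt s ** gain) ** (R2h ** R2h) ** transpose (Pt s ** gain) = Pt s ** info ** Pt s" by (simp only: gain_quadratic st)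
  have "(A - Pt s ** gain ** C) ** Pt s + Pt s ** transpose (A - Pt s ** gain ** C) + (R1h ** R1h + (Pt s ** gain) ** (R2h ** R2h) ** transpose (Pt s ** gain))
   = riccati_field A info (R1h ** R1h) (Pt s)"
   unfolding b g riccati_field_def
   by (simp add: matrix_mult_linear transpose_linear matrix_transpose_mul st matrix_mul_assoc)
  then show "(Pt has_vector_derivative (A - Pt s ** gain ** C) ** Pt s + Pt s ** transpose (A - Pt s ** gain ** C) + (R1h ** R1h + (Pt s ** gain) ** (R2h ** R2h) ** transpose (Pt s ** gain))) (at s within {0..T})"
   using RS.sol_deriv[OF Pt(1) s] by simp
 qed (rule k)
 have \<Phi>m [measurable]: "\<Phi> m \<in> borel_measurable M" for m
 proof -
  have [measurable]: "(%om. obs_sum A C a c (%s. Pt s ** gain) (%s. Y s om) T m (kap m) u) \<in> borel_measurable M"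
   by (rule obs_sum_measurable[where H = "%s _. Pt s ** gain", OF _ T k]) (auto intro: Y_measurable)
  show ?thesis unfolding \<Phi>_def[abs_def] by measurable
 qed
 have [measurable]: "(%om. mean_vec (\<eta> T om)) \<in> borel_measurable M" by (rule fromF[OF mean_vec_measurable[OF T]])
 have \<Psi>m [measurable]: "\<Psi> \<in> borel_measurable M" unfolding \<Psi>_def[abs_def] by measurable
 have cm: "cond_char T m (kap m) u \<in> borel_measurable M" for m by (rule fromF[OF cond_char_measurable[OF T k]])
 have \<phi>m: "(%om. char_fun (\<eta> T om) u) \<in> borel_measurable M" by (rule fromF[OF L.char_kernel_measurable])
 have gm [measurable]: "g m \<in> borel_measurable M" for m
  unfolding g_def[abs_def] using cm[of m] \<phi>m by measurable
 have grid: "AE om in M. \<forall>m k l. l <= m * k --> cov_F (gridp T m k l) om = Pt (gridp T m k l)"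
 proof (rule AE_grid[OF T])
  fix t :: real assume t: "0 <= t"
  from cov_F_eq[OF t] Q_eq[OF t] Pt(2)[OF t] show "AE om in M. cov_F t om = Pt t" by eventually_elim simp
 qed
 \<comment> \<open>Cost of the mismatch between the limit variance \<open>v\<close> and its discrete
   version \<open>V m\<close>.\<close>
 define e where "e m = \<bar>exp ((V m - v) / 2) - 1\<bar>" for m
 have bound: "AE om in M. norm (\<Phi> m om - \<Psi> om) <= exp (V m / 2) * g m om + e m" for m
  using grid char
 proof eventually_elim
  case (elim om)
  have eq: "cov_F (gridp T m (kap m) l) om ** gain = Pt (gridp T m (kap m) l) ** gain" if "l < m * kap m" for l
   using elim(1)[rule_format, OF less_imp_le[OF that]] by simp
  have 1: "cond_char T m (kap m) u om = \<Phi> m om * exp (- V m / 2)"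
  proof -
   have "obs_sum A C a c (%s. cov_F s om ** gain) (%s. Y s om) T m (kap m) u = obs_sum A C a c (%s. Pt s ** gain) (%s. Y s om) T m (kap m) u"
    by (rule obs_sum_cong[OF k]) (rule eq)
   moreover have "euler (%s. A - cov_F s om ** gain ** C) (T / real m) m u 0 = euler (%s. A - Pt s ** gain ** C) (T / real m) m u 0"
    by (rule euler_grid_cong[where H = "%s. cov_F s om ** gain" and H' = "%s. Pt s ** gain", OF k]) (rule eq, auto)
   moreover have "quad_var P0 A C R1h R2h (%s. cov_F s om ** gain) T m (kap m) u = V m"
    unfolding V_def by (rule quad_var_cong[OF k]) (rule eq)
   ultimately show ?thesis by (simp add: cond_char_def \<Phi>_def)
  qed
  have 2: "char_fun (\<eta> T om) u = \<Psi> om * exp (- v / 2)" using elim(2) by (simp add: \<Psi>_def v_def)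
  have e1: "exp (V m / 2) * exp (- V m / 2) = 1" "exp (V m / 2) * exp (- v / 2) = exp ((V m - v) / 2)"
   by (simp_all add: exp_add[symmetric] diff_divide_distrib)
  have "\<Phi> m om - \<Psi> om = complex_of_real (exp (V m / 2)) * (\<Phi> m om * exp (- V m / 2) - \<Psi> om * exp (- v / 2)) + \<Psi> om * complex_of_real (exp ((V m - v) / 2) - 1)"
  proof -
   have "complex_of_real (exp (V m / 2)) * (\<Phi> m om * exp (- V m / 2) - \<Psi> om * exp (- v / 2))
    = \<Phi> m om * complex_of_real (exp (V m / 2) * exp (- V m / 2)) - \<Psi> om * complex_of_real (exp (V m / 2) * exp (- v / 2))"
    by (simp only: of_real_mult) (simp only: right_diff_distrib ac_simps)
   then show ?thesis unfolding e1 by (simp add: right_diff_distrib)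
  qed
  also have "norm \<dots> <= exp (V m / 2) * g m om + e m"
   unfolding g_def 1 2 e_def
   by (rule norm_triangle_le) (simp add: norm_mult \<Psi>_def del: of_real_diff)
  finally show ?case .
 qed
 have gb: "norm (g m om) <= 2" if "om \<in> space M" for m om
  using norm_triangle_ineq4[of "cond_char T m (kap m) u om" "char_fun (\<eta> T om) u"] cond_char_norm[OF T, of m "kap m" u om]
   norm_char_fun_le[OF L.kernel_prob(1)[OF that], of u] by (simp add: g_def)
 have gi: "integrable M (g m)" for m
  by (rule integrable_const_bound[where B = 2]) (use gb in auto)
 have db: "norm (norm (\<Phi> m om - \<Psi> om)) <= 2" for m om
  using norm_triangle_ineq4[of "\<Phi> m om" "\<Psi> om"] by (simp add: \<Phi>_def \<Psi>_def)
 have le: "expectation (%om. norm (\<Phi> m om - \<Psi> om)) <= exp (V m / 2) * expectation (g m) + e m" for m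
 proof -
  have "expectation (%om. norm (\<Phi> m om - \<Psi> om)) <= expectation (%om. exp (V m / 2) * g m om + e m)"
  proof (rule integral_mono_AE[OF _ _ bound])
   show "integrable M (%om. norm (\<Phi> m om - \<Psi> om))"
    by (rule integrable_const_bound[where B = 2]) (use db in auto)
   show "integrable M (%om. exp (V m / 2) * g m om + e m)" using gi by simp
  qed
  also have "\<dots> = exp (V m / 2) * expectation (g m) + e m" using gi by (simp add: prob_space)
  finally show ?thesis .
 qed
 have "(%m. exp (V m / 2) * expectation (g m) + e m) \<longlonglongrightarrow> exp (v / 2) * 0 + \<bar>exp ((v - v) / 2) - 1\<bar>"
  unfolding e_def g_def by (intro tendsto_intros Vl cond_char_converges[OF T good]) auto
 then have lim: "(%m. exp (V m / 2) * expectation (g m) + e m) \<longlonglongrightarrow> 0" by simp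
 have "(%m. expectation (%om. norm (\<Phi> m om - \<Psi> om))) \<longlonglongrightarrow> 0"
  by (rule tendsto_sandwich[OF _ _ tendsto_const lim]) (use le in auto)
 then show ?thesis unfolding \<Phi>_def \<Psi>_def .
qed

end

section \<open>Comparison of two filters\<close>

text \<open>\<open>flow_difference\<close> carried over to the Euler schemes with constants
  independent of the grid, and to the noise coefficients, where a difference of weights meets a
  difference of gains. The summand \<open>eps\<close> makes room for the discretisation error and is
  later sent to 0.\<close>

lemma (in riccati_stable) scheme_difference:
 fixes C :: "real^'n^'m" and Gam :: "real^'m^'n" and R1h :: "real^'n^'n" and R2h :: "real^'m^'m"
 assumes S: "Gam ** C = S"
 shows "\<exists>c>0. \<forall>Q Q' T u eps. sol P0 Q --> sol P0' Q' --> 0 <= T --> u ~= 0 --> 0 < eps -->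
  (\<exists>m0. \<forall>m\<ge>m0. \<forall>k>0.
   norm (euler (%s. A - Q s ** Gam ** C) (T / real m) m u 0 - euler (%s. A - Q' s ** Gam ** C) (T / real m) m u 0)
    <= c * exp (\<mu> * T) * norm u * (norm (P0 - P0') + eps) \<and>
   norm (euler (%s. A - Q' s ** Gam ** C) (T / real m) m u 0) <= c * exp (\<mu> * T) * norm u \<and>
   (\<forall>l<m * k. norm (noise_coef A C R1h R2h (%s. Q s ** Gam) T m k u l - noise_coef A C R1h R2h (%s. Q' s ** Gam) T m k u l)
    <= c * exp (\<mu> * T) * norm u * (norm (P0 - P0') + eps)))"
proof -
 obtain K1 where K1: "0 < K1" "\<And>Q Q' T u y y' s. sol P0 Q ==> sol P0' Q' ==> adjoint_flow (clm Q) T u y ==>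
  adjoint_flow (clm Q') T u y' ==> 0 <= s ==> s <= T ==> norm (y s - y' s) <= K1 * exp (\<mu> * T) * norm (P0 - P0') * norm u"
  using flow_difference by metis
 obtain K2 where K2: "0 < K2" "\<And>Q T u y s. sol P0 Q ==> adjoint_flow (clm Q) T u y ==> 0 <= s ==> s <= T ==>
  norm (y s) <= K2 * exp (\<mu> * (T - s)) * norm u" using flow_decay by metis
 obtain K2' where K2': "0 < K2'" "\<And>Q T u y s. sol P0' Q ==> adjoint_flow (clm Q) T u y ==> 0 <= s ==> s <= T ==>
  norm (y s) <= K2' * exp (\<mu> * (T - s)) * norm u" using flow_decay by metis
 obtain K3 where K3: "0 < K3" "\<And>Q Q' t. sol P0 Q ==> sol P0' Q' ==> 0 <= t ==>
  norm (Q t - Q' t) <= K3 * exp (2 * \<mu> * t) * norm (P0 - P0')" using sol_difference by metis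
 obtain Lam where Lam: "0 < Lam" "\<And>Q t. sol P0' Q ==> 0 <= t ==> norm (Q t) <= Lam" using sol_bounded by metis
 define cy where "cy = K1 + 2"
 define cn where "cn = norm R1h * cy + norm R2h * (norm Gam * K3 * (K2 + 1) * exp (- \<mu>) + Lam * norm Gam * cy)"
 define c where "c = cy + (K2' + 1) + cn"
 have pos: "0 < cy" "0 <= cn" using K1 K2 K3 Lam by (auto simp: cy_def cn_def)
 have c: "0 < c" "cy <= c" "K2' + 1 <= c" "cn <= c" using pos K2'(1) by (auto simp: c_def)
 show ?thesis
 proof (intro exI[of _ c] conjI c(1) allI impI)
  fix Q Q' and T :: real and u :: "real^'n" and eps :: real
  assume sol: "sol P0 Q" "sol P0' Q'" and T: "0 <= T" and u: "u ~= 0" and eps: "0 < eps"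
  define dl where "dl = norm (P0 - P0')"
  define z where "z = exp (\<mu> * T) * norm u"
  have z: "0 < z" using u by (simp add: z_def)
  \<comment> \<open>The Euler error has to be dominated by \<open>z\<close> in the plain bounds and
    by z (dl + eps) in the bounds for differences; \<open>eps\<close> keeps it positive when the
    initial matrices coincide.\<close>
  define e where "e = z * min 1 (dl + eps)"
  have dl: "0 <= dl" by (simp add: dl_def)
  have e: "0 < e" "e <= z" "e <= z * (dl + eps)" using z dl eps by (auto simp: e_def min_def mult_left_le)
  have B: "(%s. A - Q s ** Gam ** C) = clm Q" "(%s. A - Q' s ** Gam ** C) = clm Q'"
   by (simp_all add: matrix_mul_assoc[symmetric] S)
  have cont: "continuous_on {0..T} (clm Q)" "continuous_on {0..T} (clm Q')"
   by (intro continuous_intros sol_continuous[OF sol(1)] sol_continuous[OF sol(2)]; simp)+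
  obtain y where y: "adjoint_flow (clm Q) T u y" using adjoint_flow_exists[OF cont(1) T] by blast
  obtain y' where y': "adjoint_flow (clm Q') T u y'" using adjoint_flow_exists[OF cont(2) T] by blast
  obtain m1 where m1: "0 < m1" "\<And>m i. m1 <= m ==> i <= m ==> norm (euler (clm Q) (T / real m) m u i - y (real i * (T / real m))) <= e"
   using euler_converges[OF y cont(1) T e(1)] by blast
  obtain m2 where m2: "0 < m2" "\<And>m i. m2 <= m ==> i <= m ==> norm (euler (clm Q') (T / real m) m u i - y' (real i * (T / real m))) <= e"
   using euler_converges[OF y' cont(2) T e(1)] by blast
  \<comment> \<open>Ensures a coarse mesh of at most 1, used where the weight at the right end of a
    block is multiplied by a gain inside the block.\<close>
  obtain m3 :: nat where m3: "T <= real m3" using real_arch_simple by blast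
  show "\<exists>m0. \<forall>m\<ge>m0. \<forall>k>0.
   norm (euler (%s. A - Q s ** Gam ** C) (T / real m) m u 0 - euler (%s. A - Q' s ** Gam ** C) (T / real m) m u 0)
    <= c * exp (\<mu> * T) * norm u * (norm (P0 - P0') + eps) \<and>
   norm (euler (%s. A - Q' s ** Gam ** C) (T / real m) m u 0) <= c * exp (\<mu> * T) * norm u \<and>
   (\<forall>l<m * k. norm (noise_coef A C R1h R2h (%s. Q s ** Gam) T m k u l - noise_coef A C R1h R2h (%s. Q' s ** Gam) T m k u l)
    <= c * exp (\<mu> * T) * norm u * (norm (P0 - P0') + eps))"
  proof (intro exI[of _ "max m1 (max m2 m3)"] allI impI)
   fix m k :: nat assume m: "max m1 (max m2 m3) <= m" and k: "0 < k"
   have mm: "m1 <= m" "m2 <= m" "m3 <= m" "0 < m" using m m1(1) by auto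
   define d where "d = T / real m"
   have d: "0 <= d" "d <= 1"
   proof -
    have "T <= real m" using m3 mm(3) by (meson of_nat_le_iff order_trans)
    then show "d <= 1" using mm(4) by (simp add: d_def)
   qed (use T in \<open>simp add: d_def\<close>)
   define Y Y' where "Y = euler (clm Q) d m u" and "Y' = euler (clm Q') d m u"
   have q: "0 <= real i * d" "real i * d <= T" if "i <= m" for i
    using coarse_bounds[OF T that] by (simp_all add: d_def)
   have dY: "norm (Y i - Y' i) <= cy * z * (dl + eps)" if i: "i <= m" for i
   proof -
    have "norm (Y i - Y' i) <= norm (Y i - y (real i * d)) + norm (y (real i * d) - y' (real i * d)) + norm (Y' i - y' (real i * d))"
     using norm_triangle_ineq4[of "Y i - y (real i * d) + (y (real i * d) - y' (real i * d))" "Y' i - y' (real i * d)"]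
      norm_triangle_ineq[of "Y i - y (real i * d)" "y (real i * d) - y' (real i * d)"] by (simp add: algebra_simps)
    also have "\<dots> <= e + K1 * exp (\<mu> * T) * norm (P0 - P0') * norm u + e"
     using m1(2)[OF mm(1) i] m2(2)[OF mm(2) i] K1(2)[OF sol y y' q[OF i]] by (intro add_mono) (auto simp: Y_def Y'_def d_def)
    also have "\<dots> <= K1 * z * (dl + eps) + 2 * (z * (dl + eps))"
    proof -
     have "K1 * exp (\<mu> * T) * norm (P0 - P0') * norm u = K1 * z * dl" by (simp add: z_def dl_def)
     moreover have "K1 * z * dl <= K1 * z * (dl + eps)" using K1(1) z eps by (intro mult_left_mono) auto
     ultimately show ?thesis using e(3) by linarith
    qed
    finally show ?thesis by (simp add: cy_def algebra_simps)
   qed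
   have nY: "norm (Y i) <= (K2 + 1) * (exp (\<mu> * (T - real i * d)) * norm u)" if i: "i <= m" for i
   proof -
    have "norm (Y i) <= norm (Y i - y (real i * d)) + norm (y (real i * d))" using norm_triangle_ineq[of "Y i - y (real i * d)" "y (real i * d)"] by simp
    also have "\<dots> <= z + K2 * exp (\<mu> * (T - real i * d)) * norm u"
     using m1(2)[OF mm(1) i] e(2) K2(2)[OF sol(1) y q[OF i]] by (intro add_mono) (auto simp: Y_def d_def)
    also have "z <= exp (\<mu> * (T - real i * d)) * norm u"
     unfolding z_def using mu_neg q[OF i] by (intro mult_right_mono) (auto simp: mult_le_cancel_left)
    finally show ?thesis by (simp add: algebra_simps)
   qed
   have nY': "norm (Y' 0) <= (K2' + 1) * z"
   proof -
    have "norm (Y' 0) <= norm (Y' 0 - y' 0) + norm (y' 0)" using norm_triangle_ineq[of "Y' 0 - y' 0" "y' 0"] by simp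
    also have "\<dots> <= z + K2' * exp (\<mu> * (T - 0)) * norm u"
     using m2(2)[OF mm(2), of 0] e(2) K2'(2)[OF sol(2) y', of 0] T by (intro add_mono) (auto simp: Y'_def d_def)
    finally show ?thesis by (simp add: z_def algebra_simps)
   qed
   have cle: "c' * z * (dl + eps) <= c * z * (dl + eps)" if "c' <= c" for c'
    using that z dl eps by (intro mult_right_mono) auto
   have nc: "norm (noise_coef A C R1h R2h (%s. Q s ** Gam) T m k u l - noise_coef A C R1h R2h (%s. Q' s ** Gam) T m k u l) <= cn * z * (dl + eps)"
    if l: "l < m * k" for l
   proof -
    define i where "i = l div k"
    have i: "i < m" using l k by (simp add: i_def less_mult_imp_div_less)
    then have i': "Suc i <= m" by simp
    have lb: "l \<in> {i * k..<i * k + k}" using mod_less_divisor[OF k, of l] div_mult_mod_eq[of l k] unfolding i_def atLeastLessThan_iff by linarith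
    define p where "p = gridp T m k l"
    have p0: "0 <= p" using gridp_bounds(1)[OF T less_imp_le[OF l]] by (simp add: p_def)
    have "real i * d <= p"
     using euler_grid(5)[OF T mm(4) k i lb] by (simp add: p_def gridp_def d_def)
    then have pb: "real (Suc i) * d - d <= p" by (simp add: algebra_simps)
    define w w' where "w = Y (Suc i)" and "w' = Y' (Suc i)"
    define H H' where "H = Q p ** Gam" and "H' = Q' p ** Gam"
    have "noise_coef A C R1h R2h (%s. Q s ** Gam) T m k u l - noise_coef A C R1h R2h (%s. Q' s ** Gam) T m k u l
     = (R1h *v (w - w'), - (R2h *v (transpose (H - H') *v w + transpose H' *v (w - w'))))"
     by (simp add: noise_coef_def Let_def weight_def B i_def[symmetric] d_def[symmetric] p_def[symmetric] w_def w'_def H_def H'_def Y_def Y'_def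
       matrix_vector_linear transpose_linear algebra_simps)
    also have "norm \<dots> <= norm (R1h *v (w - w')) + norm (R2h *v (transpose (H - H') *v w + transpose H' *v (w - w')))"
     by (rule order_trans[OF norm_Pair_le]) simp
    also have "\<dots> <= norm R1h * (cy * z * (dl + eps)) + norm R2h * (norm Gam * K3 * (K2 + 1) * exp (- \<mu>) * (z * (dl + eps)) + Lam * norm Gam * (cy * z * (dl + eps)))"
    proof (rule add_mono)
     show "norm (R1h *v (w - w')) <= norm R1h * (cy * z * (dl + eps))"
      using norm_matrix_vector_mult_le[of R1h "w - w'"] mult_left_mono[OF dY[OF i'], of "norm R1h"] by (simp add: w_def w'_def)
     have 1: "norm (transpose (H - H') *v w) <= norm Gam * K3 * (K2 + 1) * exp (- \<mu>) * (z * (dl + eps))"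
     proof -
      have "norm (transpose (H - H') *v w) <= norm (H - H') * norm w"
       using norm_matrix_vector_mult_le[of "transpose (H - H')" w] by (simp add: norm_transpose)
      also have "\<dots> <= (K3 * exp (2 * \<mu> * p) * dl * norm Gam) * ((K2 + 1) * (exp (\<mu> * (T - real (Suc i) * d)) * norm u))"
      proof (rule mult_mono)
       have "H - H' = (Q p - Q' p) ** Gam" by (simp add: H_def H'_def matrix_mult_linear)
       then have "norm (H - H') <= norm (Q p - Q' p) * norm Gam" using norm_matrix_matrix_mult_le by metis
       also have "\<dots> <= K3 * exp (2 * \<mu> * p) * dl * norm Gam"
        using K3(2)[OF sol p0] by (intro mult_right_mono) (auto simp: dl_def)
       finally show "norm (H - H') <= K3 * exp (2 * \<mu> * p) * dl * norm Gam" .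
      qed (use nY[OF i'] K3(1) dl in \<open>auto simp: w_def\<close>)
      also have "\<dots> = norm Gam * K3 * (K2 + 1) * dl * norm u * exp (2 * \<mu> * p + \<mu> * (T - real (Suc i) * d))"
       by (simp only: exp_add) (simp only: ac_simps)
      also have "\<dots> <= norm Gam * K3 * (K2 + 1) * dl * norm u * exp (\<mu> * T - \<mu>)"
      proof (rule mult_left_mono)
       \<comment> \<open>The gain difference has decayed up to \<open>p\<close>, the weight only
         back to the right end of the block containing \<open>p\<close>. The mismatch is at most one
         coarse step, of length at most 1, and costs the factor exp (- \<mu>).\<close>
       have "T - 1 <= 2 * p + (T - real (Suc i) * d)" using pb p0 d(2) by linarith
       then have "\<mu> * (2 * p + (T - real (Suc i) * d)) <= \<mu> * (T - 1)" using mu_neg by (intro mult_left_mono_neg) auto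
       then show "exp (2 * \<mu> * p + \<mu> * (T - real (Suc i) * d)) <= exp (\<mu> * T - \<mu>)" by (simp add: algebra_simps)
      qed (use K3(1) K2(1) dl in auto)
      also have "\<dots> = norm Gam * K3 * (K2 + 1) * exp (- \<mu>) * (z * dl)"
       unfolding z_def by (simp only: diff_conv_add_uminus exp_add) (simp only: ac_simps)
      also have "\<dots> <= norm Gam * K3 * (K2 + 1) * exp (- \<mu>) * (z * (dl + eps))"
       using z eps K3(1) K2(1) by (intro mult_left_mono) auto
      finally show ?thesis .
     qed
     have 2: "norm (transpose H' *v (w - w')) <= Lam * norm Gam * (cy * z * (dl + eps))"
     proof -
      have "norm (transpose H' *v (w - w')) <= norm H' * norm (w - w')"
       using norm_matrix_vector_mult_le[of "transpose H'" "w - w'"] by (simp add: norm_transpose)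
      also have "\<dots> <= (Lam * norm Gam) * (cy * z * (dl + eps))"
      proof (rule mult_mono)
       have "norm H' <= norm (Q' p) * norm Gam" unfolding H'_def by (rule norm_matrix_matrix_mult_le)
       also have "\<dots> <= Lam * norm Gam" using Lam(2)[OF sol(2) p0] by (intro mult_right_mono) auto
       finally show "norm H' <= Lam * norm Gam" .
      qed (use dY[OF i'] Lam(1) in \<open>auto simp: w_def w'_def\<close>)
      finally show ?thesis .
     qed
     have "norm (R2h *v (transpose (H - H') *v w + transpose H' *v (w - w'))) <= norm R2h * norm (transpose (H - H') *v w + transpose H' *v (w - w'))"
      by (rule norm_matrix_vector_mult_le)
     also have "\<dots> <= norm R2h * (norm Gam * K3 * (K2 + 1) * exp (- \<mu>) * (z * (dl + eps)) + Lam * norm Gam * (cy * z * (dl + eps)))"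
      by (intro mult_left_mono norm_triangle_le add_mono 1 2) simp
     finally show "norm (R2h *v (transpose (H - H') *v w + transpose H' *v (w - w'))) <= norm R2h * (norm Gam * K3 * (K2 + 1) * exp (- \<mu>) * (z * (dl + eps)) + Lam * norm Gam * (cy * z * (dl + eps)))" .
    qed
    also have "\<dots> = cn * z * (dl + eps)" by (simp only: cn_def distrib_right distrib_left ac_simps)
    finally show ?thesis .
   qed
   have "norm (Y 0 - Y' 0) <= c * z * (dl + eps)" using dY[of 0] cle[OF c(2)] by simp
   moreover have "norm (Y' 0) <= c * z" by (rule order_trans[OF nY' mult_right_mono[OF c(3) less_imp_le[OF z]]])
   moreover have "\<forall>l<m * k. norm (noise_coef A C R1h R2h (%s. Q s ** Gam) T m k u l - noise_coef A C R1h R2h (%s. Q' s ** Gam) T m k u l) <= c * z * (dl + eps)"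
    using nc cle[OF c(4)] by (meson order_trans)
   ultimately show "norm (euler (%s. A - Q s ** Gam ** C) (T / real m) m u 0 - euler (%s. A - Q' s ** Gam ** C) (T / real m) m u 0)
    <= c * exp (\<mu> * T) * norm u * (norm (P0 - P0') + eps) \<and>
   norm (euler (%s. A - Q' s ** Gam ** C) (T / real m) m u 0) <= c * exp (\<mu> * T) * norm u \<and>
   (\<forall>l<m * k. norm (noise_coef A C R1h R2h (%s. Q s ** Gam) T m k u l - noise_coef A C R1h R2h (%s. Q' s ** Gam) T m k u l)
    <= c * exp (\<mu> * T) * norm u * (norm (P0 - P0') + eps))"
    unfolding B by (simp add: Y_def Y'_def d_def z_def dl_def mult.assoc)
  qed
 qed
qed

section \<open>Second moments from bounded functionals, and the Wasserstein bound for means\<close>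

lemma iexp_add: "iexp (x + y) = iexp x * iexp y"
 by (simp add: distrib_left exp_add)

lemma vec_nth_measurable [measurable]:
 fixes f :: "'a => real^'n"
 shows "f \<in> borel_measurable M ==> (%x. f x $ i) \<in> borel_measurable M"
 by (rule borel_measurable_continuous_on[where f = "%v. v $ i"]) (auto intro!: continuous_intros)

text \<open>\<open>p\<close> and \<open>q\<close> are reached only through their exponentials, so
  their difference is tested with the bounded function 1 - cos. In the limit
  \<open>a n - b n\<close> may be replaced by \<open>D n\<close>, whose second moment is known, and
  1 - cos x <= x^2 / 2.\<close>

lemma (in prob_space) cos_expectation_bound:
 fixes a b D :: "nat => 'a => real" and p q :: "'a => real"
 assumes [measurable]: "\<And>n. a n \<in> borel_measurable M" "\<And>n. b n \<in> borel_measurable M" "\<And>n. D n \<in> borel_measurable M"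
   "p \<in> borel_measurable M" "q \<in> borel_measurable M"
  and La: "(%n. expectation (%om. norm (iexp (a n om) - iexp (p om)))) \<longlonglongrightarrow> 0"
  and Lb: "(%n. expectation (%om. norm (iexp (b n om) - iexp (q om)))) \<longlonglongrightarrow> 0"
  and lim: "AE om in M. (%n. a n om - b n om - D n om) \<longlonglongrightarrow> 0"
  and D2: "\<forall>\<^sub>F n in sequentially. integrable M (%om. (D n om)\<^sup>2) \<and> expectation (%om. (D n om)\<^sup>2) <= bet"
 shows "expectation (%om. 1 - cos (p om - q om)) <= bet / 2"
proof -
 define A1 where "A1 n om = norm (iexp (a n om) - iexp (p om))" for n om
 define B1 where "B1 n om = norm (iexp (b n om) - iexp (q om))" for n om
 define C1 where "C1 n om = norm (iexp (a n om - b n om - D n om) - 1)" for n om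
 have [measurable]: "A1 n \<in> borel_measurable M" "B1 n \<in> borel_measurable M" "C1 n \<in> borel_measurable M" for n
  unfolding A1_def[abs_def] B1_def[abs_def] C1_def[abs_def] by measurable
 have two: "norm (iexp x - iexp y) <= 2" for x y
  using norm_triangle_ineq4[of "iexp x" "iexp y"] by simp
 have two': "norm (iexp x - 1) <= 2" for x using two[of x 0] by simp
 have i: "integrable M (A1 n)" "integrable M (B1 n)" "integrable M (C1 n)" for n
 proof -
  show "integrable M (A1 n)" by (rule integrable_const_bound[where B = 2]) (use two in \<open>auto simp: A1_def\<close>)
  show "integrable M (B1 n)" by (rule integrable_const_bound[where B = 2]) (use two in \<open>auto simp: B1_def\<close>)
  show "integrable M (C1 n)"
  proof (rule integrable_const_bound[where B = 2])
   have "norm (C1 n om) <= 2" for om unfolding C1_def real_norm_def abs_norm_cancel by (rule two')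
   then show "AE om in M. norm (C1 n om) <= 2" by simp
  qed measurable
 qed
 have "(%n. expectation (%om. norm (iexp (a n om - b n om - D n om) - 1))) \<longlonglongrightarrow> 0"
 proof (rule bounded_AE_convergence_L1[where B = 1])
  show "AE om in M. (%n. iexp (a n om - b n om - D n om)) \<longlonglongrightarrow> 1"
   using lim
  proof eventually_elim
   case (elim om)
   then have "(%n. iexp (a n om - b n om - D n om)) \<longlonglongrightarrow> iexp 0" by (intro tendsto_intros)
   then show ?case by simp
  qed
 qed auto
 then have LC: "(%n. expectation (C1 n)) \<longlonglongrightarrow> 0" by (simp add: C1_def[abs_def])
 have lim0: "(%n. bet / 2 + (expectation (A1 n) + expectation (B1 n) + expectation (C1 n))) \<longlonglongrightarrow> bet / 2 + (0 + 0 + 0)"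
  unfolding A1_def B1_def by (intro tendsto_add tendsto_const La Lb LC)
 have "\<forall>\<^sub>F n in sequentially. expectation (%om. 1 - cos (p om - q om)) <= bet / 2 + (expectation (A1 n) + expectation (B1 n) + expectation (C1 n))"
  using D2
 proof eventually_elim
  case (elim n)
  have pt: "1 - cos (p om - q om) <= (D n om)\<^sup>2 / 2 + (A1 n om + B1 n om + C1 n om)" for om
  proof -
   let ?a = "iexp (a n om)" and ?b = "iexp (- b n om)" and ?p = "iexp (p om)" and ?q = "iexp (- q om)"
   \<comment> \<open>Telescoping: \<open>p\<close> is exchanged for \<open>a n\<close>, then
     \<open>q\<close> for \<open>b n\<close>, then \<open>a n - b n\<close> for \<open>D n\<close>;
     in each term the remaining factor has modulus 1.\<close>
   have split: "iexp (p om - q om) - iexp (D n om) = (?p - ?a) * ?q + ?a * (?q - ?b) + iexp (D n om) * (iexp (a n om - b n om - D n om) - 1)"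
   proof -
    have alg: "r * t = x * y ==> z * w - r = (z - x) * w + x * (w - y) + r * (t - 1)" for r t x y z w :: complex
     by (simp add: algebra_simps)
    have "D n om + (a n om - b n om - D n om) = a n om + - b n om" by simp
    then have "iexp (D n om) * iexp (a n om - b n om - D n om) = ?a * ?b" by (simp only: iexp_add[symmetric])
    then show ?thesis unfolding diff_conv_add_uminus[of "p om" "q om"] iexp_add[of "p om" "- q om"] by (rule alg)
   qed
   have qb: "norm (?q - ?b) = B1 n om"
   proof -
    have "?q - ?b = cnj (iexp (q om) - iexp (b n om))" by (simp add: exp_cnj)
    then have "norm (?q - ?b) = norm (iexp (q om) - iexp (b n om))" by (simp only: complex_mod_cnj)
    then show ?thesis by (simp add: B1_def norm_minus_commute)
   qed
   have "norm (iexp (p om - q om) - iexp (D n om)) <= A1 n om + B1 n om + C1 n om"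
    unfolding split
    by (intro norm_triangle_le add_mono) (use qb in \<open>auto simp: norm_mult A1_def C1_def norm_minus_commute\<close>)
   moreover have "cos (D n om) - cos (p om - q om) <= norm (iexp (p om - q om) - iexp (D n om))"
   proof -
    have "Re (iexp (p om - q om) - iexp (D n om)) = cos (p om - q om) - cos (D n om)" by (simp add: Re_exp)
    then show ?thesis using abs_Re_le_cmod[of "iexp (p om - q om) - iexp (D n om)"] by linarith
   qed
   moreover have "1 - cos (D n om) <= (D n om)\<^sup>2 / 2"
   proof -
    have "(sin (D n om / 2))\<^sup>2 <= (D n om / 2)\<^sup>2"
     using abs_sin_x_le_abs_x[of "D n om / 2"] by (simp only: abs_le_square_iff)
    then show ?thesis using cos_double_sin[of "D n om / 2"] by (simp add: power_divide)
   qed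
   ultimately show ?thesis by linarith
  qed
  have "expectation (%om. 1 - cos (p om - q om)) <= expectation (%om. (D n om)\<^sup>2 / 2 + (A1 n om + B1 n om + C1 n om))"
  proof (rule integral_mono[OF _ _ pt])
   have "norm (1 - cos (p om - q om)) <= 2" for om
    using cos_le_one[of "p om - q om"] cos_ge_minus_one[of "p om - q om"] unfolding real_norm_def by linarith
   then show "integrable M (%om. 1 - cos (p om - q om))"
    by (intro integrable_const_bound[where B = 2]) auto
   show "integrable M (%om. (D n om)\<^sup>2 / 2 + (A1 n om + B1 n om + C1 n om))" using elim i by simp
  qed
  also have "\<dots> = expectation (%om. (D n om)\<^sup>2) / 2 + (expectation (A1 n) + expectation (B1 n) + expectation (C1 n))"
   using elim i by simp
  finally show ?case using elim by linarith
 qed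
 from tendsto_lowerbound[OF lim0 this] show ?thesis by simp
qed

text \<open>2 (1 - cos (s Z)) / s^2 tends to Z^2 as s tends to 0, and Fatou's lemma yields
  finiteness of the second moment together with the bound.\<close>

lemma (in prob_space) second_moment_from_cos:
 fixes Z :: "'a => real"
 assumes [measurable]: "Z \<in> borel_measurable M" and bet: "0 <= bet"
  and b: "\<And>s. 0 < s ==> expectation (%om. 1 - cos (s * Z om)) <= s\<^sup>2 * bet / 2"
 shows "integrable M (%om. (Z om)\<^sup>2)" and "expectation (%om. (Z om)\<^sup>2) <= bet"
proof -
 define s where "s n = 1 / (real n + 1)" for n :: nat
 have s: "0 < s n" for n by (simp add: s_def)
 have s0: "s \<longlonglongrightarrow> 0" unfolding s_def using LIMSEQ_inverse_real_of_nat by (simp add: inverse_eq_divide add.commute)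
 define f where "f n om = 2 * (1 - cos (s n * Z om)) / (s n)\<^sup>2" for n om
 have f0: "0 <= f n om" for n om by (simp add: f_def)
 have [measurable]: "f n \<in> borel_measurable M" for n unfolding f_def[abs_def] by measurable
 have flim: "(%n. f n om) \<longlonglongrightarrow> (Z om)\<^sup>2" for om
 proof -
  have "((%x. sin (x * Z om / 2)) has_real_derivative Z om / 2) (at 0)"
   by (auto intro!: derivative_eq_intros)
  then have "((%x. sin (x * Z om / 2) / x) \<longlongrightarrow> Z om / 2) (at 0)"
   by (simp add: has_field_derivative_iff)
  moreover have "filterlim s (at 0) sequentially"
   unfolding filterlim_at using s0 less_imp_neq[OF s] by (auto intro!: always_eventually)
  ultimately have L: "(%n. sin (s n * Z om / 2) / s n) \<longlonglongrightarrow> Z om / 2" by (rule filterlim_compose)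
  have "(%n. (2 * (sin (s n * Z om / 2) / s n))\<^sup>2) \<longlonglongrightarrow> (2 * (Z om / 2))\<^sup>2"
   by (rule tendsto_power[OF tendsto_mult_left[OF L]])
  moreover have "(2 * (sin (s n * Z om / 2) / s n))\<^sup>2 = f n om" for n
   using cos_double_sin[of "s n * Z om / 2"] by (simp add: f_def power_divide power_mult_distrib)
  ultimately show ?thesis by simp
 qed
 have fi: "(\<integral>\<^sup>+om. ennreal (f n om) \<partial>M) <= ennreal bet" for n
 proof -
  have "norm (1 - cos (s n * Z om)) <= 2" for om
   using cos_le_one[of "s n * Z om"] cos_ge_minus_one[of "s n * Z om"] unfolding real_norm_def by linarith
  then have "integrable M (%om. 1 - cos (s n * Z om))"
   by (intro integrable_const_bound[where B = 2]) auto
  then have i: "integrable M (%om. 2 * (1 - cos (s n * Z om)) / (s n)\<^sup>2)" by (intro Bochner_Integration.integrable_divide integrable_mult_right)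
  have "(\<integral>\<^sup>+om. ennreal (f n om) \<partial>M) = ennreal (expectation (f n))"
   unfolding f_def using i by (intro nn_integral_eq_integral) auto
  also have "expectation (f n) = 2 * expectation (%om. 1 - cos (s n * Z om)) / (s n)\<^sup>2"
   unfolding f_def by (simp only: integral_divide_zero integral_mult_right_zero)
  also have "\<dots> <= 2 * ((s n)\<^sup>2 * bet / 2) / (s n)\<^sup>2"
   by (intro divide_right_mono mult_left_mono b s) auto
  also have "\<dots> = bet" using s[of n] by simp
  finally show ?thesis by (simp add: ennreal_leI)
 qed
 have "(\<integral>\<^sup>+om. ennreal ((Z om)\<^sup>2) \<partial>M) = (\<integral>\<^sup>+om. liminf (%n. ennreal (f n om)) \<partial>M)"
 proof (intro nn_integral_cong)
  fix om
  have "(%n. ennreal (f n om)) \<longlonglongrightarrow> ennreal ((Z om)\<^sup>2)" by (intro tendsto_ennrealI flim)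
  then show "ennreal ((Z om)\<^sup>2) = liminf (%n. ennreal (f n om))" by (intro lim_imp_Liminf[symmetric]) auto
 qed
 also have "\<dots> <= liminf (%n. \<integral>\<^sup>+om. ennreal (f n om) \<partial>M)" by (rule nn_integral_liminf) measurable
 also have "\<dots> <= ennreal bet"
  by (rule Liminf_le) (use fi in auto)
 finally have le: "(\<integral>\<^sup>+om. ennreal ((Z om)\<^sup>2) \<partial>M) <= ennreal bet" .
 show i: "integrable M (%om. (Z om)\<^sup>2)"
  by (rule integrableI_bounded) (use le in \<open>auto simp: le_less_trans[OF _ ennreal_less_top]\<close>)
 have "ennreal (expectation (%om. (Z om)\<^sup>2)) <= ennreal bet"
  using le nn_integral_eq_integral[OF i] by simp
 then show "expectation (%om. (Z om)\<^sup>2) <= bet" using bet by (simp add: ennreal_le_iff)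
qed

lemma (in prob_space) gaussian_vector_square_integrable:
 fixes X :: "'a => real^'n"
 assumes X: "gaussian_vector M X"
 shows "integrable M (%om. (norm (X om - x))\<^sup>2)"
proof -
 have Xm [measurable]: "X \<in> borel_measurable M" using X by (simp add: gaussian_vector_def)
 have "integrable M (%om. (X om $ i - x $ i)\<^sup>2)" for i
 proof -
  obtain m v where v: "0 <= v" "distr M borel (%om. axis i 1 \<bullet> X om) = normal_law m v"
   using X unfolding gaussian_vector_def by blast
  then have law: "distr M borel (%om. X om $ i) = normal_law m v" by (simp add: inner_axis')
  have 1: "integrable M (%om. X om $ i)" "integrable M (%om. (X om $ i - m)\<^sup>2)"
   using normal_law_integrable[OF _ v(1) law] normal_law_integrable_sq[OF _ v(1) law] by auto
  have "integrable M (%om. (X om $ i - m)\<^sup>2 + 2 * (m - x $ i) * X om $ i + ((x $ i)\<^sup>2 - m\<^sup>2))"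
   using 1 by simp
  then show ?thesis by (simp add: power2_eq_square algebra_simps)
 qed
 then show ?thesis unfolding power2_norm_eq_inner inner_vec_def by (simp add: power2_eq_square)
qed

lemma (in prob_space) gaussian_vector_char:
 fixes X :: "'a => real^'n"
 assumes X: "gaussian_vector M X"
 defines "m0 \<equiv> mean_vec (distr M borel X)" and "P0 \<equiv> cov_matrix (distr M borel X)"
 shows "psd P0" and "(CLINT om|M. iexp (u \<bullet> X om)) = iexp (u \<bullet> m0) * exp (- (u \<bullet> (P0 *v u)) / 2)"
proof -
 have Xm [measurable]: "X \<in> borel_measurable M" using X by (simp add: gaussian_vector_def)
 have sq: "integrable M (%om. (norm (X om - x))\<^sup>2)" for x by (rule gaussian_vector_square_integrable[OF X])
 have csq: "integrable M (%om. (X om $ i - x $ i)\<^sup>2)" for i x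
 proof (rule Bochner_Integration.integrable_bound[OF sq[of x]])
  show "AE om in M. norm ((X om $ i - x $ i)\<^sup>2) <= norm ((norm (X om - x))\<^sup>2)"
   using component_le_norm_cart[of "X _ - x" i] by (auto intro!: AE_I2 simp: abs_le_square_iff[symmetric])
 qed measurable
 have int1: "integrable M (%om. X om $ i)" for i
  by (rule square_integrable_imp_integrable) (use csq[of i 0] in auto)
 have m0: "m0 $ i = expectation (%om. X om $ i)" for i
  by (simp add: m0_def mean_vec_def integral_distr)
 have P0: "P0 $ i $ j = expectation (%om. (X om $ i - m0 $ i) * (X om $ j - m0 $ j))" for i j
  by (simp add: P0_def cov_matrix_def m0_def[symmetric] integral_distr)
 have cint: "integrable M (%om. (X om $ i - m0 $ i) * (X om $ j - m0 $ j))" for i j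
 proof (rule Bochner_Integration.integrable_bound)
  show "integrable M (%om. (X om $ i - m0 $ i)\<^sup>2 + (X om $ j - m0 $ j)\<^sup>2)" using csq by simp
  have "\<bar>p * q\<bar> <= p\<^sup>2 + q\<^sup>2" for p q :: real
   using sum_squares_bound[of "\<bar>p\<bar>" "\<bar>q\<bar>"] mult_nonneg_nonneg[OF abs_ge_zero[of p] abs_ge_zero[of q]]
   unfolding abs_mult power2_abs by linarith
  then show "AE om in M. norm ((X om $ i - m0 $ i) * (X om $ j - m0 $ j)) <= norm ((X om $ i - m0 $ i)\<^sup>2 + (X om $ j - m0 $ j)\<^sup>2)" by simp
 qed measurable
 have lin: "expectation (%om. u \<bullet> X om) = u \<bullet> m0" for u
  using int1 by (simp add: inner_vec_def m0)
 have form: "u \<bullet> (P0 *v u) = expectation (%om. (u \<bullet> X om - u \<bullet> m0)\<^sup>2)" for u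
 proof -
  have "u \<bullet> (P0 *v u) = (\<Sum>i\<in>UNIV. \<Sum>j\<in>UNIV. expectation (%om. u $ i * u $ j * ((X om $ i - m0 $ i) * (X om $ j - m0 $ j))))"
   by (simp add: inner_vec_def matrix_vector_mult_def P0 sum_distrib_left ac_simps)
  also have "\<dots> = expectation (%om. \<Sum>i\<in>UNIV. \<Sum>j\<in>UNIV. u $ i * u $ j * ((X om $ i - m0 $ i) * (X om $ j - m0 $ j)))"
   using cint by (simp add: Bochner_Integration.integral_sum)
  also have "\<dots> = expectation (%om. (u \<bullet> X om - u \<bullet> m0)\<^sup>2)"
  proof (intro Bochner_Integration.integral_cong refl)
   fix om
   have "(u \<bullet> X om - u \<bullet> m0) = (\<Sum>i\<in>UNIV. u $ i * (X om $ i - m0 $ i))"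
    by (simp add: inner_vec_def sum_subtractf right_diff_distrib)
   then show "(\<Sum>i\<in>UNIV. \<Sum>j\<in>UNIV. u $ i * u $ j * ((X om $ i - m0 $ i) * (X om $ j - m0 $ j))) = (u \<bullet> X om - u \<bullet> m0)\<^sup>2"
    by (simp add: power2_eq_square sum_product ac_simps)
  qed
  finally show ?thesis .
 qed
 show "psd P0"
  unfolding psd_def symmetric_mat_def by (auto simp: form P0 transpose_def vec_eq_iff mult.commute)
 obtain m v where v: "0 <= v" "distr M borel (%om. u \<bullet> X om) = normal_law m v"
  using X unfolding gaussian_vector_def by blast
 have um: "(%om. u \<bullet> X om) \<in> borel_measurable M" by measurable
 have m: "m = u \<bullet> m0" using normal_law_mean[OF um v] lin by simp
 have "v = u \<bullet> (P0 *v u)" using normal_law_variance[OF um v] form m by simp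
 with normal_law_char[OF um v] m show "(CLINT om|M. iexp (u \<bullet> X om)) = iexp (u \<bullet> m0) * exp (- (u \<bullet> (P0 *v u)) / 2)" by simp
qed

lemma (in prob_space) square_integrable_component:
 fixes Z :: "'a => real^'n"
 assumes [measurable]: "Z \<in> borel_measurable M" and sq: "integrable M (%om. (norm (Z om))\<^sup>2)"
 shows "integrable M (%om. Z om $ i)"
proof (rule square_integrable_imp_integrable)
 show "integrable M (%om. (Z om $ i)\<^sup>2)"
  by (rule Bochner_Integration.integrable_bound[OF sq])
   (use component_le_norm_cart[of "Z _" i] in \<open>auto intro!: AE_I2 simp: abs_le_square_iff[symmetric]\<close>)
qed measurable

text \<open>With w the difference of the means, every coupling of x and y gives |w|^2 = E (w . (x -
  y)), which is at most half of |w|^2 + E |x - y|^2.\<close>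

lemma (in prob_space) mean_difference_le_W2:
 fixes X X' :: "'a => real^'n"
 assumes [measurable]: "X \<in> borel_measurable M" "X' \<in> borel_measurable M"
  and sq: "integrable M (%om. (norm (X om))\<^sup>2)" "integrable M (%om. (norm (X' om))\<^sup>2)"
 shows "(norm (mean_vec (distr M borel X) - mean_vec (distr M borel X')))\<^sup>2 <= (W2 (distr M borel X) (distr M borel X'))\<^sup>2"
proof -
 let ?\<nu> = "distr M borel X" and ?\<nu>' = "distr M borel X'"
 define w where "w = mean_vec ?\<nu> - mean_vec ?\<nu>'"
 define J where "J = (INF \<gamma>\<in>couplings ?\<nu> ?\<nu>'. \<integral>\<^sup>+z. ennreal ((norm (fst z - snd z))\<^sup>2) \<partial>\<gamma>)"
 note int = square_integrable_component[OF assms(1) sq(1)] square_integrable_component[OF assms(2) sq(2)]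
 have lower: "ennreal ((norm w)\<^sup>2) <= (\<integral>\<^sup>+z. ennreal ((norm (fst z - snd z))\<^sup>2) \<partial>\<gamma>)" if \<gamma>: "\<gamma> \<in> couplings ?\<nu> ?\<nu>'" for \<gamma>
 proof (cases "(\<integral>\<^sup>+z. ennreal ((norm (fst z - snd z))\<^sup>2) \<partial>\<gamma>) = \<infinity>")
  case False
  from \<gamma> interpret G: prob_space \<gamma> by (simp add: couplings_def)
  from \<gamma> have [measurable_cong]: "sets \<gamma> = sets (borel \<Otimes>\<^sub>M borel)"
   and d: "distr \<gamma> borel fst = ?\<nu>" "distr \<gamma> borel snd = ?\<nu>'" by (auto simp: couplings_def)
  have isq: "integrable \<gamma> (%z. (norm (fst z - snd z))\<^sup>2)"
   by (rule integrableI_bounded) (use False in \<open>auto simp: less_top[symmetric]\<close>)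
  have comp: "integrable \<gamma> (%z. fst z $ i)" "mean_vec ?\<nu> $ i = (\<integral>z. fst z $ i \<partial>\<gamma>)"
   "integrable \<gamma> (%z. snd z $ i)" "mean_vec ?\<nu>' $ i = (\<integral>z. snd z $ i \<partial>\<gamma>)" for i
  proof -
   have "integrable ?\<nu> (%x. x $ i)" "integrable ?\<nu>' (%x. x $ i)"
    using int[of i] by (simp_all add: integrable_distr_eq)
   then show "integrable \<gamma> (%z. fst z $ i)" "integrable \<gamma> (%z. snd z $ i)"
    unfolding d[symmetric] by (simp_all add: integrable_distr_eq)
   show "mean_vec ?\<nu> $ i = (\<integral>z. fst z $ i \<partial>\<gamma>)" "mean_vec ?\<nu>' $ i = (\<integral>z. snd z $ i \<partial>\<gamma>)"
    unfolding d[symmetric] mean_vec_def by (simp_all add: integral_distr)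
  qed
  have "(norm w)\<^sup>2 = (\<integral>z. w \<bullet> (fst z - snd z) \<partial>\<gamma>)"
  proof -
   have "(\<integral>z. w \<bullet> (fst z - snd z) \<partial>\<gamma>) = (\<Sum>i\<in>UNIV. w $ i * (mean_vec ?\<nu> $ i - mean_vec ?\<nu>' $ i))"
    using comp by (simp add: inner_vec_def)
   then show ?thesis by (simp add: w_def power2_norm_eq_inner inner_vec_def)
  qed
  also have "\<dots> <= (\<integral>z. ((norm w)\<^sup>2 + (norm (fst z - snd z))\<^sup>2) / 2 \<partial>\<gamma>)"
  proof (rule integral_mono)
   show "integrable \<gamma> (%z. w \<bullet> (fst z - snd z))" using comp by (simp add: inner_vec_def)
   show "integrable \<gamma> (%z. ((norm w)\<^sup>2 + (norm (fst z - snd z))\<^sup>2) / 2)" using isq by simp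
   have "p * q <= (p\<^sup>2 + q\<^sup>2) / 2" for p q :: real using sum_squares_bound[of p q] by simp
   then show "w \<bullet> (fst z - snd z) <= ((norm w)\<^sup>2 + (norm (fst z - snd z))\<^sup>2) / 2" for z
    using norm_cauchy_schwarz[of w "fst z - snd z"] order_trans by blast
  qed
  also have "\<dots> = ((norm w)\<^sup>2 + (\<integral>z. (norm (fst z - snd z))\<^sup>2 \<partial>\<gamma>)) / 2" using isq by (simp add: G.prob_space)
  finally have "(norm w)\<^sup>2 <= (\<integral>z. (norm (fst z - snd z))\<^sup>2 \<partial>\<gamma>)" by simp
  then show ?thesis using nn_integral_eq_integral[OF isq] by (simp add: ennreal_leI)
 qed simp
 then have 1: "ennreal ((norm w)\<^sup>2) <= J" unfolding J_def by (rule INF_greatest)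
 \<comment> \<open>The infimum has to be shown finite, since \<open>enn2real\<close> sends infinity
   to 0; the given joint law is a coupling of finite cost.\<close>
 have "distr M (borel \<Otimes>\<^sub>M borel) (%om. (X om, X' om)) \<in> couplings ?\<nu> ?\<nu>'"
  by (auto simp: couplings_def distr_distr o_def intro!: prob_space_distr)
 then have "J <= (\<integral>\<^sup>+z. ennreal ((norm (fst z - snd z))\<^sup>2) \<partial>distr M (borel \<Otimes>\<^sub>M borel) (%om. (X om, X' om)))"
  unfolding J_def by (rule INF_lower)
 also have "\<dots> = (\<integral>\<^sup>+om. ennreal ((norm (X om - X' om))\<^sup>2) \<partial>M)" by (subst nn_integral_distr) auto
 also have "\<dots> < \<infinity>"
 proof -
  have i: "integrable M (%om. (norm (X om - X' om))\<^sup>2)"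
  proof (rule Bochner_Integration.integrable_bound)
   show "integrable M (%om. 2 * (norm (X om))\<^sup>2 + 2 * (norm (X' om))\<^sup>2)" using sq by simp
   have "(norm (x - y))\<^sup>2 <= 2 * (norm x)\<^sup>2 + 2 * (norm y)\<^sup>2" for x y :: "real^'n"
   proof -
    have "(norm (x - y))\<^sup>2 <= (norm x + norm y)\<^sup>2" by (intro power_mono norm_triangle_ineq4) simp
    also have "\<dots> <= 2 * (norm x)\<^sup>2 + 2 * (norm y)\<^sup>2" using sum_squares_bound[of "norm x" "norm y"] by (simp add: power2_sum)
    finally show ?thesis .
   qed
   then show "AE om in M. norm ((norm (X om - X' om))\<^sup>2) <= norm (2 * (norm (X om))\<^sup>2 + 2 * (norm (X' om))\<^sup>2)" by simp
  qed measurable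
  show ?thesis using nn_integral_eq_integral[OF i] by simp
 qed
 finally have "J < \<infinity>" .
 then have "(norm w)\<^sup>2 <= enn2real J" using enn2real_mono[OF 1] by simp
 moreover have "(W2 ?\<nu> ?\<nu>')\<^sup>2 = enn2real J" by (simp add: W2_def J_def)
 ultimately show ?thesis by (simp add: w_def)
qed

text \<open>The signal obeys the equation of the diffusion for every gain, because the integrator of
  the gain vanishes when signal and true observation noise are inserted. All defects are then 0, so
  any subdivision will do.\<close>

lemma (in prob_space) signal_representation:
 fixes W X :: "real => 'a => real^'n" and V Y :: "real => 'a => real^'m" and H :: "real => real^'m^'n"
 assumes so: "signal_observation M A a C c R1h R2h W V X Y"
  and sym: "symmetric_mat R1h" "symmetric_mat R2h"
  and T: "0 <= T" and H: "continuous_on {0..T} H" and k: "\<And>m. 0 < kap m"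
 shows "AE om in M. (%m. obs_sum A C a c H (%s. Y s om) T m (kap m) u + (euler (%s. A - H s ** C) (T / real m) m u 0 \<bullet> X 0 om
   + noise_sum A C R1h R2h H (%s. (W s om, V s om)) T m (kap m) u)) \<longlonglongrightarrow> u \<bullet> X T om"
proof -
 have cX: "continuous_process M X" using so unfolding signal_observation_def by blast
 have "AE om in M. \<forall>t\<ge>0.
    X t om = X 0 om + integral {0..t} (%s. A *v X s om + a) + R1h *v W t om \<and>
    Y t om = integral {0..t} (%s. C *v X s om + c) + R2h *v V t om"
  using so unfolding signal_observation_def by blast
 then show ?thesis using AE_space
 proof eventually_elim
  case (elim om)
  have x: "continuous_on {0..T} (%s. X s om)"
   using cX elim(2) unfolding continuous_process_def by (meson continuous_on_subset atLeastatMost_subset_iff atLeastAtMost_iff atLeast_iff subsetI)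
  have "riemann_defect A C a c R1h R2h H (%s. X s om) (%s. W s om) (%s. V s om) (%s. Y s om) T m (kap m) i = 0" for m i
  proof -
   have q: "0 <= real i * (T / real m)" and g: "0 <= gridp T m (kap m) l" for l using T by (simp_all add: gridp_def)
   have 1: "X s om - X 0 om - integral {0..s} (%r. A *v X r om + a) - R1h *v W s om = 0" if "0 <= s" for s
    using elim(1)[rule_format, OF that, THEN conjunct1] by (simp add: algebra_simps)
   have 2: "Y s om - (integral {0..s} (%r. C *v X r om + c) + R2h *v V s om) = 0" if "0 <= s" for s
    using elim(1)[rule_format, OF that, THEN conjunct2] by (simp add: algebra_simps)
   show ?thesis unfolding riemann_defect_def Let_def 1[OF q] 2[OF g] by simp
  qed
  then show ?case
   by (intro pathwise_representation[OF T x H sym k]) simp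
 qed
qed

text \<open>In the exponential sense, u . mean is the limit of the observation sum plus y0 . m0. For
  each of the two gains the signal representation replaces the observation sum by u . X_T minus an
  initial term and a Brownian sum; u . X_T cancels in the difference. There remain (y0 - y1) . (m0 -
  X_0), y1 . (m0 - m0') and a Brownian sum with deterministic coefficients, all controlled by
  \<open>scheme\<close>.\<close>

lemma filter_mean_difference:
 fixes A R1h P0 P0' :: "real^'n^'n" and C :: "real^'n^'m" and R2h :: "real^'m^'m" and a m0 m0' :: "real^'n"
 assumes f: "kalman_filter M A R1h P0 C R2h a m0 c X Xb Wb Y Vb \<eta> Q"
  and f': "kalman_filter M A R1h P0' C R2h a m0' c X Xb' Wb' Y Vb' \<eta>' Q'"
  and so: "signal_observation M A a C c R1h R2h W V X Y"
  and Gam: "Gam = transpose C ** matrix_inv (R2h ** R2h)"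
  and rs: "riccati_stable A (Gam ** C) (R1h ** R1h) P \<mu> r"
  and Pt: "riccati_stable.sol A (Gam ** C) (R1h ** R1h) P0 Pt" "\<And>t. 0 <= t ==> AE om in M. Q t om = Pt t"
  and Pt': "riccati_stable.sol A (Gam ** C) (R1h ** R1h) P0' Pt'" "\<And>t. 0 <= t ==> AE om in M. Q' t om = Pt' t"
  and T: "0 <= T"
  and char: "AE om in M. \<forall>u. char_fun (\<eta> T om) u = iexp (u \<bullet> mean_vec (\<eta> T om)) * exp (- (u \<bullet> (Pt T *v u)) / 2)"
  and char': "AE om in M. \<forall>u. char_fun (\<eta>' T om) u = iexp (u \<bullet> mean_vec (\<eta>' T om)) * exp (- (u \<bullet> (Pt' T *v u)) / 2)"
  and scheme: "\<And>(u :: real^'n) eps. u ~= 0 ==> 0 < eps ==>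
  (\<exists>m0. \<forall>m\<ge>m0. \<forall>k>0.
   norm (euler (%s. A - Pt s ** Gam ** C) (T / real m) m u 0 - euler (%s. A - Pt' s ** Gam ** C) (T / real m) m u 0)
    <= b * norm u * (dl + eps) \<and>
   norm (euler (%s. A - Pt' s ** Gam ** C) (T / real m) m u 0) <= b * norm u \<and>
   (\<forall>l<m * k. norm (noise_coef A C R1h R2h (%s. Pt s ** Gam) T m k u l - noise_coef A C R1h R2h (%s. Pt' s ** Gam) T m k u l)
    <= b * norm u * (dl + eps)))"
  and b: "0 <= b" and dl: "0 <= dl"
 defines "bet \<equiv> 3 * b\<^sup>2 * (dl\<^sup>2 * ((\<integral>om. (norm (m0 - X 0 om))\<^sup>2 \<partial>M) + T) + (norm (m0 - m0'))\<^sup>2)"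
 shows "integrable M (%om. (norm (mean_vec (\<eta> T om) - mean_vec (\<eta>' T om)))\<^sup>2)"
  and "(\<integral>om. (norm (mean_vec (\<eta> T om) - mean_vec (\<eta>' T om)))\<^sup>2 \<partial>M) <= real CARD('n) * bet"
proof -
 interpret K: kalman_filter M A R1h P0 C R2h a m0 c X Xb Wb Y Vb \<eta> Q by fact
 interpret K': kalman_filter M A R1h P0' C R2h a m0' c X Xb' Wb' Y Vb' \<eta>' Q' by fact
 interpret RS: riccati_stable A "Gam ** C" "R1h ** R1h" P \<mu> r by fact
 have gain: "K.gain = Gam" "K'.gain = Gam" by (simp_all add: K.gain_def K'.gain_def Gam)
 have info: "K.info = Gam ** C" "K'.info = Gam ** C" by (simp_all add: K.info_def K'.info_def Gam)
 obtain kap1 where kap1: "\<And>kap. (\<And>m. kap1 m <= kap m) ==> K.good_subdivision T kap" using K.good_subdivisions_exist[OF T] by blast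
 obtain kap2 where kap2: "\<And>kap. (\<And>m. kap2 m <= kap m) ==> K'.good_subdivision T kap" using K'.good_subdivisions_exist[OF T] by blast
 define kap where "kap m = max (kap1 m) (kap2 m)" for m
 have good: "K.good_subdivision T kap" "K'.good_subdivision T kap" using kap1[of kap] kap2[of kap] by (auto simp: kap_def)
 have k: "0 < kap m" for m using good(1) by (simp add: K.good_subdivision_def)
 have sub: "subalgebra M (history M Y T)" by (rule K.history_sub[OF T])
 have mm [measurable]: "(%om. mean_vec (\<eta> T om)) \<in> borel_measurable M" "(%om. mean_vec (\<eta>' T om)) \<in> borel_measurable M"
  by (rule measurable_from_subalg[OF sub K.mean_vec_measurable[OF T]], rule measurable_from_subalg[OF sub K'.mean_vec_measurable[OF T]])
 note so' = so[unfolded signal_observation_def]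
 have gX: "gaussian_vector M (X 0)" and bm: "brownian_motion M (%t om. (W t om, V t om))" and cX: "continuous_process M X"
  using so' by blast+
 have X0m [measurable]: "X 0 \<in> borel_measurable M" using gX by (simp add: gaussian_vector_def)
 have vint: "integrable M (%om. (norm (m0 - X 0 om))\<^sup>2)"
  using K.gaussian_vector_square_integrable[OF gX, of m0] by (simp add: norm_minus_commute)
 define v where "v = (\<integral>om. (norm (m0 - X 0 om))\<^sup>2 \<partial>M)"
 have v: "0 <= v" by (simp add: v_def)
 have Bm: "(%om. (W s om, V s om)) \<in> borel_measurable M" if "0 <= s" for s
  using bm that unfolding brownian_motion_def continuous_process_def by blast
 have H: "continuous_on {0..T} (%s. Pt s ** Gam)" "continuous_on {0..T} (%s. Pt' s ** Gam)"
  by (intro continuous_intros RS.sol_continuous[OF Pt(1)] RS.sol_continuous[OF Pt'(1)]; simp)+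
 have cosb: "(\<integral>om. 1 - cos (u \<bullet> mean_vec (\<eta> T om) - u \<bullet> mean_vec (\<eta>' T om)) \<partial>M) <= (norm u)\<^sup>2 * bet / 2" if u: "u ~= 0" for u
 proof -
  define y0 where "y0 m = euler (%s. A - Pt s ** Gam ** C) (T / real m) m u 0" for m
  define y1 where "y1 m = euler (%s. A - Pt' s ** Gam ** C) (T / real m) m u 0" for m
  define ob where "ob m om = obs_sum A C a c (%s. Pt s ** Gam) (%s. Y s om) T m (kap m) u" for m om
  define ob' where "ob' m om = obs_sum A C a c (%s. Pt' s ** Gam) (%s. Y s om) T m (kap m) u" for m om
  define no where "no m om = noise_sum A C R1h R2h (%s. Pt s ** Gam) (%s. (W s om, V s om)) T m (kap m) u" for m om
  define no' where "no' m om = noise_sum A C R1h R2h (%s. Pt' s ** Gam) (%s. (W s om, V s om)) T m (kap m) u" for m om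
  define tht where "tht m l = noise_coef A C R1h R2h (%s. Pt s ** Gam) T m (kap m) u l - noise_coef A C R1h R2h (%s. Pt' s ** Gam) T m (kap m) u l" for m l
  define N where "N m om = (\<Sum>l<m * kap m. tht m l \<bullet> ((W (gridp T m (kap m) (Suc l)) om, V (gridp T m (kap m) (Suc l)) om) - (W (gridp T m (kap m) l) om, V (gridp T m (kap m) l) om)))" for m om
  have N: "N m om = no m om - no' m om" for m om
   by (simp add: N_def tht_def no_def no'_def noise_sum_def inner_diff_left sum_subtractf)
  define D where "D m om = (y0 m - y1 m) \<bullet> (m0 - X 0 om) + y1 m \<bullet> (m0 - m0') - N m om" for m om
  have g0: "0 <= gridp T m (kap m) l" for m l using T by (simp add: gridp_def)
  have [measurable]: "N m \<in> borel_measurable M" for m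
   unfolding N_def[abs_def] by (intro borel_measurable_sum borel_measurable_inner borel_measurable_const borel_measurable_diff Bm g0)
  have [measurable]: "ob m \<in> borel_measurable M" for m unfolding ob_def[abs_def]
   by (rule obs_sum_measurable[where H = "%s _. Pt s ** Gam", OF _ T k]) (auto intro: K.Y_measurable)
  have [measurable]: "ob' m \<in> borel_measurable M" for m unfolding ob'_def[abs_def]
   by (rule obs_sum_measurable[where H = "%s _. Pt' s ** Gam", OF _ T k]) (auto intro: K.Y_measurable)
  have Dm [measurable]: "D m \<in> borel_measurable M" for m unfolding D_def[abs_def] by measurable
  have La: "(%m. \<integral>om. norm (iexp (ob m om + y0 m \<bullet> m0) - iexp (u \<bullet> mean_vec (\<eta> T om))) \<partial>M) \<longlonglongrightarrow> 0"
  proof -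
   have ch: "AE om in M. char_fun (\<eta> T om) u = iexp (u \<bullet> mean_vec (\<eta> T om)) * exp (- (u \<bullet> (Pt T *v u)) / 2)"
    using char by eventually_elim blast
   show ?thesis
    using K.mean_approximation[OF _ _ Pt(2) T good(1) ch, of P \<mu> r] rs Pt(1) unfolding info gain ob_def y0_def by simp
  qed
  have Lb: "(%m. \<integral>om. norm (iexp (ob' m om + y1 m \<bullet> m0') - iexp (u \<bullet> mean_vec (\<eta>' T om))) \<partial>M) \<longlonglongrightarrow> 0"
  proof -
   have ch: "AE om in M. char_fun (\<eta>' T om) u = iexp (u \<bullet> mean_vec (\<eta>' T om)) * exp (- (u \<bullet> (Pt' T *v u)) / 2)"
    using char' by eventually_elim blast
   show ?thesis
    using K'.mean_approximation[OF _ _ Pt'(2) T good(2) ch, of P \<mu> r] rs Pt'(1) unfolding info gain ob'_def y1_def by simp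
  qed
  have lim: "AE om in M. (%m. (ob m om + y0 m \<bullet> m0) - (ob' m om + y1 m \<bullet> m0') - D m om) \<longlonglongrightarrow> 0"
   using K.signal_representation[OF so K.sym1 K.sym2 T H(1), where u = u and kap = kap, OF k] K.signal_representation[OF so K.sym1 K.sym2 T H(2), where u = u and kap = kap, OF k]
  proof eventually_elim
   case (elim om)
   have L: "(%m. (ob m om + (y0 m \<bullet> X 0 om + no m om)) - (ob' m om + (y1 m \<bullet> X 0 om + no' m om))) \<longlonglongrightarrow> u \<bullet> X T om - u \<bullet> X T om"
    unfolding ob_def ob'_def y0_def y1_def no_def no'_def by (rule tendsto_diff[OF elim])
   have eq: "(ob m om + y0 m \<bullet> m0) - (ob' m om + y1 m \<bullet> m0') - D m om = (ob m om + (y0 m \<bullet> X 0 om + no m om)) - (ob' m om + (y1 m \<bullet> X 0 om + no' m om))" for m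
    by (simp add: D_def N inner_diff_left inner_diff_right algebra_simps)
   show ?case unfolding eq using L by simp
  qed
  \<comment> \<open>From (p + q - s)^2 <= 3 (p^2 + q^2 + s^2) for the three terms of
    \<open>D\<close>. The Brownian term is an isometry over a grid of total length at most
    \<open>T\<close>.\<close>
  define bet' where "bet' eps = 3 * ((b * norm u * (dl + eps))\<^sup>2 * v + (b * norm u)\<^sup>2 * (norm (m0 - m0'))\<^sup>2 + T * (b * norm u * (dl + eps))\<^sup>2)" for eps
  have main: "(\<integral>om. 1 - cos (u \<bullet> mean_vec (\<eta> T om) - u \<bullet> mean_vec (\<eta>' T om)) \<partial>M) <= bet' eps / 2" if eps: "0 < eps" for eps
  proof (rule K.cos_expectation_bound[OF _ _ Dm _ _ La Lb lim])
   obtain n0 where n0: "\<And>m. n0 <= m ==> norm (y0 m - y1 m) <= b * norm u * (dl + eps) \<and> norm (y1 m) <= b * norm u \<and>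
     (\<forall>l<m * kap m. norm (tht m l) <= b * norm u * (dl + eps))"
    using scheme[OF u eps] k unfolding y0_def y1_def tht_def by blast
   show "\<forall>\<^sub>F m in sequentially. integrable M (%om. (D m om)\<^sup>2) \<and> (\<integral>om. (D m om)\<^sup>2 \<partial>M) <= bet' eps"
    unfolding eventually_sequentially
   proof (intro exI[of _ n0] allI impI)
    fix m assume m: "n0 <= m"
    have Ni: "integrable M (%om. (N m om)\<^sup>2)"
     and NE: "(\<integral>om. (N m om)\<^sup>2 \<partial>M) = (\<Sum>l<m * kap m. (gridp T m (kap m) (Suc l) - gridp T m (kap m) l) * (norm (tht m l))\<^sup>2)"
     unfolding N_def
     using K.brownian_increments_second_moment[where p = "gridp T m (kap m)" and N = "m * kap m" and v = "tht m", OF bm g0[of m 0] gridp_mono[OF T]] by auto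
    define F where "F om = 3 * ((norm (y0 m - y1 m))\<^sup>2 * (norm (m0 - X 0 om))\<^sup>2 + (norm (y1 m))\<^sup>2 * (norm (m0 - m0'))\<^sup>2 + (N m om)\<^sup>2)" for om
    have Fi: "integrable M F" unfolding F_def[abs_def] using vint Ni by simp
    have DF: "(D m om)\<^sup>2 <= F om" for om
    proof -
     have three: "(p + q - s)\<^sup>2 <= 3 * (p\<^sup>2 + q\<^sup>2 + s\<^sup>2)" for p q s :: real
     proof -
      have "3 * (p\<^sup>2 + q\<^sup>2 + s\<^sup>2) - (p + q - s)\<^sup>2 = (p - q)\<^sup>2 + (p + s)\<^sup>2 + (q + s)\<^sup>2"
       by (simp add: power2_eq_square algebra_simps)
      then show ?thesis using zero_le_power2[of "p - q"] zero_le_power2[of "p + s"] zero_le_power2[of "q + s"] by linarith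
     qed
     have cs: "(p \<bullet> q)\<^sup>2 <= (norm p)\<^sup>2 * (norm q)\<^sup>2" for p q :: "real^'n"
      using Cauchy_Schwarz_ineq[of p q] by (simp add: power2_norm_eq_inner)
     show ?thesis unfolding D_def F_def
      by (rule order_trans[OF three]) (intro mult_left_mono add_mono cs order_refl, simp)
    qed
    show "integrable M (%om. (D m om)\<^sup>2) \<and> (\<integral>om. (D m om)\<^sup>2 \<partial>M) <= bet' eps"
    proof
     show Di: "integrable M (%om. (D m om)\<^sup>2)"
      by (rule Bochner_Integration.integrable_bound[OF Fi]) (use DF in \<open>auto intro!: AE_I2 order_trans[OF DF]\<close>)
     have "(\<integral>om. (D m om)\<^sup>2 \<partial>M) <= (\<integral>om. F om \<partial>M)" by (rule integral_mono[OF Di Fi DF])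
     also have "\<dots> = 3 * ((norm (y0 m - y1 m))\<^sup>2 * v + (norm (y1 m))\<^sup>2 * (norm (m0 - m0'))\<^sup>2 + (\<integral>om. (N m om)\<^sup>2 \<partial>M))"
      unfolding F_def v_def using vint Ni by (simp add: K.prob_space)
     also have "\<dots> <= bet' eps"
      unfolding bet'_def
     proof (intro mult_left_mono add_mono mult_right_mono power_mono)
      show "(\<integral>om. (N m om)\<^sup>2 \<partial>M) <= T * (b * norm u * (dl + eps))\<^sup>2"
      proof -
       have "(\<integral>om. (N m om)\<^sup>2 \<partial>M) <= (\<Sum>l<m * kap m. (gridp T m (kap m) (Suc l) - gridp T m (kap m) l) * (b * norm u * (dl + eps))\<^sup>2)"
        unfolding NE using n0[OF m] gridp_mono[OF T]
        by (intro sum_mono mult_left_mono power_mono) auto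
       also have "\<dots> = (gridp T m (kap m) (m * kap m) - gridp T m (kap m) 0) * (b * norm u * (dl + eps))\<^sup>2"
        unfolding sum_distrib_right[symmetric] sum_lessThan_telescope ..
       also have "\<dots> <= T * (b * norm u * (dl + eps))\<^sup>2"
        using gridp_bounds(2)[OF T order_refl, of m "kap m"] g0[of m 0] by (intro mult_right_mono) auto
       finally show ?thesis .
      qed
     qed (use n0[OF m] v in auto)
     finally show "(\<integral>om. (D m om)\<^sup>2 \<partial>M) <= bet' eps" .
    qed
   qed
  qed measurable
  have "(%n. bet' (1 / real n) / 2) \<longlonglongrightarrow> 3 * ((b * norm u * (dl + 0))\<^sup>2 * v + (b * norm u)\<^sup>2 * (norm (m0 - m0'))\<^sup>2 + T * (b * norm u * (dl + 0))\<^sup>2) / 2"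
   unfolding bet'_def by (intro tendsto_intros lim_1_over_n) auto
  then have "(\<integral>om. 1 - cos (u \<bullet> mean_vec (\<eta> T om) - u \<bullet> mean_vec (\<eta>' T om)) \<partial>M) <= 3 * ((b * norm u * (dl + 0))\<^sup>2 * v + (b * norm u)\<^sup>2 * (norm (m0 - m0'))\<^sup>2 + T * (b * norm u * (dl + 0))\<^sup>2) / 2"
   by (rule LIMSEQ_le_const) (use main in \<open>auto intro!: exI[of _ 1]\<close>)
  also have "\<dots> = (norm u)\<^sup>2 * bet / 2"
   by (simp add: bet_def v_def[symmetric] power_mult_distrib algebra_simps)
  finally show ?thesis .
 qed
 have bet: "0 <= bet" unfolding bet_def v_def[symmetric] using v T by auto
 have comp: "integrable M (%om. (mean_vec (\<eta> T om) $ i - mean_vec (\<eta>' T om) $ i)\<^sup>2)"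
  "(\<integral>om. (mean_vec (\<eta> T om) $ i - mean_vec (\<eta>' T om) $ i)\<^sup>2 \<partial>M) <= bet" for i
 proof -
  have sb: "(\<integral>om. 1 - cos (s * (mean_vec (\<eta> T om) $ i - mean_vec (\<eta>' T om) $ i)) \<partial>M) <= s\<^sup>2 * bet / 2" if "0 < s" for s
  proof -
   have "s *\<^sub>R axis i (1::real) ~= (0 :: real^'n)" using that by (simp add: axis_eq_0_iff)
   moreover have "norm (axis i (1::real) :: real^'n) = 1" by (rule norm_Basis) (simp add: axis_in_Basis_iff)
   ultimately show ?thesis using cosb[of "s *\<^sub>R axis i 1"] that by (simp add: inner_axis' right_diff_distrib)
  qed
  have Zm: "(%om. mean_vec (\<eta> T om) $ i - mean_vec (\<eta>' T om) $ i) \<in> borel_measurable M" by measurable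
  from K.second_moment_from_cos[OF Zm bet sb]
  show "integrable M (%om. (mean_vec (\<eta> T om) $ i - mean_vec (\<eta>' T om) $ i)\<^sup>2)"
   "(\<integral>om. (mean_vec (\<eta> T om) $ i - mean_vec (\<eta>' T om) $ i)\<^sup>2 \<partial>M) <= bet" by auto
 qed
 have nsq: "(norm (x - y))\<^sup>2 = (\<Sum>i\<in>UNIV. (x $ i - y $ i)\<^sup>2)" for x y :: "real^'n"
  unfolding power2_norm_eq_inner inner_vec_def by (simp add: power2_eq_square)
 show "integrable M (%om. (norm (mean_vec (\<eta> T om) - mean_vec (\<eta>' T om)))\<^sup>2)"
  unfolding nsq by (intro Bochner_Integration.integrable_sum comp)
 have "(\<integral>om. (norm (mean_vec (\<eta> T om) - mean_vec (\<eta>' T om)))\<^sup>2 \<partial>M) = (\<Sum>i\<in>UNIV. \<integral>om. (mean_vec (\<eta> T om) $ i - mean_vec (\<eta>' T om) $ i)\<^sup>2 \<partial>M)"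
  unfolding nsq using comp(1) by (intro Bochner_Integration.integral_sum) auto
 also have "\<dots> <= (\<Sum>i\<in>(UNIV::'n set). bet)" by (intro sum_mono comp(2))
 finally show "(\<integral>om. (norm (mean_vec (\<eta> T om) - mean_vec (\<eta>' T om)))\<^sup>2 \<partial>M) <= real CARD('n) * bet" by simp
qed

theorem theorem3p5:
  fixes A R1h R S P P0 P0' :: "real^'n^'n"
    and C :: "real^'n^'m"
    and R2h :: "real^'m^'m"
    and a :: "real^'n"
    and c :: "real^'m"
  assumes "symmetric_mat R1h" and "invertible R1h"
    and "symmetric_mat R2h" and "invertible R2h"
    and R_def: "R = R1h ** R1h"
    and S_def: "S = transpose C ** matrix_inv (R2h ** R2h) ** C"
    and "controllable_pair A R1h" and "observable_pair A C"
    and "positive_definite P"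
    and "A ** P + P ** transpose A - P ** S ** P + R = 0"
    and "log_norm (A - P ** S) < 0"
  shows "\<exists>c1 c2 :: real \<Rightarrow> real.
    \<forall>(M :: 'w measure) W V X Y Wb Vb Xb \<eta> Wb' Vb' Xb' \<eta>'.
      prob_space M \<and>
      signal_observation M A a C c R1h R2h W V X Y \<and>
      kalman_bucy_diffusion M A a C c R1h R2h X Y Wb Vb Xb \<eta> \<and>
      kalman_bucy_diffusion M A a C c R1h R2h X Y Wb' Vb' Xb' \<eta>' \<and>
      gaussian_vector M (Xb 0) \<and> cov_matrix (distr M borel (Xb 0)) = P0 \<and>
      gaussian_vector M (Xb' 0) \<and> cov_matrix (distr M borel (Xb' 0)) = P0' \<longrightarrow>
      (\<exists>t0\<ge>0.
        (\<forall>\<epsilon>. 0 < \<epsilon> \<and> \<epsilon> \<le> 2 \<longrightarrow>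
          (\<forall>t\<ge>t0. AE \<omega> in M.
            Ent (\<eta> t \<omega>) (\<eta>' t \<omega>)
              \<le> ereal (c1 \<epsilon> *
                  (exp ((1 - \<epsilon>) * log_norm (A - P ** S) * t) * frobenius_norm (P0 - P0')
                   + (norm (cond_mean M (history M Y t) (Xb' t) \<omega>
                            - cond_mean M (history M Y t) (Xb t) \<omega>))\<^sup>2)))) \<and>
        (\<forall>\<epsilon>. 0 < \<epsilon> \<and> \<epsilon> \<le> 1/2 \<longrightarrow>
          (\<forall>t\<ge>t0.
            Ent (distr M borel (Xb t)) (distr M borel (Xb' t))
              \<le> ereal (c2 \<epsilon> * exp ((1 - \<epsilon>) * log_norm (A - P ** S) * t) *
                  ((W2 (distr M borel (Xb 0)) (distr M borel (Xb' 0)))\<^sup>2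
                   + frobenius_norm (P0 - P0'))))))"
proof -
 define Gam where "Gam = transpose C ** matrix_inv (R2h ** R2h)"
 have S: "Gam ** C = S" by (simp add: Gam_def S_def)
 define \<mu> where "\<mu> = log_norm (A - P ** S)"
 have \<mu>: "\<mu> < 0" using assms(11) by (simp add: \<mu>_def)
 obtain r where rs: "riccati_stable A S R P \<mu> r"
  using riccati_stable_filter[OF assms(1-4) S_def assms(9) assms(10)[unfolded R_def] assms(11)]
  unfolding \<mu>_def R_def by blast
 interpret RS: riccati_stable A S R P \<mu> r by (rule rs)
 define dl where "dl = norm (P0 - P0')"
 have dl: "0 <= dl" by (simp add: dl_def)
 obtain b where b: "0 < b" and scheme: "\<And>Q Q' T (u :: real^'n) eps. RS.sol P0 Q ==> RS.sol P0' Q' ==> 0 <= T ==> u ~= 0 ==> 0 < eps ==>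
  (\<exists>m0. \<forall>m\<ge>m0. \<forall>k>0.
   norm (euler (%s. A - Q s ** Gam ** C) (T / real m) m u 0 - euler (%s. A - Q' s ** Gam ** C) (T / real m) m u 0)
    <= b * exp (\<mu> * T) * norm u * (dl + eps) \<and>
   norm (euler (%s. A - Q' s ** Gam ** C) (T / real m) m u 0) <= b * exp (\<mu> * T) * norm u \<and>
   (\<forall>l<m * k. norm (noise_coef A C R1h R2h (%s. Q s ** Gam) T m k u l - noise_coef A C R1h R2h (%s. Q' s ** Gam) T m k u l)
    <= b * exp (\<mu> * T) * norm u * (dl + eps)))"
  using RS.scheme_difference[OF S, where ?R1h.0 = R1h and ?R2h.0 = R2h and ?P0.0 = P0 and P0' = P0'] unfolding dl_def by blast
 obtain K where K: "0 < K" "\<And>Q Q' t. RS.sol P0 Q ==> RS.sol P0' Q' ==> 0 <= t ==> norm (Q t - Q' t) <= K * exp (2 * \<mu> * t) * dl"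
  using RS.sol_difference[of P0 P0'] unfolding dl_def by blast
 obtain l where l: "0 < l" "\<And>Q t x. RS.sol P0' Q ==> 1 <= t ==> l * (norm x)\<^sup>2 <= x \<bullet> (Q t *v x)"
  using RS.sol_lower[of P0'] by blast
 define n where "n = real CARD('n)"
 have n: "0 <= n" by (simp add: n_def)
 \<comment> \<open>Both constants serve every eps: the covariances approach each other like exp (2
   \<mu> t) and the bound for the laws holds with exp (\<mu> t), faster than the rates asked for.
   The factor dl + 1 in \<open>c2\<close> reduces dl^2 to dl.\<close>
 define c1 where "c1 = (2 + 12 * n * K) / l"
 define c2 where "c2 = (6 * n * b\<^sup>2 * (dl + 1) + 12 * n * K) / l"
 have c1: "0 <= c1" and c2: "0 <= c2" using n K(1) l(1) dl by (auto simp: c1_def c2_def)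
 show ?thesis
 proof (rule exI[of _ "%_. c1"], rule exI[of _ "%_. c2"], intro allI impI, elim conjE, unfold \<mu>_def[symmetric] dl_def[symmetric])
  fix M :: "'w measure" and W V X Y Wb Vb Xb \<eta> Wb' Vb' Xb' \<eta>'
  assume M: "prob_space M" and so: "signal_observation M A a C c R1h R2h W V X Y"
   and kb: "kalman_bucy_diffusion M A a C c R1h R2h X Y Wb Vb Xb \<eta>"
   and kb': "kalman_bucy_diffusion M A a C c R1h R2h X Y Wb' Vb' Xb' \<eta>'"
   and g: "gaussian_vector M (Xb 0)" and P0: "cov_matrix (distr M borel (Xb 0)) = P0"
   and g': "gaussian_vector M (Xb' 0)" and P0': "cov_matrix (distr M borel (Xb' 0)) = P0'"
  interpret prob_space M by (rule M)
  define m0 where "m0 = mean_vec (distr M borel (Xb 0))"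
  define m0' where "m0' = mean_vec (distr M borel (Xb' 0))"
  have cX: "continuous_process M X" and cY: "continuous_process M Y" and gX: "gaussian_vector M (X 0)"
   using so unfolding signal_observation_def by blast+
  obtain Q where Q: "continuous_process M Q" "\<And>t. 0 <= t ==> AE om in M. Q t om = cov_matrix (\<eta> t om)"
   using kb[unfolded kalman_bucy_diffusion_def] by (elim conjE exE) blast
  obtain Q' where Q': "continuous_process M Q'" "\<And>t. 0 <= t ==> AE om in M. Q' t om = cov_matrix (\<eta>' t om)"
   using kb'[unfolded kalman_bucy_diffusion_def] by (elim conjE exE) blast
  have f: "kalman_filter M A R1h P0 C R2h a m0 c X Xb Wb Y Vb \<eta> Q"
   by (intro kalman_filter.intro M kalman_filter_axioms.intro assms(1) assms(3) assms(4) kb cX cY Q)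
    (use gaussian_vector_char[OF g] in \<open>simp_all add: P0 m0_def\<close>)
  have f': "kalman_filter M A R1h P0' C R2h a m0' c X Xb' Wb' Y Vb' \<eta>' Q'"
   by (intro kalman_filter.intro M kalman_filter_axioms.intro assms(1) assms(3) assms(4) kb' cX cY Q')
    (use gaussian_vector_char[OF g'] in \<open>simp_all add: P0' m0'_def\<close>)
  interpret F: kalman_filter M A R1h P0 C R2h a m0 c X Xb Wb Y Vb \<eta> Q by (rule f)
  interpret F': kalman_filter M A R1h P0' C R2h a m0' c X Xb' Wb' Y Vb' \<eta>' Q' by (rule f')
  have info: "F.info = S" "F'.info = S" by (simp_all add: F.info_def F'.info_def S_def)
  obtain Pt where Pt: "RS.sol P0 Pt" and Pta: "\<And>t. 0 <= t ==> AE om in M. Q t om = Pt t \<and> cov_matrix (\<eta> t om) = Pt t \<and>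
    (\<forall>u. char_fun (\<eta> t om) u = iexp (u \<bullet> mean_vec (\<eta> t om)) * exp (- (u \<bullet> (Pt t *v u)) / 2))"
   using F.covariance_riccati[unfolded info, OF rs[unfolded R_def]] unfolding R_def by blast
  obtain Pt' where Pt': "RS.sol P0' Pt'" and Pta': "\<And>t. 0 <= t ==> AE om in M. Q' t om = Pt' t \<and> cov_matrix (\<eta>' t om) = Pt' t \<and>
    (\<forall>u. char_fun (\<eta>' t om) u = iexp (u \<bullet> mean_vec (\<eta>' t om)) * exp (- (u \<bullet> (Pt' t *v u)) / 2))"
   using F'.covariance_riccati[unfolded info, OF rs[unfolded R_def]] unfolding R_def by blast
  define w where "w = W2 (distr M borel (Xb 0)) (distr M borel (Xb' 0))"
  have mw: "(norm (m0 - m0'))\<^sup>2 <= w\<^sup>2"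
   unfolding w_def m0_def m0'_def
   by (rule mean_difference_le_W2) (use F.Xb_measurable F'.Xb_measurable F.Xb_sq F'.Xb_sq in auto)
  define v where "v = expectation (%om. (norm (m0 - X 0 om))\<^sup>2)"
  have v: "0 <= v" by (simp add: v_def)
  \<comment> \<open>The 1 serves \<open>sol_lower\<close>, the second term makes exp (\<mu> t) (v +
    t) <= 1, and the third brings the covariances within l / 2, as \<open>Ent_gaussian_le\<close>
    asks. \<open>v\<close> depends on the signal, which \<open>t0\<close> may do but
    \<open>c1\<close> and \<open>c2\<close> may not.\<close>
  define t0 where "t0 = 1 + 2 * (v + 1) / \<mu>\<^sup>2 + 2 * K * dl / l"
  have t0: "1 <= t0" "2 * (v + 1) / \<mu>\<^sup>2 <= t0" "2 * K * dl / l <= t0"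
   using v dl K(1) l(1) by (auto simp: t0_def)
  have large: "exp (\<mu> * t) * (v + t) <= 1" "norm (Pt t - Pt' t) <= l / 2" if t: "t0 <= t" for t
  proof -
   have t1: "1 <= t" using t t0 by linarith
   have "v + t <= (v + 1) * t" using v t1 by (simp add: distrib_right mult_left_mono[of 1 t v, simplified])
   also have "(v + 1) * t <= (\<mu>\<^sup>2 * t / 2) * t"
   proof (rule mult_right_mono)
    have "2 * (v + 1) / \<mu>\<^sup>2 <= t" using t t0 by linarith
    then show "v + 1 <= \<mu>\<^sup>2 * t / 2" using \<mu> by (simp add: pos_divide_le_eq mult.commute)
   qed (use t1 in simp)
   also have "\<dots> = (- \<mu> * t)\<^sup>2 / 2" by (simp add: power2_eq_square)
   also have "\<dots> <= exp (- \<mu> * t)"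
   proof -
    have "0 <= - \<mu> * t" using \<mu> t1 by (simp add: mult_nonpos_nonneg)
    from exp_lower_Taylor_quadratic[OF this] this show ?thesis by linarith
   qed
   finally have "exp (\<mu> * t) * (v + t) <= exp (\<mu> * t) * exp (- \<mu> * t)" by (intro mult_left_mono) auto
   then show e: "exp (\<mu> * t) * (v + t) <= 1" by (simp add: exp_add[symmetric])
   have "exp (2 * \<mu> * t) <= exp (\<mu> * t)" using \<mu> t1 by (simp add: mult_nonpos_nonneg)
   moreover have "exp (\<mu> * t) * t <= exp (\<mu> * t) * (v + t)" using v by (intro mult_left_mono) auto
   ultimately have e2: "exp (2 * \<mu> * t) * t <= 1"
    using e mult_right_mono[of "exp (2 * \<mu> * t)" "exp (\<mu> * t)" t] t1 by linarith
   have "norm (Pt t - Pt' t) <= exp (2 * \<mu> * t) * (K * dl)" using K(2)[OF Pt Pt', of t] t1 by (simp add: ac_simps)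
   also have "\<dots> <= exp (2 * \<mu> * t) * (l / 2 * t)"
   proof (rule mult_left_mono)
    have "2 * K * dl / l <= t" using t t0 by linarith
    then show "K * dl <= l / 2 * t" using l(1) by (simp add: pos_divide_le_eq ac_simps)
   qed simp
   also have "\<dots> = l / 2 * (exp (2 * \<mu> * t) * t)" by simp
   also have "\<dots> <= l / 2 * 1" using l(1) e2 by (intro mult_left_mono) auto
   finally show "norm (Pt t - Pt' t) <= l / 2" by simp
  qed
  have Pd: "norm (Pt t - Pt' t) <= K * exp (2 * \<mu> * t) * dl" if "t0 <= t" for t
   using K(2)[OF Pt Pt', of t] that t0 by simp
  have ent: "Ent \<nu> \<nu>' <= ereal ((2 * (\<integral>om. (norm (m om - m' om))\<^sup>2 \<partial>M) + 12 * n * norm (Pt t - Pt' t)) / l)"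
   if "t0 <= t" "prob_space \<nu>" "sets \<nu> = sets borel" "prob_space \<nu>'" "sets \<nu>' = sets borel"
    "m \<in> borel_measurable M" "m' \<in> borel_measurable M" "integrable M (%om. (norm (m om - m' om))\<^sup>2)"
    "\<And>u. char_fun \<nu> u = (CLINT om|M. iexp (u \<bullet> m om)) * exp (- (u \<bullet> (Pt t *v u)) / 2)"
    "\<And>u. char_fun \<nu>' u = (CLINT om|M. iexp (u \<bullet> m' om)) * exp (- (u \<bullet> (Pt' t *v u)) / 2)"
   for t \<nu> \<nu>' m m'
  proof -
   have t1: "0 <= t" "1 <= t" using that(1) t0 by auto
   show ?thesis unfolding n_def
    by (rule Ent_gaussian_le[OF that(2-8) RS.sol_sym[OF Pt t1(1)] RS.sol_sym[OF Pt' t1(1)] l(1) l(2)[OF Pt' t1(2)] large(2)[OF that(1)] that(9,10)])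
  qed
  have i: "AE om in M. Ent (\<eta> t om) (\<eta>' t om) <= ereal (c1 * (exp ((1 - eps) * \<mu> * t) * dl
    + (norm (cond_mean M (history M Y t) (Xb' t) om - cond_mean M (history M Y t) (Xb t) om))\<^sup>2))"
   if eps: "0 < eps" "eps <= 2" and t: "t0 <= t" for eps t
  proof -
   have t1: "0 <= t" using t t0 by linarith
   interpret L: conditional_law M "history M Y t" "Xb t" "\<eta> t" by (rule F.conditional[OF t1])
   interpret L': conditional_law M "history M Y t" "Xb' t" "\<eta>' t" by (rule F'.conditional[OF t1])
   have cm: "AE om in M. cond_mean M (history M Y t) (Xb t) om = mean_vec (\<eta> t om)"
    unfolding cond_mean_def mean_vec_def vec_eq_iff vec_lambda_beta
    by (intro eventually_all_finite L.cond_exp_eq square_integrable_component[OF F.Xb_measurable F.Xb_sq] t1) simp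
   have cm': "AE om in M. cond_mean M (history M Y t) (Xb' t) om = mean_vec (\<eta>' t om)"
    unfolding cond_mean_def mean_vec_def vec_eq_iff vec_lambda_beta
    by (intro eventually_all_finite L'.cond_exp_eq square_integrable_component[OF F'.Xb_measurable F'.Xb_sq] t1) simp
   from Pta[OF t1] Pta'[OF t1] cm cm' AE_space show ?thesis
   proof eventually_elim
    case (elim om)
    define d where "d = (norm (mean_vec (\<eta> t om) - mean_vec (\<eta>' t om)))\<^sup>2"
    \<comment> \<open>For a fixed outcome the means are constants, so \<open>ent\<close> is used
      with constant functions on the probability space.\<close>
    have "Ent (\<eta> t om) (\<eta>' t om) <= ereal ((2 * (\<integral>_. d \<partial>M) + 12 * n * norm (Pt t - Pt' t)) / l)"
     unfolding d_def
     by (rule ent[OF t L.kernel_prob[OF elim(5)] L'.kernel_prob[OF elim(5)]]) (use elim(1,2) in \<open>simp_all add: prob_space\<close>)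
    also have "\<dots> <= ereal (c1 * (exp ((1 - eps) * \<mu> * t) * dl + d))"
    proof -
     let ?e = "exp ((1 - eps) * \<mu> * t)"
     have "(1 - eps) * (- \<mu> * t) <= 2 * (- \<mu> * t)" using eps \<mu> t1 by (intro mult_right_mono) (auto simp: mult_nonpos_nonneg)
     then have "exp (2 * \<mu> * t) <= ?e" by (simp add: algebra_simps)
     then have "K * exp (2 * \<mu> * t) * dl <= K * ?e * dl" using K(1) dl by (intro mult_right_mono mult_left_mono) auto
     then have "12 * n * norm (Pt t - Pt' t) <= 12 * n * (K * ?e * dl)" using Pd[OF t] n by (intro mult_left_mono) auto
     moreover have "0 <= 2 * (?e * dl)" "0 <= 12 * n * K * d" using dl n K(1) by (auto simp: d_def)
     moreover have "12 * n * (K * ?e * dl) = 12 * n * K * (?e * dl)" by simp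
     moreover have "(2 + 12 * n * K) * (?e * dl + d) = 2 * (?e * dl) + 2 * d + 12 * n * K * (?e * dl) + 12 * n * K * d"
      by (simp add: algebra_simps)
     ultimately have "2 * d + 12 * n * norm (Pt t - Pt' t) <= (2 + 12 * n * K) * (?e * dl + d)" by linarith
     then show ?thesis using l(1) by (simp add: c1_def prob_space divide_right_mono)
    qed
    finally show ?case unfolding elim(3,4) d_def by (simp add: norm_minus_commute)
   qed
  qed
  have ii: "Ent (distr M borel (Xb t)) (distr M borel (Xb' t)) <= ereal (c2 * exp ((1 - eps) * \<mu> * t) * (w\<^sup>2 + dl))"
   if eps: "0 < eps" "eps <= 1/2" and t: "t0 <= t" for eps t
  proof -
   have t1: "0 <= t" using t t0 by linarith
   interpret L: conditional_law M "history M Y t" "Xb t" "\<eta> t" by (rule F.conditional[OF t1])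
   interpret L': conditional_law M "history M Y t" "Xb' t" "\<eta>' t" by (rule F'.conditional[OF t1])
   let ?m = "%om. mean_vec (\<eta> t om)" and ?m' = "%om. mean_vec (\<eta>' t om)"
   have mm: "?m \<in> borel_measurable M" "?m' \<in> borel_measurable M"
    by (rule measurable_from_subalg[OF F.history_sub[OF t1] F.mean_vec_measurable[OF t1]],
      rule measurable_from_subalg[OF F.history_sub[OF t1] F'.mean_vec_measurable[OF t1]])
   have S': "Gam ** C = S" by (rule S)
   have ch: "AE om in M. \<forall>u. char_fun (\<eta> t om) u = iexp (u \<bullet> mean_vec (\<eta> t om)) * exp (- (u \<bullet> (Pt t *v u)) / 2)"
    using Pta[OF t1] by eventually_elim blast
   have ch': "AE om in M. \<forall>u. char_fun (\<eta>' t om) u = iexp (u \<bullet> mean_vec (\<eta>' t om)) * exp (- (u \<bullet> (Pt' t *v u)) / 2)"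
    using Pta'[OF t1] by eventually_elim blast
   have QP: "AE om in M. Q s om = Pt s" "AE om in M. Q' s om = Pt' s" if "0 <= s" for s
    using Pta[OF that] Pta'[OF that] by auto
   note md = filter_mean_difference[OF f f' so Gam_def rs[folded S, unfolded R_def] Pt[unfolded R_def, folded S] QP(1) Pt'[unfolded R_def, folded S] QP(2) t1 ch ch'
     scheme[OF Pt Pt' t1] _ dl, folded v_def]
   define E where "E = expectation (%om. (norm (?m om - ?m' om))\<^sup>2)"
   have int: "integrable M (%om. (norm (?m om - ?m' om))\<^sup>2)" by (rule md(1)) (use b in auto)
   have Eb: "E <= n * (3 * (b * exp (\<mu> * t))\<^sup>2 * (dl\<^sup>2 * (v + t) + (norm (m0 - m0'))\<^sup>2))"
    unfolding E_def n_def by (rule md(2)) (use b in auto)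
   let ?x = "exp (\<mu> * t)"
   have x1: "?x <= 1" using \<mu> t1 by (simp add: mult_nonpos_nonneg)
   \<comment> \<open>Of the two factors exp (\<mu> t) in the second moment of the mean difference,
     one absorbs v + t and the other remains as the rate.\<close>
   have "?x * (dl\<^sup>2 * (v + t) + (norm (m0 - m0'))\<^sup>2) <= (dl + 1) * (w\<^sup>2 + dl)"
   proof -
    have "dl\<^sup>2 * (?x * (v + t)) <= dl\<^sup>2 * 1" by (intro mult_left_mono large(1)[OF t]) simp
    moreover have "?x * (norm (m0 - m0'))\<^sup>2 <= 1 * w\<^sup>2" using x1 mw by (intro mult_mono) auto
    moreover have "(dl + 1) * (w\<^sup>2 + dl) = dl\<^sup>2 + w\<^sup>2 + dl * w\<^sup>2 + dl" by (simp add: power2_eq_square algebra_simps)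
    moreover have "0 <= dl * w\<^sup>2" using dl by simp
    moreover have "?x * (dl\<^sup>2 * (v + t) + (norm (m0 - m0'))\<^sup>2) = dl\<^sup>2 * (?x * (v + t)) + ?x * (norm (m0 - m0'))\<^sup>2" by (simp add: algebra_simps)
    ultimately show ?thesis using dl by linarith
   qed
   then have "(n * 3 * b\<^sup>2 * ?x) * (?x * (dl\<^sup>2 * (v + t) + (norm (m0 - m0'))\<^sup>2)) <= (n * 3 * b\<^sup>2 * ?x) * ((dl + 1) * (w\<^sup>2 + dl))"
    using n by (intro mult_left_mono) auto
   moreover have eqE: "n * (3 * (b * ?x)\<^sup>2 * (dl\<^sup>2 * (v + t) + (norm (m0 - m0'))\<^sup>2)) = (n * 3 * b\<^sup>2 * ?x) * (?x * (dl\<^sup>2 * (v + t) + (norm (m0 - m0'))\<^sup>2))"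
    by (simp only: power2_eq_square ac_simps)
   ultimately have E1: "E <= (n * 3 * b\<^sup>2 * ?x) * ((dl + 1) * (w\<^sup>2 + dl))" using Eb by linarith
   have P1: "norm (Pt t - Pt' t) <= K * ?x * (w\<^sup>2 + dl)"
   proof -
    have "exp (2 * \<mu> * t) <= ?x" using \<mu> t1 by (simp add: mult_nonpos_nonneg)
    then have "K * exp (2 * \<mu> * t) * dl <= K * ?x * (w\<^sup>2 + dl)" using K(1) dl by (intro mult_mono mult_left_mono) auto
    then show ?thesis using Pd[OF t] by linarith
   qed
   \<comment> \<open>The law of the state is a mixture of Gaussians with random mean and a common
     deterministic covariance, the form in which \<open>ent\<close> takes its measures.\<close>
   have char_mix: "char_fun (distr M borel (Z t)) u = (CLINT om|M. iexp (u \<bullet> mean_vec (\<zeta> t om))) * exp (- (u \<bullet> (p *v u)) / 2)"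
    if Z: "conditional_law M (history M Y t) (Z t) (\<zeta> t)"
     and p: "AE om in M. \<forall>u. char_fun (\<zeta> t om) u = iexp (u \<bullet> mean_vec (\<zeta> t om)) * exp (- (u \<bullet> (p *v u)) / 2)"
     and mz: "(%om. mean_vec (\<zeta> t om)) \<in> borel_measurable M"
    for Z :: "real => 'w => real^'n" and \<zeta> p u
   proof -
    interpret Z: conditional_law M "history M Y t" "Z t" "\<zeta> t" by (rule Z)
    have "char_fun (distr M borel (Z t)) u = (CLINT om|M. iexp (u \<bullet> Z t om))"
     unfolding char_fun_def by (rule integral_distr) (auto intro!: iexp_measurable)
    also have "\<dots> = (CLINT om|M. indicator (space M) om * iexp (u \<bullet> Z t om))"
     by (intro Bochner_Integration.integral_cong) auto
    also have "\<dots> = (CLINT om|M. indicator (space M) om * char_fun (\<zeta> t om) u)"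
    proof (rule Z.char_disintegration)
     show "space M \<in> sets (history M Y t)" using sets.top[of "history M Y t"] by simp
    qed
    also have "\<dots> = (CLINT om|M. char_fun (\<zeta> t om) u)" by (intro Bochner_Integration.integral_cong) auto
    also have "\<dots> = (CLINT om|M. iexp (u \<bullet> mean_vec (\<zeta> t om)) * exp (- (u \<bullet> (p *v u)) / 2))"
    proof (rule integral_cong_AE)
     show "(%om. char_fun (\<zeta> t om) u) \<in> borel_measurable M"
      by (rule measurable_from_subalg[OF F.history_sub[OF t1] Z.char_kernel_measurable])
     show "(%om. iexp (u \<bullet> mean_vec (\<zeta> t om)) * exp (- (u \<bullet> (p *v u)) / 2)) \<in> borel_measurable M" using mz by measurable
     show "AE om in M. char_fun (\<zeta> t om) u = iexp (u \<bullet> mean_vec (\<zeta> t om)) * exp (- (u \<bullet> (p *v u)) / 2)"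
      using p by eventually_elim blast
    qed
    finally show ?thesis by simp
   qed
   have pd: "prob_space (distr M borel (Xb t))" "prob_space (distr M borel (Xb' t))" by (auto intro!: prob_space_distr)
   have "Ent (distr M borel (Xb t)) (distr M borel (Xb' t)) <= ereal ((2 * E + 12 * n * norm (Pt t - Pt' t)) / l)"
    unfolding E_def
   proof (rule ent[OF t pd(1) _ pd(2) _ mm int])
    fix u
    show "char_fun (distr M borel (Xb t)) u = (CLINT om|M. iexp (u \<bullet> mean_vec (\<eta> t om))) * exp (- (u \<bullet> (Pt t *v u)) / 2)"
     by (rule char_mix[of Xb \<eta>, OF L.conditional_law_axioms ch mm(1)])
    show "char_fun (distr M borel (Xb' t)) u = (CLINT om|M. iexp (u \<bullet> mean_vec (\<eta>' t om))) * exp (- (u \<bullet> (Pt' t *v u)) / 2)"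
     by (rule char_mix[of Xb' \<eta>', OF L'.conditional_law_axioms ch' mm(2)])
   qed simp_all
   also have "\<dots> <= ereal (c2 * exp ((1 - eps) * \<mu> * t) * (w\<^sup>2 + dl))"
   proof -
    have "2 * E + 12 * n * norm (Pt t - Pt' t) <= 2 * ((n * 3 * b\<^sup>2 * ?x) * ((dl + 1) * (w\<^sup>2 + dl))) + 12 * n * (K * ?x * (w\<^sup>2 + dl))"
     using E1 P1 n by (intro add_mono mult_left_mono) auto
    also have "\<dots> = (6 * n * b\<^sup>2 * (dl + 1) + 12 * n * K) * (?x * (w\<^sup>2 + dl))" by (simp add: algebra_simps)
    finally have "(2 * E + 12 * n * norm (Pt t - Pt' t)) / l <= (6 * n * b\<^sup>2 * (dl + 1) + 12 * n * K) * (?x * (w\<^sup>2 + dl)) / l"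
     using l(1) by (intro divide_right_mono) auto
    also have "\<dots> = c2 * (?x * (w\<^sup>2 + dl))" by (simp add: c2_def)
    also have "\<dots> <= c2 * (exp ((1 - eps) * \<mu> * t) * (w\<^sup>2 + dl))"
    proof (intro mult_left_mono mult_right_mono c2)
     have "(1 - eps) * (- \<mu> * t) <= 1 * (- \<mu> * t)" using eps \<mu> t1 by (intro mult_right_mono) (auto simp: mult_nonpos_nonneg)
     then show "?x <= exp ((1 - eps) * \<mu> * t)" by (simp add: algebra_simps)
    qed (use dl in auto)
    finally show ?thesis by (simp add: mult.assoc)
   qed
   finally show ?thesis .
  qed
  show "\<exists>t0\<ge>0.
    (\<forall>eps. 0 < eps \<and> eps <= 2 -->
     (\<forall>t\<ge>t0. AE om in M. Ent (\<eta> t om) (\<eta>' t om)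
       <= ereal (c1 * (exp ((1 - eps) * \<mu> * t) * dl
         + (norm (cond_mean M (history M Y t) (Xb' t) om - cond_mean M (history M Y t) (Xb t) om))\<^sup>2)))) \<and>
    (\<forall>eps. 0 < eps \<and> eps <= 1/2 -->
     (\<forall>t\<ge>t0. Ent (distr M borel (Xb t)) (distr M borel (Xb' t))
       <= ereal (c2 * exp ((1 - eps) * \<mu> * t) * ((W2 (distr M borel (Xb 0)) (distr M borel (Xb' 0)))\<^sup>2 + dl))))"
   unfolding w_def[symmetric] using i ii t0(1) by (intro exI[of _ t0]) auto
 qed
qed

end
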